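(* Let $p\ge2$ and $0<a<b<\beta_p$. For every $\varepsilon>0$ there exists a constant $K>0$ such that for all $\beta\in[a,b]$ and all $N\ge1$, $$\mathbb E\big\langle 1\{|R_{1,2}|\ge\varepsilon\}\big\rangle_\beta\le K\exp(-N/K).$$
   Context: $\Sigma_N=\{-1,1\}^N$, $(g_{i_1,\dots,i_p})$ i.i.d. standard Gaussians, $H_N(\sigma)=N^{-(p-1)/2}\sum_{1\le i_1,\dots,i_p\le N}g_{i_1,\dots,i_p}\sigma_{i_1}\cdots\sigma_{i_p}$, $F_N(\beta)=\frac1N\log\sum_{\sigma}2^{-N}\exp(\tfrac{\beta}{\sqrt2}H_N(\sigma))$, which converges a.s. to a nonrandom $F(\beta)\le\beta^2/4$. $\mathcal R=\{\beta>0:F(\beta)=\beta^2/4\}$, $\beta_p=\max\mathcal R$. The Gibbs measure is $G_{N,\beta}(\sigma)\propto\exp(\tfrac{\beta}{\sqrt2}H_N(\sigma))$ on $\Sigma_N$; $\langle\cdot\rangle_\beta$ is the average with respect to $G_{N,\beta}^{\otimes2}$ over two independent samples $\sigma^1,\sigma^2$, and $R_{1,2}=\frac1N\sum_{i=1}^N\sigma^1_i\sigma^2_i$ is their overlap. $\mathbb E$ is expectation over the disorder $g$. *)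

theory Defs
  imports "HOL-Probability.Probability"
begin

definition gauss :: "real measure" where
  "gauss = density lborel (\<lambda>x. ennreal (std_normal_density x))"

text \<open>Disorder: one i.i.d. standard Gaussian g xs for every finite index list xs
  (all N are coupled on a common probability space; H_N uses the entries
  g [i_1,...,i_p] with i_k < N).\<close>
definition disorder :: "(nat list \<Rightarrow> real) measure" where
  "disorder = (\<Pi>\<^sub>M xs\<in>(UNIV :: nat list set). gauss)"

definition Sigma :: "nat \<Rightarrow> (nat \<Rightarrow> real) set" where
  "Sigma N = PiE {..<N} (\<lambda>_. {-1, 1})"

definition idx :: "nat \<Rightarrow> nat \<Rightarrow> nat list set" where
  "idx p N = {xs. length xs = p \<and> set xs \<subseteq> {..<N}}"

definition H :: "nat \<Rightarrow> nat \<Rightarrow> (nat list \<Rightarrow> real) \<Rightarrow> (nat \<Rightarrow> real) \<Rightarrow> real" where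
  "H p N g \<sigma> = real N powr (- (real p - 1) / 2) *
      (\<Sum>xs\<in>idx p N. g xs * prod_list (map \<sigma> xs))"

definition weight :: "nat \<Rightarrow> nat \<Rightarrow> real \<Rightarrow> (nat list \<Rightarrow> real) \<Rightarrow> (nat \<Rightarrow> real) \<Rightarrow> real" where
  "weight p N \<beta> g \<sigma> = exp (\<beta> / sqrt 2 * H p N g \<sigma>)"

definition FN :: "nat \<Rightarrow> nat \<Rightarrow> (nat list \<Rightarrow> real) \<Rightarrow> real \<Rightarrow> real" where
  "FN p N g \<beta> = ln (\<Sum>\<sigma>\<in>Sigma N. 2 powr (- real N) * weight p N \<beta> g \<sigma>) / real N"

definition F :: "nat \<Rightarrow> real \<Rightarrow> real" where
  "F p \<beta> = (THE c. AE g in disorder. (\<lambda>N. FN p N g \<beta>) \<longlonglongrightarrow> c)"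

definition replica_sym :: "nat \<Rightarrow> real set" where
  "replica_sym p = {\<beta>. \<beta> > 0 \<and> F p \<beta> = \<beta>\<^sup>2 / 4}"

definition beta_c :: "nat \<Rightarrow> real" where
  "beta_c p = Sup (replica_sym p)"

definition gibbs :: "nat \<Rightarrow> nat \<Rightarrow> real \<Rightarrow> (nat list \<Rightarrow> real) \<Rightarrow> (nat \<Rightarrow> real) \<Rightarrow> real" where
  "gibbs p N \<beta> g \<sigma> = weight p N \<beta> g \<sigma> / (\<Sum>\<tau>\<in>Sigma N. weight p N \<beta> g \<tau>)"

definition overlap :: "nat \<Rightarrow> (nat \<Rightarrow> real) \<Rightarrow> (nat \<Rightarrow> real) \<Rightarrow> real" where
  "overlap N \<sigma>1 \<sigma>2 = (\<Sum>i<N. \<sigma>1 i * \<sigma>2 i) / real N"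

definition overlap_tail :: "nat \<Rightarrow> nat \<Rightarrow> real \<Rightarrow> real \<Rightarrow> (nat list \<Rightarrow> real) \<Rightarrow> real" where
  "overlap_tail p N \<beta> \<epsilon> g = (\<Sum>\<sigma>1\<in>Sigma N. \<Sum>\<sigma>2\<in>Sigma N.
      gibbs p N \<beta> g \<sigma>1 * gibbs p N \<beta> g \<sigma>2 *
      (if \<bar>overlap N \<sigma>1 \<sigma>2\<bar> \<ge> \<epsilon> then 1 else 0))"

end

theory Submission
  imports Defs
begin

text \<open>
  Let \<open>W\<close> be the partition function divided by its expectation. Weighting the disorder by \<open>W\<close> and
  sampling a configuration from the Gibbs measure amounts to planting a uniform configuration, that
  is, to shifting the Gaussian couplings in its direction; by symmetry the planted configuration may
  be taken constant. For \<open>\<beta>\<close> below a point \<open>b'\<close> of the replica symmetric phase \<open>ln W = o(N)\<close>, and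
  concentration carries this over to the planted disorder: planting does not raise the free energy
  to leading order, uniformly in \<open>\<beta> \<le> b'\<close>.

  Suppose now that the configurations \<open>\<sigma>\<close> with \<open>R\<^sup>p \<ge> t\<close> relative to the planted one carry more than
  an exponentially small part of the partition function, while pairs of samples with
  \<open>R\<^sub>1\<^sub>2\<^sup>p \<ge> 3t/2\<close> are exponentially rare. Raising \<open>\<beta>\<close> by \<open>\<kappa>\<close> changes the restricted planted free
  energy per spin by at least \<open>\<kappa> \<beta> (t - E\<langle>R\<^sub>1\<^sub>2\<^sup>p\<rangle> / 2) - O(\<kappa>\<^sup>2)\<close>, which is positive because
  \<open>E\<langle>R\<^sub>1\<^sub>2\<^sup>p\<rangle> \<le> 3t/2 + o(1)\<close>; this contradicts the previous paragraph. So the exponential bound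
  descends from threshold \<open>3t/2\<close> to \<open>t\<close>, starting from the trivial thresholds above \<open>1\<close>. Pairs with
  \<open>R\<^sub>1\<^sub>2\<^sup>p \<le> 0\<close> are controlled by their annealed weight.

  Since \<open>F\<close> is defined as the almost sure limit, its existence has to be established as well, also for
  odd \<open>p\<close>. The expected free energy is almost superadditive by interpolation between one system and
  independent blocks. The sign of the error is right as soon as overlaps are almost nonnegative, which
  is enforced by small \<open>s\<close>-spin perturbations: they yield the Ghirlanda--Guerra identities, hence
  Talagrand's positivity principle.
\<close>

section \<open>Gaussian disorder\<close>

text \<open>Inside the phase only one thing is known: the free energy has its annealed value, a
  statement up to factors of the form exp (o(N)). Every contradiction below is therefore one between
  exponential rates; a second moment is computed only at \<beta> = 1. The factor 3/2 of the descent
  could be any number between 1 and 2: the slope t - E\<langle>R^p\<rangle>/2 is positive as long as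
  E\<langle>R^p\<rangle> < 2t. Uniformity in \<beta> rests on a single point b' of the phase. The
  normalised expected free energy is nonincreasing in \<beta>, so its closeness to 0 at b' extends
  to all smaller \<beta>, and the gap between b and b' is the room for raising \<beta>. Derivatives
  of the free energy in its parameters are never taken: convexity of the log-partition function
  compares finite increments, and quadratic errors vanish on telescoping. Negative overlaps obstruct
  superadditivity because R^p is not convex on [-1, 1] for odd p. The perturbations that exclude
  them have fixed small strength: strong enough to act as the size grows, weak enough to shift the
  free energy by a small multiple of it.\<close>

lemma prob_space_gauss: "prob_space gauss"
  unfolding gauss_def by (rule prob_space_normal_density) simp

lemma sets_gauss [simp, measurable_cong]: "sets gauss = sets borel"
  by (simp add: gauss_def)

lemma space_gauss [simp]: "space gauss = UNIV"
  by (simp add: gauss_def)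

lemma measurable_gauss1 [simp]: "measurable gauss M = measurable borel M"
  by (rule measurable_cong_sets) auto

lemma measurable_gauss2 [simp]: "measurable M gauss = measurable M borel"
  by (rule measurable_cong_sets) auto

interpretation gauss: prob_space gauss
  by (rule prob_space_gauss)

interpretation disorder: prob_space disorder
  unfolding disorder_def by (intro prob_space_PiM prob_space_gauss)

lemma space_disorder [simp]: "space disorder = UNIV"
  by (simp add: disorder_def space_PiM)

lemma measurable_coordinate [measurable]: "(\<lambda>g. g i) \<in> borel_measurable disorder"
  using measurable_component_singleton[of i UNIV "\<lambda>_. gauss"]
  by (simp add: disorder_def)

lemma measurable_into_disorder:
  assumes "\<And>i. (\<lambda>x. f x i) \<in> borel_measurable M"
  shows "f \<in> measurable M disorder"
  unfolding disorder_def
proof (rule measurable_PiM_single')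
  show "(\<lambda>\<omega>. f \<omega> i) \<in> measurable M gauss" for i
    using assms[of i] by simp
qed auto

lemma measurable_resample [measurable]:
  "(\<lambda>(x, g). g(i := x)) \<in> measurable (gauss \<Otimes>\<^sub>M disorder) disorder"
  by (rule measurable_into_disorder) (auto simp: fun_upd_def split_beta)

lemma measurable_resample_fixed [measurable]:
  "(\<lambda>x. g(i := x)) \<in> measurable borel disorder"
proof (rule measurable_into_disorder)
  show "(\<lambda>x. (g(i := x)) j) \<in> borel_measurable borel" for j
    by (cases "j = i") auto
qed

text \<open>Putting a fresh Gaussian into one coordinate does not change the law of the disorder.
  Statements about finitely many couplings are proved below by induction on the coordinates, each
  step being a one-dimensional statement about the resampled coupling.\<close>

lemma distr_resample:
  "distr (gauss \<Otimes>\<^sub>M disorder) disorder (\<lambda>(x, g). g(i := x)) = disorder"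
  using distr_pair_PiM_eq_PiM[of UNIV "\<lambda>_. gauss" i] prob_space_gauss
  by (simp add: disorder_def)

interpretation gd: pair_prob_space gauss disorder ..
interpretation dg: pair_prob_space disorder gauss ..
interpretation gg: pair_prob_space gauss gauss ..
interpretation dd: pair_prob_space disorder disorder ..

lemma nn_integral_resample:
  assumes [measurable]: "f \<in> borel_measurable disorder"
  shows "(\<integral>\<^sup>+g. f g \<partial>disorder) = (\<integral>\<^sup>+g. \<integral>\<^sup>+x. f (g(i := x)) \<partial>gauss \<partial>disorder)"
proof -
  have "(\<integral>\<^sup>+g. f g \<partial>disorder) =
      (\<integral>\<^sup>+z. f ((snd z)(i := fst z)) \<partial>(gauss \<Otimes>\<^sub>M disorder))"
    by (subst distr_resample[of i, symmetric], subst nn_integral_distr)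
       (auto simp: split_beta)
  also have "\<dots> = (\<integral>\<^sup>+g. \<integral>\<^sup>+x. f (g(i := x)) \<partial>gauss \<partial>disorder)"
    by (subst gd.nn_integral_snd[symmetric]) (auto simp: split_beta)
  finally show ?thesis .
qed

lemma integral_resample:
  fixes f :: "(nat list \<Rightarrow> real) \<Rightarrow> real"
  assumes f: "integrable disorder f"
  shows "(\<integral>g. f g \<partial>disorder) = (\<integral>g. (\<integral>x. f (g(i := x)) \<partial>gauss) \<partial>disorder)"
proof -
  have [measurable]: "f \<in> borel_measurable disorder" using f by simp
  have "(\<integral>g. f g \<partial>disorder) = (\<integral>z. f ((snd z)(i := fst z)) \<partial>(gauss \<Otimes>\<^sub>M disorder))"
    by (subst distr_resample[of i, symmetric], subst integral_distr)
       (auto simp: split_beta)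
  also have "\<dots> = (\<integral>g. (\<integral>x. f (g(i := x)) \<partial>gauss) \<partial>disorder)"
  proof (subst gd.integral_snd[of "\<lambda>x g. f (g(i := x))"])
    have "integrable (distr (gauss \<Otimes>\<^sub>M disorder) disorder (\<lambda>(x, g). g(i := x))) f"
      using f by (simp add: distr_resample)
    then show "integrable (gauss \<Otimes>\<^sub>M disorder) (case_prod (\<lambda>x g. f (g(i := x))))"
      by (subst (asm) integrable_distr_eq) (auto simp: split_beta')
  qed (simp add: split_beta')
  finally show ?thesis .
qed

lemma nn_integral_gauss:
  assumes [measurable]: "f \<in> borel_measurable borel"
  shows "(\<integral>\<^sup>+x. f x \<partial>gauss) = (\<integral>\<^sup>+x. ennreal (std_normal_density x) * f x \<partial>lborel)"
  unfolding gauss_def by (subst nn_integral_density) auto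

text \<open>Cameron-Martin in one dimension: translate Lebesgue measure and complete the square in
  the density.\<close>

lemma nn_integral_gauss_shift:
  assumes [measurable]: "f \<in> borel_measurable borel"
  shows "(\<integral>\<^sup>+x. f (x + b) \<partial>gauss) = (\<integral>\<^sup>+x. ennreal (exp (b * x - b\<^sup>2 / 2)) * f x \<partial>gauss)"
proof -
  have "(\<integral>\<^sup>+x. f (x + b) \<partial>gauss) = (\<integral>\<^sup>+x. ennreal (std_normal_density x) * f (x + b) \<partial>lborel)"
    by (subst nn_integral_gauss) auto
  also have "\<dots> = (\<integral>\<^sup>+x. ennreal (std_normal_density (x - b)) * f x \<partial>lborel)"
    using nn_integral_real_affine[of "\<lambda>x. ennreal (std_normal_density (x - b)) * f x" 1 b]
    by (simp add: add.commute)
  also have "\<dots> = (\<integral>\<^sup>+x. ennreal (std_normal_density x) * (ennreal (exp (b * x - b\<^sup>2 / 2)) * f x) \<partial>lborel)"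
  proof (rule nn_integral_cong)
    fix x :: real
    have "std_normal_density (x - b) = std_normal_density x * exp (b * x - b\<^sup>2 / 2)"
      by (simp add: std_normal_density_def exp_add[symmetric] power2_eq_square field_simps)
    then show "ennreal (std_normal_density (x - b)) * f x =
        ennreal (std_normal_density x) * (ennreal (exp (b * x - b\<^sup>2 / 2)) * f x)"
      by (simp add: ennreal_mult mult.assoc)
  qed
  also have "\<dots> = (\<integral>\<^sup>+x. ennreal (exp (b * x - b\<^sup>2 / 2)) * f x \<partial>gauss)"
    by (subst nn_integral_gauss) auto
  finally show ?thesis .
qed

lemma nn_integral_gauss_exp: "(\<integral>\<^sup>+x. ennreal (exp (k * x)) \<partial>gauss) = ennreal (exp (k\<^sup>2 / 2))"
proof -
  have "(\<integral>\<^sup>+x. ennreal (exp (k * x)) \<partial>gauss) =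
     (\<integral>\<^sup>+x. ennreal (exp (k\<^sup>2 / 2)) * ennreal (exp (k * x - k\<^sup>2 / 2)) \<partial>gauss)"
    by (intro nn_integral_cong) (simp flip: ennreal_mult exp_add)
  also have "\<dots> = ennreal (exp (k\<^sup>2 / 2)) * (\<integral>\<^sup>+x. ennreal (exp (k * x - k\<^sup>2 / 2)) * 1 \<partial>gauss)"
    by (subst nn_integral_cmult) auto
  also have "\<dots> = ennreal (exp (k\<^sup>2 / 2))"
    by (subst nn_integral_gauss_shift[symmetric]) (auto simp: gauss.emeasure_space_1[simplified])
  finally show ?thesis .
qed

lemma nn_integral_gauss_symmetric:
  assumes [measurable]: "f \<in> borel_measurable borel"
  shows "(\<integral>\<^sup>+x. f (- x) \<partial>gauss) = (\<integral>\<^sup>+x. f x \<partial>gauss)"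
proof -
  have "(\<integral>\<^sup>+x. f (- x) \<partial>gauss) = (\<integral>\<^sup>+x. ennreal (std_normal_density x) * f (- x) \<partial>lborel)"
    by (subst nn_integral_gauss) auto
  also have "\<dots> = (\<integral>\<^sup>+x. ennreal (std_normal_density x) * f x \<partial>lborel)"
    using nn_integral_real_affine[of "\<lambda>x. ennreal (std_normal_density x) * f x" "-1" 0]
    by (simp add: std_normal_density_def)
  also have "\<dots> = (\<integral>\<^sup>+x. f x \<partial>gauss)"
    by (subst nn_integral_gauss) auto
  finally show ?thesis .
qed

lemma integrable_gauss_abs: "integrable gauss (\<lambda>x. \<bar>x\<bar>)"
proof -
  have "integrable lborel (\<lambda>x. std_normal_density x * \<bar>x\<bar>)"
    using integrable_std_normal_moment_abs[of 1] by simp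
  then show ?thesis
    unfolding gauss_def by (subst integrable_density) auto
qed

lemma distr_coordinate: "distr disorder gauss (\<lambda>g. g i) = gauss"
  unfolding disorder_def
  by (rule distr_PiM_component) (auto intro: prob_space_gauss)

lemma integrable_coordinate_abs: "integrable disorder (\<lambda>g. \<bar>g i\<bar>)"
proof -
  have "integrable (distr disorder gauss (\<lambda>g. g i)) (\<lambda>x. \<bar>x\<bar>)"
    by (simp add: distr_coordinate integrable_gauss_abs)
  then show ?thesis
    by (subst (asm) integrable_distr_eq) auto
qed

lemma integrable_coordinate: "integrable disorder (\<lambda>g. g i)"
  using integrable_coordinate_abs by (rule Bochner_Integration.integrable_bound) auto

text \<open>The tangent of \<open>exp\<close> at the mean of \<open>Y\<close> lies below
  \<open>exp\<close>. Stated in \<open>ennreal\<close>, since it is applied to exponential moments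
  before these are known to be finite.\<close>

lemma (in prob_space) nn_jensen_exp:
  fixes Y :: "'a \<Rightarrow> real"
  assumes Y: "integrable M Y"
  shows "ennreal (exp (\<integral>x. Y x \<partial>M)) \<le> (\<integral>\<^sup>+x. ennreal (exp (Y x)) \<partial>M)"
proof (cases "integrable M (\<lambda>x. exp (Y x))")
  case True
  let ?m = "\<integral>x. Y x \<partial>M"
  have "(\<integral>x. exp ?m * (1 + Y x - ?m) \<partial>M) \<le> (\<integral>x. exp (Y x) \<partial>M)"
  proof (rule integral_mono)
    show "exp ?m * (1 + Y x - ?m) \<le> exp (Y x)" for x
    proof -
      have "1 + (Y x - ?m) \<le> exp (Y x - ?m)" by (rule exp_ge_add_one_self)
      then have "exp ?m * (1 + (Y x - ?m)) \<le> exp ?m * exp (Y x - ?m)"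
        by (intro mult_left_mono) auto
      then show ?thesis by (simp flip: exp_add add: algebra_simps)
    qed
  qed (use Y True in auto)
  moreover have "(\<integral>x. exp ?m * (1 + Y x - ?m) \<partial>M) = exp ?m"
    using Y by (simp add: prob_space)
  ultimately show ?thesis
    using True by (subst nn_integral_eq_integral) auto
next
  case False
  have [measurable]: "Y \<in> borel_measurable M" using Y by simp
  have "\<not> (\<integral>\<^sup>+x. ennreal (exp (Y x)) \<partial>M) < \<infinity>"
  proof
    assume fin: "(\<integral>\<^sup>+x. ennreal (exp (Y x)) \<partial>M) < \<infinity>"
    have "integrable M (\<lambda>x. exp (Y x))"
      by (rule integrableI_nonneg[OF _ _ fin]) auto
    with False show False by contradiction
  qed
  then have "(\<integral>\<^sup>+x. ennreal (exp (Y x)) \<partial>M) = \<infinity>"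
    by (metis infinity_ennreal_def less_top)
  then show ?thesis by simp
qed

section \<open>Sub-Gaussian concentration for Lipschitz functions of the couplings\<close>

lemma exp_pm_mono:
  fixes u v :: real
  assumes "\<bar>u\<bar> \<le> \<bar>v\<bar>"
  shows "exp u + exp (- u) \<le> exp v + exp (- v)"
proof -
  have "cosh u \<le> cosh v"
    using assms by (metis abs_ge_zero cosh_real_abs cosh_real_nonneg_le_iff)
  then show ?thesis by (simp add: cosh_def)
qed

lemma integrable_gauss_lipschitz:
  fixes f :: "real \<Rightarrow> real"
  assumes [measurable]: "f \<in> borel_measurable borel"
    and lip: "\<And>x y. \<bar>f x - f y\<bar> \<le> c * \<bar>x - y\<bar>"
  shows "integrable gauss f"
proof (rule Bochner_Integration.integrable_bound)
  show "integrable gauss (\<lambda>x. \<bar>f 0\<bar> + c * \<bar>x\<bar>)"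
    using integrable_gauss_abs by auto
  have "\<bar>f x\<bar> \<le> \<bar>f 0\<bar> + c * \<bar>x\<bar>" for x
    using lip[of x 0] by simp
  then show "AE x in gauss. norm (f x) \<le> norm (\<bar>f 0\<bar> + c * \<bar>x\<bar>)"
    by (auto intro: order_trans[OF _ abs_ge_self])
qed auto

text \<open>Symmetrisation: comparing with an independent copy replaces the exponential by a
  hyperbolic cosine, which is monotone in the absolute value of its argument.\<close>
lemma gauss_lipschitz_mgf:
  fixes f :: "real \<Rightarrow> real"
  assumes [measurable]: "f \<in> borel_measurable borel"
    and lip: "\<And>x y. \<bar>f x - f y\<bar> \<le> c * \<bar>x - y\<bar>"
  shows "(\<integral>\<^sup>+x. ennreal (exp (l * (f x - (\<integral>y. f y \<partial>gauss)))) \<partial>gauss) \<le> ennreal (exp (l\<^sup>2 * c\<^sup>2))"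
proof -
  note int = integrable_gauss_lipschitz[OF assms]
  let ?m = "\<integral>y. f y \<partial>gauss"
  define I where "I = (\<integral>\<^sup>+x. \<integral>\<^sup>+y. ennreal (exp (l * (f x - f y))) \<partial>gauss \<partial>gauss)"
  have "(\<integral>\<^sup>+x. ennreal (exp (l * (f x - ?m))) \<partial>gauss) \<le> I"
    unfolding I_def
  proof (rule nn_integral_mono)
    fix x
    have "integrable gauss (\<lambda>y. l * (f x - f y))" using int by auto
    moreover have "(\<integral>y. l * (f x - f y) \<partial>gauss) = l * (f x - ?m)"
      using int by (simp add: gauss.prob_space[simplified])
    ultimately show "ennreal (exp (l * (f x - ?m))) \<le> (\<integral>\<^sup>+y. ennreal (exp (l * (f x - f y))) \<partial>gauss)"
      using gauss.nn_jensen_exp[of "\<lambda>y. l * (f x - f y)"] by metis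
  qed
  \<comment> \<open>The difference \<open>x - y\<close> of the two copies has variance 2, so the
    exponent is \<open>l\<^sup>2 * c\<^sup>2\<close> instead of the optimal half of it; only the
    order matters later.\<close>
  moreover have "I \<le> ennreal (exp (l\<^sup>2 * c\<^sup>2))"
  proof -
    \<comment> \<open>Exchanging the two copies flips the sign of the exponent; adding both forms
      produces the hyperbolic cosine.\<close>
    have I2: "I = (\<integral>\<^sup>+x. \<integral>\<^sup>+y. ennreal (exp (- (l * (f x - f y)))) \<partial>gauss \<partial>gauss)"
      unfolding I_def
      by (subst gg.Fubini') (auto simp: algebra_simps)
    have "I + I = (\<integral>\<^sup>+x. \<integral>\<^sup>+y. ennreal (exp (l * (f x - f y)) + exp (- (l * (f x - f y)))) \<partial>gauss \<partial>gauss)"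
      by (subst (2) I2, unfold I_def, subst nn_integral_add[symmetric])
         (auto simp: nn_integral_add[symmetric])
    also have "\<dots> \<le> (\<integral>\<^sup>+x. \<integral>\<^sup>+y. ennreal (exp (l * c * (x - y)) + exp (- (l * c * (x - y)))) \<partial>gauss \<partial>gauss)"
    proof (intro nn_integral_mono ennreal_leI exp_pm_mono)
      fix x y
      have c: "c \<ge> 0" using lip[of 0 1] abs_ge_zero[of "f 0 - f 1"] by simp
      show "\<bar>l * (f x - f y)\<bar> \<le> \<bar>l * c * (x - y)\<bar>"
        using mult_left_mono[OF lip[of x y], of "\<bar>l\<bar>"] c by (simp add: abs_mult mult.assoc)
    qed
    also have "\<dots> = (\<integral>\<^sup>+x. ennreal (exp (l * c * x)) * ennreal (exp ((l * c)\<^sup>2 / 2)) +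
         ennreal (exp (- (l * c) * x)) * ennreal (exp ((l * c)\<^sup>2 / 2)) \<partial>gauss)"
    proof (rule nn_integral_cong)
      fix x :: real
      have "(\<integral>\<^sup>+y. ennreal (exp (l * c * (x - y)) + exp (- (l * c * (x - y)))) \<partial>gauss) =
        (\<integral>\<^sup>+y. ennreal (exp (l * c * x)) * ennreal (exp (- (l * c) * y)) +
               ennreal (exp (- (l * c) * x)) * ennreal (exp (l * c * y)) \<partial>gauss)"
        by (intro nn_integral_cong) (simp flip: ennreal_mult ennreal_plus exp_add add: algebra_simps)
      also have "\<dots> = ennreal (exp (l * c * x)) * (\<integral>\<^sup>+y. ennreal (exp (- (l * c) * y)) \<partial>gauss) +
          ennreal (exp (- (l * c) * x)) * (\<integral>\<^sup>+y. ennreal (exp (l * c * y)) \<partial>gauss)"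
        by (simp add: nn_integral_add nn_integral_cmult)
      finally show "(\<integral>\<^sup>+y. ennreal (exp (l * c * (x - y)) + exp (- (l * c * (x - y)))) \<partial>gauss) =
        ennreal (exp (l * c * x)) * ennreal (exp ((l * c)\<^sup>2 / 2)) +
         ennreal (exp (- (l * c) * x)) * ennreal (exp ((l * c)\<^sup>2 / 2))"
        using nn_integral_gauss_exp[of "- (l * c)"] nn_integral_gauss_exp[of "l * c"] by simp
    qed
    also have "\<dots> = (\<integral>\<^sup>+x. ennreal (exp (l * c * x)) \<partial>gauss) * ennreal (exp ((l * c)\<^sup>2 / 2)) +
        (\<integral>\<^sup>+x. ennreal (exp (- (l * c) * x)) \<partial>gauss) * ennreal (exp ((l * c)\<^sup>2 / 2))"
      by (simp add: nn_integral_add nn_integral_multc)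
    also have "\<dots> = ennreal (exp (l\<^sup>2 * c\<^sup>2)) + ennreal (exp (l\<^sup>2 * c\<^sup>2))"
      using nn_integral_gauss_exp[of "- (l * c)"] nn_integral_gauss_exp[of "l * c"]
      by (simp flip: ennreal_mult ennreal_plus exp_add add: power_mult_distrib)
    finally have "I + I \<le> ennreal (exp (l\<^sup>2 * c\<^sup>2)) + ennreal (exp (l\<^sup>2 * c\<^sup>2))" .
    then show ?thesis
      by (cases I) (auto simp: top_unique simp flip: ennreal_plus)
  qed
  ultimately show ?thesis by (rule order_trans)
qed

definition depends_on :: "nat list set \<Rightarrow> ((nat list \<Rightarrow> real) \<Rightarrow> 'a) \<Rightarrow> bool" where
  "depends_on J f \<longleftrightarrow> (\<forall>g g'. (\<forall>i\<in>J. g i = g' i) \<longrightarrow> f g = f g')"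

text \<open>Each coupling moves alone, with its own constant; the sum of the squares of the
  constants will play the role of a variance.\<close>

definition coord_lipschitz ::
    "nat list set \<Rightarrow> (nat list \<Rightarrow> real) \<Rightarrow> ((nat list \<Rightarrow> real) \<Rightarrow> real) \<Rightarrow> bool" where
  "coord_lipschitz J c f \<longleftrightarrow> (\<forall>g. \<forall>i\<in>J. \<forall>x y. \<bar>f (g(i := x)) - f (g(i := y))\<bar> \<le> c i * \<bar>x - y\<bar>)"

text \<open>Set the couplings in \<open>J\<close> to 0 one after the other. This linear growth gives
  integrability.\<close>

lemma coord_lipschitz_bound:
  assumes "finite J" "depends_on J f" "coord_lipschitz J c f"
  shows "\<bar>f g - f (\<lambda>_. 0)\<bar> \<le> (\<Sum>i\<in>J. c i * \<bar>g i\<bar>)"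
  using assms
proof (induction J arbitrary: f rule: finite_induct)
  case empty
  then have "f g = f (\<lambda>_. 0)" by (auto simp: depends_on_def)
  then show ?case by simp
next
  case (insert i J)
  let ?h = "\<lambda>g. f (g(i := 0))"
  have "depends_on J ?h"
    using insert.prems(1) unfolding depends_on_def by (auto 0 3 intro: fun_upd_other)
  moreover have "coord_lipschitz J c ?h"
    unfolding coord_lipschitz_def
  proof (intro allI ballI)
    fix g j x y assume "j \<in> J"
    then have "j \<noteq> i" using insert.hyps by auto
    then show "\<bar>f ((g(j := x))(i := 0)) - f ((g(j := y))(i := 0))\<bar> \<le> c j * \<bar>x - y\<bar>"
      using insert.prems(2) \<open>j \<in> J\<close> unfolding coord_lipschitz_def
      by (subst (1 2) fun_upd_twist) auto
  qed
  ultimately have "\<bar>?h g - ?h (\<lambda>_. 0)\<bar> \<le> (\<Sum>i\<in>J. c i * \<bar>g i\<bar>)"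
    by (rule insert.IH)
  moreover have "\<bar>f (g(i := g i)) - f (g(i := 0))\<bar> \<le> c i * \<bar>g i - 0\<bar>"
    using insert.prems(2) unfolding coord_lipschitz_def by blast
  moreover have "(\<lambda>_. 0)(i := 0) = (\<lambda>_. 0::real)" by auto
  ultimately show ?case using insert.hyps by simp
qed

lemma integrable_coord_lipschitz:
  assumes "finite J" "depends_on J f" "coord_lipschitz J c f" "f \<in> borel_measurable disorder"
  shows "integrable disorder f"
proof (rule Bochner_Integration.integrable_bound)
  show "integrable disorder (\<lambda>g. \<bar>f (\<lambda>_. 0)\<bar> + (\<Sum>i\<in>J. c i * \<bar>g i\<bar>))"
    using integrable_coordinate_abs by auto
  show "AE g in disorder. norm (f g) \<le> norm (\<bar>f (\<lambda>_. 0)\<bar> + (\<Sum>i\<in>J. c i * \<bar>g i\<bar>))"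
  proof (rule AE_I2)
    fix g
    show "norm (f g) \<le> norm (\<bar>f (\<lambda>_. 0)\<bar> + (\<Sum>i\<in>J. c i * \<bar>g i\<bar>))"
      using coord_lipschitz_bound[OF assms(1-3), of g] unfolding real_norm_def by linarith
  qed
qed (use assms in auto)

text \<open>The martingale method: averaging over coupling \<open>i\<close> leaves a function
  \<open>h\<close> of the remaining couplings with the same Lipschitz constants, and given those
  couplings \<open>f - h\<close> is a centred Lipschitz function of one Gaussian. The exponents add
  up along the induction.\<close>

theorem coord_lipschitz_mgf:
  assumes "finite J" "depends_on J f" "coord_lipschitz J c f" "f \<in> borel_measurable disorder"
  shows "(\<integral>\<^sup>+g. ennreal (exp (l * (f g - (\<integral>g'. f g' \<partial>disorder)))) \<partial>disorder)
     \<le> ennreal (exp (l\<^sup>2 * (\<Sum>i\<in>J. (c i)\<^sup>2)))"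
  using assms
proof (induction J arbitrary: f rule: finite_induct)
  case empty
  then have "f g = f (\<lambda>_. 0)" for g by (auto simp: depends_on_def)
  then have "f = (\<lambda>g. f (\<lambda>_. 0))" by blast
  then obtain k where "f = (\<lambda>g. k)" by blast
  then show ?case
    by (simp add: disorder.prob_space[simplified] disorder.emeasure_space_1[simplified])
next
  case (insert i J)
  have [measurable]: "f \<in> borel_measurable disorder" by fact
  have lip: "\<bar>f (g(j := x)) - f (g(j := y))\<bar> \<le> c j * \<bar>x - y\<bar>" if "j \<in> insert i J" for g j x y
    using insert.prems(2) that unfolding coord_lipschitz_def by blast
  have [measurable]: "(\<lambda>x. f (g(i := x))) \<in> borel_measurable borel" for g
    by (rule measurable_compose[OF measurable_resample_fixed]) fact
  have int1: "integrable gauss (\<lambda>x. f (g(i := x)))" for g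
    by (rule integrable_gauss_lipschitz[where c = "c i"]) (use lip in auto)
  define h where "h g = (\<integral>x. f (g(i := x)) \<partial>gauss)" for g
  have [measurable]: "h \<in> borel_measurable disorder"
    unfolding h_def by (rule gauss.borel_measurable_lebesgue_integral) (simp add: split_beta')
  have dep: "depends_on J h"
    unfolding depends_on_def
  proof (intro allI impI)
    fix g g' :: "nat list \<Rightarrow> real" assume "\<forall>j\<in>J. g j = g' j"
    then have "f (g(i := x)) = f (g'(i := x))" for x
      using insert.prems(1) unfolding depends_on_def by auto
    then show "h g = h g'" by (simp add: h_def)
  qed
  have liph: "coord_lipschitz J c h"
    unfolding coord_lipschitz_def
  proof (intro allI ballI)
    fix g :: "nat list \<Rightarrow> real" and j x y assume j: "j \<in> J"
    have tw: "(g(j := z))(i := u) = (g(i := u))(j := z)" for z u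
      using j insert.hyps by (intro fun_upd_twist) auto
    note int2 = int1[of "g(j := x)", unfolded tw] int1[of "g(j := y)", unfolded tw]
    have "\<bar>h (g(j := x)) - h (g(j := y))\<bar> =
        \<bar>\<integral>u. f ((g(j := x))(i := u)) - f ((g(j := y))(i := u)) \<partial>gauss\<bar>"
      unfolding h_def using int1 by simp
    also have "\<dots> \<le> (\<integral>u. \<bar>f ((g(j := x))(i := u)) - f ((g(j := y))(i := u))\<bar> \<partial>gauss)"
      by (rule integral_abs_bound)
    also have "\<dots> \<le> (\<integral>u. c j * \<bar>x - y\<bar> \<partial>gauss)"
      by (rule integral_mono)
         (use lip j in \<open>auto simp: tw intro!: integrable_abs Bochner_Integration.integrable_diff int2\<close>)
    also have "\<dots> = c j * \<bar>x - y\<bar>" by (simp add: gauss.prob_space[simplified])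
    finally show "\<bar>h (g(j := x)) - h (g(j := y))\<bar> \<le> c j * \<bar>x - y\<bar>" .
  qed
  have intf: "integrable disorder f"
    by (rule integrable_coord_lipschitz[of "insert i J" f c]) (use insert in auto)
  let ?m = "\<integral>g. f g \<partial>disorder"
  have m: "?m = (\<integral>g. h g \<partial>disorder)"
    unfolding h_def by (rule integral_resample[OF intf])
  have "(\<integral>\<^sup>+g. ennreal (exp (l * (f g - ?m))) \<partial>disorder) =
      (\<integral>\<^sup>+g. \<integral>\<^sup>+x. ennreal (exp (l * (f (g(i := x)) - ?m))) \<partial>gauss \<partial>disorder)"
    by (rule nn_integral_resample) auto
  also have "\<dots> \<le> (\<integral>\<^sup>+g. ennreal (exp (l\<^sup>2 * (c i)\<^sup>2)) * ennreal (exp (l * (h g - ?m))) \<partial>disorder)"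
  proof (rule nn_integral_mono)
    fix g
    have "(\<integral>\<^sup>+x. ennreal (exp (l * (f (g(i := x)) - ?m))) \<partial>gauss) =
        (\<integral>\<^sup>+x. ennreal (exp (l * (h g - ?m))) * ennreal (exp (l * (f (g(i := x)) - h g))) \<partial>gauss)"
      by (intro nn_integral_cong) (simp flip: ennreal_mult exp_add add: algebra_simps)
    also have "\<dots> = ennreal (exp (l * (h g - ?m))) *
        (\<integral>\<^sup>+x. ennreal (exp (l * (f (g(i := x)) - h g))) \<partial>gauss)"
      by (subst nn_integral_cmult) auto
    also have "\<dots> \<le> ennreal (exp (l * (h g - ?m))) * ennreal (exp (l\<^sup>2 * (c i)\<^sup>2))"
      unfolding h_def by (intro mult_left_mono gauss_lipschitz_mgf) (use lip in auto)
    finally show "(\<integral>\<^sup>+x. ennreal (exp (l * (f (g(i := x)) - ?m))) \<partial>gauss) \<le>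
       ennreal (exp (l\<^sup>2 * (c i)\<^sup>2)) * ennreal (exp (l * (h g - ?m)))"
      by (simp add: mult.commute)
  qed
  also have "\<dots> = ennreal (exp (l\<^sup>2 * (c i)\<^sup>2)) * (\<integral>\<^sup>+g. ennreal (exp (l * (h g - ?m))) \<partial>disorder)"
    by (subst nn_integral_cmult) auto
  also have "\<dots> \<le> ennreal (exp (l\<^sup>2 * (c i)\<^sup>2)) * ennreal (exp (l\<^sup>2 * (\<Sum>i\<in>J. (c i)\<^sup>2)))"
    unfolding m by (intro mult_left_mono insert.IH dep liph) auto
  also have "\<dots> = ennreal (exp (l\<^sup>2 * (\<Sum>i\<in>insert i J. (c i)\<^sup>2)))"
    using insert.hyps by (simp flip: ennreal_mult exp_add add: algebra_simps)
  finally show ?case .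
qed

text \<open>The exponent is \<open>l\<^sup>2 * V\<close> without the customary factor 1/2, so
  \<open>V\<close> is half of the usual variance proxy and the tails come out as
  \<open>exp (- x\<^sup>2 / (4 * V))\<close>.\<close>

definition subgaussian :: "((nat list \<Rightarrow> real) \<Rightarrow> real) \<Rightarrow> real \<Rightarrow> bool" where
  "subgaussian f V \<longleftrightarrow> integrable disorder f \<and>
     (\<forall>l. (\<integral>\<^sup>+g. ennreal (exp (l * (f g - (\<integral>g'. f g' \<partial>disorder)))) \<partial>disorder) \<le> ennreal (exp (l\<^sup>2 * V)))"

lemma subgaussianI:
  assumes "finite J" "depends_on J f" "coord_lipschitz J c f" "f \<in> borel_measurable disorder"
    and "(\<Sum>i\<in>J. (c i)\<^sup>2) \<le> V"
  shows "subgaussian f V"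
  unfolding subgaussian_def
proof (intro conjI allI)
  show "integrable disorder f"
    by (rule integrable_coord_lipschitz) fact+
  fix l
  have "ennreal (exp (l\<^sup>2 * (\<Sum>i\<in>J. (c i)\<^sup>2))) \<le> ennreal (exp (l\<^sup>2 * V))"
    using assms(5) by (intro ennreal_leI) (auto intro: mult_left_mono)
  with coord_lipschitz_mgf[OF assms(1-4), of l]
  show "(\<integral>\<^sup>+g. ennreal (exp (l * (f g - (\<integral>g'. f g' \<partial>disorder)))) \<partial>disorder) \<le> ennreal (exp (l\<^sup>2 * V))"
    by (rule order_trans)
qed

lemma subgaussian_uminus:
  assumes "subgaussian f V" shows "subgaussian (\<lambda>g. - f g) V"
  unfolding subgaussian_def
proof (intro conjI allI)
  show "integrable disorder (\<lambda>g. - f g)" using assms by (auto simp: subgaussian_def)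
  fix l :: real
  have "(\<integral>\<^sup>+g. ennreal (exp (l * (- f g - (\<integral>g'. - f g' \<partial>disorder)))) \<partial>disorder) =
     (\<integral>\<^sup>+g. ennreal (exp ((- l) * (f g - (\<integral>g'. f g' \<partial>disorder)))) \<partial>disorder)"
    by (simp add: algebra_simps)
  also have "\<dots> \<le> ennreal (exp ((- l)\<^sup>2 * V))"
    using assms unfolding subgaussian_def by blast
  finally show "(\<integral>\<^sup>+g. ennreal (exp (l * (- f g - (\<integral>g'. - f g' \<partial>disorder)))) \<partial>disorder)
      \<le> ennreal (exp (l\<^sup>2 * V))" by simp
qed

lemma subgaussian_upper_tail:
  assumes sg: "subgaussian f V" and V: "V > 0" and x: "x \<ge> 0"
  shows "measure disorder {g. (\<integral>g. f g \<partial>disorder) + x \<le> f g} \<le> exp (- x\<^sup>2 / (4 * V))"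
proof -
  let ?m = "\<integral>g. f g \<partial>disorder"
  have [measurable]: "f \<in> borel_measurable disorder" using sg by (auto simp: subgaussian_def)
  \<comment> \<open>The minimiser of the Chernoff exponent
    \<open>- l * x + l\<^sup>2 * V\<close>.\<close>
  define l where "l = x / (2 * V)"
  have l: "l \<ge> 0" using V x by (simp add: l_def)
  have "emeasure disorder {g. ?m + x \<le> f g} \<le>
     emeasure disorder ({g\<in>space disorder. 1 \<le> ennreal (exp (- l * x)) * ennreal (exp (l * (f g - ?m)))})"
  proof (rule emeasure_mono)
    show "{g. ?m + x \<le> f g} \<subseteq> {g\<in>space disorder. 1 \<le> ennreal (exp (- l * x)) * ennreal (exp (l * (f g - ?m)))}"
    proof safe
      fix g assume "?m + x \<le> f g"
      then have "0 \<le> l * (f g - ?m - x)" using l by simp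
      then have "0 \<le> - l * x + l * (f g - ?m)" by (simp add: algebra_simps)
      then have "1 \<le> exp (- l * x + l * (f g - ?m))" by simp
      then show "1 \<le> ennreal (exp (- l * x)) * ennreal (exp (l * (f g - ?m)))"
        by (simp flip: ennreal_mult exp_add)
    qed auto
  qed measurable
  also have "\<dots> \<le> ennreal (exp (- l * x)) * (\<integral>\<^sup>+g. ennreal (exp (l * (f g - ?m))) * indicator (space disorder) g \<partial>disorder)"
    by (rule nn_integral_Markov_inequality) (use sets.top[of disorder] in auto)
  also have "\<dots> \<le> ennreal (exp (- l * x)) * ennreal (exp (l\<^sup>2 * V))"
    using sg by (intro mult_left_mono) (auto simp: subgaussian_def)
  also have "\<dots> = ennreal (exp (- x\<^sup>2 / (4 * V)))"
  proof -
    have "- l * x + l\<^sup>2 * V = - x\<^sup>2 / (4 * V)"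
      using V by (simp add: l_def power2_eq_square field_simps)
    then show ?thesis by (simp flip: ennreal_mult exp_add)
  qed
  finally show ?thesis
    by (simp add: disorder.emeasure_eq_measure)
qed

lemma subgaussian_lower_tail:
  assumes sg: "subgaussian f V" and V: "V > 0" and x: "x \<ge> 0"
  shows "measure disorder {g. f g \<le> (\<integral>g. f g \<partial>disorder) - x} \<le> exp (- x\<^sup>2 / (4 * V))"
proof -
  have "{g. f g \<le> (\<integral>g. f g \<partial>disorder) - x} = {g. (\<integral>g. - f g \<partial>disorder) + x \<le> - f g}"
    by auto
  then show ?thesis
    using subgaussian_upper_tail[OF subgaussian_uminus[OF sg] V x] by simp
qed

lemma subgaussian_abs_deviation:
  assumes sg: "subgaussian f V" and V: "V > 0"
  shows "(\<integral>g. \<bar>f g - (\<integral>g. f g \<partial>disorder)\<bar> \<partial>disorder) \<le> 6 * sqrt V"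
proof -
  let ?m = "\<integral>g. f g \<partial>disorder"
  have int: "integrable disorder f" using sg by (auto simp: subgaussian_def)
  then have [measurable]: "f \<in> borel_measurable disorder" by simp
  \<comment> \<open>This scale makes both exponential moments at most \<open>exp 1\<close>; the
    constant 6 comes from \<open>2 * exp 1 \<le> 6\<close>.\<close>
  define l where "l = 1 / sqrt V"
  have l: "l > 0" "l\<^sup>2 * V = 1" using V by (auto simp: l_def power_divide)
  have "ennreal (\<integral>g. \<bar>f g - ?m\<bar> \<partial>disorder) = (\<integral>\<^sup>+g. ennreal \<bar>f g - ?m\<bar> \<partial>disorder)"
    using int by (intro nn_integral_eq_integral[symmetric]) auto
  also have "\<dots> \<le> (\<integral>\<^sup>+g. ennreal (sqrt V) * (ennreal (exp (l * (f g - ?m))) + ennreal (exp ((-l) * (f g - ?m)))) \<partial>disorder)"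
  proof (rule nn_integral_mono)
    fix g
    have "l * \<bar>f g - ?m\<bar> \<le> exp (l * \<bar>f g - ?m\<bar>)"
      using exp_ge_add_one_self[of "l * \<bar>f g - ?m\<bar>"] by linarith
    also have "\<dots> \<le> exp (l * (f g - ?m)) + exp ((-l) * (f g - ?m))"
      by (cases "f g \<ge> ?m") (auto simp: algebra_simps)
    finally have "\<bar>f g - ?m\<bar> \<le> sqrt V * (exp (l * (f g - ?m)) + exp ((-l) * (f g - ?m)))"
      using V by (simp add: l_def field_simps)
    then show "ennreal \<bar>f g - ?m\<bar> \<le> ennreal (sqrt V) * (ennreal (exp (l * (f g - ?m))) + ennreal (exp ((-l) * (f g - ?m))))"
      using V by (simp flip: ennreal_mult ennreal_plus)
  qed
  also have "\<dots> = ennreal (sqrt V) * ((\<integral>\<^sup>+g. ennreal (exp (l * (f g - ?m))) \<partial>disorder) +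
      (\<integral>\<^sup>+g. ennreal (exp ((-l) * (f g - ?m))) \<partial>disorder))"
    by (simp add: nn_integral_cmult nn_integral_add)
  also have "\<dots> \<le> ennreal (sqrt V) * (ennreal (exp (l\<^sup>2 * V)) + ennreal (exp ((-l)\<^sup>2 * V)))"
    by (intro mult_left_mono add_mono sg[unfolded subgaussian_def, THEN conjunct2, rule_format]) simp
  also have "\<dots> = ennreal (sqrt V * (2 * exp 1))"
    using l(2) V by (simp flip: ennreal_mult ennreal_plus)
  also have "\<dots> \<le> ennreal (6 * sqrt V)"
    using V exp_le by (intro ennreal_leI) auto
  finally show ?thesis using V by simp
qed

section \<open>Gaussian integration by parts\<close>

lemma tendsto_std_normal_density:
  "(std_normal_density \<longlongrightarrow> 0) at_top" "(std_normal_density \<longlongrightarrow> 0) at_bot"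
proof -
  have b: "std_normal_density x \<le> exp (1/2) * exp (- x)" "std_normal_density x \<le> exp (1/2) * exp x" for x
  proof -
    have "std_normal_density x \<le> exp (- x\<^sup>2 / 2)"
      unfolding std_normal_density_def using pi_gt3
      by (intro mult_left_le_one_le) (auto simp: divide_le_eq_1)
    moreover have "- x\<^sup>2 / 2 \<le> 1/2 + (- x)" "- x\<^sup>2 / 2 \<le> 1/2 + x"
      using zero_le_power2[of "x - 1"] zero_le_power2[of "x + 1"] by (auto simp: power2_eq_square algebra_simps)
    ultimately show "std_normal_density x \<le> exp (1/2) * exp (- x)" "std_normal_density x \<le> exp (1/2) * exp x"
      unfolding exp_add[symmetric] by (auto intro: order_trans)
  qed
  have t1: "((\<lambda>x::real. exp (1/2) * exp (- x)) \<longlongrightarrow> exp (1/2) * 0) at_top"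
    by (intro tendsto_intros filterlim_compose[OF exp_at_bot] filterlim_uminus_at_bot_at_top)
  show "(std_normal_density \<longlongrightarrow> 0) at_top"
    by (rule tendsto_sandwich[of "\<lambda>_. 0"]) (use b t1 in auto)
  have t2: "((\<lambda>x::real. exp (1/2) * exp x) \<longlongrightarrow> exp (1/2) * 0) at_bot"
    by (intro tendsto_intros exp_at_bot)
  show "(std_normal_density \<longlongrightarrow> 0) at_bot"
    by (rule tendsto_sandwich[of "\<lambda>_. 0"]) (use b t2 in auto)
qed

lemma integral_gauss:
  fixes f :: "real \<Rightarrow> real"
  assumes [measurable]: "f \<in> borel_measurable borel"
  shows "(\<integral>x. f x \<partial>gauss) = (\<integral>x. std_normal_density x * f x \<partial>lborel)"
  unfolding gauss_def by (subst integral_density) auto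

text \<open>The density \<open>d\<close> satisfies \<open>d' = - x * d\<close>, so
  \<open>d * F' - d * (x * F)\<close> is the derivative of \<open>d * F\<close>, which vanishes at
  both ends of the line. Boundedness of \<open>F\<close> and \<open>F'\<close> is what products of
  Gibbs weights provide.\<close>

lemma gauss_ibp:
  fixes F F' :: "real \<Rightarrow> real"
  assumes deriv: "\<And>x. (F has_real_derivative F' x) (at x)"
    and cont: "\<And>x. isCont F' x"
    and B: "\<And>x. \<bar>F x\<bar> \<le> B" "\<And>x. \<bar>F' x\<bar> \<le> B"
  shows "(\<integral>x. x * F x \<partial>gauss) = (\<integral>x. F' x \<partial>gauss)"
proof -
  let ?d = std_normal_density
  have [measurable]: "F' \<in> borel_measurable borel"
    by (rule borel_measurable_continuous_onI) (use cont in \<open>auto simp: continuous_on_eq_continuous_at\<close>)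
  have contF: "isCont F x" for x using deriv by (rule DERIV_isCont)
  have [measurable]: "F \<in> borel_measurable borel"
    by (rule borel_measurable_continuous_onI) (use contF in \<open>auto simp: continuous_on_eq_continuous_at\<close>)
  have d_deriv: "(?d has_real_derivative (- x * ?d x)) (at x)" for x
    unfolding std_normal_density_def by (auto intro!: derivative_eq_intros simp: field_simps)
  have d_cont: "isCont ?d x" for x using d_deriv by (rule DERIV_isCont)
  have i1: "integrable lborel (\<lambda>x. ?d x * F' x)"
  proof (rule Bochner_Integration.integrable_bound)
    show "integrable lborel (\<lambda>x. B * ?d x)" by auto
    show "AE x in lborel. norm (?d x * F' x) \<le> norm (B * ?d x)"
    proof (rule AE_I2)
      fix x
      have "?d x * \<bar>F' x\<bar> \<le> ?d x * \<bar>B\<bar>"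
        using B(2)[of x] by (intro mult_left_mono) auto
      then show "norm (?d x * F' x) \<le> norm (B * ?d x)" by (simp add: abs_mult mult.commute)
    qed
  qed auto
  have i2: "integrable lborel (\<lambda>x. ?d x * (x * F x))"
  proof (rule Bochner_Integration.integrable_bound)
    show "integrable lborel (\<lambda>x. B * (?d x * \<bar>x\<bar>))"
      using integrable_std_normal_moment_abs[of 1] by auto
    show "AE x in lborel. norm (?d x * (x * F x)) \<le> norm (B * (?d x * \<bar>x\<bar>))"
    proof (rule AE_I2)
      fix x
      have "?d x * \<bar>x\<bar> * \<bar>F x\<bar> \<le> ?d x * \<bar>x\<bar> * B"
        by (rule mult_left_mono) (use B in auto)
      also have "\<dots> \<le> \<bar>B * (?d x * \<bar>x\<bar>)\<bar>" by (simp add: mult.commute)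
      finally show "norm (?d x * (x * F x)) \<le> norm (B * (?d x * \<bar>x\<bar>))"
        by (simp add: abs_mult mult.assoc)
    qed
  qed auto
  have "(LBINT x=-\<infinity>..\<infinity>. ?d x * F' x - ?d x * (x * F x)) = 0 - 0"
  proof (rule interval_integral_FTC_integrable[where F = "\<lambda>x. ?d x * F x"])
    show "((\<lambda>x. ?d x * F x) has_vector_derivative ?d x * F' x - ?d x * (x * F x)) (at x)" for x
      unfolding has_real_derivative_iff_has_vector_derivative[symmetric]
      by (auto intro!: derivative_eq_intros deriv d_deriv simp: algebra_simps)
    show "isCont (\<lambda>x. ?d x * F' x - ?d x * (x * F x)) x" for x
      by (intro continuous_intros cont contF d_cont)
    show "set_integrable lborel (einterval (- \<infinity>) \<infinity>) (\<lambda>x. ?d x * F' x - ?d x * (x * F x))"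
      using i1 i2 by (simp add: set_integrable_def)
    have bd: "norm (?d x * F x) \<le> norm (?d x) * B" for x
      using B(1)[of x] by (auto simp: abs_mult intro: mult_left_mono)
    have tz: "((\<lambda>x. ?d x * F x) \<longlongrightarrow> 0) FF" if "(?d \<longlongrightarrow> 0) FF" for FF
    proof (rule Lim_null_comparison)
      show "\<forall>\<^sub>F x in FF. norm (?d x * F x) \<le> norm (?d x) * B" using bd by simp
      show "((\<lambda>x. norm (?d x) * B) \<longlongrightarrow> 0) FF"
        using tendsto_mult_left_zero[OF tendsto_norm_zero[OF that]] by simp
    qed
    show "(((\<lambda>x. ?d x * F x) \<circ> real_of_ereal) \<longlongrightarrow> 0) (at_right (- \<infinity>))"
      "(((\<lambda>x. ?d x * F x) \<circ> real_of_ereal) \<longlongrightarrow> 0) (at_left \<infinity>)"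
      using tz tendsto_std_normal_density by (auto simp: ereal_tendsto_simps)
  qed simp
  then have "(\<integral>x. ?d x * F' x - ?d x * (x * F x) \<partial>lborel) = 0"
    by (simp add: interval_lebesgue_integral_def set_lebesgue_integral_def)
  then show ?thesis
    using i1 i2 by (simp add: integral_gauss)
qed

lemma integrable_disorder_bounded:
  fixes f :: "(nat list \<Rightarrow> real) \<Rightarrow> real"
  assumes "f \<in> borel_measurable disorder" "\<And>g. \<bar>f g\<bar> \<le> B"
  shows "integrable disorder f"
  by (rule disorder.integrable_const_bound[of _ B]) (use assms in auto)

lemma integrable_coordinate_mult:
  fixes f :: "(nat list \<Rightarrow> real) \<Rightarrow> real"
  assumes [measurable]: "f \<in> borel_measurable disorder" and B: "\<And>g. \<bar>f g\<bar> \<le> B"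
  shows "integrable disorder (\<lambda>g. g i * f g)"
proof (rule Bochner_Integration.integrable_bound)
  show "integrable disorder (\<lambda>g. B * \<bar>g i\<bar>)" using integrable_coordinate_abs by auto
  show "AE g in disorder. norm (g i * f g) \<le> norm (B * \<bar>g i\<bar>)"
  proof (rule AE_I2)
    fix g :: "nat list \<Rightarrow> real"
    have "\<bar>g i\<bar> * \<bar>f g\<bar> \<le> \<bar>g i\<bar> * B" using B by (intro mult_left_mono) auto
    also have "\<dots> \<le> \<bar>B * \<bar>g i\<bar>\<bar>" by (simp add: mult.commute)
    finally show "norm (g i * f g) \<le> norm (B * \<bar>g i\<bar>)" by (simp add: abs_mult)
  qed
qed auto

lemma disorder_ibp:
  fixes F F' :: "(nat list \<Rightarrow> real) \<Rightarrow> real"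
  assumes [measurable]: "F \<in> borel_measurable disorder" "F' \<in> borel_measurable disorder"
    and deriv: "\<And>g x. ((\<lambda>x. F (g(i := x))) has_real_derivative F' (g(i := x))) (at x)"
    and cont: "\<And>g x. isCont (\<lambda>x. F' (g(i := x))) x"
    and B: "\<And>g. \<bar>F g\<bar> \<le> B" "\<And>g. \<bar>F' g\<bar> \<le> B"
  shows "(\<integral>g. g i * F g \<partial>disorder) = (\<integral>g. F' g \<partial>disorder)"
proof -
  have "(\<integral>g. g i * F g \<partial>disorder) = (\<integral>g. (\<integral>x. x * F (g(i := x)) \<partial>gauss) \<partial>disorder)"
    by (subst integral_resample[where i = i]) (auto intro: integrable_coordinate_mult B)
  also have "\<dots> = (\<integral>g. (\<integral>x. F' (g(i := x)) \<partial>gauss) \<partial>disorder)"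
    by (subst gauss_ibp[OF deriv cont B]) (rule refl)
  also have "\<dots> = (\<integral>g. F' g \<partial>disorder)"
    by (subst (2) integral_resample[where i = i]) (auto intro: integrable_disorder_bounded B)
  finally show ?thesis .
qed

section \<open>Shifts, sign changes and partial resampling of the couplings\<close>

lemma measurable_shift: "(\<lambda>g i. g i + c i) \<in> measurable disorder disorder"
  by (rule measurable_into_disorder) measurable

lemma measurable_upd_add: "(\<lambda>g. g(i := g i + c)) \<in> measurable disorder disorder"
  by (rule measurable_into_disorder) (auto simp: fun_upd_def)

lemma measurable_borel_resample:
  assumes [measurable]: "f \<in> borel_measurable disorder"
  shows "(\<lambda>x. f (g(i := x))) \<in> borel_measurable borel"
  by (rule measurable_compose[OF measurable_resample_fixed]) fact

text \<open>One shifted coordinate at a time. Read from right to left, it turns an exponential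
  weight that is linear in the couplings into a shift of the couplings, which is how planting
  arises.\<close>

lemma cameron_martin:
  assumes "finite J" "f \<in> borel_measurable disorder"
  shows "(\<integral>\<^sup>+g. f (\<lambda>i. g i + (if i \<in> J then b i else 0)) \<partial>disorder) =
     (\<integral>\<^sup>+g. ennreal (exp ((\<Sum>i\<in>J. b i * g i) - (\<Sum>i\<in>J. (b i)\<^sup>2) / 2)) * f g \<partial>disorder)"
  using assms
proof (induction J arbitrary: f rule: finite_induct)
  case empty
  then show ?case by simp
next
  case (insert i J)
  have [measurable]: "f \<in> borel_measurable disorder" by fact
  let ?e = "\<lambda>J (g :: nat list \<Rightarrow> real). exp ((\<Sum>i\<in>J. b i * g i) - (\<Sum>i\<in>J. (b i)\<^sup>2) / 2)"
  have [measurable]: "(\<lambda>g. f (g(i := g i + b i))) \<in> borel_measurable disorder"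
    by (rule measurable_compose[OF measurable_upd_add]) fact
  have upd: "?e J (g(i := x)) = ?e J g" for g :: "nat list \<Rightarrow> real" and x
    using insert.hyps by (auto intro!: sum.cong)
  have "(\<integral>\<^sup>+g. f (\<lambda>j. g j + (if j \<in> insert i J then b j else 0)) \<partial>disorder) =
     (\<integral>\<^sup>+g. (\<lambda>g. f (g(i := g i + b i))) (\<lambda>j. g j + (if j \<in> J then b j else 0)) \<partial>disorder)"
  proof (rule nn_integral_cong)
    fix g :: "nat list \<Rightarrow> real"
    have "(\<lambda>j. g j + (if j \<in> insert i J then b j else 0)) =
      (\<lambda>g. g(i := g i + b i)) (\<lambda>j. g j + (if j \<in> J then b j else 0))"
      using insert.hyps by auto
    then show "f (\<lambda>j. g j + (if j \<in> insert i J then b j else 0)) =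
      (\<lambda>g. f (g(i := g i + b i))) (\<lambda>j. g j + (if j \<in> J then b j else 0))" by simp
  qed
  also have "\<dots> = (\<integral>\<^sup>+g. ennreal (?e J g) * f (g(i := g i + b i)) \<partial>disorder)"
    by (rule insert.IH) measurable
  also have "\<dots> = (\<integral>\<^sup>+g. \<integral>\<^sup>+x. ennreal (?e J g) * f (g(i := x + b i)) \<partial>gauss \<partial>disorder)"
    by (subst nn_integral_resample[where i = i]) (simp_all only: upd fun_upd_same fun_upd_upd, measurable)
  also have "\<dots> = (\<integral>\<^sup>+g. \<integral>\<^sup>+x. ennreal (?e (insert i J) (g(i := x))) * f (g(i := x)) \<partial>gauss \<partial>disorder)"
  proof (rule nn_integral_cong)
    fix g :: "nat list \<Rightarrow> real"
    note [measurable] = measurable_borel_resample[of f g i]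
    have s: "?e (insert i J) (g(i := x)) = ?e J g * exp (b i * x - (b i)\<^sup>2 / 2)" for x
    proof -
      have *: "(\<Sum>j\<in>J. b j * (if j = i then x else g j)) = (\<Sum>j\<in>J. b j * g j)"
        using insert.hyps by (auto intro!: sum.cong)
      show ?thesis
        using insert.hyps by (simp add: * fun_upd_def exp_add[symmetric] add_divide_distrib)
    qed
    have "(\<integral>\<^sup>+x. ennreal (?e J g) * f (g(i := x + b i)) \<partial>gauss) =
       ennreal (?e J g) * (\<integral>\<^sup>+x. f (g(i := x + b i)) \<partial>gauss)"
      by (subst nn_integral_cmult) auto
    also have "\<dots> = ennreal (?e J g) * (\<integral>\<^sup>+x. ennreal (exp (b i * x - (b i)\<^sup>2 / 2)) * f (g(i := x)) \<partial>gauss)"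
      by (subst nn_integral_gauss_shift) auto
    also have "\<dots> = (\<integral>\<^sup>+x. ennreal (?e (insert i J) (g(i := x))) * f (g(i := x)) \<partial>gauss)"
      unfolding s by (subst nn_integral_cmult[symmetric]) (auto simp: ennreal_mult mult.assoc)
    finally show "(\<integral>\<^sup>+x. ennreal (?e J g) * f (g(i := x + b i)) \<partial>gauss) =
      (\<integral>\<^sup>+x. ennreal (?e (insert i J) (g(i := x))) * f (g(i := x)) \<partial>gauss)" .
  qed
  also have "\<dots> = (\<integral>\<^sup>+g. ennreal (?e (insert i J) g) * f g \<partial>disorder)"
    by (rule nn_integral_resample[symmetric]) measurable
  finally show ?case .
qed

lemma measurable_upd_mult: "(\<lambda>g. g(i := c * g i)) \<in> measurable disorder disorder"
  by (rule measurable_into_disorder) (auto simp: fun_upd_def)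

text \<open>Symmetry of the Gaussian, one coordinate at a time; it justifies the gauge
  transformation that moves the planted configuration to the constant one.\<close>

lemma nn_integral_sign_flip:
  assumes "finite J" "f \<in> borel_measurable disorder" "\<And>i. i \<in> J \<Longrightarrow> s i = 1 \<or> s i = (-1::real)"
  shows "(\<integral>\<^sup>+g. f (\<lambda>i. if i \<in> J then s i * g i else g i) \<partial>disorder) = (\<integral>\<^sup>+g. f g \<partial>disorder)"
  using assms
proof (induction J arbitrary: f rule: finite_induct)
  case empty
  then show ?case by simp
next
  case (insert i J)
  have [measurable]: "f \<in> borel_measurable disorder" by fact
  have m2 [measurable]: "(\<lambda>g. f (g(i := s i * g i))) \<in> borel_measurable disorder"
    by (rule measurable_compose[OF measurable_upd_mult]) fact
  have "(\<integral>\<^sup>+g. f (\<lambda>j. if j \<in> insert i J then s j * g j else g j) \<partial>disorder) =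
     (\<integral>\<^sup>+g. (\<lambda>g. f (g(i := s i * g i))) (\<lambda>j. if j \<in> J then s j * g j else g j) \<partial>disorder)"
  proof (rule nn_integral_cong)
    fix g :: "nat list \<Rightarrow> real"
    have "(\<lambda>j. if j \<in> insert i J then s j * g j else g j) =
      (\<lambda>g. g(i := s i * g i)) (\<lambda>j. if j \<in> J then s j * g j else g j)"
      using insert.hyps by auto
    then show "f (\<lambda>j. if j \<in> insert i J then s j * g j else g j) =
      (\<lambda>g. f (g(i := s i * g i))) (\<lambda>j. if j \<in> J then s j * g j else g j)" by simp
  qed
  also have "\<dots> = (\<integral>\<^sup>+g. f (g(i := s i * g i)) \<partial>disorder)"
    by (rule insert.IH[OF m2]) (use insert.prems in auto)
  also have "\<dots> = (\<integral>\<^sup>+g. \<integral>\<^sup>+x. f (g(i := s i * x)) \<partial>gauss \<partial>disorder)"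
    by (subst nn_integral_resample[where i = i]) (rule m2, simp only: fun_upd_same fun_upd_upd)
  also have "\<dots> = (\<integral>\<^sup>+g. \<integral>\<^sup>+x. f (g(i := x)) \<partial>gauss \<partial>disorder)"
  proof (rule nn_integral_cong)
    fix g :: "nat list \<Rightarrow> real"
    note [measurable] = measurable_borel_resample[of f g i]
    show "(\<integral>\<^sup>+x. f (g(i := s i * x)) \<partial>gauss) = (\<integral>\<^sup>+x. f (g(i := x)) \<partial>gauss)"
      using insert.prems(2)[of i] nn_integral_gauss_symmetric[of "\<lambda>x. f (g(i := x))"] by auto
  qed
  also have "\<dots> = (\<integral>\<^sup>+g. f g \<partial>disorder)"
    by (rule nn_integral_resample[symmetric]) measurable
  finally show ?case .
qed

lemma measurable_merge:
  "(\<lambda>(g', g) i. if i \<in> K then g' i else g i) \<in> measurable (disorder \<Otimes>\<^sub>M disorder) disorder"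
proof (rule measurable_into_disorder)
  show "(\<lambda>x. (case x of (g', g) \<Rightarrow> \<lambda>i. if i \<in> K then g' i else g i) i)
      \<in> borel_measurable (disorder \<Otimes>\<^sub>M disorder)" for i
    by (cases "i \<in> K") (auto simp: split_beta')
qed

lemma measurable_merge':
  "(\<lambda>g' i. if i \<in> K then g' i else g i) \<in> measurable disorder disorder"
proof (rule measurable_into_disorder)
  show "(\<lambda>g'. if i \<in> K then g' i else g i) \<in> borel_measurable disorder" for i
    by (cases "i \<in> K") auto
qed

text \<open>Replacing the couplings in \<open>K\<close> by an independent copy leaves the law
  unchanged; the inner integral is the conditional expectation given the couplings outside
  \<open>K\<close>.\<close>

lemma nn_integral_merge:
  assumes "finite K" "f \<in> borel_measurable disorder"
  shows "(\<integral>\<^sup>+g. f g \<partial>disorder) =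
     (\<integral>\<^sup>+g. \<integral>\<^sup>+g'. f (\<lambda>i. if i \<in> K then g' i else g i) \<partial>disorder \<partial>disorder)"
  using assms
proof (induction K rule: finite_induct)
  case empty
  then show ?case by (simp add: disorder.emeasure_space_1[simplified])
next
  case (insert i K)
  have [measurable]: "f \<in> borel_measurable disorder" by fact
  let ?m = "\<lambda>K g' g i. if i \<in> K then g' i else (g i :: real)"
  have m1[measurable]: "(\<lambda>g. \<integral>\<^sup>+g'. f (?m K' g' g) \<partial>disorder) \<in> borel_measurable disorder" for K'
  proof -
    have "(\<lambda>(g, g'). f (?m K' g' g)) \<in> borel_measurable (disorder \<Otimes>\<^sub>M disorder)"
      using measurable_compose[OF measurable_pair_swap' measurable_compose[OF measurable_merge[of K'], of f borel]]
      by (simp add: split_beta' cong: if_cong)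
    then show ?thesis by (rule disorder.borel_measurable_nn_integral)
  qed
  have e: "?m K g' (g(i := x)) = ?m (insert i K) (g'(i := x)) g" for g g' x
    using insert.hyps by auto
  have "(\<integral>\<^sup>+g. f g \<partial>disorder) = (\<integral>\<^sup>+g. \<integral>\<^sup>+g'. f (?m K g' g) \<partial>disorder \<partial>disorder)"
    by (rule insert.IH) fact
  also have "\<dots> = (\<integral>\<^sup>+g. \<integral>\<^sup>+x. \<integral>\<^sup>+g'. f (?m (insert i K) (g'(i := x)) g) \<partial>disorder \<partial>gauss \<partial>disorder)"
    by (subst nn_integral_resample[where i = i]) (simp_all only: e m1)
  also have "\<dots> = (\<integral>\<^sup>+g. \<integral>\<^sup>+g'. \<integral>\<^sup>+x. f (?m (insert i K) (g'(i := x)) g) \<partial>gauss \<partial>disorder \<partial>disorder)"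
  proof (rule nn_integral_cong)
    fix g :: "nat list \<Rightarrow> real"
    have "(\<lambda>(x, g'). f (?m (insert i K) (g'(i := x)) g)) \<in> borel_measurable (gauss \<Otimes>\<^sub>M disorder)"
      using measurable_compose[OF measurable_compose[OF measurable_resample[of i] measurable_merge'[of "insert i K" g]] \<open>f \<in> borel_measurable disorder\<close>]
      by (simp only: split_beta')
    then show "(\<integral>\<^sup>+x. \<integral>\<^sup>+g'. f (?m (insert i K) (g'(i := x)) g) \<partial>disorder \<partial>gauss) =
      (\<integral>\<^sup>+g'. \<integral>\<^sup>+x. f (?m (insert i K) (g'(i := x)) g) \<partial>gauss \<partial>disorder)"
      by (rule gd.Fubini'[symmetric])
  qed
  also have "\<dots> = (\<integral>\<^sup>+g. \<integral>\<^sup>+g'. f (?m (insert i K) g' g) \<partial>disorder \<partial>disorder)"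
  proof (rule nn_integral_cong)
    fix g :: "nat list \<Rightarrow> real"
    have "(\<lambda>g'. f (?m (insert i K) g' g)) \<in> borel_measurable disorder"
      by (rule measurable_compose[OF measurable_merge']) fact
    then show "(\<integral>\<^sup>+g'. \<integral>\<^sup>+x. f (?m (insert i K) (g'(i := x)) g) \<partial>gauss \<partial>disorder) =
      (\<integral>\<^sup>+g'. f (?m (insert i K) g' g) \<partial>disorder)"
      by (rule nn_integral_resample[symmetric])
  qed
  finally show ?case .
qed

text \<open>An injective relabelling keeps the law, so lists with different tags can serve as
  independent families of couplings inside the same disorder.\<close>

lemma distr_reindex:
  assumes "inj f"
  shows "distr disorder disorder (\<lambda>g i. g (f i)) = disorder"
  using distr_PiM_reindex[of UNIV "\<lambda>_. gauss" f UNIV] assms prob_space_gauss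
  by (simp add: disorder_def restrict_UNIV)

lemma measurable_reindex: "(\<lambda>g i. g (f i)) \<in> measurable disorder disorder"
  by (rule measurable_into_disorder) measurable

section \<open>Finite Gibbs measures\<close>

text \<open>Log-partition function, Gibbs weights, Gibbs average and average over \<open>n\<close> replicas of the
  Hamiltonian \<open>X\<close>; \<open>en\<close> is a Hamiltonian that is affine in the couplings.\<close>
definition lse :: "'o set \<Rightarrow> ('o \<Rightarrow> real) \<Rightarrow> real" where
  "lse \<Omega> X = ln (\<Sum>\<omega>\<in>\<Omega>. exp (X \<omega>))"

definition sm :: "'o set \<Rightarrow> ('o \<Rightarrow> real) \<Rightarrow> 'o \<Rightarrow> real" where
  "sm \<Omega> X \<omega> = exp (X \<omega>) / (\<Sum>\<omega>'\<in>\<Omega>. exp (X \<omega>'))"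

definition avg :: "'o set \<Rightarrow> ('o \<Rightarrow> real) \<Rightarrow> ('o \<Rightarrow> real) \<Rightarrow> real" where
  "avg \<Omega> X f = (\<Sum>\<omega>\<in>\<Omega>. sm \<Omega> X \<omega> * f \<omega>)"

definition rep :: "'o set \<Rightarrow> ('o \<Rightarrow> real) \<Rightarrow> nat \<Rightarrow> ((nat \<Rightarrow> 'o) \<Rightarrow> real) \<Rightarrow> real" where
  "rep \<Omega> X n f = (\<Sum>\<tau>\<in>PiE {..<n} (\<lambda>_. \<Omega>). (\<Prod>l<n. sm \<Omega> X (\<tau> l)) * f \<tau>)"

definition en :: "nat list set \<Rightarrow> (nat list \<Rightarrow> 'o \<Rightarrow> real) \<Rightarrow> ('o \<Rightarrow> real) \<Rightarrow> (nat list \<Rightarrow> real) \<Rightarrow> 'o \<Rightarrow> real" where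
  "en J a c g \<omega> = (\<Sum>i\<in>J. a i \<omega> * g i) + c \<omega>"

lemma sum_exp_pos:
  fixes X :: "'o \<Rightarrow> real"
  assumes "finite \<Omega>" "\<Omega> \<noteq> {}"
  shows "(\<Sum>\<omega>\<in>\<Omega>. exp (X \<omega>)) > 0"
  by (rule sum_pos) (use assms in auto)

lemma sm_nonneg: "sm \<Omega> X \<omega> \<ge> 0"
  by (auto simp: sm_def intro!: divide_nonneg_nonneg sum_nonneg)

lemma sum_sm:
  assumes "finite \<Omega>" "\<Omega> \<noteq> {}"
  shows "(\<Sum>\<omega>\<in>\<Omega>. sm \<Omega> X \<omega>) = 1"
  using sum_exp_pos[OF assms, of X] by (simp add: sm_def flip: sum_divide_distrib)

lemma sm_le_1:
  assumes "finite \<Omega>" "\<omega> \<in> \<Omega>"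
  shows "sm \<Omega> X \<omega> \<le> 1"
proof -
  have "sm \<Omega> X \<omega> \<le> (\<Sum>\<omega>\<in>\<Omega>. sm \<Omega> X \<omega>)"
    by (rule member_le_sum) (use assms sm_nonneg in auto)
  moreover have "\<Omega> \<noteq> {}" using assms by auto
  ultimately show ?thesis using sum_sm[of \<Omega> X] assms(1) by simp
qed

lemma avg_const:
  assumes "finite \<Omega>" "\<Omega> \<noteq> {}"
  shows "avg \<Omega> X (\<lambda>_. k) = k"
  using sum_sm[OF assms, of X] by (simp add: avg_def flip: sum_distrib_right)

lemma avg_mono:
  assumes "\<And>\<omega>. \<omega> \<in> \<Omega> \<Longrightarrow> f \<omega> \<le> h \<omega>"
  shows "avg \<Omega> X f \<le> avg \<Omega> X h"
  unfolding avg_def by (intro sum_mono mult_left_mono assms sm_nonneg)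

lemma avg_add: "avg \<Omega> X (\<lambda>\<omega>. f \<omega> + h \<omega>) = avg \<Omega> X f + avg \<Omega> X h"
  by (simp add: avg_def distrib_left sum.distrib)

lemma avg_diff: "avg \<Omega> X (\<lambda>\<omega>. f \<omega> - h \<omega>) = avg \<Omega> X f - avg \<Omega> X h"
  by (simp add: avg_def right_diff_distrib sum_subtractf)

lemma avg_cmult: "avg \<Omega> X (\<lambda>\<omega>. k * f \<omega>) = k * avg \<Omega> X f"
  by (simp add: avg_def sum_distrib_left mult_ac)

lemma avg_sum: "avg \<Omega> X (\<lambda>\<omega>. \<Sum>i\<in>I. f i \<omega>) = (\<Sum>i\<in>I. avg \<Omega> X (f i))"
  unfolding avg_def sum_distrib_left by (rule sum.swap)

lemma avg_abs_le:
  assumes "finite \<Omega>" "\<Omega> \<noteq> {}" "\<And>\<omega>. \<omega> \<in> \<Omega> \<Longrightarrow> \<bar>f \<omega>\<bar> \<le> B"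
  shows "\<bar>avg \<Omega> X f\<bar> \<le> B"
proof -
  have "avg \<Omega> X f \<le> avg \<Omega> X (\<lambda>_. B)" "avg \<Omega> X (\<lambda>_. - B) \<le> avg \<Omega> X f"
    using assms(3) by (auto intro!: avg_mono simp: abs_le_iff minus_le_iff)
  then show ?thesis by (simp add: avg_const assms)
qed

lemma avg_nonneg:
  assumes "\<And>\<omega>. \<omega> \<in> \<Omega> \<Longrightarrow> f \<omega> \<ge> 0"
  shows "avg \<Omega> X f \<ge> 0"
  unfolding avg_def by (intro sum_nonneg mult_nonneg_nonneg assms sm_nonneg)

lemma lse_ge:
  assumes "finite \<Omega>" "\<omega> \<in> \<Omega>"
  shows "X \<omega> \<le> lse \<Omega> X"
proof -
  have "exp (X \<omega>) \<le> (\<Sum>\<omega>\<in>\<Omega>. exp (X \<omega>))"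
    using assms by (intro member_le_sum) auto
  then show ?thesis unfolding lse_def using sum_exp_pos[of \<Omega> X] assms
    by (subst ln_ge_iff) auto
qed

lemma exp_lse:
  assumes "finite \<Omega>" "\<Omega> \<noteq> {}"
  shows "exp (lse \<Omega> X) = (\<Sum>\<omega>\<in>\<Omega>. exp (X \<omega>))"
  using sum_exp_pos[OF assms, of X] by (simp add: lse_def)

lemma lse_add_const:
  assumes "finite \<Omega>" "\<Omega> \<noteq> {}"
  shows "lse \<Omega> (\<lambda>\<omega>. X \<omega> + k) = lse \<Omega> X + k"
  using sum_exp_pos[OF assms, of X]
  by (simp add: lse_def exp_add ln_mult flip: sum_distrib_right)

lemma lse_mono:
  assumes "finite \<Omega>" "\<Omega> \<noteq> {}" "\<And>\<omega>. \<omega> \<in> \<Omega> \<Longrightarrow> X \<omega> \<le> Y \<omega>"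
  shows "lse \<Omega> X \<le> lse \<Omega> Y"
  unfolding lse_def using sum_exp_pos[OF assms(1,2), of X] assms(3) by (auto intro!: ln_mono sum_mono)

lemma lse_mono_set:
  assumes "finite \<Omega>" "\<Omega>' \<noteq> {}" "\<Omega>' \<subseteq> \<Omega>"
  shows "lse \<Omega>' X \<le> lse \<Omega> X"
  unfolding lse_def using sum_exp_pos[of \<Omega>' X] assms finite_subset
  by (auto intro!: ln_mono sum_mono2)

lemma exp_lse_diff:
  assumes "finite \<Omega>" "\<Omega> \<noteq> {}"
  shows "exp (lse \<Omega> Y - lse \<Omega> X) = avg \<Omega> X (\<lambda>\<omega>. exp (Y \<omega> - X \<omega>))"
  by (simp add: exp_diff exp_lse[OF assms] avg_def sm_def sum_divide_distrib)

text \<open>Convexity of the log-partition function: its gradient at \<open>X\<close> is the Gibbs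
  average under \<open>X\<close>. Being exact for any two Hamiltonians, the inequality is used in
  place of derivatives with respect to parameters.\<close>

lemma lse_convex:
  assumes "finite \<Omega>" "\<Omega> \<noteq> {}"
  shows "avg \<Omega> X (\<lambda>\<omega>. Y \<omega> - X \<omega>) \<le> lse \<Omega> Y - lse \<Omega> X"
proof -
  let ?d = "lse \<Omega> Y - lse \<Omega> X"
  have "avg \<Omega> X (\<lambda>\<omega>. Y \<omega> - X \<omega> - ?d + 1) \<le> avg \<Omega> X (\<lambda>\<omega>. exp (- ?d) * exp (Y \<omega> - X \<omega>))"
  proof (rule avg_mono)
    fix \<omega>
    show "Y \<omega> - X \<omega> - ?d + 1 \<le> exp (- ?d) * exp (Y \<omega> - X \<omega>)"
      using exp_ge_add_one_self[of "Y \<omega> - X \<omega> - ?d"] by (simp add: algebra_simps flip: exp_add)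
  qed
  also have "\<dots> = exp (- ?d) * exp ?d"
    unfolding avg_cmult by (simp only: exp_lse_diff[OF assms])
  also have "\<dots> = 1" by (simp flip: exp_add)
  finally show ?thesis
    by (simp add: avg_diff avg_add avg_const assms)
qed

lemma en_upd:
  assumes "finite J" "i \<in> J"
  shows "en J a c (g(i := x)) \<omega> = en J a c g \<omega> + a i \<omega> * (x - g i)"
proof -
  have "(\<Sum>j\<in>J. a j \<omega> * (g(i := x)) j) = (\<Sum>j\<in>J. a j \<omega> * g j + (if j = i then a i \<omega> * (x - g i) else 0))"
    by (intro sum.cong) (auto simp: algebra_simps)
  then show ?thesis using assms by (simp add: en_def sum.distrib sum.delta)
qed

lemma measurable_en [measurable]: "(\<lambda>g. en J a c g \<omega>) \<in> borel_measurable disorder"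
  unfolding en_def by measurable

lemma measurable_lse_en [measurable]: "(\<lambda>g. lse \<Omega> (en J a c g)) \<in> borel_measurable disorder"
  unfolding lse_def by measurable

lemma measurable_sm_en [measurable]: "(\<lambda>g. sm \<Omega> (en J a c g) \<omega>) \<in> borel_measurable disorder"
  unfolding sm_def by measurable

lemma measurable_avg_en [measurable]:
  assumes [measurable]: "\<And>\<omega>. (\<lambda>g. f g \<omega>) \<in> borel_measurable disorder"
  shows "(\<lambda>g. avg \<Omega> (en J a c g) (f g)) \<in> borel_measurable disorder"
  unfolding avg_def by measurable

text \<open>Changing coupling \<open>i\<close> by \<open>d\<close> moves every energy by at most
  \<open>A i * \<bar>d\<bar>\<close>, hence also their log-sum-exp, whatever the number of
  configurations and the field \<open>c\<close>.\<close>

lemma subgaussian_lse_en: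
  assumes fin: "finite \<Omega>" "\<Omega> \<noteq> {}" "finite J"
    and A: "\<And>i \<omega>. i \<in> J \<Longrightarrow> \<omega> \<in> \<Omega> \<Longrightarrow> \<bar>a i \<omega>\<bar> \<le> A i" and V: "(\<Sum>i\<in>J. (A i)\<^sup>2) \<le> V"
  shows "subgaussian (\<lambda>g. lse \<Omega> (en J a c g)) V"
proof (rule subgaussianI[OF \<open>finite J\<close> _ _ _ V])
  show "depends_on J (\<lambda>g. lse \<Omega> (en J a c g))"
    unfolding depends_on_def
  proof (intro allI impI)
    fix g g' :: "nat list \<Rightarrow> real" assume "\<forall>i\<in>J. g i = g' i"
    then have "en J a c g = en J a c g'" unfolding en_def by auto
    then show "lse \<Omega> (en J a c g) = lse \<Omega> (en J a c g')" by simp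
  qed
  have le: "lse \<Omega> (en J a c (g(i := x))) \<le> lse \<Omega> (en J a c (g(i := y))) + A i * \<bar>x - y\<bar>"
    if "i \<in> J" for g i x y
  proof -
    have "lse \<Omega> (en J a c (g(i := x))) \<le> lse \<Omega> (\<lambda>\<omega>. en J a c (g(i := y)) \<omega> + A i * \<bar>x - y\<bar>)"
    proof (rule lse_mono[OF fin(1,2)])
      fix \<omega> assume w: "\<omega> \<in> \<Omega>"
      have "a i \<omega> * (x - y) \<le> \<bar>a i \<omega>\<bar> * \<bar>x - y\<bar>" by (metis abs_ge_self abs_mult)
      also have "\<dots> \<le> A i * \<bar>x - y\<bar>" using A[OF that w] by (rule mult_right_mono) simp
      finally have "a i \<omega> * (x - y) \<le> A i * \<bar>x - y\<bar>" .
      then show "en J a c (g(i := x)) \<omega> \<le> en J a c (g(i := y)) \<omega> + A i * \<bar>x - y\<bar>"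
        by (simp add: en_upd[OF fin(3) that] algebra_simps)
    qed
    also have "\<dots> = lse \<Omega> (en J a c (g(i := y))) + A i * \<bar>x - y\<bar>"
      by (rule lse_add_const[OF fin(1,2)])
    finally show ?thesis .
  qed
  show "coord_lipschitz J A (\<lambda>g. lse \<Omega> (en J a c g))"
    unfolding coord_lipschitz_def
  proof (intro allI ballI)
    fix g i x y assume "i \<in> J"
    from le[OF this, of g x y] le[OF this, of g y x]
    show "\<bar>lse \<Omega> (en J a c (g(i := x))) - lse \<Omega> (en J a c (g(i := y)))\<bar> \<le> A i * \<bar>x - y\<bar>"
      unfolding abs_minus_commute[of y x] by linarith
  qed
qed measurable

lemma integrable_lse_en:
  assumes "finite \<Omega>" "\<Omega> \<noteq> {}" "finite J"
  shows "integrable disorder (\<lambda>g. lse \<Omega> (en J a c g))"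
proof -
  have "subgaussian (\<lambda>g. lse \<Omega> (en J a c g)) (\<Sum>i\<in>J. (\<Sum>\<omega>\<in>\<Omega>. \<bar>a i \<omega>\<bar>)\<^sup>2)"
    by (rule subgaussian_lse_en[OF assms, where A = "\<lambda>i. \<Sum>\<omega>\<in>\<Omega>. \<bar>a i \<omega>\<bar>"])
       (use assms in \<open>auto intro: member_le_sum\<close>)
  then show ?thesis by (simp add: subgaussian_def)
qed

lemma prod_sm:
  "(\<Prod>l\<in>T. sm \<Omega> X (\<tau> l)) = exp (\<Sum>l\<in>T. X (\<tau> l)) / (\<Sum>\<omega>\<in>\<Omega>. exp (X \<omega>)) ^ card T"
  if "finite T"
  using that by (simp add: sm_def prod_dividef exp_sum)

text \<open>Logarithmic derivative of a product of Gibbs weights: each replica contributes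
  \<open>a i (\<tau> l)\<close>, and each of the \<open>card T\<close> normalisations subtracts the
  average over a fresh replica.\<close>

lemma gibbs_ibp_prod:
  assumes fin: "finite \<Omega>" "\<Omega> \<noteq> {}" "finite J" "finite T" and i: "i \<in> J"
    and \<tau>: "\<And>l. l \<in> T \<Longrightarrow> \<tau> l \<in> \<Omega>"
  shows "(\<integral>g. g i * (\<Prod>l\<in>T. sm \<Omega> (en J a c g) (\<tau> l)) \<partial>disorder) =
    (\<integral>g. (\<Prod>l\<in>T. sm \<Omega> (en J a c g) (\<tau> l)) *
       ((\<Sum>l\<in>T. a i (\<tau> l)) - real (card T) * avg \<Omega> (en J a c g) (a i)) \<partial>disorder)"
proof -
  let ?P = "\<lambda>g. \<Prod>l\<in>T. sm \<Omega> (en J a c g) (\<tau> l)"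
  let ?F = "\<lambda>g. ?P g * ((\<Sum>l\<in>T. a i (\<tau> l)) - real (card T) * avg \<Omega> (en J a c g) (a i))"
  let ?B = "1 + (\<Sum>l\<in>T. \<bar>a i (\<tau> l)\<bar>) + real (card T) * (\<Sum>\<omega>\<in>\<Omega>. \<bar>a i \<omega>\<bar>)"
  have P01: "0 \<le> ?P g" "?P g \<le> 1" for g
    using \<tau> fin by (auto intro!: prod_nonneg prod_le_1 sm_nonneg sm_le_1)
  show ?thesis
  proof (rule disorder_ibp[where F = ?P and F' = ?F and B = ?B])
    show "?P \<in> borel_measurable disorder" by measurable
    show "?F \<in> borel_measurable disorder" by measurable
    fix g :: "nat list \<Rightarrow> real" and x
    let ?X = "\<lambda>x \<omega>. en J a c g \<omega> + a i \<omega> * (x - g i)"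
    let ?Z = "\<lambda>x. \<Sum>\<omega>\<in>\<Omega>. exp (?X x \<omega>)"
    have Z: "?Z x > 0" for x by (rule sum_exp_pos[OF fin(1,2)])
    have upd: "en J a c (g(i := x)) = ?X x" for x
      by (rule ext) (rule en_upd[OF fin(3) i])
    have dZ: "(?Z has_real_derivative (\<Sum>\<omega>\<in>\<Omega>. exp (?X x \<omega>) * a i \<omega>)) (at x)" for x
      by (auto intro!: derivative_eq_intros)
    have eq: "?P (g(i := x)) = exp (\<Sum>l\<in>T. ?X x (\<tau> l)) / ?Z x ^ card T" for x
      unfolding upd by (rule prod_sm[OF fin(4)])
    have av: "avg \<Omega> (?X x) (a i) = (\<Sum>\<omega>\<in>\<Omega>. exp (?X x \<omega>) * a i \<omega>) / ?Z x" for x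
      by (simp add: avg_def sm_def sum_divide_distrib)
    have dE: "((\<lambda>x. exp (\<Sum>l\<in>T. ?X x (\<tau> l))) has_real_derivative
        exp (\<Sum>l\<in>T. ?X x (\<tau> l)) * (\<Sum>l\<in>T. a i (\<tau> l))) (at x)" for x
      by (auto intro!: derivative_eq_intros)
    have dP: "((\<lambda>x. ?Z x ^ card T) has_real_derivative
        real (card T) * ?Z x ^ (card T - 1) * (\<Sum>\<omega>\<in>\<Omega>. exp (?X x \<omega>) * a i \<omega>)) (at x)" for x
      using DERIV_power[OF dZ[of x], of "card T"] by (simp add: mult_ac)
    \<comment> \<open>For \<open>card T = 0\<close> both sides are 0, so the truncated exponent is
      harmless.\<close>
    have pw: "real (card T) * ?Z x ^ (card T - 1) = real (card T) * ?Z x ^ card T / ?Z x" for x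
      using Z[of x] by (cases "card T") auto
    show "((\<lambda>x. ?P (g(i := x))) has_real_derivative ?F (g(i := x))) (at x)"
    proof -
      have "((\<lambda>x. exp (\<Sum>l\<in>T. ?X x (\<tau> l)) / ?Z x ^ card T) has_real_derivative
        (exp (\<Sum>l\<in>T. ?X x (\<tau> l)) * (\<Sum>l\<in>T. a i (\<tau> l)) * ?Z x ^ card T -
         exp (\<Sum>l\<in>T. ?X x (\<tau> l)) *
          (real (card T) * ?Z x ^ (card T - 1) * (\<Sum>\<omega>\<in>\<Omega>. exp (?X x \<omega>) * a i \<omega>))) /
         (?Z x ^ card T * ?Z x ^ card T)) (at x)"
        by (rule DERIV_divide[OF dE dP]) (use Z[of x] in auto)
      moreover have "(exp (\<Sum>l\<in>T. ?X x (\<tau> l)) * (\<Sum>l\<in>T. a i (\<tau> l)) * ?Z x ^ card T -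
         exp (\<Sum>l\<in>T. ?X x (\<tau> l)) *
          (real (card T) * ?Z x ^ (card T - 1) * (\<Sum>\<omega>\<in>\<Omega>. exp (?X x \<omega>) * a i \<omega>))) /
         (?Z x ^ card T * ?Z x ^ card T) = ?F (g(i := x))"
        unfolding upd av prod_sm[OF fin(4)] pw
      proof -
        define E S Q z where "E = exp (\<Sum>l\<in>T. ?X x (\<tau> l))" and "S = (\<Sum>l\<in>T. a i (\<tau> l))"
          and "Q = (\<Sum>\<omega>\<in>\<Omega>. exp (?X x \<omega>) * a i \<omega>)" and "z = ?Z x"
        have z: "z > 0" "z ^ card T > 0" using Z[of x] by (auto simp: z_def)
        have "(E * S * z ^ card T - E * (real (card T) * z ^ card T / z * Q)) / (z ^ card T * z ^ card T) =
            E / z ^ card T * (S - real (card T) * (Q / z))"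
          using z by (simp add: field_simps)
        then show "(exp (\<Sum>l\<in>T. ?X x (\<tau> l)) * (\<Sum>l\<in>T. a i (\<tau> l)) * ?Z x ^ card T -
         exp (\<Sum>l\<in>T. ?X x (\<tau> l)) *
          (real (card T) * ?Z x ^ card T / ?Z x * (\<Sum>\<omega>\<in>\<Omega>. exp (?X x \<omega>) * a i \<omega>))) /
         (?Z x ^ card T * ?Z x ^ card T) =
         exp (\<Sum>l\<in>T. ?X x (\<tau> l)) / ?Z x ^ card T *
         ((\<Sum>l\<in>T. a i (\<tau> l)) - real (card T) * ((\<Sum>\<omega>\<in>\<Omega>. exp (?X x \<omega>) * a i \<omega>) / ?Z x))"
          unfolding E_def S_def Q_def z_def .
      qed
      ultimately show ?thesis unfolding eq by simp
    qed
    have cZ: "isCont ?Z x" for x using dZ by (rule DERIV_isCont)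
    show "isCont (\<lambda>x. ?F (g(i := x))) x"
      unfolding eq upd av sm_def
      by (intro continuous_intros cZ) (use Z[of x] in auto)
    show "\<bar>?P g\<bar> \<le> ?B"
    proof -
      have "0 \<le> (\<Sum>l\<in>T. \<bar>a i (\<tau> l)\<bar>) + real (card T) * (\<Sum>\<omega>\<in>\<Omega>. \<bar>a i \<omega>\<bar>)"
        by (intro add_nonneg_nonneg mult_nonneg_nonneg sum_nonneg) auto
      then show ?thesis using P01[of g] by linarith
    qed
    show "\<bar>?F g\<bar> \<le> ?B"
    proof -
      have 1: "\<bar>avg \<Omega> (en J a c g) (a i)\<bar> \<le> (\<Sum>\<omega>\<in>\<Omega>. \<bar>a i \<omega>\<bar>)"
        by (rule avg_abs_le[OF fin(1,2)]) (use fin in \<open>auto intro: member_le_sum\<close>)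
      have 2: "\<bar>\<Sum>l\<in>T. a i (\<tau> l)\<bar> \<le> (\<Sum>l\<in>T. \<bar>a i (\<tau> l)\<bar>)" by (rule sum_abs)
      have 3: "\<bar>real (card T) * avg \<Omega> (en J a c g) (a i)\<bar> \<le> real (card T) * (\<Sum>\<omega>\<in>\<Omega>. \<bar>a i \<omega>\<bar>)"
        unfolding abs_mult by (intro mult_mono 1) auto
      have "\<bar>?F g\<bar> \<le> 1 * \<bar>(\<Sum>l\<in>T. a i (\<tau> l)) - real (card T) * avg \<Omega> (en J a c g) (a i)\<bar>"
        unfolding abs_mult using P01[of g] by (intro mult_right_mono) auto
      also have "\<dots> \<le> \<bar>\<Sum>l\<in>T. a i (\<tau> l)\<bar> + \<bar>real (card T) * avg \<Omega> (en J a c g) (a i)\<bar>"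
        unfolding mult_1 by (rule abs_triangle_ineq4)
      also have "\<dots> \<le> (\<Sum>l\<in>T. \<bar>a i (\<tau> l)\<bar>) + real (card T) * (\<Sum>\<omega>\<in>\<Omega>. \<bar>a i \<omega>\<bar>)"
        by (intro add_mono 2 3)
      also have "\<dots> \<le> ?B" by simp
      finally show ?thesis .
    qed
  qed
qed

text \<open>The one-replica case, summed over couplings: the covariance of the two linear forms at
  the same configuration, minus their covariance at two independent replicas.\<close>

lemma gibbs_ibp:
  assumes fin: "finite \<Omega>" "\<Omega> \<noteq> {}" "finite J" and K: "K \<subseteq> J"
  shows "(\<integral>g. avg \<Omega> (en J a c g) (\<lambda>\<omega>. \<Sum>i\<in>K. b i \<omega> * g i) \<partial>disorder) =
    (\<integral>g. avg \<Omega> (en J a c g) (\<lambda>\<omega>. \<Sum>i\<in>K. b i \<omega> * a i \<omega>) \<partial>disorder) -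
    (\<integral>g. avg \<Omega> (en J a c g) (\<lambda>\<omega>. avg \<Omega> (en J a c g) (\<lambda>\<omega>'. \<Sum>i\<in>K. b i \<omega> * a i \<omega>')) \<partial>disorder)"
proof -
  let ?s = "\<lambda>g. sm \<Omega> (en J a c g)" and ?A = "\<lambda>g. avg \<Omega> (en J a c g)"
  have finK: "finite K" using K fin(3) finite_subset by auto
  have one: "(\<integral>g. g i * ?s g \<omega> \<partial>disorder) = (\<integral>g. ?s g \<omega> * (a i \<omega> - ?A g (a i)) \<partial>disorder)"
    if "i \<in> K" "\<omega> \<in> \<Omega>" for i \<omega>
    using gibbs_ibp_prod[of \<Omega> J "{0::nat}" i "\<lambda>_. \<omega>" a c] fin that K by auto
  have sb: "\<bar>?s g \<omega>\<bar> \<le> 1" if "\<omega> \<in> \<Omega>" for g \<omega>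
    using sm_nonneg[of \<Omega> "en J a c g" \<omega>] sm_le_1[OF fin(1) that, of "en J a c g"] by linarith
  have ab: "\<bar>?A g (a i)\<bar> \<le> (\<Sum>\<omega>\<in>\<Omega>. \<bar>a i \<omega>\<bar>)" for g i
    by (rule avg_abs_le[OF fin(1,2)]) (use fin in \<open>auto intro: member_le_sum\<close>)
  have i1: "integrable disorder (\<lambda>g. g i * ?s g \<omega>)" if "\<omega> \<in> \<Omega>" for i \<omega>
    by (rule integrable_coordinate_mult[where B = 1]) (use sb that in auto)
  have i2: "integrable disorder (\<lambda>g. ?s g \<omega>)" if "\<omega> \<in> \<Omega>" for \<omega>
    by (rule integrable_disorder_bounded[where B = 1]) (use sb that in auto)
  have i3: "integrable disorder (\<lambda>g. ?s g \<omega> * ?A g (a i))" if "\<omega> \<in> \<Omega>" for i \<omega>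
  proof (rule integrable_disorder_bounded[where B = "\<Sum>\<omega>\<in>\<Omega>. \<bar>a i \<omega>\<bar>"])
    show "\<bar>?s g \<omega> * ?A g (a i)\<bar> \<le> (\<Sum>\<omega>\<in>\<Omega>. \<bar>a i \<omega>\<bar>)" for g
      using mult_mono[OF sb[OF that, of g] ab[of g i]] by (simp add: abs_mult)
  qed measurable
  have "(\<integral>g. ?A g (\<lambda>\<omega>. \<Sum>i\<in>K. b i \<omega> * g i) \<partial>disorder) =
    (\<integral>g. (\<Sum>\<omega>\<in>\<Omega>. \<Sum>i\<in>K. b i \<omega> * (g i * ?s g \<omega>)) \<partial>disorder)"
    by (simp add: avg_def sum_distrib_left mult_ac)
  also have "\<dots> = (\<Sum>\<omega>\<in>\<Omega>. \<Sum>i\<in>K. b i \<omega> * (\<integral>g. g i * ?s g \<omega> \<partial>disorder))"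
    using i1 by (simp add: Bochner_Integration.integral_sum)
  also have "\<dots> = (\<Sum>\<omega>\<in>\<Omega>. \<Sum>i\<in>K. b i \<omega> * (\<integral>g. ?s g \<omega> * (a i \<omega> - ?A g (a i)) \<partial>disorder))"
    using one by (intro sum.cong refl) auto
  also have "\<dots> = (\<Sum>\<omega>\<in>\<Omega>. \<Sum>i\<in>K. b i \<omega> * ((\<integral>g. ?s g \<omega> * a i \<omega> \<partial>disorder) - (\<integral>g. ?s g \<omega> * ?A g (a i) \<partial>disorder)))"
    using i2 i3 by (intro sum.cong refl) (auto simp: right_diff_distrib)
  also have "\<dots> = (\<integral>g. (\<Sum>\<omega>\<in>\<Omega>. \<Sum>i\<in>K. b i \<omega> * (?s g \<omega> * a i \<omega>)) \<partial>disorder) -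
     (\<integral>g. (\<Sum>\<omega>\<in>\<Omega>. \<Sum>i\<in>K. b i \<omega> * (?s g \<omega> * ?A g (a i))) \<partial>disorder)"
    using i2 i3 by (simp add: Bochner_Integration.integral_sum right_diff_distrib sum_subtractf)
  also have "(\<lambda>g. \<Sum>\<omega>\<in>\<Omega>. \<Sum>i\<in>K. b i \<omega> * (?s g \<omega> * a i \<omega>)) = (\<lambda>g. ?A g (\<lambda>\<omega>. \<Sum>i\<in>K. b i \<omega> * a i \<omega>))"
    by (simp add: avg_def sum_distrib_left mult_ac)
  also have "(\<lambda>g. \<Sum>\<omega>\<in>\<Omega>. \<Sum>i\<in>K. b i \<omega> * (?s g \<omega> * ?A g (a i))) =
     (\<lambda>g. ?A g (\<lambda>\<omega>. ?A g (\<lambda>\<omega>'. \<Sum>i\<in>K. b i \<omega> * a i \<omega>')))"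
  proof
    fix g
    have "?A g (\<lambda>\<omega>'. \<Sum>i\<in>K. b i \<omega> * a i \<omega>') = (\<Sum>i\<in>K. b i \<omega> * ?A g (a i))" for \<omega>
      by (simp add: avg_sum avg_cmult)
    moreover have "?A g (\<lambda>\<omega>. \<Sum>i\<in>K. b i \<omega> * y i) = (\<Sum>\<omega>\<in>\<Omega>. \<Sum>i\<in>K. b i \<omega> * (?s g \<omega> * y i))" for y
      by (simp add: avg_def sum_distrib_left mult_ac)
    ultimately show "(\<Sum>\<omega>\<in>\<Omega>. \<Sum>i\<in>K. b i \<omega> * (?s g \<omega> * ?A g (a i))) =
       ?A g (\<lambda>\<omega>. ?A g (\<lambda>\<omega>'. \<Sum>i\<in>K. b i \<omega> * a i \<omega>'))" by simp
  qed
  finally show ?thesis .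
qed

section \<open>Spin configurations and the energy\<close>

lemma idx_0: "idx 0 N = {[]}"
  by (auto simp: idx_def)

lemma idx_Suc: "idx (Suc p) N = (\<lambda>(i, xs). i # xs) ` ({..<N} \<times> idx p N)"
  by (auto simp: idx_def length_Suc_conv image_iff)

lemma finite_idx [simp]: "finite (idx p N)"
  by (induction p) (auto simp: idx_0 idx_Suc)

lemma sum_idx_prod_list:
  fixes f :: "nat \<Rightarrow> real"
  shows "(\<Sum>xs\<in>idx p N. prod_list (map f xs)) = (\<Sum>i<N. f i) ^ p"
proof (induction p)
  case 0
  then show ?case by (simp add: idx_0)
next
  case (Suc p)
  have "inj_on (\<lambda>(i, xs). i # xs) ({..<N} \<times> idx p N)" by (auto simp: inj_on_def)
  then have "(\<Sum>xs\<in>idx (Suc p) N. prod_list (map f xs)) =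
      (\<Sum>(i, xs)\<in>{..<N} \<times> idx p N. f i * prod_list (map f xs))"
    by (simp add: idx_Suc sum.reindex split_beta' o_def)
  also have "\<dots> = (\<Sum>i<N. f i) * (\<Sum>xs\<in>idx p N. prod_list (map f xs))"
    by (simp add: sum.cartesian_product[symmetric] sum_product)
  finally show ?case by (simp add: Suc.IH)
qed

lemma prod_list_map_mult:
  fixes f h :: "'b \<Rightarrow> real"
  shows "prod_list (map f xs) * prod_list (map h xs) = prod_list (map (\<lambda>i. f i * h i) xs)"
  by (induction xs) (auto simp: mult_ac)

lemma card_idx: "real (card (idx p N)) = real N ^ p"
  using sum_idx_prod_list[of "\<lambda>_. 1" p N] by (simp add: map_replicate_const)

lemma finite_Sigma [simp]: "finite (Sigma N)"
  unfolding Sigma_def by (intro finite_PiE) auto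

lemma card_Sigma: "card (Sigma N) = 2 ^ N"
  unfolding Sigma_def by (subst card_PiE) (auto simp: numeral_2_eq_2)

lemma Sigma_nonempty [simp]: "Sigma N \<noteq> {}"
  using card_Sigma[of N] by (metis card.empty power_not_zero zero_neq_numeral)

lemma Sigma_square: "\<sigma> \<in> Sigma N \<Longrightarrow> i < N \<Longrightarrow> \<sigma> i * \<sigma> i = 1"
  unfolding Sigma_def by (auto simp: PiE_def Pi_def)

lemma Sigma_abs: "\<sigma> \<in> Sigma N \<Longrightarrow> i < N \<Longrightarrow> \<bar>\<sigma> i\<bar> = 1"
  unfolding Sigma_def by (auto simp: PiE_def Pi_def)

lemma prod_list_Sigma:
  assumes "\<sigma> \<in> Sigma N" "set xs \<subseteq> {..<N}"
  shows "prod_list (map \<sigma> xs) = 1 \<or> prod_list (map \<sigma> xs) = -1"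
  using assms(2)
proof (induction xs)
  case (Cons i xs)
  then have "\<sigma> i = 1 \<or> \<sigma> i = -1" using assms(1) unfolding Sigma_def by (auto simp: PiE_def Pi_def)
  then show ?case using Cons by auto
qed simp

definition hc :: "nat \<Rightarrow> nat \<Rightarrow> nat list \<Rightarrow> (nat \<Rightarrow> real) \<Rightarrow> real" where
  "hc p N xs \<sigma> = real N powr (- (real p - 1) / 2) * prod_list (map \<sigma> xs)"

lemma H_hc: "H p N g \<sigma> = (\<Sum>xs\<in>idx p N. hc p N xs \<sigma> * g xs)"
  by (simp add: H_def hc_def sum_distrib_left mult_ac)

lemma powr_half_square:
  assumes "N \<ge> 1" "p \<ge> 1"
  shows "(real N powr (- (real p - 1) / 2))\<^sup>2 * real N ^ p = real N"
proof -
  have "(real N powr (- (real p - 1) / 2))\<^sup>2 = real N powr (1 - real p)"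
    by (simp add: power2_eq_square powr_add[symmetric])
  moreover have "real N ^ p = real N powr real p"
    using assms by (simp add: powr_realpow)
  ultimately show ?thesis using assms by (simp add: powr_add[symmetric])
qed

lemma hc_abs:
  assumes "xs \<in> idx p N" "\<sigma> \<in> Sigma N"
  shows "\<bar>hc p N xs \<sigma>\<bar> = real N powr (- (real p - 1) / 2)"
  using prod_list_Sigma[OF assms(2), of xs] assms(1) by (auto simp: hc_def idx_def abs_mult)

lemma sum_hc_bound_square:
  assumes "N \<ge> 1" "p \<ge> 1"
  shows "(\<Sum>xs\<in>idx p N. (k * real N powr (- (real p - 1) / 2))\<^sup>2) = k\<^sup>2 * real N"
  using powr_half_square[OF assms] by (simp add: card_idx power_mult_distrib mult_ac)

text \<open>Summing products over all index lists is the expansion of the \<open>p\<close>-th power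
  of a sum; the covariance of the energies is therefore a function of the overlap alone.\<close>

lemma hc_cov:
  assumes "N \<ge> 1" "p \<ge> 1"
  shows "(\<Sum>xs\<in>idx p N. hc p N xs \<sigma> * hc p N xs \<tau>) = real N * overlap N \<sigma> \<tau> ^ p"
proof -
  let ?k = "real N powr (- (real p - 1) / 2)"
  have "(\<Sum>xs\<in>idx p N. hc p N xs \<sigma> * hc p N xs \<tau>) =
     (\<Sum>xs\<in>idx p N. ?k\<^sup>2 * prod_list (map (\<lambda>i. \<sigma> i * \<tau> i) xs))"
    by (simp add: hc_def power2_eq_square prod_list_map_mult[symmetric] mult_ac)
  also have "\<dots> = ?k\<^sup>2 * (\<Sum>i<N. \<sigma> i * \<tau> i) ^ p"
    by (simp add: sum_distrib_left[symmetric] sum_idx_prod_list)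
  also have "\<dots> = (?k\<^sup>2 * real N ^ p) * overlap N \<sigma> \<tau> ^ p"
    using assms by (simp add: overlap_def power_divide)
  finally show ?thesis using powr_half_square[OF assms] by simp
qed

lemma overlap_self: "N \<ge> 1 \<Longrightarrow> \<sigma> \<in> Sigma N \<Longrightarrow> overlap N \<sigma> \<sigma> = 1"
  by (simp add: overlap_def Sigma_square)

lemma overlap_commute: "overlap N \<sigma> \<tau> = overlap N \<tau> \<sigma>"
  by (simp add: overlap_def mult.commute)

lemma overlap_abs_le_1:
  assumes "\<sigma> \<in> Sigma N" "\<tau> \<in> Sigma N"
  shows "\<bar>overlap N \<sigma> \<tau>\<bar> \<le> 1"
proof -
  have "\<bar>\<Sum>i<N. \<sigma> i * \<tau> i\<bar> \<le> (\<Sum>i<N. \<bar>\<sigma> i * \<tau> i\<bar>)" by (rule sum_abs)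
  also have "\<dots> = real N" using assms by (simp add: abs_mult Sigma_abs)
  finally show ?thesis unfolding overlap_def by (cases "N = 0") (auto simp: abs_divide)
qed

lemma overlap_pow_abs_le_1:
  assumes "\<sigma> \<in> Sigma N" "\<tau> \<in> Sigma N"
  shows "\<bar>overlap N \<sigma> \<tau> ^ p\<bar> \<le> 1"
  using overlap_abs_le_1[OF assms] by (simp add: power_abs power_le_one)

lemma en_hc: "en (idx p N) (\<lambda>xs \<sigma>. k * hc p N xs \<sigma>) c g \<sigma> = k * H p N g \<sigma> + c \<sigma>"
  by (simp add: en_def H_hc sum_distrib_left mult_ac)

lemma subgaussian_lse_H:
  assumes "N \<ge> 1" "p \<ge> 1" "A \<subseteq> Sigma N" "A \<noteq> {}"
  shows "subgaussian (\<lambda>g. lse A (\<lambda>\<sigma>. k * H p N g \<sigma> + c \<sigma>)) (k\<^sup>2 * real N)"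
  unfolding en_hc[symmetric, abs_def]
proof (rule subgaussian_lse_en[where A = "\<lambda>_. \<bar>k\<bar> * real N powr (- (real p - 1) / 2)"])
  show "finite A" by (rule finite_subset[OF assms(3)]) simp
  show "(\<Sum>i\<in>idx p N. (\<bar>k\<bar> * real N powr (- (real p - 1) / 2))\<^sup>2) \<le> k\<^sup>2 * real N"
    using sum_hc_bound_square[OF assms(1,2), of "\<bar>k\<bar>"] by simp
  show "\<bar>k * hc p N i \<omega>\<bar> \<le> \<bar>k\<bar> * real N powr (- (real p - 1) / 2)"
    if "i \<in> idx p N" "\<omega> \<in> A" for i \<omega>
    using hc_abs[OF that(1), of \<omega>] that assms(3) by (auto simp: abs_mult)
qed (use assms in auto)

text \<open>Integration by parts; self-overlaps are 1, so the diagonal term is constant. The subset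
  \<open>A\<close> and the deterministic field \<open>c\<close> make room for restricted and planted
  systems.\<close>

lemma expectation_H:
  fixes k :: real and c :: "(nat \<Rightarrow> real) \<Rightarrow> real"
  assumes "N \<ge> 1" "p \<ge> 1" "A \<subseteq> Sigma N" "A \<noteq> {}"
  defines "X \<equiv> \<lambda>g \<sigma>. k * H p N g \<sigma> + c \<sigma>"
  shows "(\<integral>g. avg A (X g) (H p N g) \<partial>disorder) =
    k * real N * (1 - (\<integral>g. avg A (X g) (\<lambda>\<sigma>. avg A (X g) (\<lambda>\<tau>. overlap N \<sigma> \<tau> ^ p)) \<partial>disorder))"
proof -
  have finA: "finite A" by (rule finite_subset[OF assms(3)]) simp
  let ?a = "\<lambda>xs \<sigma>. k * hc p N xs \<sigma>"
  have cov: "(\<Sum>xs\<in>idx p N. hc p N xs \<sigma> * ?a xs \<tau>) = k * real N * overlap N \<sigma> \<tau> ^ p" for \<sigma> \<tau>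
    using hc_cov[OF assms(1,2), of \<sigma> \<tau>] by (simp add: mult.left_commute mult.assoc flip: sum_distrib_left)
  have X: "X g = en (idx p N) ?a c g" for g
    unfolding X_def by (simp add: en_hc[abs_def] fun_eq_iff)
  have d: "avg A (X g) (\<lambda>\<sigma>. k * real N * overlap N \<sigma> \<sigma> ^ p) = k * real N" for g
  proof -
    have "avg A (X g) (\<lambda>\<sigma>. k * real N * overlap N \<sigma> \<sigma> ^ p) = avg A (X g) (\<lambda>\<sigma>. k * real N)"
      unfolding avg_def using assms(1,3) by (intro sum.cong) (auto simp: overlap_self subset_iff)
    then show ?thesis using finA assms(4) by (simp add: avg_const)
  qed
  have "(\<integral>g. avg A (X g) (H p N g) \<partial>disorder) =
     (\<integral>g. avg A (en (idx p N) ?a c g) (\<lambda>\<omega>. \<Sum>i\<in>idx p N. hc p N i \<omega> * g i) \<partial>disorder)"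
    unfolding X H_hc[abs_def] ..
  also have "\<dots> = (\<integral>g. avg A (X g) (\<lambda>\<omega>. \<Sum>i\<in>idx p N. hc p N i \<omega> * ?a i \<omega>) \<partial>disorder) -
    (\<integral>g. avg A (X g) (\<lambda>\<omega>. avg A (X g) (\<lambda>\<omega>'. \<Sum>i\<in>idx p N. hc p N i \<omega> * ?a i \<omega>')) \<partial>disorder)"
    unfolding X by (rule gibbs_ibp) (use finA assms in auto)
  also have "\<dots> = k * real N - k * real N * (\<integral>g. avg A (X g) (\<lambda>\<sigma>. avg A (X g) (\<lambda>\<tau>. overlap N \<sigma> \<tau> ^ p)) \<partial>disorder)"
    unfolding cov d by (simp add: avg_cmult disorder.prob_space[simplified])
  finally show ?thesis by (simp add: algebra_simps)
qed

lemma measurable_H [measurable]: "(\<lambda>g. H p N g \<sigma>) \<in> borel_measurable disorder"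
  unfolding H_def by measurable

lemma measurable_sm:
  assumes [measurable]: "\<And>\<omega>. (\<lambda>g. X g \<omega>) \<in> borel_measurable disorder"
  shows "(\<lambda>g. sm \<Omega> (X g) \<omega>) \<in> borel_measurable disorder"
  unfolding sm_def by measurable

lemma measurable_avg:
  assumes [measurable]: "\<And>\<omega>. (\<lambda>g. X g \<omega>) \<in> borel_measurable disorder"
    "\<And>\<omega>. (\<lambda>g. f g \<omega>) \<in> borel_measurable disorder"
  shows "(\<lambda>g. avg \<Omega> (X g) (f g)) \<in> borel_measurable disorder"
  unfolding avg_def using measurable_sm[of X] by measurable

lemma measurable_lse:
  assumes [measurable]: "\<And>\<omega>. (\<lambda>g. X g \<omega>) \<in> borel_measurable disorder"
  shows "(\<lambda>g. lse \<Omega> (X g)) \<in> borel_measurable disorder"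
  unfolding lse_def by measurable

lemma integrable_H: "integrable disorder (\<lambda>g. H p N g \<sigma>)"
  unfolding H_hc using integrable_coordinate by auto

lemma integrable_avg_H:
  assumes "finite A" and [measurable]: "\<And>\<sigma>. (\<lambda>g. X g \<sigma>) \<in> borel_measurable disorder"
  shows "integrable disorder (\<lambda>g. avg A (X g) (H p N g))"
  unfolding avg_def
proof (rule Bochner_Integration.integrable_sum)
  fix \<sigma> assume s: "\<sigma> \<in> A"
  note [measurable] = measurable_sm[of X A \<sigma>, OF assms(2)]
  show "integrable disorder (\<lambda>g. sm A (X g) \<sigma> * H p N g \<sigma>)"
  proof (rule Bochner_Integration.integrable_bound[OF integrable_H[of p N \<sigma>]])
    have "\<bar>sm A (X g) \<sigma> * H p N g \<sigma>\<bar> \<le> 1 * \<bar>H p N g \<sigma>\<bar>" for g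
      unfolding abs_mult using sm_nonneg[of A "X g" \<sigma>] sm_le_1[OF assms(1) s, of "X g"]
      by (intro mult_right_mono) auto
    then show "AE g in disorder. norm (sm A (X g) \<sigma> * H p N g \<sigma>) \<le> norm (H p N g \<sigma>)" by simp
  qed measurable
qed

lemma integrable_avg_bounded:
  assumes "finite A" "A \<noteq> {}" and [measurable]: "\<And>\<sigma>. (\<lambda>g. X g \<sigma>) \<in> borel_measurable disorder"
    "\<And>\<sigma>. (\<lambda>g. f g \<sigma>) \<in> borel_measurable disorder"
    and "\<And>g \<sigma>. \<sigma> \<in> A \<Longrightarrow> \<bar>f g \<sigma>\<bar> \<le> B"
  shows "integrable disorder (\<lambda>g. avg A (X g) (f g))"
  by (rule integrable_disorder_bounded[where B = B])
     (use assms in \<open>auto intro!: measurable_avg avg_abs_le\<close>)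

text \<open>A mean value inequality without derivatives: over \<open>n\<close> equal steps the
  quadratic errors add up to \<open>C * (y - x)\<^sup>2 / n\<close>, which tends to 0.\<close>

lemma increment_bound_telescope:
  fixes f :: "real \<Rightarrow> real"
  assumes "x \<le> y" and inc: "\<And>u v. x \<le> u \<Longrightarrow> u \<le> v \<Longrightarrow> v \<le> y \<Longrightarrow> f v - f u \<le> B * (v - u) + C * (v - u)\<^sup>2"
  shows "f y - f x \<le> B * (y - x)"
proof -
  have step: "f y - f x \<le> B * (y - x) + C * (y - x)\<^sup>2 / real n" if n: "n \<ge> 1" for n
  proof -
    define t where "t k = x + (y - x) * real k / real n" for k
    have d: "t (Suc k) - t k = (y - x) / real n" for k by (simp add: t_def algebra_simps add_divide_distrib diff_divide_distrib)
    have "f y - f x = f (t n) - f (t 0)" using n by (simp add: t_def)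
    also have "\<dots> = (\<Sum>k<n. f (t (Suc k)) - f (t k))"
      by (simp only: sum_lessThan_telescope[of "\<lambda>k. f (t k)" n])
    also have "\<dots> \<le> (\<Sum>k<n. B * ((y - x) / real n) + C * ((y - x) / real n)\<^sup>2)"
    proof (rule sum_mono)
      fix k assume k: "k \<in> {..<n}"
      have 1: "x \<le> t k" using assms(1) by (simp add: t_def)
      have "0 \<le> (y - x) / real n" using assms(1) by simp
      then have 2: "t k \<le> t (Suc k)" using d[of k] by linarith
      have "(y - x) * (real (Suc k) / real n) \<le> (y - x) * 1"
        using k assms(1) by (intro mult_left_mono) (auto simp: divide_le_eq_1)
      then have 3: "t (Suc k) \<le> y" by (simp add: t_def)
      from inc[OF 1 2 3] show "f (t (Suc k)) - f (t k) \<le> B * ((y - x) / real n) + C * ((y - x) / real n)\<^sup>2"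
        unfolding d .
    qed
    also have "\<dots> = B * (y - x) + C * (y - x)\<^sup>2 / real n"
      using n by (simp add: power2_eq_square field_simps)
    finally show ?thesis .
  qed
  have "(\<lambda>n. B * (y - x) + C * (y - x)\<^sup>2 / real n) \<longlonglongrightarrow> B * (y - x) + 0"
    by (intro tendsto_intros lim_const_over_n)
  then have "(\<lambda>n. B * (y - x) + C * (y - x)\<^sup>2 / real n) \<longlonglongrightarrow> B * (y - x)" by simp
  then show ?thesis
    by (rule LIMSEQ_le_const) (use step in blast)
qed

section \<open>The planted disorder\<close>

text \<open>Restricted to \<open>{..<N}\<close> because \<open>Sigma N\<close> consists of
  extensional functions; \<open>smul\<close> is restricted for the same reason.\<close>

definition ones :: "nat \<Rightarrow> nat \<Rightarrow> real" where
  "ones N = (\<lambda>i\<in>{..<N}. 1)"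

definition smul :: "nat \<Rightarrow> (nat \<Rightarrow> real) \<Rightarrow> (nat \<Rightarrow> real) \<Rightarrow> nat \<Rightarrow> real" where
  "smul N s \<sigma> = (\<lambda>i\<in>{..<N}. s i * \<sigma> i)"

definition gauge :: "nat \<Rightarrow> nat \<Rightarrow> (nat \<Rightarrow> real) \<Rightarrow> (nat list \<Rightarrow> real) \<Rightarrow> nat list \<Rightarrow> real" where
  "gauge p N s g = (\<lambda>xs. if xs \<in> idx p N then prod_list (map s xs) * g xs else g xs)"

text \<open>The shift is the coefficient vector of
  \<open>\<beta> / sqrt 2 * H p N g (ones N)\<close>; by Cameron-Martin it is the effect of
  weighting the disorder with the normalised exponential of that energy.\<close>

definition planted :: "nat \<Rightarrow> nat \<Rightarrow> real \<Rightarrow> (nat list \<Rightarrow> real) \<Rightarrow> nat list \<Rightarrow> real" where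
  "planted p N \<beta> g = (\<lambda>xs. g xs + (if xs \<in> idx p N then \<beta> / sqrt 2 * hc p N xs (ones N) else 0))"

text \<open>The normalisation makes the weights \<open>exp (Xe \<dots> \<sigma>)\<close> have expectation \<open>2\<^sup>-\<^sup>N\<close>.\<close>
definition Xe :: "nat \<Rightarrow> nat \<Rightarrow> real \<Rightarrow> (nat list \<Rightarrow> real) \<Rightarrow> (nat \<Rightarrow> real) \<Rightarrow> real" where
  "Xe p N \<beta> g \<sigma> = \<beta> / sqrt 2 * H p N g \<sigma> + (- (\<beta>\<^sup>2 / 4 * real N) - real N * ln 2)"

definition LW :: "nat \<Rightarrow> nat \<Rightarrow> real \<Rightarrow> (nat list \<Rightarrow> real) \<Rightarrow> real" where
  "LW p N \<beta> g = lse (Sigma N) (Xe p N \<beta> g)"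

lemma ones_in_Sigma [simp]: "ones N \<in> Sigma N"
  by (auto simp: ones_def Sigma_def)

lemma smul_in_Sigma: "s \<in> Sigma N \<Longrightarrow> \<sigma> \<in> Sigma N \<Longrightarrow> smul N s \<sigma> \<in> Sigma N"
  by (fastforce simp: smul_def Sigma_def PiE_def Pi_def)

lemma Sigma_extensional: "\<sigma> \<in> Sigma N \<Longrightarrow> (\<lambda>i\<in>{..<N}. \<sigma> i) = \<sigma>"
  unfolding Sigma_def by (metis PiE_restrict restrict_ext)

lemma smul_smul:
  assumes "s \<in> Sigma N" "\<sigma> \<in> Sigma N"
  shows "smul N s (smul N s \<sigma>) = \<sigma>"
proof -
  have "smul N s (smul N s \<sigma>) = (\<lambda>i\<in>{..<N}. (s i * s i) * \<sigma> i)"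
    by (auto simp: smul_def mult.assoc)
  also have "\<dots> = (\<lambda>i\<in>{..<N}. \<sigma> i)" using assms(1) by (auto simp: Sigma_square)
  finally show ?thesis using Sigma_extensional[OF assms(2)] by simp
qed

lemma smul_self: "s \<in> Sigma N \<Longrightarrow> smul N s s = ones N"
  by (auto simp: smul_def ones_def Sigma_square)

lemma bij_smul: "s \<in> Sigma N \<Longrightarrow> bij_betw (smul N s) (Sigma N) (Sigma N)"
  by (rule bij_betw_byWitness[where f' = "smul N s"]) (auto simp: smul_smul smul_in_Sigma)

lemma overlap_smul: "s \<in> Sigma N \<Longrightarrow> overlap N (smul N s \<sigma>) (smul N s \<tau>) = overlap N \<sigma> \<tau>"
proof -
  assume s: "s \<in> Sigma N"
  have "smul N s \<sigma> i * smul N s \<tau> i = \<sigma> i * \<tau> i" if "i < N" for i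
  proof -
    have "smul N s \<sigma> i * smul N s \<tau> i = (s i * s i) * (\<sigma> i * \<tau> i)" using that by (simp add: smul_def)
    then show ?thesis using Sigma_square[OF s that] by simp
  qed
  then show ?thesis by (simp add: overlap_def)
qed

lemma prod_list_smul:
  assumes "set xs \<subseteq> {..<N}"
  shows "prod_list (map (smul N s \<sigma>) xs) = prod_list (map s xs) * prod_list (map \<sigma> xs)"
proof -
  have "map (smul N s \<sigma>) xs = map (\<lambda>i. s i * \<sigma> i) xs"
    using assms by (intro map_cong) (auto simp: smul_def)
  then show ?thesis by (simp only: prod_list_map_mult)
qed

lemma H_gauge: "H p N (gauge p N s g) \<sigma> = H p N g (smul N s \<sigma>)"
proof -
  have "(\<Sum>xs\<in>idx p N. gauge p N s g xs * prod_list (map \<sigma> xs)) =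
     (\<Sum>xs\<in>idx p N. g xs * prod_list (map (smul N s \<sigma>) xs))"
    by (intro sum.cong refl) (auto simp: gauge_def idx_def prod_list_smul)
  then show ?thesis by (simp add: H_def)
qed

lemma H_planted:
  assumes "N \<ge> 1" "p \<ge> 1"
  shows "H p N (planted p N \<beta> g) \<sigma> = H p N g \<sigma> + \<beta> / sqrt 2 * real N * overlap N (ones N) \<sigma> ^ p"
proof -
  have "H p N (planted p N \<beta> g) \<sigma> =
     (\<Sum>xs\<in>idx p N. hc p N xs \<sigma> * g xs + \<beta> / sqrt 2 * (hc p N xs \<sigma> * hc p N xs (ones N)))"
    unfolding H_hc by (intro sum.cong refl) (auto simp: planted_def algebra_simps)
  then show ?thesis
    using hc_cov[OF assms, of \<sigma> "ones N"]
    by (simp only: sum.distrib sum_distrib_left[symmetric] H_hc overlap_commute[of N \<sigma>] mult.assoc)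
qed

lemma Xe_gauge: "Xe p N \<beta> (gauge p N s g) \<sigma> = Xe p N \<beta> g (smul N s \<sigma>)"
  by (simp add: Xe_def H_gauge)

lemma Xe_planted:
  assumes "N \<ge> 1" "p \<ge> 1"
  shows "Xe p N \<beta> (planted p N \<beta> g) \<sigma> = \<beta> / sqrt 2 * H p N g \<sigma> +
     (\<beta>\<^sup>2 / 2 * real N * overlap N (ones N) \<sigma> ^ p - \<beta>\<^sup>2 / 4 * real N - real N * ln 2)"
  by (simp add: Xe_def H_planted[OF assms] power2_eq_square field_simps)

lemma LW_gauge: "s \<in> Sigma N \<Longrightarrow> LW p N \<beta> (gauge p N s g) = LW p N \<beta> g"
  unfolding LW_def lse_def Xe_gauge
  by (subst sum.reindex_bij_betw[OF bij_smul]) auto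

lemma sets_disorder_Collect [measurable (raw)]:
  "Measurable.pred disorder P \<Longrightarrow> {g. P g} \<in> sets disorder"
  by (drule predE) (simp only: space_disorder UNIV_I simp_thms)

lemma measurable_Xe [measurable]: "(\<lambda>g. Xe p N \<beta> g \<sigma>) \<in> borel_measurable disorder"
  unfolding Xe_def by measurable

lemma measurable_LW [measurable]: "LW p N \<beta> \<in> borel_measurable disorder"
  unfolding LW_def[abs_def] by (rule measurable_lse) measurable

lemma measurable_planted: "planted p N \<beta> \<in> measurable disorder disorder"
  unfolding planted_def[abs_def] by (rule measurable_shift)

text \<open>In the term of \<open>s\<close> the gauge transformation by \<open>s\<close> moves
  \<open>s\<close> to \<open>ones N\<close>, and Cameron-Martin then absorbs the exponential weight
  into the shift. All \<open>2 ^ N\<close> terms become equal, and their number cancels the term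
  \<open>real N * ln 2\<close> in \<open>Xe\<close>.\<close>

lemma planted_nn_integral:
  fixes \<Psi> :: "(nat \<Rightarrow> real) \<Rightarrow> (nat list \<Rightarrow> real) \<Rightarrow> ennreal"
  assumes N: "N \<ge> 1" "p \<ge> 1" and m [measurable]: "\<And>s. \<Psi> s \<in> borel_measurable disorder"
    and inv: "\<And>s g. s \<in> Sigma N \<Longrightarrow> \<Psi> s (gauge p N s g) = \<Psi> (ones N) g"
  shows "(\<integral>\<^sup>+g. (\<Sum>s\<in>Sigma N. ennreal (exp (Xe p N \<beta> g s)) * \<Psi> s g) \<partial>disorder) =
     (\<integral>\<^sup>+g. \<Psi> (ones N) (planted p N \<beta> g) \<partial>disorder)"
proof -
  let ?b = "\<lambda>xs. \<beta> / sqrt 2 * hc p N xs (ones N)"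
  have b2: "(\<Sum>xs\<in>idx p N. (?b xs)\<^sup>2) = \<beta>\<^sup>2 / 2 * real N"
  proof -
    have "(\<Sum>xs\<in>idx p N. (?b xs)\<^sup>2) = (\<Sum>xs\<in>idx p N. \<beta>\<^sup>2 / 2 * (hc p N xs (ones N) * hc p N xs (ones N)))"
      by (intro sum.cong refl) (simp add: power_mult_distrib power_divide power2_eq_square)
    then show ?thesis using hc_cov[OF N, of "ones N" "ones N"] overlap_self[OF N(1) ones_in_Sigma]
      by (simp only: sum_distrib_left[symmetric] power_one mult_1_right)
  qed
  have "(\<integral>\<^sup>+g. ennreal (exp (Xe p N \<beta> g s)) * \<Psi> s g \<partial>disorder) =
     ennreal (exp (- real N * ln 2)) * (\<integral>\<^sup>+g. \<Psi> (ones N) (planted p N \<beta> g) \<partial>disorder)"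
    if s: "s \<in> Sigma N" for s
  proof -
    let ?f = "\<lambda>g. ennreal (exp (Xe p N \<beta> g s)) * \<Psi> s g"
    have "(\<integral>\<^sup>+g. ?f g \<partial>disorder) = (\<integral>\<^sup>+g. ?f (gauge p N s g) \<partial>disorder)"
      unfolding gauge_def
      by (rule nn_integral_sign_flip[symmetric])
         (auto simp: idx_def[of p N] intro!: prod_list_Sigma[OF s] simp del: finite_idx intro: finite_idx[unfolded idx_def])
    also have "\<dots> = (\<integral>\<^sup>+g. ennreal (exp (- real N * ln 2)) *
        (ennreal (exp ((\<Sum>i\<in>idx p N. ?b i * g i) - (\<Sum>i\<in>idx p N. (?b i)\<^sup>2) / 2)) * \<Psi> (ones N) g) \<partial>disorder)"
    proof (rule nn_integral_cong)
      fix g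
      have "Xe p N \<beta> (gauge p N s g) s = - real N * ln 2 + ((\<Sum>i\<in>idx p N. ?b i * g i) - (\<Sum>i\<in>idx p N. (?b i)\<^sup>2) / 2)"
        unfolding Xe_gauge smul_self[OF s] b2 by (simp add: Xe_def H_hc sum_distrib_left mult_ac)
      then show "?f (gauge p N s g) = ennreal (exp (- real N * ln 2)) *
        (ennreal (exp ((\<Sum>i\<in>idx p N. ?b i * g i) - (\<Sum>i\<in>idx p N. (?b i)\<^sup>2) / 2)) * \<Psi> (ones N) g)"
        by (simp only: inv[OF s] exp_add ennreal_mult exp_ge_zero mult.assoc)
    qed
    also have "\<dots> = ennreal (exp (- real N * ln 2)) *
       (\<integral>\<^sup>+g. ennreal (exp ((\<Sum>i\<in>idx p N. ?b i * g i) - (\<Sum>i\<in>idx p N. (?b i)\<^sup>2) / 2)) * \<Psi> (ones N) g \<partial>disorder)"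
      by (rule nn_integral_cmult) measurable
    also have "\<dots> = ennreal (exp (- real N * ln 2)) * (\<integral>\<^sup>+g. \<Psi> (ones N) (planted p N \<beta> g) \<partial>disorder)"
      unfolding planted_def by (subst cameron_martin) auto
    finally show ?thesis .
  qed
  then have "(\<integral>\<^sup>+g. (\<Sum>s\<in>Sigma N. ennreal (exp (Xe p N \<beta> g s)) * \<Psi> s g) \<partial>disorder) =
     (\<Sum>s\<in>Sigma N. ennreal (exp (- real N * ln 2)) * (\<integral>\<^sup>+g. \<Psi> (ones N) (planted p N \<beta> g) \<partial>disorder))"
    by (subst nn_integral_sum) auto
  also have "\<dots> = (ennreal (real (2 ^ N)) * ennreal (exp (- real N * ln 2))) * (\<integral>\<^sup>+g. \<Psi> (ones N) (planted p N \<beta> g) \<partial>disorder)"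
    by (simp add: card_Sigma mult.assoc ennreal_of_nat_eq_real_of_nat del: of_nat_power)
  also have "ennreal (real (2 ^ N)) * ennreal (exp (- real N * ln 2)) = 1"
  proof -
    have "exp (- real N * ln 2) = 1 / 2 ^ N"
      by (simp add: exp_minus exp_of_nat_mult field_simps)
    then show ?thesis by (simp flip: ennreal_mult)
  qed
  finally show ?thesis by simp
qed

lemma planted_integral:
  fixes \<Psi> :: "(nat \<Rightarrow> real) \<Rightarrow> (nat list \<Rightarrow> real) \<Rightarrow> real"
  assumes N: "N \<ge> 1" "p \<ge> 1" and m [measurable]: "\<And>s. \<Psi> s \<in> borel_measurable disorder"
    and inv: "\<And>s g. s \<in> Sigma N \<Longrightarrow> \<Psi> s (gauge p N s g) = \<Psi> (ones N) g"
    and B: "\<And>s g. 0 \<le> \<Psi> s g" "\<And>s g. \<Psi> s g \<le> B"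
  shows "integrable disorder (\<lambda>g. \<Sum>s\<in>Sigma N. exp (Xe p N \<beta> g s) * \<Psi> s g)" (is "integrable _ ?L")
    and "(\<integral>g. (\<Sum>s\<in>Sigma N. exp (Xe p N \<beta> g s) * \<Psi> s g) \<partial>disorder) =
     (\<integral>g. \<Psi> (ones N) (planted p N \<beta> g) \<partial>disorder)"
proof -
  have [measurable]: "(\<lambda>g. \<Psi> (ones N) (planted p N \<beta> g)) \<in> borel_measurable disorder"
    by (rule measurable_compose[OF measurable_planted m])
  have iR: "integrable disorder (\<lambda>g. \<Psi> (ones N) (planted p N \<beta> g))"
    by (rule integrable_disorder_bounded[where B = B]) (use B in \<open>auto simp: abs_of_nonneg\<close>)
  have "(\<integral>\<^sup>+g. ennreal (?L g) \<partial>disorder) = (\<integral>\<^sup>+g. (\<Sum>s\<in>Sigma N. ennreal (exp (Xe p N \<beta> g s)) * ennreal (\<Psi> s g)) \<partial>disorder)"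
    using B by (intro nn_integral_cong) (simp add: ennreal_mult sum_ennreal[symmetric])
  also have "\<dots> = (\<integral>\<^sup>+g. ennreal (\<Psi> (ones N) (planted p N \<beta> g)) \<partial>disorder)"
    by (rule planted_nn_integral[OF N]) (use inv in auto)
  also have "\<dots> = ennreal (\<integral>g. \<Psi> (ones N) (planted p N \<beta> g) \<partial>disorder)"
    by (rule nn_integral_eq_integral[OF iR]) (use B in auto)
  finally have eq: "(\<integral>\<^sup>+g. ennreal (?L g) \<partial>disorder) = ennreal (\<integral>g. \<Psi> (ones N) (planted p N \<beta> g) \<partial>disorder)" .
  have nn: "?L g \<ge> 0" for g using B by (auto intro!: sum_nonneg)
  show iL: "integrable disorder ?L"
    by (rule integrableI_nonneg) (use nn eq in auto)
  show "(\<integral>g. ?L g \<partial>disorder) = (\<integral>g. \<Psi> (ones N) (planted p N \<beta> g) \<partial>disorder)"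
    using eq nn_integral_eq_integral[OF iL] nn B
    by (simp add: integral_nonneg_AE)
qed

lemma exp_LW: "exp (LW p N \<beta> g) = (\<Sum>s\<in>Sigma N. exp (Xe p N \<beta> g s))"
  unfolding LW_def by (rule exp_lse) auto

text \<open>For gauge invariant functions the sum over \<open>s\<close> factors out: on them
  \<open>exp (LW p N \<beta> g)\<close> acts as the density of the planted law with respect to the
  disorder.\<close>

lemma planted_integral_LW:
  assumes N: "N \<ge> 1" "p \<ge> 1" and m: "\<Psi> \<in> borel_measurable disorder"
    and inv: "\<And>s g. s \<in> Sigma N \<Longrightarrow> \<Psi> (gauge p N s g) = \<Psi> g"
    and B: "\<And>g. 0 \<le> \<Psi> g" "\<And>g. \<Psi> g \<le> B"
  shows "integrable disorder (\<lambda>g. exp (LW p N \<beta> g) * \<Psi> g)"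
    and "(\<integral>g. exp (LW p N \<beta> g) * \<Psi> g \<partial>disorder) = (\<integral>g. \<Psi> (planted p N \<beta> g) \<partial>disorder)"
  using planted_integral[of N p "\<lambda>_. \<Psi>" B \<beta>] assms by (auto simp: exp_LW sum_distrib_right)

lemma LW_markov:
  assumes N: "N \<ge> 1" "p \<ge> 1"
  shows "measure disorder {g. x \<le> LW p N \<beta> g} \<le> exp (- x)"
proof -
  have i: "integrable disorder (\<lambda>g. exp (LW p N \<beta> g))"
    and e: "(\<integral>g. exp (LW p N \<beta> g) \<partial>disorder) = 1"
    using planted_integral_LW[OF N, of "\<lambda>_. 1" 1 \<beta>] by (auto simp: disorder.prob_space[simplified])
  have "measure disorder {g. x \<le> LW p N \<beta> g} = (\<integral>g. indicator {g. x \<le> LW p N \<beta> g} g \<partial>disorder)"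
    by simp
  also have "\<dots> \<le> (\<integral>g. exp (- x) * exp (LW p N \<beta> g) \<partial>disorder)"
  proof (rule integral_mono)
    show "integrable disorder (indicator {g. x \<le> LW p N \<beta> g} :: _ \<Rightarrow> real)"
      by (rule integrable_disorder_bounded[where B = 1]) (auto simp: indicator_def)
    show "integrable disorder (\<lambda>g. exp (- x) * exp (LW p N \<beta> g))" using i by simp
    show "indicator {g. x \<le> LW p N \<beta> g} g \<le> exp (- x) * exp (LW p N \<beta> g)" for g
      by (auto simp: indicator_def simp flip: exp_add)
  qed
  finally show ?thesis using e by simp
qed

lemma subgaussian_mono: "subgaussian f V \<Longrightarrow> V \<le> V' \<Longrightarrow> subgaussian f V'"
  unfolding subgaussian_def
proof safe
  fix l assume l: "\<forall>l. (\<integral>\<^sup>+g. ennreal (exp (l * (f g - (\<integral>g'. f g' \<partial>disorder)))) \<partial>disorder) \<le> ennreal (exp (l\<^sup>2 * V))" and "V \<le> V'"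
  then have "ennreal (exp (l\<^sup>2 * V)) \<le> ennreal (exp (l\<^sup>2 * V'))"
    by (auto intro!: ennreal_leI mult_left_mono)
  with l show "(\<integral>\<^sup>+g. ennreal (exp (l * (f g - (\<integral>g'. f g' \<partial>disorder)))) \<partial>disorder) \<le> ennreal (exp (l\<^sup>2 * V'))"
    by (blast intro: order_trans)
qed

text \<open>Planting adds only a deterministic term to each energy, so both laws have the same
  constant. It is expressed through \<open>b\<close> in order to be uniform in \<beta> \<le>
  b.\<close>

lemma subgaussian_Xe:
  assumes "N \<ge> 1" "p \<ge> 1" "A \<subseteq> Sigma N" "A \<noteq> {}" "0 \<le> \<beta>" "\<beta> \<le> b"
  shows "subgaussian (\<lambda>g. lse A (Xe p N \<beta> g)) (b\<^sup>2 / 2 * real N)"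
    and "subgaussian (\<lambda>g. lse A (Xe p N \<beta> (planted p N \<beta> g))) (b\<^sup>2 / 2 * real N)"
proof -
  have "\<beta>\<^sup>2 \<le> b\<^sup>2" using assms by (intro power_mono) auto
  then have V: "(\<beta> / sqrt 2)\<^sup>2 * real N \<le> b\<^sup>2 / 2 * real N"
    by (intro mult_right_mono) (auto simp: power_divide)
  show "subgaussian (\<lambda>g. lse A (Xe p N \<beta> g)) (b\<^sup>2 / 2 * real N)"
    unfolding Xe_def[abs_def]
    by (rule subgaussian_mono[OF subgaussian_lse_H[OF assms(1-4)] V])
  show "subgaussian (\<lambda>g. lse A (Xe p N \<beta> (planted p N \<beta> g))) (b\<^sup>2 / 2 * real N)"
    unfolding Xe_planted[OF assms(1,2), abs_def]
    by (rule subgaussian_mono[OF subgaussian_lse_H[OF assms(1-4)] V])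
qed

lemma subgaussian_tails_linear:
  assumes "subgaussian f (b\<^sup>2 / 2 * real N)" "N \<ge> 1" "b > 0" "x \<ge> 0"
  shows "measure disorder {g. (\<integral>g. f g \<partial>disorder) + x * real N \<le> f g} \<le> exp (- (x\<^sup>2 / (2 * b\<^sup>2)) * real N)"
    and "measure disorder {g. f g \<le> (\<integral>g. f g \<partial>disorder) - x * real N} \<le> exp (- (x\<^sup>2 / (2 * b\<^sup>2)) * real N)"
proof -
  have V: "b\<^sup>2 / 2 * real N > 0" using assms by auto
  have e: "- (x * real N)\<^sup>2 / (4 * (b\<^sup>2 / 2 * real N)) = - (x\<^sup>2 / (2 * b\<^sup>2)) * real N"
    using assms by (simp add: power2_eq_square field_simps)
  show "measure disorder {g. (\<integral>g. f g \<partial>disorder) + x * real N \<le> f g} \<le> exp (- (x\<^sup>2 / (2 * b\<^sup>2)) * real N)"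
    using subgaussian_upper_tail[OF assms(1) V, of "x * real N"] assms unfolding e by simp
  show "measure disorder {g. f g \<le> (\<integral>g. f g \<partial>disorder) - x * real N} \<le> exp (- (x\<^sup>2 / (2 * b\<^sup>2)) * real N)"
    using subgaussian_lower_tail[OF assms(1) V, of "x * real N"] assms unfolding e by simp
qed

lemma eventually_exp_le:
  assumes "k > 0" "q > 0"
  shows "\<forall>\<^sub>F N in sequentially. exp (- k * real N) \<le> q"
proof -
  have "((\<lambda>N. exp (- k * real N)) \<longlongrightarrow> 0) sequentially"
  proof (rule filterlim_compose[OF exp_at_bot])
    show "filterlim (\<lambda>N. - k * real N) at_bot sequentially"
      using assms(1)
      by (intro filterlim_tendsto_neg_mult_at_bot[OF tendsto_const]) (auto simp: filterlim_real_sequentially)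
  qed
  from order_tendstoD(2)[OF this assms(2)] show ?thesis by (rule eventually_mono) simp
qed

definition EL :: "nat \<Rightarrow> nat \<Rightarrow> real \<Rightarrow> real" where
  "EL p N \<beta> = (\<integral>g. LW p N \<beta> g \<partial>disorder)"

text \<open>Formally \<open>E [W * ln W]\<close> with \<open>W = exp LW\<close>, the relative
  entropy of the law with density \<open>W\<close> with respect to the disorder.\<close>

definition DN :: "nat \<Rightarrow> nat \<Rightarrow> real \<Rightarrow> real" where
  "DN p N \<beta> = (\<integral>g. LW p N \<beta> (planted p N \<beta> g) \<partial>disorder)"

lemma integrable_lse_Xe:
  assumes "N \<ge> 1" "p \<ge> 1" "A \<subseteq> Sigma N" "A \<noteq> {}" "0 \<le> \<beta>"
  shows "integrable disorder (\<lambda>g. lse A (Xe p N \<beta> g))"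
    "integrable disorder (\<lambda>g. lse A (Xe p N \<beta> (planted p N \<beta> g)))"
  using subgaussian_Xe[OF assms order_refl] by (auto simp: subgaussian_def)

text \<open>The \<open>p\<close>-th power of the overlap is a positive definite kernel: its average
  over two replicas is a sum of squares. This includes odd \<open>p\<close>, although single
  overlaps may be negative.\<close>

lemma avg_avg_overlap_nonneg:
  assumes "N \<ge> 1" "p \<ge> 1"
  shows "avg A X (\<lambda>\<sigma>. avg A X (\<lambda>\<tau>. overlap N \<sigma> \<tau> ^ p)) \<ge> 0"
proof -
  have "real N * avg A X (\<lambda>\<sigma>. avg A X (\<lambda>\<tau>. overlap N \<sigma> \<tau> ^ p)) =
     avg A X (\<lambda>\<sigma>. avg A X (\<lambda>\<tau>. \<Sum>xs\<in>idx p N. hc p N xs \<sigma> * hc p N xs \<tau>))"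
    unfolding hc_cov[OF assms] avg_cmult ..
  also have "\<dots> = (\<Sum>xs\<in>idx p N. (avg A X (hc p N xs))\<^sup>2)"
  proof -
    have "avg A X (\<lambda>\<sigma>. avg A X (\<lambda>\<tau>. \<Sum>xs\<in>idx p N. hc p N xs \<sigma> * hc p N xs \<tau>)) =
      (\<Sum>xs\<in>idx p N. avg A X (\<lambda>\<sigma>. avg A X (hc p N xs) * hc p N xs \<sigma>))"
      by (simp add: avg_sum avg_cmult mult.commute)
    then show ?thesis by (simp add: avg_cmult power2_eq_square)
  qed
  also have "\<dots> \<ge> 0" by (intro sum_nonneg) auto
  finally show ?thesis using assms by (simp add: zero_le_mult_iff)
qed

text \<open>The formal derivative is \<open>- \<beta> / 2 * N * E \<langle>R ^ p\<rangle>\<close>,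
  hence at most 0. The tangent at the right endpoint \<open>v\<close> gives this up to a quadratic
  error, which \<open>increment_bound_telescope\<close> removes.\<close>

lemma EL_antimono:
  assumes N: "N \<ge> 1" "p \<ge> 1" and b: "0 \<le> \<beta>1" "\<beta>1 \<le> \<beta>2"
  shows "EL p N \<beta>2 \<le> EL p N \<beta>1"
proof -
  have "EL p N v - EL p N u \<le> 0 * (v - u) + real N / 4 * (v - u)\<^sup>2" if uv: "\<beta>1 \<le> u" "u \<le> v" "v \<le> \<beta>2" for u v
  proof -
    let ?X = "Xe p N"
    have pos: "0 \<le> u" "0 \<le> v" using b uv by auto
    let ?k = "(v - u) / sqrt 2" and ?c = "- (v\<^sup>2 - u\<^sup>2) / 4 * real N"
    have iH: "integrable disorder (\<lambda>g. avg (Sigma N) (?X v g) (H p N g))"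
      by (rule integrable_avg_H) (auto simp: measurable_Xe)
    have "LW p N v g - LW p N u g \<le> ?k * avg (Sigma N) (?X v g) (H p N g) + ?c" for g
    proof -
      have "avg (Sigma N) (?X v g) (\<lambda>\<sigma>. ?X u g \<sigma> - ?X v g \<sigma>) \<le> LW p N u g - LW p N v g"
        unfolding LW_def by (rule lse_convex) auto
      moreover have "avg (Sigma N) (?X v g) (\<lambda>\<sigma>. ?X u g \<sigma> - ?X v g \<sigma>) =
         avg (Sigma N) (?X v g) (\<lambda>\<sigma>. (- ?k) * H p N g \<sigma> + (- ?c))"
        by (intro arg_cong[where f = "avg _ _"] ext) (simp add: Xe_def field_simps)
      moreover have "avg (Sigma N) (?X v g) (\<lambda>\<sigma>. (- ?k) * H p N g \<sigma> + (- ?c)) =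
         (- ?k) * avg (Sigma N) (?X v g) (H p N g) + (- ?c)"
        by (subst avg_add, subst avg_cmult, subst avg_const) auto
      ultimately show ?thesis by linarith
    qed
    moreover have iv: "integrable disorder (LW p N v)" "integrable disorder (LW p N u)"
      using integrable_lse_Xe(1)[OF N, of "Sigma N" v] integrable_lse_Xe(1)[OF N, of "Sigma N" u] pos
      by (auto simp: LW_def[abs_def])
    ultimately have "(\<integral>g. LW p N v g - LW p N u g \<partial>disorder) \<le> (\<integral>g. ?k * avg (Sigma N) (?X v g) (H p N g) + ?c \<partial>disorder)"
      using iH by (intro integral_mono) auto
    then have "EL p N v - EL p N u \<le> ?k * (\<integral>g. avg (Sigma N) (?X v g) (H p N g) \<partial>disorder) + ?c"
      using iv iH by (simp add: EL_def disorder.prob_space[simplified])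
    also have "\<dots> \<le> ?k * (v / sqrt 2 * real N) + ?c"
    proof (intro add_right_mono mult_left_mono)
      let ?r = "\<integral>g. avg (Sigma N) (?X v g) (\<lambda>\<sigma>. avg (Sigma N) (?X v g) (\<lambda>\<tau>. overlap N \<sigma> \<tau> ^ p)) \<partial>disorder"
      have "(\<integral>g. avg (Sigma N) (?X v g) (H p N g) \<partial>disorder) = v / sqrt 2 * real N * (1 - ?r)"
        unfolding Xe_def[abs_def] by (rule expectation_H[OF N]) auto
      moreover have "?r \<ge> 0" by (intro Bochner_Integration.integral_nonneg avg_avg_overlap_nonneg N)
      ultimately show "(\<integral>g. avg (Sigma N) (?X v g) (H p N g) \<partial>disorder) \<le> v / sqrt 2 * real N"
        using pos mult_left_le[of "1 - ?r" "v / sqrt 2 * real N"] by simp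
    qed (use uv in auto)
    also have "?k * (v / sqrt 2 * real N) + ?c = real N / 4 * (v - u)\<^sup>2"
      by (simp add: power2_eq_square field_simps)
    finally show ?thesis by simp
  qed
  from increment_bound_telescope[OF b(2) this] show ?thesis by simp
qed

lemma measure_disorder_mono:
  assumes "A \<subseteq> B" "B \<in> sets disorder"
  shows "measure disorder A \<le> measure disorder B"
  using assms by (rule disorder.finite_measure_mono)

context
  fixes p :: nat and b :: real
  assumes p: "p \<ge> 1" and b: "b > 0"
    and EL_b: "\<And>\<eta>. \<eta> > 0 \<Longrightarrow> \<forall>\<^sub>F N in sequentially. - \<eta> * real N \<le> EL p N b"
begin

text \<open>Half of \<open>\<eta>\<close> is spent on the expectation, by \<open>EL_antimono\<close>
  for all \<beta> \<le> b at once, and half on concentration.\<close>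

lemma LW_lower_tail:
  assumes "\<eta> > 0"
  shows "\<forall>\<^sub>F N in sequentially. \<forall>\<beta>\<in>{0<..b}.
    measure disorder {g. LW p N \<beta> g \<le> - \<eta> * real N} \<le> exp (- (\<eta>\<^sup>2 / (8 * b\<^sup>2)) * real N)"
  using EL_b[of "\<eta> / 2", OF half_gt_zero[OF assms]] eventually_ge_at_top[of 1]
proof eventually_elim
  case (elim N)
  show ?case
  proof
    fix \<beta> assume \<beta>: "\<beta> \<in> {0<..b}"
    have "- (\<eta> / 2) * real N \<le> EL p N \<beta>"
      using EL_antimono[of N p \<beta> b] \<beta> elim p by auto
    then have "measure disorder {g. LW p N \<beta> g \<le> - \<eta> * real N} \<le>
      measure disorder {g. LW p N \<beta> g \<le> (\<integral>g. LW p N \<beta> g \<partial>disorder) - (\<eta> / 2) * real N}"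
      unfolding EL_def by (intro measure_disorder_mono) (auto simp: algebra_simps)
    also have "\<dots> \<le> exp (- ((\<eta> / 2)\<^sup>2 / (2 * b\<^sup>2)) * real N)"
      unfolding LW_def
      by (rule subgaussian_tails_linear(2)[OF subgaussian_Xe(1)]) (use \<beta> elim p b assms in auto)
    finally show "measure disorder {g. LW p N \<beta> g \<le> - \<eta> * real N} \<le> exp (- (\<eta>\<^sup>2 / (8 * b\<^sup>2)) * real N)"
      by (simp add: power_divide)
  qed
qed

text \<open>Under the planted law \<open>LW\<close> concentrates around \<open>DN\<close>. If that value were of order \<open>N\<close>, the
  size-biased mass of the typical event \<open>LW = o(N)\<close> would be exponentially small, contradicting
  that the partition function is of its annealed order.\<close>
lemma DN_small:
  assumes "\<delta> > 0"
  shows "\<forall>\<^sub>F N in sequentially. \<forall>\<beta>\<in>{0<..b}. DN p N \<beta> \<le> \<delta> * real N"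
proof -
  define k where "k = (\<delta> / 2)\<^sup>2 / (2 * b\<^sup>2)"
  \<comment> \<open>The planted law will give the event \<open>S\<close> mass at most
    \<open>exp (- k * N)\<close>, while the size-biased typical event has mass at least
    \<open>exp (- \<eta> * N) / 2\<close>; with half the rate the second is the larger one.\<close>
  define \<eta> where "\<eta> = k / 2"
  have k: "k > 0" "\<eta> > 0" using assms b by (auto simp: k_def \<eta>_def)
  have k2: "\<eta>\<^sup>2 / (8 * b\<^sup>2) > 0" using k b by auto
  have h: "\<delta> / 2 > 0" using assms by simp
  show ?thesis
    using LW_lower_tail[OF k(2)] eventually_exp_le[OF k2, of "1/4", simplified]
      eventually_exp_le[OF h, of "1/4", simplified] eventually_exp_le[OF k(2), of "1/4", simplified] eventually_ge_at_top[of 1]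
  proof eventually_elim
    case (elim N)
    show ?case
    proof (rule ballI, rule ccontr)
      fix \<beta> assume \<beta>: "\<beta> \<in> {0<..b}" and "\<not> DN p N \<beta> \<le> \<delta> * real N"
      then have D: "DN p N \<beta> > \<delta> * real N" by simp
      define S where "S = {g. LW p N \<beta> g \<le> \<delta> / 2 * real N}"
      have [measurable]: "S \<in> sets disorder" unfolding S_def by measurable
      let ?I = "indicator S :: _ \<Rightarrow> real"
      have "(\<integral>g. ?I (planted p N \<beta> g) \<partial>disorder) = measure disorder {g. LW p N \<beta> (planted p N \<beta> g) \<le> \<delta> / 2 * real N}"
      proof -
        have "(\<lambda>g. ?I (planted p N \<beta> g)) = indicator {g. LW p N \<beta> (planted p N \<beta> g) \<le> \<delta> / 2 * real N}"
          by (auto simp: S_def indicator_def)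
        then show ?thesis by simp
      qed
      also have "\<dots> \<le> measure disorder {g. LW p N \<beta> (planted p N \<beta> g) \<le>
           (\<integral>g. LW p N \<beta> (planted p N \<beta> g) \<partial>disorder) - \<delta> / 2 * real N}"
      proof (rule measure_disorder_mono)
        have [measurable]: "(\<lambda>g. LW p N \<beta> (planted p N \<beta> g)) \<in> borel_measurable disorder"
          by (rule measurable_compose[OF measurable_planted]) measurable
        show "{g. LW p N \<beta> (planted p N \<beta> g) \<le> (\<integral>g. LW p N \<beta> (planted p N \<beta> g) \<partial>disorder) - \<delta> / 2 * real N} \<in> disorder.events"
          by measurable
      qed (use D in \<open>auto simp: DN_def\<close>)
      also have "\<dots> \<le> exp (- k * real N)"
        unfolding k_def LW_def
        by (rule subgaussian_tails_linear(2)[OF subgaussian_Xe(2)]) (use \<beta> elim p b assms in auto)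
      finally have up: "(\<integral>g. exp (LW p N \<beta> g) * ?I g \<partial>disorder) \<le> exp (- k * real N)"
        using planted_integral_LW(2)[of N p ?I 1 \<beta>] elim p
        by (auto simp: S_def indicator_def LW_gauge)
      have int: "integrable disorder (\<lambda>g. exp (LW p N \<beta> g) * ?I g)"
        by (rule planted_integral_LW(1)[where B = 1]) (use elim p in \<open>auto simp: S_def indicator_def LW_gauge\<close>)
      define T where "T = {g. LW p N \<beta> g \<le> - \<eta> * real N}"
      define U where "U = {g. \<delta> / 2 * real N \<le> LW p N \<beta> g}"
      have [measurable]: "T \<in> sets disorder" "U \<in> sets disorder" unfolding T_def U_def by measurable
      have pT: "measure disorder T \<le> 1/4" using elim(1) \<beta> elim(2) unfolding T_def by force
      have pU: "measure disorder U \<le> 1/4" using LW_markov[of N p "\<delta> / 2 * real N" \<beta>] elim p unfolding U_def by (auto simp: mult.commute)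
      \<comment> \<open>Outside \<open>T\<close> and \<open>U\<close> the disorder lies in
        \<open>S\<close> and has density at least \<open>exp (- \<eta> * real N)\<close>; on
        \<open>T\<close> or \<open>U\<close> the integrand on the left is at most 0.\<close>
      have "(\<integral>g. exp (- \<eta> * real N) * (1 - indicator T g - indicator U g) \<partial>disorder) \<le>
         (\<integral>g. exp (LW p N \<beta> g) * ?I g \<partial>disorder)"
      proof (rule integral_mono[OF _ int])
        show "integrable disorder (\<lambda>g. exp (- \<eta> * real N) * (1 - indicator T g - indicator U g))"
          by (rule integrable_disorder_bounded[where B = "exp (- \<eta> * real N)"]) (auto simp: indicator_def)
        fix g
        show "exp (- \<eta> * real N) * (1 - indicator T g - indicator U g) \<le> exp (LW p N \<beta> g) * ?I g"
          by (auto simp: indicator_def S_def T_def U_def intro: order_trans[of _ 0])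
      qed
      moreover have "(\<integral>g. exp (- \<eta> * real N) * (1 - indicator T g - indicator U g) \<partial>disorder) =
         exp (- \<eta> * real N) * (1 - measure disorder T - measure disorder U)"
        by (simp add: disorder.prob_space[simplified] integrable_disorder_bounded[where B = 1] disorder.finite_measure_axioms)
      moreover have "exp (- \<eta> * real N) * (1/2) \<le> exp (- \<eta> * real N) * (1 - measure disorder T - measure disorder U)"
        using pT pU by (intro mult_left_mono) auto
      moreover have "exp (- k * real N) = exp (- \<eta> * real N) * exp (- \<eta> * real N)"
        by (simp add: \<eta>_def flip: exp_add)
      moreover have "exp (- \<eta> * real N) * exp (- \<eta> * real N) \<le> exp (- \<eta> * real N) * (1/4)"
        using elim(4) by (intro mult_left_mono) auto
      moreover have "exp (- \<eta> * real N) > 0" by simp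
      ultimately show False using up by argo
    qed
  qed
qed

end

section \<open>Descent of the overlap threshold\<close>

lemma avg_cong:
  assumes "\<And>\<omega>. \<omega> \<in> \<Omega> \<Longrightarrow> f \<omega> = h \<omega>"
  shows "avg \<Omega> X f = avg \<Omega> X h"
  unfolding avg_def using assms by (intro sum.cong) auto

lemma avg_of_bool:
  assumes "finite \<Omega>" "{\<omega>\<in>\<Omega>. P \<omega>} \<noteq> {}"
  shows "avg \<Omega> X (\<lambda>\<omega>. of_bool (P \<omega>)) = exp (lse {\<omega>\<in>\<Omega>. P \<omega>} X - lse \<Omega> X)"
proof -
  have ne: "\<Omega> \<noteq> {}" using assms(2) by auto
  have "(\<Sum>\<omega>\<in>\<Omega>. exp (X \<omega>) * of_bool (P \<omega>)) = (\<Sum>\<omega>\<in>{\<omega>\<in>\<Omega>. P \<omega>}. exp (X \<omega>))"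
    by (simp add: assms(1) sum.inter_filter of_bool_def if_distrib cong: if_cong)
  then show ?thesis
    using assms ne by (simp add: avg_def sm_def exp_diff exp_lse sum_divide_distrib[symmetric])
qed

lemma avg_gauge:
  assumes s: "s \<in> Sigma N"
  shows "avg (Sigma N) (Xe p N \<beta> (gauge p N s g)) f = avg (Sigma N) (Xe p N \<beta> g) (\<lambda>\<sigma>. f (smul N s \<sigma>))"
proof -
  have Z: "(\<Sum>\<sigma>\<in>Sigma N. exp (Xe p N \<beta> g (smul N s \<sigma>))) = (\<Sum>\<sigma>\<in>Sigma N. exp (Xe p N \<beta> g \<sigma>))"
    by (rule sum.reindex_bij_betw[OF bij_smul[OF s]])
  have "avg (Sigma N) (Xe p N \<beta> (gauge p N s g)) f =
     (\<Sum>\<sigma>\<in>Sigma N. sm (Sigma N) (Xe p N \<beta> g) (smul N s \<sigma>) * f (smul N s (smul N s \<sigma>)))"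
    unfolding avg_def sm_def Xe_gauge Z using smul_smul[OF s] by (intro sum.cong) auto
  also have "\<dots> = (\<Sum>\<sigma>\<in>Sigma N. sm (Sigma N) (Xe p N \<beta> g) \<sigma> * f (smul N s \<sigma>))"
    by (rule sum.reindex_bij_betw[OF bij_smul[OF s]])
  finally show ?thesis by (simp add: avg_def)
qed

text \<open>The threshold is on the \<open>p\<close>-th power because the energy sees overlaps only
  through it.\<close>

definition shell :: "nat \<Rightarrow> nat \<Rightarrow> real \<Rightarrow> (nat \<Rightarrow> real) set" where
  "shell p N t = {\<sigma>\<in>Sigma N. t \<le> overlap N (ones N) \<sigma> ^ p}"

text \<open>Only the second replica is averaged. The first one, \<open>s\<close>, stays visible
  because it is the one that turns into the planted configuration.\<close>

definition rho :: "nat \<Rightarrow> nat \<Rightarrow> real \<Rightarrow> real \<Rightarrow> (nat \<Rightarrow> real) \<Rightarrow> (nat list \<Rightarrow> real) \<Rightarrow> real" where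
  "rho p N \<beta> t s g = avg (Sigma N) (Xe p N \<beta> g) (\<lambda>\<tau>. of_bool (t \<le> overlap N s \<tau> ^ p))"

definition pairfrac :: "nat \<Rightarrow> nat \<Rightarrow> real \<Rightarrow> real \<Rightarrow> (nat list \<Rightarrow> real) \<Rightarrow> real" where
  "pairfrac p N \<beta> t g = avg (Sigma N) (Xe p N \<beta> g) (\<lambda>\<sigma>. rho p N \<beta> t \<sigma> g)"

definition Q :: "nat \<Rightarrow> nat \<Rightarrow> real \<Rightarrow> real \<Rightarrow> real" where
  "Q p N \<beta> t = (\<integral>g. pairfrac p N \<beta> t g \<partial>disorder)"

lemma shell_subset: "shell p N t \<subseteq> Sigma N"
  by (auto simp: shell_def)

lemma shell_nonempty: "N \<ge> 1 \<Longrightarrow> t \<le> 1 \<Longrightarrow> shell p N t \<noteq> {}"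
  using overlap_self[OF _ ones_in_Sigma, of N] by (auto simp: shell_def intro!: exI[of _ "ones N"])

lemma finite_shell: "finite (shell p N t)"
  by (rule finite_subset[OF shell_subset]) simp

lemma rho_gauge:
  assumes s: "s \<in> Sigma N"
  shows "rho p N \<beta> t s (gauge p N s g) = rho p N \<beta> t (ones N) g"
  unfolding rho_def avg_gauge[OF s]
proof (rule avg_cong)
  fix \<sigma> assume \<sigma>: "\<sigma> \<in> Sigma N"
  have "overlap N s (smul N s \<sigma>) = overlap N (ones N) \<sigma>"
    using overlap_smul[OF s, of s "smul N s \<sigma>"] smul_self[OF s] smul_smul[OF s \<sigma>] by simp
  then show "of_bool (t \<le> overlap N s (smul N s \<sigma>) ^ p) = (of_bool (t \<le> overlap N (ones N) \<sigma> ^ p) :: real)"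
    by simp
qed

lemma pairfrac_gauge:
  assumes s: "s \<in> Sigma N"
  shows "pairfrac p N \<beta> t (gauge p N s g) = pairfrac p N \<beta> t g"
  unfolding pairfrac_def rho_def avg_gauge[OF s] overlap_smul[OF s] ..

lemma rho_eq:
  assumes "N \<ge> 1" "t \<le> 1"
  shows "rho p N \<beta> t (ones N) g = exp (lse (shell p N t) (Xe p N \<beta> g) - LW p N \<beta> g)"
  unfolding rho_def LW_def shell_def
  by (rule avg_of_bool) (use shell_nonempty[OF assms, of p] in \<open>auto simp: shell_def\<close>)

lemma rho_01: "0 \<le> rho p N \<beta> t s g" "rho p N \<beta> t s g \<le> 1"
proof -
  show "0 \<le> rho p N \<beta> t s g" unfolding rho_def by (rule avg_nonneg) auto
  have "rho p N \<beta> t s g \<le> avg (Sigma N) (Xe p N \<beta> g) (\<lambda>_. 1)" unfolding rho_def by (rule avg_mono) auto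
  then show "rho p N \<beta> t s g \<le> 1" by (simp add: avg_const)
qed

lemma pairfrac_01: "0 \<le> pairfrac p N \<beta> t g" "pairfrac p N \<beta> t g \<le> 1"
proof -
  show "0 \<le> pairfrac p N \<beta> t g" unfolding pairfrac_def by (rule avg_nonneg) (auto simp: rho_01)
  have "pairfrac p N \<beta> t g \<le> avg (Sigma N) (Xe p N \<beta> g) (\<lambda>_. 1)" unfolding pairfrac_def by (rule avg_mono) (auto simp: rho_01)
  then show "pairfrac p N \<beta> t g \<le> 1" by (simp add: avg_const)
qed

lemma measurable_rho [measurable]: "rho p N \<beta> t s \<in> borel_measurable disorder"
  unfolding rho_def[abs_def] by (rule measurable_avg) auto

lemma measurable_pairfrac [measurable]: "pairfrac p N \<beta> t \<in> borel_measurable disorder"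
  unfolding pairfrac_def[abs_def] by (rule measurable_avg) auto

lemma integrable_pairfrac: "integrable disorder (pairfrac p N \<beta> t)"
  by (rule integrable_disorder_bounded[where B = 1]) (auto simp: pairfrac_01 abs_of_nonneg)

lemma sm_Xe: "sm (Sigma N) (Xe p N \<beta> g) s = exp (Xe p N \<beta> g s) * exp (- LW p N \<beta> g)"
  by (simp add: sm_def exp_minus exp_LW divide_inverse)

lemma integral_indicator_Collect:
  assumes "Measurable.pred disorder P"
  shows "(\<integral>g. of_bool (P g) \<partial>disorder) = measure disorder {g. P g}"
proof -
  have "(\<lambda>g. of_bool (P g) :: real) = indicator {g. P g}" by (auto simp: indicator_def)
  then show ?thesis by simp
qed

lemma integrable_of_bool:
  assumes [measurable]: "Measurable.pred disorder P"
  shows "integrable disorder (\<lambda>g. of_bool (P g) :: real)"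
  by (rule integrable_disorder_bounded[where B = 1]) auto

lemma measurable_lse_Xe_planted [measurable]:
  "(\<lambda>g. lse A (Xe p N \<beta> (planted p N \<beta>' g))) \<in> borel_measurable disorder"
  by (rule measurable_lse) (rule measurable_compose[OF measurable_planted measurable_Xe])

text \<open>Sampling the first replica costs a factor \<open>exp (- LW)\<close>, at most
  \<open>exp y\<close> off the event of small \<open>LW\<close>. What remains is a planted
  expectation, in which the fraction of second replicas is the relative weight of the shell: at most
  \<open>exp (y - z)\<close>, unless the shell itself weighs at least
  \<open>exp (- z)\<close>.\<close>

lemma Q_le_planted_shell:
  assumes N: "N \<ge> 1" "p \<ge> 1" and t: "t \<le> 1"
  shows "Q p N \<beta> t \<le> measure disorder {g. LW p N \<beta> g \<le> - y} +
     exp y * (measure disorder {g. - z \<le> lse (shell p N t) (Xe p N \<beta> (planted p N \<beta> g))} + exp (y - z))"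
proof -
  let ?I = "\<lambda>g. of_bool (- y < LW p N \<beta> g) :: real"
  let ?\<Psi> = "\<lambda>s g. rho p N \<beta> t s g * ?I g"
  let ?L = "\<lambda>g. \<Sum>s\<in>Sigma N. exp (Xe p N \<beta> g s) * ?\<Psi> s g"
  let ?A = "shell p N t" and ?pl = "planted p N \<beta>"
  have \<Psi>: "integrable disorder ?L" "(\<integral>g. ?L g \<partial>disorder) = (\<integral>g. ?\<Psi> (ones N) (?pl g) \<partial>disorder)"
    by (rule planted_integral[OF N, where B = 1];
        auto simp: rho_gauge LW_gauge rho_01 intro: mult_le_one)+
  have "pairfrac p N \<beta> t g \<le> of_bool (LW p N \<beta> g \<le> - y) + exp y * ?L g" for g
  proof (cases "LW p N \<beta> g \<le> - y")
    case True
    have "0 \<le> ?L g" by (intro sum_nonneg mult_nonneg_nonneg) (auto simp: rho_01)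
    then show ?thesis using True pairfrac_01(2)[of p N \<beta> t g] by simp
  next
    case False
    have "pairfrac p N \<beta> t g = (\<Sum>s\<in>Sigma N. exp (- LW p N \<beta> g) * (exp (Xe p N \<beta> g s) * rho p N \<beta> t s g))"
      unfolding pairfrac_def avg_def sm_Xe by (simp add: mult_ac)
    also have "\<dots> \<le> (\<Sum>s\<in>Sigma N. exp y * (exp (Xe p N \<beta> g s) * rho p N \<beta> t s g))"
      using False by (intro sum_mono mult_right_mono) (auto simp: rho_01)
    finally show ?thesis using False by (simp add: sum_distrib_left)
  qed
  then have "Q p N \<beta> t \<le> (\<integral>g. of_bool (LW p N \<beta> g \<le> - y) + exp y * ?L g \<partial>disorder)"
    unfolding Q_def using \<Psi>(1) by (intro integral_mono integrable_pairfrac) (auto intro!: integrable_of_bool Bochner_Integration.integrable_add)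
  also have "\<dots> = measure disorder {g. LW p N \<beta> g \<le> - y} + exp y * (\<integral>g. ?\<Psi> (ones N) (?pl g) \<partial>disorder)"
    using \<Psi>(1) by (subst Bochner_Integration.integral_add) (auto simp: integrable_of_bool integral_indicator_Collect \<Psi>(2))
  also have "(\<integral>g. ?\<Psi> (ones N) (?pl g) \<partial>disorder) \<le>
      (\<integral>g. of_bool (- z \<le> lse ?A (Xe p N \<beta> (?pl g))) + exp (y - z) \<partial>disorder)"
  proof (rule integral_mono)
    show "integrable disorder (\<lambda>g. ?\<Psi> (ones N) (?pl g))"
    proof (rule integrable_disorder_bounded[where B = 1])
      show "(\<lambda>g. ?\<Psi> (ones N) (?pl g)) \<in> borel_measurable disorder"
        by (rule measurable_compose[OF measurable_planted, of "?\<Psi> (ones N)"]) measurable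
    qed (use rho_01 in \<open>auto simp: abs_of_nonneg\<close>)
    show "integrable disorder (\<lambda>g. of_bool (- z \<le> lse ?A (Xe p N \<beta> (?pl g))) + exp (y - z))"
      by (intro Bochner_Integration.integrable_add integrable_of_bool) auto
    fix g
    show "?\<Psi> (ones N) (?pl g) \<le> of_bool (- z \<le> lse ?A (Xe p N \<beta> (?pl g))) + exp (y - z)"
    proof (cases "- z \<le> lse ?A (Xe p N \<beta> (?pl g)) \<or> \<not> - y < LW p N \<beta> (?pl g)")
      case True
      then show ?thesis using rho_01(2)[of p N \<beta> t "ones N" "?pl g"]
        by (auto intro: order_trans[of _ 1])
    next
      case False
      then show ?thesis by (simp add: rho_eq[OF N(1) t])
    qed
  qed
  also have "\<dots> = measure disorder {g. - z \<le> lse ?A (Xe p N \<beta> (?pl g))} + exp (y - z)"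
    by (subst Bochner_Integration.integral_add)
       (auto simp: integrable_of_bool integral_indicator_Collect disorder.prob_space[simplified])
  finally show ?thesis by (simp add: mult_left_mono)
qed

text \<open>Convexity in \<open>\<beta>\<close> of the planted restricted free energy, with the slope at \<open>\<beta>\<close> computed by
  Gaussian integration by parts.\<close>
lemma planted_shell_increment:
  fixes \<beta> \<kappa> t :: real
  assumes N: "N \<ge> 1" "p \<ge> 1" and t: "t \<le> 1" and pos: "0 \<le> \<beta>" "0 \<le> \<kappa>"
  defines "A \<equiv> shell p N t" and "X \<equiv> \<lambda>\<beta> g. Xe p N \<beta> (planted p N \<beta> g)"
  defines "r \<equiv> (\<integral>g. avg A (X \<beta> g) (\<lambda>\<sigma>. avg A (X \<beta> g) (\<lambda>\<tau>. overlap N \<sigma> \<tau> ^ p)) \<partial>disorder)"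
  shows "(\<integral>g. lse A (X \<beta> g) \<partial>disorder) + real N *
      (\<kappa> * \<beta> / 2 * (1 - r) + (2 * \<kappa> * \<beta> + \<kappa>\<^sup>2) / 2 * t - (2 * \<kappa> * \<beta> + \<kappa>\<^sup>2) / 4)
     \<le> (\<integral>g. lse A (X (\<beta> + \<kappa>) g) \<partial>disorder)"
proof -
  have A: "A \<subseteq> Sigma N" "A \<noteq> {}" "finite A"
    unfolding A_def using shell_subset shell_nonempty[OF N(1) t] finite_shell by auto
  let ?d = "(\<beta> + \<kappa>)\<^sup>2 - \<beta>\<^sup>2"
  have d: "?d = 2 * \<kappa> * \<beta> + \<kappa>\<^sup>2" by (simp add: power2_eq_square algebra_simps)
  have d0: "0 \<le> ?d" unfolding d using pos by simp
  have mX [measurable]: "(\<lambda>g. X \<beta> g \<sigma>) \<in> borel_measurable disorder" for \<sigma>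
    unfolding X_def by (rule measurable_compose[OF measurable_planted measurable_Xe])
  have iH: "integrable disorder (\<lambda>g. avg A (X \<beta> g) (H p N g))"
    by (rule integrable_avg_H[OF A(3)]) (rule mX)
  have il: "integrable disorder (\<lambda>g. lse A (X \<beta> g))" "integrable disorder (\<lambda>g. lse A (X (\<beta> + \<kappa>) g))"
    unfolding X_def using integrable_lse_Xe(2)[OF N A(1,2)] pos by auto
  have "lse A (X \<beta> g) + (\<kappa> / sqrt 2 * avg A (X \<beta> g) (H p N g) + (?d / 2 * real N * t - ?d / 4 * real N))
      \<le> lse A (X (\<beta> + \<kappa>) g)" for g
  proof -
    have "\<kappa> / sqrt 2 * avg A (X \<beta> g) (H p N g) + (?d / 2 * real N * t - ?d / 4 * real N) =
        avg A (X \<beta> g) (\<lambda>\<sigma>. \<kappa> / sqrt 2 * H p N g \<sigma> + (?d / 2 * real N * t - ?d / 4 * real N))"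
      by (subst avg_add, subst avg_cmult, subst avg_const) (use A in auto)
    also have "\<dots> \<le> avg A (X \<beta> g) (\<lambda>\<sigma>. X (\<beta> + \<kappa>) g \<sigma> - X \<beta> g \<sigma>)"
    proof (rule avg_mono)
      fix \<sigma> assume "\<sigma> \<in> A"
      then have m: "t \<le> overlap N (ones N) \<sigma> ^ p" by (simp add: A_def shell_def)
      have "X (\<beta> + \<kappa>) g \<sigma> - X \<beta> g \<sigma> = \<kappa> / sqrt 2 * H p N g \<sigma> +
          (?d / 2 * real N * overlap N (ones N) \<sigma> ^ p - ?d / 4 * real N)"
        unfolding X_def Xe_planted[OF N] by (simp add: field_simps)
      \<comment> \<open>The planted field grows with \<beta>; here the restriction to the shell
        enters, as a lower bound on the overlap with the planted configuration.\<close>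
      moreover have "?d / 2 * real N * t \<le> ?d / 2 * real N * overlap N (ones N) \<sigma> ^ p"
        using m d0 by (intro mult_left_mono) auto
      ultimately show "\<kappa> / sqrt 2 * H p N g \<sigma> + (?d / 2 * real N * t - ?d / 4 * real N) \<le> X (\<beta> + \<kappa>) g \<sigma> - X \<beta> g \<sigma>"
        by linarith
    qed
    also have "\<dots> \<le> lse A (X (\<beta> + \<kappa>) g) - lse A (X \<beta> g)"
      by (rule lse_convex) (use A in auto)
    finally show ?thesis by linarith
  qed
  then have "(\<integral>g. lse A (X \<beta> g) + (\<kappa> / sqrt 2 * avg A (X \<beta> g) (H p N g) + (?d / 2 * real N * t - ?d / 4 * real N)) \<partial>disorder)
     \<le> (\<integral>g. lse A (X (\<beta> + \<kappa>) g) \<partial>disorder)"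
    using iH il by (intro integral_mono) auto
  moreover have "(\<integral>g. lse A (X \<beta> g) + (\<kappa> / sqrt 2 * avg A (X \<beta> g) (H p N g) + (?d / 2 * real N * t - ?d / 4 * real N)) \<partial>disorder) =
     (\<integral>g. lse A (X \<beta> g) \<partial>disorder) + (\<kappa> / sqrt 2 * (\<integral>g. avg A (X \<beta> g) (H p N g) \<partial>disorder) + (?d / 2 * real N * t - ?d / 4 * real N))"
    using iH il by (simp add: disorder.prob_space[simplified])
  moreover have "(\<integral>g. avg A (X \<beta> g) (H p N g) \<partial>disorder) = \<beta> / sqrt 2 * real N * (1 - r)"
    unfolding r_def X_def Xe_planted[OF N, abs_def] by (rule expectation_H[OF N A(1,2)])
  moreover have "\<kappa> / sqrt 2 * (\<beta> / sqrt 2 * real N * (1 - r)) + (?d / 2 * real N * t - ?d / 4 * real N) =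
     real N * (\<kappa> * \<beta> / 2 * (1 - r) + ?d / 2 * t - ?d / 4)"
    by (simp add: field_simps)
  ultimately show ?thesis unfolding d[symmetric] by (simp only:)
qed

text \<open>If the shell weighs more than \<open>exp (- y)\<close> and the whole system less than
  \<open>exp z\<close>, passing from the shell to the full Gibbs measure costs
  \<open>exp (y + z)\<close> per replica. Undoing the planting costs another \<open>exp z\<close>,
  because the planted law has density \<open>exp LW\<close>, which is below \<open>exp z\<close> on
  the event kept.\<close>

lemma restricted_pair_bound:
  fixes \<beta> t u y z :: real
  assumes N: "N \<ge> 1" "p \<ge> 1" and t: "t \<le> 1"
  defines "A \<equiv> shell p N t" and "X \<equiv> \<lambda>g. Xe p N \<beta> (planted p N \<beta> g)"
  shows "(\<integral>g. avg A (X g) (\<lambda>\<sigma>. avg A (X g) (\<lambda>\<tau>. of_bool (u \<le> overlap N \<sigma> \<tau> ^ p))) \<partial>disorder) \<le>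
     measure disorder {g. lse A (X g) \<le> - y} + measure disorder {g. z \<le> LW p N \<beta> (planted p N \<beta> g)} +
     exp (2 * y + 3 * z) * Q p N \<beta> u"
proof -
  let ?pl = "planted p N \<beta>"
  have A: "A \<subseteq> Sigma N" "A \<noteq> {}" "finite A"
    unfolding A_def using shell_subset shell_nonempty[OF N(1) t] finite_shell by auto
  have mX [measurable]: "(\<lambda>g. X g \<sigma>) \<in> borel_measurable disorder" for \<sigma>
    unfolding X_def by (rule measurable_compose[OF measurable_planted measurable_Xe])
  have [measurable]: "(\<lambda>g. LW p N \<beta> (?pl g)) \<in> borel_measurable disorder"
    by (rule measurable_compose[OF measurable_planted]) measurable
  have [measurable]: "(\<lambda>g. lse A (X g)) \<in> borel_measurable disorder"
    by (rule measurable_lse) (rule mX)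
  let ?b = "\<lambda>g. of_bool (lse A (X g) \<le> - y) :: real" and ?c = "\<lambda>g. of_bool (z \<le> LW p N \<beta> (?pl g)) :: real"
  let ?\<Psi> = "\<lambda>g. pairfrac p N \<beta> u g * of_bool (LW p N \<beta> g < z)"
  let ?F = "\<lambda>g. avg A (X g) (\<lambda>\<sigma>. avg A (X g) (\<lambda>\<tau>. of_bool (u \<le> overlap N \<sigma> \<tau> ^ p)))"
  have F01: "0 \<le> avg A (X g) (\<lambda>\<tau>. of_bool (u \<le> overlap N \<sigma> \<tau> ^ p))" "avg A (X g) (\<lambda>\<tau>. of_bool (u \<le> overlap N \<sigma> \<tau> ^ p)) \<le> 1" for g \<sigma>
  proof -
    have "avg A (X g) (\<lambda>\<tau>. of_bool (u \<le> overlap N \<sigma> \<tau> ^ p)) \<le> avg A (X g) (\<lambda>_. 1)"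
      by (rule avg_mono) auto
    then show "avg A (X g) (\<lambda>\<tau>. of_bool (u \<le> overlap N \<sigma> \<tau> ^ p)) \<le> 1" by (simp add: avg_const A)
  qed (rule avg_nonneg, simp)
  have F1: "?F g \<le> 1" for g
  proof -
    have "?F g \<le> avg A (X g) (\<lambda>_. 1)" by (rule avg_mono) (rule F01)
    then show ?thesis by (simp add: avg_const A)
  qed
  have m\<Psi> [measurable]: "?\<Psi> \<in> borel_measurable disorder" by measurable
  have pt: "?F g \<le> ?b g + ?c g + exp (2 * y + 2 * z) * ?\<Psi> (?pl g)" for g
  proof (cases "lse A (X g) \<le> - y \<or> z \<le> LW p N \<beta> (?pl g)")
    case True
    have "0 \<le> exp (2 * y + 2 * z) * ?\<Psi> (?pl g)" by (simp add: pairfrac_01)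
    then show ?thesis using True F1[of g] by (auto simp del: of_bool_eq(1) split: if_splits)
  next
    case False
    have sm: "sm A (X g) \<sigma> \<le> exp (y + z) * sm (Sigma N) (X g) \<sigma>" for \<sigma>
    proof -
      have "sm A (X g) \<sigma> = exp (X g \<sigma>) * exp (- lse A (X g))"
        using A by (simp add: sm_def exp_minus exp_lse divide_inverse)
      also have "\<dots> \<le> exp (X g \<sigma>) * (exp (y + z) * exp (- LW p N \<beta> (?pl g)))"
        using False by (intro mult_left_mono) (auto simp flip: exp_add)
      also have "\<dots> = exp (y + z) * sm (Sigma N) (X g) \<sigma>"
        unfolding X_def sm_Xe by (simp add: mult_ac)
      finally show ?thesis .
    qed
    have av: "avg A (X g) f \<le> exp (y + z) * avg (Sigma N) (X g) f" if "\<And>\<sigma>. f \<sigma> \<ge> 0" for f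
    proof -
      have "avg A (X g) f \<le> (\<Sum>\<sigma>\<in>A. exp (y + z) * sm (Sigma N) (X g) \<sigma> * f \<sigma>)"
        unfolding avg_def by (intro sum_mono mult_right_mono sm that)
      also have "\<dots> \<le> (\<Sum>\<sigma>\<in>Sigma N. exp (y + z) * sm (Sigma N) (X g) \<sigma> * f \<sigma>)"
        by (intro sum_mono2 mult_nonneg_nonneg that sm_nonneg) (use A in auto)
      finally show ?thesis by (simp add: avg_def sum_distrib_left mult.assoc)
    qed
    have "?F g \<le> avg A (X g) (\<lambda>\<sigma>. exp (y + z) * rho p N \<beta> u \<sigma> (?pl g))"
      by (rule avg_mono) (use av in \<open>auto simp: rho_def X_def\<close>)
    also have "\<dots> = exp (y + z) * avg A (X g) (\<lambda>\<sigma>. rho p N \<beta> u \<sigma> (?pl g))" by (rule avg_cmult)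
    also have "\<dots> \<le> exp (y + z) * (exp (y + z) * avg (Sigma N) (X g) (\<lambda>\<sigma>. rho p N \<beta> u \<sigma> (?pl g)))"
      by (intro mult_left_mono av) (auto simp: rho_01)
    also have "\<dots> = exp (2 * y + 2 * z) * ?\<Psi> (?pl g)"
    proof -
      have "exp (2 * y + 2 * z) = exp (y + z) * exp (y + z)" by (simp flip: exp_add)
      then show ?thesis using False by (simp add: pairfrac_def X_def)
    qed
    finally show ?thesis using False by simp
  qed
  have int\<Psi>: "integrable disorder (\<lambda>g. ?\<Psi> (?pl g))"
    by (rule integrable_disorder_bounded[where B = 1])
       (auto simp: pairfrac_01 abs_mult intro: measurable_compose[OF measurable_planted m\<Psi>])
  have "(\<integral>g. ?F g \<partial>disorder) \<le> (\<integral>g. ?b g + ?c g + exp (2 * y + 2 * z) * ?\<Psi> (?pl g) \<partial>disorder)"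
  proof (rule integral_mono[OF _ _ pt])
    show "integrable disorder ?F"
      by (rule integrable_avg_bounded[where B = 1]) (use A F01 in \<open>auto intro!: measurable_avg mX simp: abs_of_nonneg\<close>)
    show "integrable disorder (\<lambda>g. ?b g + ?c g + exp (2 * y + 2 * z) * ?\<Psi> (?pl g))"
      using int\<Psi> by (intro Bochner_Integration.integrable_add integrable_of_bool) auto
  qed
  also have "\<dots> = measure disorder {g. lse A (X g) \<le> - y} + measure disorder {g. z \<le> LW p N \<beta> (?pl g)} +
     exp (2 * y + 2 * z) * (\<integral>g. ?\<Psi> (?pl g) \<partial>disorder)"
    using int\<Psi>
    by (subst Bochner_Integration.integral_add, intro Bochner_Integration.integrable_add integrable_of_bool, measurable)
       (auto simp: integral_indicator_Collect integrable_of_bool)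
  also have "(\<integral>g. ?\<Psi> (?pl g) \<partial>disorder) \<le> exp z * Q p N \<beta> u"
  proof -
    have i: "integrable disorder (\<lambda>g. exp (LW p N \<beta> g) * ?\<Psi> g)"
      and e: "(\<integral>g. exp (LW p N \<beta> g) * ?\<Psi> g \<partial>disorder) = (\<integral>g. ?\<Psi> (?pl g) \<partial>disorder)"
      by (rule planted_integral_LW[OF N m\<Psi>, where B = 1]; auto simp: pairfrac_gauge LW_gauge pairfrac_01)+
    have "(\<integral>g. exp (LW p N \<beta> g) * ?\<Psi> g \<partial>disorder) \<le> (\<integral>g. exp z * pairfrac p N \<beta> u g \<partial>disorder)"
    proof (rule integral_mono[OF i])
      show "integrable disorder (\<lambda>g. exp z * pairfrac p N \<beta> u g)" using integrable_pairfrac by auto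
      show "exp (LW p N \<beta> g) * ?\<Psi> g \<le> exp z * pairfrac p N \<beta> u g" for g
        by (cases "LW p N \<beta> g < z") (auto simp: pairfrac_01 intro!: mult_right_mono)
    qed
    then show ?thesis unfolding e Q_def by simp
  qed
  also have "exp (2 * y + 2 * z) * (exp z * Q p N \<beta> u) = exp (2 * y + 3 * z) * Q p N \<beta> u"
    by (simp add: mult.assoc[symmetric] flip: exp_add)
  finally show ?thesis by (simp add: mult_left_mono)
qed

context
  fixes p :: nat and b a0 b0 :: real
  assumes p: "p \<ge> 1" and b: "b > 0"
    and EL_b: "\<And>\<eta>. \<eta> > 0 \<Longrightarrow> \<forall>\<^sub>F N in sequentially. - \<eta> * real N \<le> EL p N b"
    and ab: "0 < a0" "a0 \<le> b0" "b0 < b"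
begin

text \<open>Descent of the overlap threshold. If the shell at level \<open>t\<close> around a planted configuration
  had subexponentially small weight, two samples from it would have overlap at most about
  \<open>3t/2\<close> by the previous level, and raising \<open>\<beta>\<close> would make the planted free energy exceed the
  bound of \<open>DN_small\<close>.\<close>
lemma overlap_step:
  assumes t: "0 < t" "t \<le> 1" and \<gamma>: "\<gamma> > 0"
    and IH: "\<forall>\<^sub>F N in sequentially. \<forall>\<beta>\<in>{a0..b0}. Q p N \<beta> (3 / 2 * t) \<le> exp (- \<gamma> * real N)"
  shows "\<exists>\<gamma>'>0. \<forall>\<^sub>F N in sequentially. \<forall>\<beta>\<in>{a0..b0}. Q p N \<beta> t \<le> exp (- \<gamma>' * real N)"
proof -
  \<comment> \<open>\<open>\<kappa> \<le> b - b0\<close> keeps \<open>\<beta> + \<kappa>\<close>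
    where \<open>DN_small\<close> applies, and \<open>\<kappa> \<le> a0 * t / 2\<close> bounds the
    quadratic loss. In \<open>\<eta>\<close>, the first bound puts \<open>4 * \<eta>\<close> below
    the gain in free energy; the second beats the factor \<open>exp (14 * \<eta> * N)\<close> from
    \<open>restricted_pair_bound\<close>, where 14 = 2 * 4 + 3 * 2.\<close>
  define \<kappa> where "\<kappa> = min (a0 * t / 2) (b - b0)"
  define \<eta> where "\<eta> = min (\<kappa> * a0 * t / 128) (\<gamma> / 28)"
  have \<kappa>: "\<kappa> > 0" "\<kappa> \<le> a0 * t / 2" "\<kappa> \<le> b - b0" using ab t unfolding \<kappa>_def by (simp, intro min.cobounded1, intro min.cobounded2)
  have \<eta>: "\<eta> > 0" "\<eta> \<le> \<kappa> * a0 * t / 128" "\<eta> \<le> \<gamma> / 28"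
    using \<kappa> ab t \<gamma> unfolding \<eta>_def by (simp, intro min.cobounded1, intro min.cobounded2)
  define k where "k = \<eta>\<^sup>2 / (2 * b\<^sup>2)"
  have k: "k > 0" using \<eta> b by (simp add: k_def)
  \<comment> \<open>\<open>Q_le_planted_shell\<close> multiplies by
    \<open>exp (\<eta>' * N)\<close>; this must leave positive rates against both \<open>k\<close>,
    from concentration, and \<open>2 * \<eta> - \<eta>'\<close>, from the lightness of the
    shell.\<close>
  define \<eta>' where "\<eta>' = min (k / 2) (\<eta> / 2)"
  have \<eta>': "\<eta>' > 0" "\<eta>' \<le> k / 2" "\<eta>' \<le> \<eta> / 2"
    using k \<eta> unfolding \<eta>'_def by (simp, intro min.cobounded1, intro min.cobounded2)
  define k' where "k' = \<eta>'\<^sup>2 / (8 * b\<^sup>2)"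
  have k': "k' > 0" using \<eta>' b by (simp add: k'_def)
  \<comment> \<open>The factor 1/2 absorbs constants: each of the three final terms has rate at
    least \<open>2 * \<gamma>'\<close> and so is at most a third of the target for large
    \<open>N\<close>.\<close>
  define \<gamma>' where "\<gamma>' = min k' (min (k / 2) \<eta>) / 2"
  have \<gamma>': "\<gamma>' > 0" "2 * \<gamma>' \<le> k'" "2 * \<gamma>' \<le> k / 2" "2 * \<gamma>' \<le> \<eta>" using k k' \<eta> by (auto simp: \<gamma>'_def)
  have \<gamma>2: "\<gamma> / 2 > 0" and t24: "t / 24 > 0" using \<gamma> t by auto
  have ev1: "\<forall>\<^sub>F N in sequentially. \<forall>\<beta>\<in>{0<..b}.
      measure disorder {g. LW p N \<beta> g \<le> - \<eta>' * real N} \<le> exp (- (\<eta>'\<^sup>2 / (8 * b\<^sup>2)) * real N)"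
    by (rule LW_lower_tail[OF p b _ \<eta>'(1)]) (rule EL_b)
  have ev2: "\<forall>\<^sub>F N in sequentially. \<forall>\<beta>\<in>{0<..b}. DN p N \<beta> \<le> \<eta> * real N"
    by (rule DN_small[OF p b _ \<eta>(1)]) (rule EL_b)
  have "\<forall>\<^sub>F N in sequentially. \<forall>\<beta>\<in>{a0..b0}. Q p N \<beta> t \<le> exp (- \<gamma>' * real N)"
    using ev1 ev2 eventually_exp_le[OF k t24] eventually_exp_le[OF \<gamma>2 t24] IH
      eventually_exp_le[OF \<gamma>'(1), of "1 / 3", simplified] eventually_ge_at_top[of 1]
  proof eventually_elim
    case (elim N)
    have N: "N \<ge> 1" "p \<ge> 1" "real N > 0" using elim p by auto
    show ?case
    proof
      fix \<beta> assume \<beta>: "\<beta> \<in> {a0..b0}"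
      have \<beta>b: "\<beta> \<in> {0<..b}" "\<beta> + \<kappa> \<in> {0<..b}" using \<beta> ab \<kappa> by auto
      define A where "A = shell p N t"
      have A: "A \<subseteq> Sigma N" "A \<noteq> {}" "finite A"
        unfolding A_def using shell_subset shell_nonempty[OF N(1) t(2)] finite_shell by auto
      define X where "X = (\<lambda>\<beta> g. Xe p N \<beta> (planted p N \<beta> g))"
      define lA where "lA = (\<lambda>\<beta>. \<integral>g. lse A (X \<beta> g) \<partial>disorder)"
      have sub: "subgaussian (\<lambda>g. lse A (X \<beta> g)) (b\<^sup>2 / 2 * real N)"
        unfolding X_def by (rule subgaussian_Xe(2)) (use N A \<beta>b in auto)
      have [measurable]: "(\<lambda>g. lse A (X \<beta> g)) \<in> borel_measurable disorder"
        unfolding X_def by measurable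
      have [measurable]: "(\<lambda>g. LW p N \<beta> (planted p N \<beta> g)) \<in> borel_measurable disorder"
        by (rule measurable_compose[OF measurable_planted]) measurable
      have lA: "lA \<beta> \<le> - 3 * \<eta> * real N"
      proof (rule ccontr)
        assume "\<not> lA \<beta> \<le> - 3 * \<eta> * real N"
        then have big: "lA \<beta> > - 3 * \<eta> * real N" by simp
        define r where "r = (\<integral>g. avg A (X \<beta> g) (\<lambda>\<sigma>. avg A (X \<beta> g) (\<lambda>\<tau>. overlap N \<sigma> \<tau> ^ p)) \<partial>disorder)"
        define B where "B = (\<integral>g. avg A (X \<beta> g) (\<lambda>\<sigma>. avg A (X \<beta> g) (\<lambda>\<tau>. of_bool (3 / 2 * t \<le> overlap N \<sigma> \<tau> ^ p))) \<partial>disorder)"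
        have B: "B \<le> t / 8"
        proof -
          have "B \<le> measure disorder {g. lse A (X \<beta> g) \<le> - (4 * \<eta> * real N)} +
             measure disorder {g. 2 * \<eta> * real N \<le> LW p N \<beta> (planted p N \<beta> g)} +
             exp (2 * (4 * \<eta> * real N) + 3 * (2 * \<eta> * real N)) * Q p N \<beta> (3 / 2 * t)"
            unfolding B_def A_def X_def by (rule restricted_pair_bound) (use N t in auto)
          also have "measure disorder {g. lse A (X \<beta> g) \<le> - (4 * \<eta> * real N)} \<le> exp (- k * real N)"
          proof -
            have "measure disorder {g. lse A (X \<beta> g) \<le> - (4 * \<eta> * real N)} \<le>
              measure disorder {g. lse A (X \<beta> g) \<le> (\<integral>g. lse A (X \<beta> g) \<partial>disorder) - \<eta> * real N}"
              using big by (intro measure_disorder_mono) (auto simp: lA_def)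
            also have "\<dots> \<le> exp (- k * real N)"
              unfolding k_def by (rule subgaussian_tails_linear(2)[OF sub]) (use N b \<eta> in auto)
            finally show ?thesis .
          qed
          also have "measure disorder {g. 2 * \<eta> * real N \<le> LW p N \<beta> (planted p N \<beta> g)} \<le> exp (- k * real N)"
          proof -
            have "DN p N \<beta> \<le> \<eta> * real N" using elim(2) \<beta>b by auto
            then have "measure disorder {g. 2 * \<eta> * real N \<le> LW p N \<beta> (planted p N \<beta> g)} \<le>
              measure disorder {g. (\<integral>g. LW p N \<beta> (planted p N \<beta> g) \<partial>disorder) + \<eta> * real N \<le> LW p N \<beta> (planted p N \<beta> g)}"
              by (intro measure_disorder_mono) (auto simp: DN_def)
            also have "\<dots> \<le> exp (- k * real N)"
              unfolding k_def LW_def by (rule subgaussian_tails_linear(1)[OF subgaussian_Xe(2)]) (use N b \<eta> \<beta>b in auto)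
            finally show ?thesis .
          qed
          also have "exp (2 * (4 * \<eta> * real N) + 3 * (2 * \<eta> * real N)) * Q p N \<beta> (3 / 2 * t) \<le> exp (- (\<gamma> / 2) * real N)"
          proof -
            have "exp (2 * (4 * \<eta> * real N) + 3 * (2 * \<eta> * real N)) * Q p N \<beta> (3 / 2 * t) \<le>
              exp (2 * (4 * \<eta> * real N) + 3 * (2 * \<eta> * real N)) * exp (- \<gamma> * real N)"
              using elim(5) \<beta> by (intro mult_left_mono) auto
            also have "\<dots> = exp ((14 * \<eta> - \<gamma>) * real N)" by (simp add: algebra_simps flip: exp_add)
            also have "\<dots> \<le> exp (- (\<gamma> / 2) * real N)"
            proof -
              have "(14 * \<eta> - \<gamma>) * real N \<le> (- (\<gamma> / 2)) * real N"
                using \<eta>(3) by (intro mult_right_mono) auto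
              then show ?thesis by (simp only: exp_le_cancel_iff)
            qed
            finally show ?thesis .
          qed
          finally show ?thesis using elim(3,4) by simp
        qed
        have mX: "(\<lambda>g. X \<beta> g \<sigma>) \<in> borel_measurable disorder" for \<sigma>
          unfolding X_def by (rule measurable_compose[OF measurable_planted measurable_Xe])
        have r: "r \<le> 3 / 2 * t + t / 8"
        proof -
          have ib: "integrable disorder (\<lambda>g. avg A (X \<beta> g) (\<lambda>\<sigma>. avg A (X \<beta> g) (\<lambda>\<tau>. h \<sigma> \<tau>)))"
            if "\<And>\<sigma> \<tau>. \<sigma> \<in> A \<Longrightarrow> \<tau> \<in> A \<Longrightarrow> \<bar>h \<sigma> \<tau>\<bar> \<le> 1" for h
            by (rule integrable_avg_bounded[where B = 1])
               (use A that in \<open>auto intro!: measurable_avg mX avg_abs_le\<close>)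
          have "r \<le> (\<integral>g. 3 / 2 * t + avg A (X \<beta> g) (\<lambda>\<sigma>. avg A (X \<beta> g) (\<lambda>\<tau>. of_bool (3 / 2 * t \<le> overlap N \<sigma> \<tau> ^ p))) \<partial>disorder)"
            unfolding r_def
          proof (rule integral_mono)
            show "integrable disorder (\<lambda>g. avg A (X \<beta> g) (\<lambda>\<sigma>. avg A (X \<beta> g) (\<lambda>\<tau>. overlap N \<sigma> \<tau> ^ p)))"
              by (rule ib) (use A overlap_pow_abs_le_1 in blast)
            show "integrable disorder (\<lambda>g. 3 / 2 * t + avg A (X \<beta> g) (\<lambda>\<sigma>. avg A (X \<beta> g) (\<lambda>\<tau>. of_bool (3 / 2 * t \<le> overlap N \<sigma> \<tau> ^ p))))"
              by (intro Bochner_Integration.integrable_add ib) auto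
            fix g
            have "avg A (X \<beta> g) (\<lambda>\<sigma>. avg A (X \<beta> g) (\<lambda>\<tau>. overlap N \<sigma> \<tau> ^ p)) \<le>
               avg A (X \<beta> g) (\<lambda>\<sigma>. avg A (X \<beta> g) (\<lambda>\<tau>. 3 / 2 * t + of_bool (3 / 2 * t \<le> overlap N \<sigma> \<tau> ^ p)))"
            proof (intro avg_mono)
              fix \<sigma> \<tau> assume "\<sigma> \<in> A" "\<tau> \<in> A"
              then have "\<bar>overlap N \<sigma> \<tau> ^ p\<bar> \<le> 1" using A by (intro overlap_pow_abs_le_1) auto
              then show "overlap N \<sigma> \<tau> ^ p \<le> 3 / 2 * t + of_bool (3 / 2 * t \<le> overlap N \<sigma> \<tau> ^ p)"
                using t by (cases "3 / 2 * t \<le> overlap N \<sigma> \<tau> ^ p") auto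
            qed
            also have "\<dots> = 3 / 2 * t + avg A (X \<beta> g) (\<lambda>\<sigma>. avg A (X \<beta> g) (\<lambda>\<tau>. of_bool (3 / 2 * t \<le> overlap N \<sigma> \<tau> ^ p)))"
              by (simp only: avg_add avg_const[OF A(3,2)])
            finally show "avg A (X \<beta> g) (\<lambda>\<sigma>. avg A (X \<beta> g) (\<lambda>\<tau>. overlap N \<sigma> \<tau> ^ p)) \<le> \<dots>" .
          qed
          also have "\<dots> = 3 / 2 * t + B"
            unfolding B_def by (subst Bochner_Integration.integral_add) (auto intro!: ib simp: disorder.prob_space[simplified])
          finally show ?thesis using B by simp
        qed
        have "lA \<beta> + real N *
            (\<kappa> * \<beta> / 2 * (1 - r) + (2 * \<kappa> * \<beta> + \<kappa>\<^sup>2) / 2 * t - (2 * \<kappa> * \<beta> + \<kappa>\<^sup>2) / 4) \<le> lA (\<beta> + \<kappa>)"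
          unfolding lA_def r_def A_def X_def
          by (rule planted_shell_increment) (use N t \<kappa> \<beta>b in auto)
        also have "lA (\<beta> + \<kappa>) \<le> DN p N (\<beta> + \<kappa>)"
          unfolding lA_def DN_def LW_def X_def
          by (intro integral_mono integrable_lse_Xe(2) lse_mono_set) (use N A \<beta>b in auto)
        also have "\<dots> \<le> \<eta> * real N" using elim(2) \<beta>b by auto
        finally have "real N * (\<kappa> * \<beta> / 2 * (1 - r) + (2 * \<kappa> * \<beta> + \<kappa>\<^sup>2) / 2 * t - (2 * \<kappa> * \<beta> + \<kappa>\<^sup>2) / 4) < real N * (4 * \<eta>)"
          using big by (simp add: algebra_simps)
        then have c1: "\<kappa> * \<beta> / 2 * (1 - r) + (2 * \<kappa> * \<beta> + \<kappa>\<^sup>2) / 2 * t - (2 * \<kappa> * \<beta> + \<kappa>\<^sup>2) / 4 < 4 * \<eta>"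
          using N(3) mult_less_cancel_left_pos by blast
        have \<kappa>\<beta>: "0 < \<kappa> * \<beta>" using \<kappa> \<beta>b by simp
        have c2: "\<kappa> * \<beta> * r \<le> \<kappa> * \<beta> * (3 / 2 * t + t / 8)" using r \<kappa>\<beta> by (intro mult_left_mono) auto
        have "a0 * t \<le> \<beta> * t" using \<beta> t by (intro mult_right_mono) auto
        then have "\<kappa> \<le> \<beta> * t / 2" using \<kappa>(2) by linarith
        then have "\<kappa> * \<kappa> \<le> \<kappa> * (\<beta> * t / 2)"
          using \<kappa>(1) by (intro mult_left_mono) auto
        then have c3: "\<kappa>\<^sup>2 \<le> \<kappa> * \<beta> * t / 2" by (simp add: power2_eq_square mult_ac)
        have c4: "4 * \<eta> \<le> \<kappa> * \<beta> * t / 32"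
        proof -
          have "\<kappa> * a0 * t \<le> \<kappa> * \<beta> * t" using \<kappa> \<beta> t by (intro mult_right_mono mult_left_mono) auto
          then show ?thesis using \<eta>(2) by linarith
        qed
        have c5: "0 \<le> \<kappa>\<^sup>2 * t" using t by simp
        have c6: "0 < \<kappa> * \<beta> * t" using \<kappa>\<beta> t by simp
        \<comment> \<open>The linear gain is at least
          \<open>\<kappa> * \<beta> * t * (1 - 13 / 16)\<close> and the quadratic loss at most
          \<open>\<kappa> * \<beta> * t / 8\<close>. What is left,
          \<open>\<kappa> * \<beta> * t / 16\<close>, exceeds the bound
          \<open>4 * \<eta> \<le> \<kappa> * \<beta> * t / 32\<close>.\<close>
        have "\<kappa> * \<beta> / 2 * (1 - r) + (2 * \<kappa> * \<beta> + \<kappa>\<^sup>2) / 2 * t - (2 * \<kappa> * \<beta> + \<kappa>\<^sup>2) / 4 =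
           - (\<kappa> * \<beta> * r) / 2 + \<kappa> * \<beta> * t + \<kappa>\<^sup>2 * t / 2 - \<kappa>\<^sup>2 / 4"
          by (simp add: field_simps)
        moreover have "\<kappa> * \<beta> * (3 / 2 * t + t / 8) = 13 / 8 * (\<kappa> * \<beta> * t)" by (simp add: field_simps)
        ultimately show False using c1 c2 c3 c4 c5 c6 by linarith
      qed
      have "Q p N \<beta> t \<le> measure disorder {g. LW p N \<beta> g \<le> - (\<eta>' * real N)} +
         exp (\<eta>' * real N) * (measure disorder {g. - (2 * \<eta> * real N) \<le> lse A (X \<beta> g)} +
           exp (\<eta>' * real N - 2 * \<eta> * real N))"
        unfolding A_def X_def by (rule Q_le_planted_shell) (use N t in auto)
      also have "measure disorder {g. LW p N \<beta> g \<le> - (\<eta>' * real N)} \<le> exp (- \<gamma>' * real N) * (1 / 3)"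
      proof -
        have "measure disorder {g. LW p N \<beta> g \<le> - (\<eta>' * real N)} \<le> exp (- k' * real N)"
          using elim(1) \<beta>b unfolding k'_def by simp
        also have "\<dots> \<le> exp (- (2 * \<gamma>') * real N)"
          using mult_right_mono[OF \<gamma>'(2), of "real N"] by simp
        also have "\<dots> = exp (- \<gamma>' * real N) * exp (- \<gamma>' * real N)" by (simp flip: exp_add)
        also have "\<dots> \<le> exp (- \<gamma>' * real N) * (1 / 3)" using elim(6) by (intro mult_left_mono) auto
        finally show ?thesis .
      qed
      also have "exp (\<eta>' * real N) * (measure disorder {g. - (2 * \<eta> * real N) \<le> lse A (X \<beta> g)} +
           exp (\<eta>' * real N - 2 * \<eta> * real N)) \<le> exp (- \<gamma>' * real N) * (1 / 3) + exp (- \<gamma>' * real N) * (1 / 3)"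
      proof -
        have "measure disorder {g. - (2 * \<eta> * real N) \<le> lse A (X \<beta> g)} \<le>
           measure disorder {g. (\<integral>g. lse A (X \<beta> g) \<partial>disorder) + \<eta> * real N \<le> lse A (X \<beta> g)}"
          using lA by (intro measure_disorder_mono) (auto simp: lA_def)
        also have "\<dots> \<le> exp (- k * real N)"
          unfolding k_def by (rule subgaussian_tails_linear(1)[OF sub]) (use N b \<eta> in auto)
        finally have m: "measure disorder {g. - (2 * \<eta> * real N) \<le> lse A (X \<beta> g)} \<le> exp (- k * real N)" .
        have third: "exp (x * real N) \<le> exp (- \<gamma>' * real N) * (1 / 3)" if "x \<le> - (2 * \<gamma>')" for x
        proof -
          have "exp (x * real N) \<le> exp (- (2 * \<gamma>') * real N)"
            using mult_right_mono[OF that, of "real N"] by simp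
          also have "\<dots> = exp (- \<gamma>' * real N) * exp (- \<gamma>' * real N)" by (simp flip: exp_add)
          also have "\<dots> \<le> exp (- \<gamma>' * real N) * (1 / 3)" using elim(6) by (intro mult_left_mono) auto
          finally show ?thesis .
        qed
        have "exp (\<eta>' * real N) * (measure disorder {g. - (2 * \<eta> * real N) \<le> lse A (X \<beta> g)} +
           exp (\<eta>' * real N - 2 * \<eta> * real N)) \<le> exp (\<eta>' * real N) * (exp (- k * real N) +
           exp (\<eta>' * real N - 2 * \<eta> * real N))"
          using m by (intro mult_left_mono add_mono) auto
        also have "\<dots> = exp ((\<eta>' - k) * real N) + exp ((2 * \<eta>' - 2 * \<eta>) * real N)"
          by (simp add: distrib_left algebra_simps flip: exp_add)
        also have "\<dots> \<le> exp (- \<gamma>' * real N) * (1 / 3) + exp (- \<gamma>' * real N) * (1 / 3)"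
          using \<eta>' \<gamma>' by (intro add_mono third) auto
        finally show ?thesis .
      qed
      finally show "Q p N \<beta> t \<le> exp (- \<gamma>' * real N)" by simp
    qed
  qed
  then show ?thesis using \<gamma>'(1) by blast
qed

lemma Q_eq_0:
  assumes "t > 1"
  shows "Q p N \<beta> t = 0"
proof -
  have "rho p N \<beta> t \<sigma> g = 0" if "\<sigma> \<in> Sigma N" for \<sigma> g
  proof -
    have "rho p N \<beta> t \<sigma> g = avg (Sigma N) (Xe p N \<beta> g) (\<lambda>_. 0)"
      unfolding rho_def
    proof (rule avg_cong)
      fix \<tau> assume "\<tau> \<in> Sigma N"
      then have "\<bar>overlap N \<sigma> \<tau> ^ p\<bar> \<le> 1" using that by (intro overlap_pow_abs_le_1)
      then show "of_bool (t \<le> overlap N \<sigma> \<tau> ^ p) = (0 :: real)" using assms by auto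
    qed
    then show ?thesis by (simp add: avg_const)
  qed
  then have "pairfrac p N \<beta> t g = avg (Sigma N) (Xe p N \<beta> g) (\<lambda>_. 0)" for g
    unfolding pairfrac_def by (intro avg_cong)
  then show ?thesis by (simp add: Q_def avg_const)
qed

text \<open>Each descent divides the threshold by 3/2, so from above 1 it takes \<open>n\<close>
  descents with \<open>(2 / 3) ^ n < t\<close> to reach \<open>t\<close>. The rate may deteriorate
  but stays positive.\<close>

lemma overlap_power_tail:
  assumes "t > 0"
  shows "\<exists>\<gamma>>0. \<forall>\<^sub>F N in sequentially. \<forall>\<beta>\<in>{a0..b0}. Q p N \<beta> t \<le> exp (- \<gamma> * real N)"
proof -
  have base: "\<exists>\<gamma>>0. \<forall>\<^sub>F N in sequentially. \<forall>\<beta>\<in>{a0..b0}. Q p N \<beta> t \<le> exp (- \<gamma> * real N)" if "t > 1" for t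
    using that by (intro exI[of _ 1]) (auto simp: Q_eq_0)
  have "t > 0 \<Longrightarrow> t > (2 / 3) ^ n \<Longrightarrow>
     \<exists>\<gamma>>0. \<forall>\<^sub>F N in sequentially. \<forall>\<beta>\<in>{a0..b0}. Q p N \<beta> t \<le> exp (- \<gamma> * real N)" for n
  proof (induction n arbitrary: t)
    case 0
    then show ?case using base by simp
  next
    case (Suc n)
    show ?case
    proof (cases "t > 1")
      case False
      have "3 / 2 * t > 0" "3 / 2 * t > (2 / 3) ^ n" using Suc.prems by auto
      from Suc.IH[OF this] obtain \<gamma> where "\<gamma> > 0"
        "\<forall>\<^sub>F N in sequentially. \<forall>\<beta>\<in>{a0..b0}. Q p N \<beta> (3 / 2 * t) \<le> exp (- \<gamma> * real N)" by blast
      then show ?thesis using overlap_step[OF Suc.prems(1)] False by auto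
    qed (rule base)
  qed
  moreover obtain n where "(2 / 3) ^ n < t"
    using real_arch_pow_inv[OF assms, of "2 / 3"] by auto
  ultimately show ?thesis using assms by blast
qed

end

section \<open>Positivity of the overlap\<close>

lemma rep_marginal:
  assumes "finite \<Omega>" "\<Omega> \<noteq> {}" "l < n"
  shows "rep \<Omega> X n (\<lambda>\<tau>. u (\<tau> l)) = avg \<Omega> X u"
proof -
  let ?k = "\<lambda>l' \<omega>. sm \<Omega> X \<omega> * (if l' = l then u \<omega> else 1)"
  have "rep \<Omega> X n (\<lambda>\<tau>. u (\<tau> l)) = (\<Sum>\<tau>\<in>PiE {..<n} (\<lambda>_. \<Omega>). \<Prod>l'<n. ?k l' (\<tau> l'))"
    unfolding rep_def using assms(3) by (intro sum.cong refl) (simp add: prod.distrib prod.delta)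
  also have "\<dots> = (\<Prod>l'<n. \<Sum>\<omega>\<in>\<Omega>. ?k l' \<omega>)"
    using assms by (subst prod_sum_PiE) auto
  also have "\<dots> = (\<Prod>l'<n. if l' = l then avg \<Omega> X u else 1)"
    using sum_sm[OF assms(1,2), of X] by (intro prod.cong refl) (auto simp: avg_def)
  also have "\<dots> = avg \<Omega> X u" using assms(3) by (simp add: prod.delta)
  finally show ?thesis .
qed

lemma rep_const:
  assumes "finite \<Omega>" "\<Omega> \<noteq> {}"
  shows "rep \<Omega> X n (\<lambda>_. k) = k"
proof -
  have "rep \<Omega> X n (\<lambda>_. k) = (\<Sum>\<tau>\<in>PiE {..<n} (\<lambda>_. \<Omega>). \<Prod>l<n. sm \<Omega> X (\<tau> l)) * k"
    by (simp add: rep_def sum_distrib_right)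
  also have "(\<Sum>\<tau>\<in>PiE {..<n} (\<lambda>_. \<Omega>). \<Prod>l<n. sm \<Omega> X (\<tau> l)) = (\<Prod>l<n. \<Sum>\<omega>\<in>\<Omega>. sm \<Omega> X \<omega>)"
    using assms by (subst prod_sum_PiE) auto
  finally show ?thesis by (simp add: sum_sm[OF assms])
qed

lemma rep_mono:
  assumes "\<And>\<tau>. \<tau> \<in> PiE {..<n} (\<lambda>_. \<Omega>) \<Longrightarrow> f \<tau> \<le> h \<tau>"
  shows "rep \<Omega> X n f \<le> rep \<Omega> X n h"
  unfolding rep_def by (intro sum_mono mult_left_mono assms prod_nonneg) (auto simp: sm_nonneg)

lemma rep_cong:
  assumes "\<And>\<tau>. \<tau> \<in> PiE {..<n} (\<lambda>_. \<Omega>) \<Longrightarrow> f \<tau> = h \<tau>"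
  shows "rep \<Omega> X n f = rep \<Omega> X n h"
  unfolding rep_def using assms by (intro sum.cong) auto

lemma rep_add: "rep \<Omega> X n (\<lambda>\<tau>. f \<tau> + h \<tau>) = rep \<Omega> X n f + rep \<Omega> X n h"
  by (simp add: rep_def distrib_left sum.distrib)

lemma rep_diff: "rep \<Omega> X n (\<lambda>\<tau>. f \<tau> - h \<tau>) = rep \<Omega> X n f - rep \<Omega> X n h"
  by (simp add: rep_def right_diff_distrib sum_subtractf)

lemma rep_cmult: "rep \<Omega> X n (\<lambda>\<tau>. k * f \<tau>) = k * rep \<Omega> X n f"
  by (simp add: rep_def sum_distrib_left mult_ac)

lemma rep_sum: "rep \<Omega> X n (\<lambda>\<tau>. \<Sum>i\<in>I. f i \<tau>) = (\<Sum>i\<in>I. rep \<Omega> X n (f i))"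
  unfolding rep_def sum_distrib_left by (rule sum.swap)

lemma rep_abs_le:
  assumes "finite \<Omega>" "\<Omega> \<noteq> {}" "\<And>\<tau>. \<tau> \<in> PiE {..<n} (\<lambda>_. \<Omega>) \<Longrightarrow> \<bar>f \<tau>\<bar> \<le> B"
  shows "\<bar>rep \<Omega> X n f\<bar> \<le> B"
proof -
  have "rep \<Omega> X n f \<le> rep \<Omega> X n (\<lambda>_. B)" "rep \<Omega> X n (\<lambda>_. - B) \<le> rep \<Omega> X n f"
    using assms(3) by (auto intro!: rep_mono simp: abs_le_iff minus_le_iff)
  then show ?thesis by (simp add: rep_const assms)
qed

lemma abs_rep_le: "\<bar>rep \<Omega> X n f\<bar> \<le> rep \<Omega> X n (\<lambda>\<tau>. \<bar>f \<tau>\<bar>)"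
proof -
  have "rep \<Omega> X n f \<le> rep \<Omega> X n (\<lambda>\<tau>. \<bar>f \<tau>\<bar>)" by (rule rep_mono) auto
  moreover have "rep \<Omega> X n (\<lambda>\<tau>. (-1) * f \<tau>) \<le> rep \<Omega> X n (\<lambda>\<tau>. \<bar>f \<tau>\<bar>)" by (rule rep_mono) auto
  ultimately show ?thesis unfolding rep_cmult by simp
qed

text \<open>The last replica is integrated first, given the others: the form in which a fresh
  replica enters the Ghirlanda-Guerra identities.\<close>

lemma rep_Suc:
  "rep \<Omega> X (Suc n) f = rep \<Omega> X n (\<lambda>\<tau>. avg \<Omega> X (\<lambda>\<omega>. f (\<tau>(n := \<omega>))))"
proof -
  have inj: "inj_on (\<lambda>(y, g). g(n := y)) (\<Omega> \<times> PiE {..<n} (\<lambda>_. \<Omega>))"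
  proof (rule inj_onI, clarify)
    fix y g y' g' assume g: "g \<in> PiE {..<n} (\<lambda>_. \<Omega>)" "g' \<in> PiE {..<n} (\<lambda>_. \<Omega>)" and e: "g(n := y) = g'(n := y')"
    have "y = y'" using fun_cong[OF e, of n] by simp
    moreover have "g k = g' k" for k
      using fun_cong[OF e, of k] g by (cases "k = n") (auto simp: PiE_def extensional_def)
    ultimately show "y = y' \<and> g = g'" by auto
  qed
  have "rep \<Omega> X (Suc n) f =
     (\<Sum>(\<omega>, \<tau>)\<in>\<Omega> \<times> PiE {..<n} (\<lambda>_. \<Omega>). (\<Prod>l<Suc n. sm \<Omega> X ((\<tau>(n := \<omega>)) l)) * f (\<tau>(n := \<omega>)))"
    unfolding rep_def lessThan_Suc PiE_insert_eq by (subst sum.reindex[OF inj]) (simp add: split_beta' o_def)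
  also have "\<dots> = (\<Sum>\<omega>\<in>\<Omega>. \<Sum>\<tau>\<in>PiE {..<n} (\<lambda>_. \<Omega>). (\<Prod>l<n. sm \<Omega> X (\<tau> l)) * (sm \<Omega> X \<omega> * f (\<tau>(n := \<omega>))))"
    unfolding sum.cartesian_product[symmetric] by (intro sum.cong refl) (simp add: lessThan_Suc mult_ac)
  also have "\<dots> = rep \<Omega> X n (\<lambda>\<tau>. avg \<Omega> X (\<lambda>\<omega>. f (\<tau>(n := \<omega>))))"
    by (subst sum.swap) (simp add: rep_def avg_def sum_distrib_left)
  finally show ?thesis .
qed

lemma integrable_rep_bounded:
  assumes "finite \<Omega>" "\<Omega> \<noteq> {}" and [measurable]: "\<And>\<omega>. (\<lambda>g. X g \<omega>) \<in> borel_measurable disorder"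
    "\<And>\<tau>. (\<lambda>g. f g \<tau>) \<in> borel_measurable disorder"
    and "\<And>g \<tau>. \<tau> \<in> PiE {..<n} (\<lambda>_. \<Omega>) \<Longrightarrow> \<bar>f g \<tau>\<bar> \<le> B"
  shows "integrable disorder (\<lambda>g. rep \<Omega> (X g) n (f g))"
proof (rule integrable_disorder_bounded[where B = B])
  show "(\<lambda>g. rep \<Omega> (X g) n (f g)) \<in> borel_measurable disorder"
    unfolding rep_def using measurable_sm[of X] by measurable
qed (use assms in \<open>auto intro: rep_abs_le\<close>)

lemma prod_sm_le_1:
  assumes "finite \<Omega>" "\<tau> \<in> PiE {..<n} (\<lambda>_. \<Omega>)"
  shows "\<bar>\<Prod>l<n. sm \<Omega> X (\<tau> l)\<bar> \<le> 1"
proof -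
  have "0 \<le> (\<Prod>l<n. sm \<Omega> X (\<tau> l))" "(\<Prod>l<n. sm \<Omega> X (\<tau> l)) \<le> 1"
    using assms by (auto intro!: prod_nonneg prod_le_1 sm_nonneg sm_le_1 simp: PiE_def Pi_def)
  then show ?thesis by simp
qed

text \<open>\<open>f\<close> depends on the configurations only, so it passes through the
  integration by parts of the product of \<open>n\<close> Gibbs weights.\<close>

lemma gibbs_ibp_rep:
  assumes fin: "finite \<Omega>" "\<Omega> \<noteq> {}" "finite J" and K: "K \<subseteq> J" and l: "l < n"
  shows "(\<integral>g. rep \<Omega> (en J a c g) n (\<lambda>\<tau>. f \<tau> * (\<Sum>i\<in>K. b i (\<tau> l) * g i)) \<partial>disorder) =
    (\<integral>g. rep \<Omega> (en J a c g) n (\<lambda>\<tau>. f \<tau> * ((\<Sum>l'<n. \<Sum>i\<in>K. b i (\<tau> l) * a i (\<tau> l')) -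
       real n * avg \<Omega> (en J a c g) (\<lambda>\<omega>. \<Sum>i\<in>K. b i (\<tau> l) * a i \<omega>))) \<partial>disorder)"
proof -
  let ?P = "\<lambda>g \<tau>. \<Prod>l<n. sm \<Omega> (en J a c g) (\<tau> l)" and ?T = "PiE {..<n} (\<lambda>_. \<Omega>)"
  let ?D = "\<lambda>g \<tau> i. (\<Sum>l'<n. a i (\<tau> l')) - real n * avg \<Omega> (en J a c g) (a i)"
  have one: "(\<integral>g. g i * ?P g \<tau> \<partial>disorder) = (\<integral>g. ?P g \<tau> * ?D g \<tau> i \<partial>disorder)" if "i \<in> K" "\<tau> \<in> ?T" for i \<tau>
    using gibbs_ibp_prod[of \<Omega> J "{..<n}" i \<tau> a c] fin that K by (auto simp: PiE_def Pi_def)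
  have i1: "integrable disorder (\<lambda>g. g i * ?P g \<tau>)" if "\<tau> \<in> ?T" for i \<tau>
    by (rule integrable_coordinate_mult[where B = 1]) (use prod_sm_le_1[OF fin(1) that] in auto)
  have i2: "integrable disorder (\<lambda>g. ?P g \<tau> * ?D g \<tau> i)" if t: "\<tau> \<in> ?T" for i \<tau>
  proof (rule integrable_disorder_bounded)
    fix g
    have "\<bar>avg \<Omega> (en J a c g) (a i)\<bar> \<le> (\<Sum>\<omega>\<in>\<Omega>. \<bar>a i \<omega>\<bar>)"
      by (rule avg_abs_le[OF fin(1,2)]) (use fin in \<open>auto intro: member_le_sum\<close>)
    then have "\<bar>real n * avg \<Omega> (en J a c g) (a i)\<bar> \<le> real n * (\<Sum>\<omega>\<in>\<Omega>. \<bar>a i \<omega>\<bar>)"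
      by (simp add: abs_mult mult_left_mono)
    then have "\<bar>?D g \<tau> i\<bar> \<le> \<bar>\<Sum>l'<n. a i (\<tau> l')\<bar> + real n * (\<Sum>\<omega>\<in>\<Omega>. \<bar>a i \<omega>\<bar>)"
      using abs_triangle_ineq4[of "\<Sum>l'<n. a i (\<tau> l')" "real n * avg \<Omega> (en J a c g) (a i)"] by linarith
    then show "\<bar>?P g \<tau> * ?D g \<tau> i\<bar> \<le> 1 * (\<bar>\<Sum>l'<n. a i (\<tau> l')\<bar> + real n * (\<Sum>\<omega>\<in>\<Omega>. \<bar>a i \<omega>\<bar>))"
      unfolding abs_mult[of "?P g \<tau>"] using prod_sm_le_1[OF fin(1) t] by (intro mult_mono) auto
  qed measurable
  have "(\<integral>g. rep \<Omega> (en J a c g) n (\<lambda>\<tau>. f \<tau> * (\<Sum>i\<in>K. b i (\<tau> l) * g i)) \<partial>disorder) =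
    (\<integral>g. (\<Sum>\<tau>\<in>?T. \<Sum>i\<in>K. f \<tau> * b i (\<tau> l) * (g i * ?P g \<tau>)) \<partial>disorder)"
    by (simp add: rep_def sum_distrib_left sum_distrib_right mult_ac)
  also have "\<dots> = (\<Sum>\<tau>\<in>?T. \<Sum>i\<in>K. f \<tau> * b i (\<tau> l) * (\<integral>g. g i * ?P g \<tau> \<partial>disorder))"
    using i1 by (simp add: Bochner_Integration.integral_sum)
  also have "\<dots> = (\<Sum>\<tau>\<in>?T. \<Sum>i\<in>K. f \<tau> * b i (\<tau> l) * (\<integral>g. ?P g \<tau> * ?D g \<tau> i \<partial>disorder))"
    using one by (intro sum.cong refl) auto
  also have "\<dots> = (\<integral>g. (\<Sum>\<tau>\<in>?T. \<Sum>i\<in>K. f \<tau> * b i (\<tau> l) * (?P g \<tau> * ?D g \<tau> i)) \<partial>disorder)"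
    using i2 by (simp add: Bochner_Integration.integral_sum)
  also have "(\<lambda>g. \<Sum>\<tau>\<in>?T. \<Sum>i\<in>K. f \<tau> * b i (\<tau> l) * (?P g \<tau> * ?D g \<tau> i)) =
    (\<lambda>g. rep \<Omega> (en J a c g) n (\<lambda>\<tau>. f \<tau> * ((\<Sum>l'<n. \<Sum>i\<in>K. b i (\<tau> l) * a i (\<tau> l')) -
       real n * avg \<Omega> (en J a c g) (\<lambda>\<omega>. \<Sum>i\<in>K. b i (\<tau> l) * a i \<omega>))))"
  proof
    fix g
    have "(\<Sum>i\<in>K. b i (\<tau> l) * ?D g \<tau> i) = (\<Sum>l'<n. \<Sum>i\<in>K. b i (\<tau> l) * a i (\<tau> l')) -
       real n * avg \<Omega> (en J a c g) (\<lambda>\<omega>. \<Sum>i\<in>K. b i (\<tau> l) * a i \<omega>)" for \<tau>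
      unfolding avg_sum avg_cmult by (subst sum.swap)
        (simp add: right_diff_distrib sum_subtractf sum_distrib_left mult_ac)
    then have "(\<Sum>i\<in>K. f \<tau> * b i (\<tau> l) * (?P g \<tau> * ?D g \<tau> i)) = ?P g \<tau> * (f \<tau> * ((\<Sum>l'<n. \<Sum>i\<in>K. b i (\<tau> l) * a i (\<tau> l')) -
       real n * avg \<Omega> (en J a c g) (\<lambda>\<omega>. \<Sum>i\<in>K. b i (\<tau> l) * a i \<omega>)))" for \<tau>
      by (subst (asm) eq_commute) (simp add: sum_distrib_left mult_ac)
    then show "(\<Sum>\<tau>\<in>?T. \<Sum>i\<in>K. f \<tau> * b i (\<tau> l) * (?P g \<tau> * ?D g \<tau> i)) =
      rep \<Omega> (en J a c g) n (\<lambda>\<tau>. f \<tau> * ((\<Sum>l'<n. \<Sum>i\<in>K. b i (\<tau> l) * a i (\<tau> l')) -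
       real n * avg \<Omega> (en J a c g) (\<lambda>\<omega>. \<Sum>i\<in>K. b i (\<tau> l) * a i \<omega>)))"
      by (simp only: rep_def)
  qed
  finally show ?thesis .
qed

text \<open>A deterministic reference weight \<open>exp (c \<omega>)\<close>, perturbed by small independent \<open>s\<close>-spin
  Hamiltonians \<open>s = 1, \<dots>, S\<close> of the configuration \<open>sg \<omega>\<close>.\<close>
locale perturbed =
  fixes \<Omega> :: "'o set" and c :: "'o \<Rightarrow> real" and sg :: "'o \<Rightarrow> nat \<Rightarrow> real"
    and M S :: nat and \<eta> :: real
  assumes fin: "finite \<Omega>" and ne: "\<Omega> \<noteq> {}" and sg: "\<And>\<omega>. \<omega> \<in> \<Omega> \<Longrightarrow> sg \<omega> \<in> Sigma M"
    and M: "M \<ge> 1" and \<eta>: "\<eta> > 0"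
begin

definition R :: "'o \<Rightarrow> 'o \<Rightarrow> real" where "R \<omega> \<omega>' = overlap M (sg \<omega>) (sg \<omega>')"

text \<open>The length of a list tells the order \<open>s\<close> of its interaction, so one
  disorder carries independent \<open>s\<close>-spin Hamiltonians for all \<open>s\<close> from 1 to
  \<open>S\<close>.\<close>

definition J :: "nat list set" where "J = (\<Union>s\<in>{1..S}. idx s M)"

text \<open>The strengths are integer multiples of \<open>\<eta>\<close>: differences between
  neighbouring integers take the place of derivatives with respect to the strength.\<close>

definition ax :: "(nat \<Rightarrow> nat) \<Rightarrow> nat list \<Rightarrow> 'o \<Rightarrow> real" where
  "ax x i \<omega> = \<eta> * real (x (length i)) * hc (length i) M i (sg \<omega>)"

definition pot :: "(nat \<Rightarrow> nat) \<Rightarrow> (nat list \<Rightarrow> real) \<Rightarrow> 'o \<Rightarrow> real" where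
  "pot x g = en J (ax x) c g"

definition h :: "nat \<Rightarrow> (nat list \<Rightarrow> real) \<Rightarrow> 'o \<Rightarrow> real" where
  "h s g \<omega> = \<eta> * H s M g (sg \<omega>)"

definition eh :: "nat \<Rightarrow> (nat \<Rightarrow> nat) \<Rightarrow> real" where
  "eh s x = (\<integral>g. avg \<Omega> (pot x g) (h s g) \<partial>disorder)"

text \<open>Thermal and disorder fluctuations together, since the centring is by the full
  expectation \<open>eh s x\<close>.\<close>

definition dev :: "nat \<Rightarrow> (nat \<Rightarrow> nat) \<Rightarrow> real" where
  "dev s x = (\<integral>g. avg \<Omega> (pot x g) (\<lambda>\<omega>. \<bar>h s g \<omega> - eh s x\<bar>) \<partial>disorder)"

definition pe :: "(real \<Rightarrow> real) \<Rightarrow> (nat \<Rightarrow> nat) \<Rightarrow> real" where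
  "pe f x = (\<integral>g. avg \<Omega> (pot x g) (\<lambda>\<omega>. avg \<Omega> (pot x g) (\<lambda>\<omega>'. f (R \<omega> \<omega>'))) \<partial>disorder)"

lemma finite_J: "finite J" by (simp add: J_def)

lemma measurable_pot [measurable]: "(\<lambda>g. pot x g \<omega>) \<in> borel_measurable disorder"
  unfolding pot_def by measurable

lemma measurable_h [measurable]: "(\<lambda>g. h s g \<omega>) \<in> borel_measurable disorder"
  unfolding h_def by measurable

lemma R_le_1: "\<omega> \<in> \<Omega> \<Longrightarrow> \<omega>' \<in> \<Omega> \<Longrightarrow> \<bar>R \<omega> \<omega>'\<bar> \<le> 1"
  unfolding R_def by (intro overlap_abs_le_1 sg)

lemma R_self: "\<omega> \<in> \<Omega> \<Longrightarrow> R \<omega> \<omega> = 1"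
  unfolding R_def by (intro overlap_self M sg)

lemma sum_J: "(\<Sum>i\<in>J. f i) = (\<Sum>s=1..S. \<Sum>i\<in>idx s M. f i)" for f :: "nat list \<Rightarrow> real"
  unfolding J_def by (rule sum.UNION_disjoint) (auto simp: idx_def simp del: finite_idx intro: finite_idx[unfolded idx_def])

lemma pot_eq: "pot x g \<omega> = (\<Sum>s=1..S. real (x s) * h s g \<omega>) + c \<omega>"
proof -
  have "(\<Sum>i\<in>idx s M. ax x i \<omega> * g i) = real (x s) * h s g \<omega>" for s
    unfolding h_def H_hc sum_distrib_left
    by (intro sum.cong refl) (auto simp: ax_def idx_def)
  then show ?thesis by (simp add: pot_def en_def sum_J)
qed

lemma pot_upd:
  assumes "s \<in> {1..S}"
  shows "pot (x(s := x s + 1)) g \<omega> = pot x g \<omega> + h s g \<omega>"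
proof -
  have "(\<Sum>s'=1..S. real ((x(s := x s + 1)) s') * h s' g \<omega>) =
     (\<Sum>s'=1..S. real (x s') * h s' g \<omega> + (if s' = s then h s g \<omega> else 0))"
    by (intro sum.cong refl) (auto simp: algebra_simps)
  then show ?thesis using assms by (simp add: pot_eq sum.distrib sum.delta)
qed

lemma subgaussian_pot:
  assumes "\<And>s. s \<in> {1..S} \<Longrightarrow> x s \<le> B"
  shows "subgaussian (\<lambda>g. lse \<Omega> (pot x g)) (real S * ((real B)\<^sup>2 * \<eta>\<^sup>2 * real M))"
  unfolding pot_def
proof (rule subgaussian_lse_en[where A = "\<lambda>i. (\<eta> * real (x (length i))) * real M powr (- (real (length i) - 1) / 2)"])
  show "\<bar>ax x i \<omega>\<bar> \<le> (\<eta> * real (x (length i))) * real M powr (- (real (length i) - 1) / 2)"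
    if "i \<in> J" "\<omega> \<in> \<Omega>" for i \<omega>
  proof -
    have "i \<in> idx (length i) M" using that(1) by (auto simp: J_def idx_def)
    from hc_abs[OF this sg[OF that(2)]] show ?thesis using \<eta> by (simp add: ax_def abs_mult)
  qed
  have "(\<Sum>i\<in>idx s M. ((\<eta> * real (x (length i))) * real M powr (- (real (length i) - 1) / 2))\<^sup>2) \<le>
      (real B)\<^sup>2 * \<eta>\<^sup>2 * real M" if s: "s \<in> {1..S}" for s
  proof -
    have "(\<Sum>i\<in>idx s M. ((\<eta> * real (x (length i))) * real M powr (- (real (length i) - 1) / 2))\<^sup>2) =
      (\<Sum>i\<in>idx s M. ((\<eta> * real (x s)) * real M powr (- (real s - 1) / 2))\<^sup>2)"
      by (intro sum.cong refl) (auto simp: idx_def)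
    also have "\<dots> = (\<eta> * real (x s))\<^sup>2 * real M"
      by (rule sum_hc_bound_square) (use M s in auto)
    also have "\<dots> \<le> (real B)\<^sup>2 * \<eta>\<^sup>2 * real M"
    proof -
      have "(real (x s))\<^sup>2 \<le> (real B)\<^sup>2" using assms[OF s] by (intro power_mono) auto
      then have "(real (x s))\<^sup>2 * (\<eta>\<^sup>2 * real M) \<le> (real B)\<^sup>2 * (\<eta>\<^sup>2 * real M)"
        by (rule mult_right_mono) auto
      then show ?thesis by (simp add: power_mult_distrib mult_ac)
    qed
    finally show ?thesis .
  qed
  then have "(\<Sum>s=1..S. \<Sum>i\<in>idx s M. ((\<eta> * real (x (length i))) * real M powr (- (real (length i) - 1) / 2))\<^sup>2) \<le>
      (\<Sum>s=1..S. (real B)\<^sup>2 * \<eta>\<^sup>2 * real M)" by (rule sum_mono)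
  then show "(\<Sum>i\<in>J. ((\<eta> * real (x (length i))) * real M powr (- (real (length i) - 1) / 2))\<^sup>2) \<le>
      real S * ((real B)\<^sup>2 * \<eta>\<^sup>2 * real M)" by (simp add: sum_J)
qed (use fin ne finite_J in auto)

lemma integrable_avg_h:
  assumes m: "\<And>g \<omega>. \<bar>u g \<omega>\<bar> \<le> \<bar>h s g \<omega>\<bar> + k" and [measurable]: "\<And>\<omega>. (\<lambda>g. u g \<omega>) \<in> borel_measurable disorder"
  shows "integrable disorder (\<lambda>g. avg \<Omega> (pot x g) (u g))"
  unfolding avg_def
proof (rule Bochner_Integration.integrable_sum)
  fix \<omega> assume w: "\<omega> \<in> \<Omega>"
  note [measurable] = measurable_sm[of "pot x" \<Omega> \<omega>, OF measurable_pot]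
  have ih: "integrable disorder (\<lambda>g. \<bar>h s g \<omega>\<bar> + \<bar>k\<bar>)" using integrable_H by (auto simp: h_def)
  show "integrable disorder (\<lambda>g. sm \<Omega> (pot x g) \<omega> * u g \<omega>)"
  proof (rule Bochner_Integration.integrable_bound[OF ih])
    have "\<bar>sm \<Omega> (pot x g) \<omega> * u g \<omega>\<bar> \<le> 1 * (\<bar>h s g \<omega>\<bar> + \<bar>k\<bar>)" for g
      unfolding abs_mult using sm_nonneg[of \<Omega> "pot x g" \<omega>] sm_le_1[OF fin w, of "pot x g"] m[of g \<omega>]
      by (intro mult_mono) auto
    then show "AE g in disorder. norm (sm \<Omega> (pot x g) \<omega> * u g \<omega>) \<le> norm (\<bar>h s g \<omega>\<bar> + \<bar>k\<bar>)" by simp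
  qed measurable
qed

lemma cov_h:
  assumes "s \<in> {1..S}"
  shows "(\<Sum>i\<in>idx s M. (\<eta> * hc s M i (sg \<omega>)) * ax x i \<omega>') = \<eta>\<^sup>2 * real (x s) * real M * R \<omega> \<omega>' ^ s"
proof -
  have "(\<Sum>i\<in>idx s M. (\<eta> * hc s M i (sg \<omega>)) * ax x i \<omega>') =
     (\<Sum>i\<in>idx s M. (\<eta>\<^sup>2 * real (x s)) * (hc s M i (sg \<omega>) * hc s M i (sg \<omega>')))"
    by (intro sum.cong refl) (auto simp: ax_def idx_def power2_eq_square)
  also have "\<dots> = (\<eta>\<^sup>2 * real (x s)) * (real M * overlap M (sg \<omega>) (sg \<omega>') ^ s)"
    unfolding sum_distrib_left[symmetric] using assms by (subst hc_cov[OF M]) auto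
  finally show ?thesis by (simp add: R_def mult_ac)
qed

lemma h_sum: "h s g \<omega> = (\<Sum>i\<in>idx s M. (\<eta> * hc s M i (sg \<omega>)) * g i)"
  by (simp add: h_def H_hc sum_distrib_left mult_ac)

lemma idx_subset_J: "s \<in> {1..S} \<Longrightarrow> idx s M \<subseteq> J"
  by (auto simp: J_def)

lemma eh_eq:
  assumes s: "s \<in> {1..S}"
  shows "eh s x = \<eta>\<^sup>2 * real (x s) * real M * (1 - pe (\<lambda>y. y ^ s) x)"
proof -
  let ?k = "\<eta>\<^sup>2 * real (x s) * real M"
  have d: "avg \<Omega> (pot x g) (\<lambda>\<omega>. ?k * R \<omega> \<omega> ^ s) = ?k" for g
  proof -
    have "avg \<Omega> (pot x g) (\<lambda>\<omega>. ?k * R \<omega> \<omega> ^ s) = avg \<Omega> (pot x g) (\<lambda>\<omega>. ?k)"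
      by (rule avg_cong) (simp add: R_self)
    then show ?thesis by (simp add: avg_const fin ne)
  qed
  have "eh s x = (\<integral>g. avg \<Omega> (pot x g) (\<lambda>\<omega>. \<Sum>i\<in>idx s M. (\<eta> * hc s M i (sg \<omega>)) * ax x i \<omega>) \<partial>disorder) -
    (\<integral>g. avg \<Omega> (pot x g) (\<lambda>\<omega>. avg \<Omega> (pot x g) (\<lambda>\<omega>'. \<Sum>i\<in>idx s M. (\<eta> * hc s M i (sg \<omega>)) * ax x i \<omega>')) \<partial>disorder)"
    unfolding eh_def h_sum[abs_def] pot_def by (rule gibbs_ibp[OF fin ne finite_J idx_subset_J[OF s]])
  also have "\<dots> = ?k - ?k * pe (\<lambda>y. y ^ s) x"
    unfolding cov_h[OF s] d by (simp add: avg_cmult pe_def disorder.prob_space[simplified])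
  finally show ?thesis by (simp add: algebra_simps)
qed

lemma pe_bound:
  assumes "\<And>y. \<bar>y\<bar> \<le> 1 \<Longrightarrow> \<bar>f y\<bar> \<le> B"
  shows "integrable disorder (\<lambda>g. avg \<Omega> (pot x g) (\<lambda>\<omega>. avg \<Omega> (pot x g) (\<lambda>\<omega>'. f (R \<omega> \<omega>'))))"
    and "\<bar>pe f x\<bar> \<le> B"
proof -
  have b: "\<bar>avg \<Omega> (pot x g) (\<lambda>\<omega>'. f (R \<omega> \<omega>'))\<bar> \<le> B" if "\<omega> \<in> \<Omega>" for g \<omega>
    using that by (intro avg_abs_le fin ne assms R_le_1)
  show i: "integrable disorder (\<lambda>g. avg \<Omega> (pot x g) (\<lambda>\<omega>. avg \<Omega> (pot x g) (\<lambda>\<omega>'. f (R \<omega> \<omega>'))))"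
    by (rule integrable_avg_bounded[where B = B]) (use fin ne b in \<open>auto intro!: measurable_avg\<close>)
  have b2: "\<bar>avg \<Omega> (pot x g) (\<lambda>\<omega>. avg \<Omega> (pot x g) (\<lambda>\<omega>'. f (R \<omega> \<omega>')))\<bar> \<le> B" for g
    by (intro avg_abs_le fin ne b)
  have "\<bar>pe f x\<bar> \<le> (\<integral>g. \<bar>avg \<Omega> (pot x g) (\<lambda>\<omega>. avg \<Omega> (pot x g) (\<lambda>\<omega>'. f (R \<omega> \<omega>')))\<bar> \<partial>disorder)"
    unfolding pe_def by (rule integral_abs_bound)
  also have "\<dots> \<le> (\<integral>g. B \<partial>disorder)" using i b2 by (intro integral_mono) auto
  finally show "\<bar>pe f x\<bar> \<le> B" by (simp add: disorder.prob_space[simplified])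
qed

lemma power_abs_le_1: "\<bar>y\<bar> \<le> 1 \<Longrightarrow> \<bar>y ^ s\<bar> \<le> 1" for y :: real
  by (simp add: power_abs power_le_one)

lemma eh_bounds:
  assumes "s \<in> {1..S}"
  shows "0 \<le> eh s x" "eh s x \<le> 2 * \<eta>\<^sup>2 * real (x s) * real M"
proof -
  have "\<bar>pe (\<lambda>y. y ^ s) x\<bar> \<le> 1" by (rule pe_bound(2)) (rule power_abs_le_1)
  then have 1: "0 \<le> 1 - pe (\<lambda>y. y ^ s) x" "1 - pe (\<lambda>y. y ^ s) x \<le> 2" by auto
  have k: "0 \<le> \<eta>\<^sup>2 * real (x s) * real M" by simp
  show "0 \<le> eh s x" unfolding eh_eq[OF assms] using 1 k by (intro mult_nonneg_nonneg) auto
  show "eh s x \<le> 2 * \<eta>\<^sup>2 * real (x s) * real M" unfolding eh_eq[OF assms]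
    using mult_left_mono[OF 1(2) k] by simp
qed

text \<open>The identity of Ghirlanda and Guerra with its error term: integrate by parts in
  \<open>\<langle>f (h (\<tau> l) - E\<langle>h\<rangle>)\<rangle>\<close>.\<close>
lemma ghirlanda_guerra:
  assumes s: "s \<in> {1..S}" and l: "l < n" and x: "x s \<ge> 1"
    and f: "\<And>\<tau>. \<bar>f \<tau>\<bar> \<le> 1"
  shows "\<bar>(\<integral>g. rep \<Omega> (pot x g) n (\<lambda>\<tau>. f \<tau> * ((\<Sum>l'<n. R (\<tau> l) (\<tau> l') ^ s) -
       real n * avg \<Omega> (pot x g) (\<lambda>\<omega>. R (\<tau> l) \<omega> ^ s))) \<partial>disorder) -
     (\<integral>g. rep \<Omega> (pot x g) n f \<partial>disorder) * (1 - pe (\<lambda>y. y ^ s) x)\<bar> \<le> dev s x / (\<eta>\<^sup>2 * real (x s) * real M)"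
proof -
  let ?k = "\<eta>\<^sup>2 * real (x s) * real M"
  have k: "?k > 0" using x M \<eta> by simp
  let ?I = "\<integral>g. rep \<Omega> (pot x g) n (\<lambda>\<tau>. f \<tau> * ((\<Sum>l'<n. R (\<tau> l) (\<tau> l') ^ s) -
       real n * avg \<Omega> (pot x g) (\<lambda>\<omega>. R (\<tau> l) \<omega> ^ s))) \<partial>disorder"
  have "(\<integral>g. rep \<Omega> (pot x g) n (\<lambda>\<tau>. f \<tau> * h s g (\<tau> l)) \<partial>disorder) =
    (\<integral>g. rep \<Omega> (pot x g) n (\<lambda>\<tau>. f \<tau> * ((\<Sum>l'<n. \<Sum>i\<in>idx s M. (\<eta> * hc s M i (sg (\<tau> l))) * ax x i (\<tau> l')) -
       real n * avg \<Omega> (pot x g) (\<lambda>\<omega>. \<Sum>i\<in>idx s M. (\<eta> * hc s M i (sg (\<tau> l))) * ax x i \<omega>))) \<partial>disorder)"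
    unfolding h_sum[abs_def] pot_def by (rule gibbs_ibp_rep[OF fin ne finite_J idx_subset_J[OF s] l])
  also have "\<dots> = (\<integral>g. ?k * rep \<Omega> (pot x g) n (\<lambda>\<tau>. f \<tau> * ((\<Sum>l'<n. R (\<tau> l) (\<tau> l') ^ s) -
       real n * avg \<Omega> (pot x g) (\<lambda>\<omega>. R (\<tau> l) \<omega> ^ s))) \<partial>disorder)"
    unfolding cov_h[OF s] avg_cmult rep_cmult[symmetric] sum_distrib_left[symmetric]
    by (intro Bochner_Integration.integral_cong refl arg_cong[where f = "rep _ _ _"] ext) (simp add: algebra_simps)
  finally have ibp: "(\<integral>g. rep \<Omega> (pot x g) n (\<lambda>\<tau>. f \<tau> * h s g (\<tau> l)) \<partial>disorder) = ?k * ?I" by simp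
  have i0: "integrable disorder (\<lambda>g. rep \<Omega> (pot x g) n f)"
    by (rule integrable_rep_bounded[where B = 1]) (use fin ne f in auto)
  have i1: "integrable disorder (\<lambda>g. avg \<Omega> (pot x g) (\<lambda>\<omega>. \<bar>h s g \<omega> - eh s x\<bar>))"
    by (rule integrable_avg_h[where s = s and k = "\<bar>eh s x\<bar>"]) auto
  have dom: "\<bar>rep \<Omega> (pot x g) n (\<lambda>\<tau>. f \<tau> * (h s g (\<tau> l) - eh s x))\<bar> \<le>
      avg \<Omega> (pot x g) (\<lambda>\<omega>. \<bar>h s g \<omega> - eh s x\<bar>)" for g
  proof -
    have "\<bar>rep \<Omega> (pot x g) n (\<lambda>\<tau>. f \<tau> * (h s g (\<tau> l) - eh s x))\<bar> \<le>
       rep \<Omega> (pot x g) n (\<lambda>\<tau>. \<bar>f \<tau> * (h s g (\<tau> l) - eh s x)\<bar>)" by (rule abs_rep_le)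
    also have "\<dots> \<le> rep \<Omega> (pot x g) n (\<lambda>\<tau>. \<bar>h s g (\<tau> l) - eh s x\<bar>)"
      by (rule rep_mono) (use mult_right_mono[OF f abs_ge_zero] in \<open>auto simp: abs_mult\<close>)
    also have "\<dots> = avg \<Omega> (pot x g) (\<lambda>\<omega>. \<bar>h s g \<omega> - eh s x\<bar>)"
      by (rule rep_marginal[OF fin ne l, of _ "\<lambda>\<omega>. \<bar>h s g \<omega> - eh s x\<bar>"])
    finally show ?thesis .
  qed
  have mr [measurable]: "(\<lambda>g. rep \<Omega> (pot x g) n (\<lambda>\<tau>. f \<tau> * (h s g (\<tau> l) - eh s x))) \<in> borel_measurable disorder"
    unfolding rep_def using measurable_sm[of "pot x", OF measurable_pot] by measurable
  have i2: "integrable disorder (\<lambda>g. rep \<Omega> (pot x g) n (\<lambda>\<tau>. f \<tau> * (h s g (\<tau> l) - eh s x)))"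
    by (rule Bochner_Integration.integrable_bound[OF i1 mr])
       (use dom in \<open>auto intro: order_trans[OF _ abs_ge_self]\<close>)
  have split: "rep \<Omega> (pot x g) n (\<lambda>\<tau>. f \<tau> * h s g (\<tau> l)) =
     rep \<Omega> (pot x g) n (\<lambda>\<tau>. f \<tau> * (h s g (\<tau> l) - eh s x)) + eh s x * rep \<Omega> (pot x g) n f" for g
    unfolding rep_cmult[symmetric] rep_add[symmetric] by (simp add: algebra_simps)
  have "?k * ?I = (\<integral>g. rep \<Omega> (pot x g) n (\<lambda>\<tau>. f \<tau> * (h s g (\<tau> l) - eh s x)) \<partial>disorder) +
      eh s x * (\<integral>g. rep \<Omega> (pot x g) n f \<partial>disorder)"
    unfolding ibp[symmetric] split using i0 i2 by simp
  then have e: "?k * (?I - (\<integral>g. rep \<Omega> (pot x g) n f \<partial>disorder) * (1 - pe (\<lambda>y. y ^ s) x)) =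
      (\<integral>g. rep \<Omega> (pot x g) n (\<lambda>\<tau>. f \<tau> * (h s g (\<tau> l) - eh s x)) \<partial>disorder)"
    unfolding eh_eq[OF s] by (simp add: algebra_simps)
  have "\<bar>?k * (?I - (\<integral>g. rep \<Omega> (pot x g) n f \<partial>disorder) * (1 - pe (\<lambda>y. y ^ s) x))\<bar>
      \<le> (\<integral>g. \<bar>rep \<Omega> (pot x g) n (\<lambda>\<tau>. f \<tau> * (h s g (\<tau> l) - eh s x))\<bar> \<partial>disorder)"
    unfolding e by (rule integral_abs_bound)
  also have "\<dots> \<le> dev s x" unfolding dev_def using i1 i2 dom by (intro integral_mono) auto
  finally show ?thesis using k by (simp add: abs_mult le_divide_eq mult.commute[of ?k])
qed

text \<open>One more unit of strength adds exactly \<open>h s\<close> to the Hamiltonian, so by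
  convexity the increment of the free energy lies between the slopes at its two ends.\<close>

lemma eh_convex:
  assumes s: "s \<in> {1..S}"
  shows "eh s x \<le> (\<integral>g. lse \<Omega> (pot (x(s := x s + 1)) g) \<partial>disorder) - (\<integral>g. lse \<Omega> (pot x g) \<partial>disorder)"
    and "(\<integral>g. lse \<Omega> (pot (x(s := x s + 1)) g) \<partial>disorder) - (\<integral>g. lse \<Omega> (pot x g) \<partial>disorder) \<le> eh s (x(s := x s + 1))"
proof -
  let ?y = "x(s := x s + 1)"
  have il: "integrable disorder (\<lambda>g. lse \<Omega> (pot z g))" for z
    unfolding pot_def by (rule integrable_lse_en) (use fin ne finite_J in auto)
  have ih: "integrable disorder (\<lambda>g. avg \<Omega> (pot z g) (h s g))" for z
    by (rule integrable_avg_h[where s = s and k = 0]) auto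
  have d: "(\<lambda>\<omega>. pot ?y g \<omega> - pot x g \<omega>) = h s g" "(\<lambda>\<omega>. pot x g \<omega> - pot ?y g \<omega>) = (\<lambda>\<omega>. (-1) * h s g \<omega>)" for g
    unfolding pot_upd[OF s] by auto
  have 1: "avg \<Omega> (pot x g) (h s g) \<le> lse \<Omega> (pot ?y g) - lse \<Omega> (pot x g)" for g
    using lse_convex[OF fin ne, of "pot x g" "pot ?y g"] unfolding d .
  have 2: "lse \<Omega> (pot ?y g) - lse \<Omega> (pot x g) \<le> avg \<Omega> (pot ?y g) (h s g)" for g
    using lse_convex[OF fin ne, of "pot ?y g" "pot x g"] unfolding d avg_cmult by simp
  have "eh s x \<le> (\<integral>g. lse \<Omega> (pot ?y g) - lse \<Omega> (pot x g) \<partial>disorder)"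
    unfolding eh_def using 1 il ih by (intro integral_mono) auto
  then show "eh s x \<le> (\<integral>g. lse \<Omega> (pot ?y g) \<partial>disorder) - (\<integral>g. lse \<Omega> (pot x g) \<partial>disorder)"
    using il by simp
  have "(\<integral>g. lse \<Omega> (pot ?y g) - lse \<Omega> (pot x g) \<partial>disorder) \<le> eh s ?y"
    unfolding eh_def using 2 il ih by (intro integral_mono) auto
  then show "(\<integral>g. lse \<Omega> (pot ?y g) \<partial>disorder) - (\<integral>g. lse \<Omega> (pot x g) \<partial>disorder) \<le> eh s ?y"
    using il by simp
qed

text \<open>Bound the absolute value by \<open>\<bar>y\<bar> \<le> ln (exp y + exp (- y))\<close>: by Jensen's inequality its Gibbs average
  is controlled by increments of the free energy, which concentrate.\<close>
lemma dev_bound: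
  assumes s: "s \<in> {1..S}" and x: "x s \<ge> 1" and B: "\<And>s. s \<in> {1..S} \<Longrightarrow> x s + 1 \<le> B"
  shows "dev s x \<le> ln 2 + (eh s (x(s := x s + 1)) - eh s (x(s := x s - 1))) +
     24 * sqrt (real S * ((real B)\<^sup>2 * \<eta>\<^sup>2 * real M))"
proof -
  define V where "V = real S * ((real B)\<^sup>2 * \<eta>\<^sup>2 * real M)"
  define y z where "y = x(s := x s + 1)" and "z = x(s := x s - 1)"
  have B1: "B \<ge> 1" "S \<ge> 1" using B[OF s] s by auto
  have V: "V > 0" unfolding V_def using B1 M \<eta> by simp
  \<comment> \<open>Here \<open>x s \<ge> 1\<close> matters: at \<open>x s = 0\<close> the truncated
    subtraction would leave \<open>z = x\<close>.\<close>
  have zx: "z(s := z s + 1) = x" using x by (auto simp: z_def)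
  have py: "pot y g \<omega> = pot x g \<omega> + h s g \<omega>" for g \<omega> unfolding y_def by (rule pot_upd[OF s])
  have pz: "pot z g \<omega> = pot x g \<omega> - h s g \<omega>" for g \<omega> using pot_upd[OF s, of z g \<omega>] unfolding zx by simp
  let ?L = "\<lambda>w g. lse \<Omega> (pot w g)" and ?E = "\<lambda>w. \<integral>g. lse \<Omega> (pot w g) \<partial>disorder"
  have sub: "subgaussian (?L w) V" if "w \<in> {x, y, z}" for w
    unfolding V_def
  proof (rule subgaussian_pot)
    fix s' assume s': "s' \<in> {1..S}"
    have "w s' \<le> x s' + 1" using that by (auto simp: y_def z_def)
    then show "w s' \<le> B" using B[OF s'] by linarith
  qed
  have il: "integrable disorder (?L w)" for w
    unfolding pot_def by (rule integrable_lse_en) (use fin ne finite_J in auto)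
  have c1: "eh s x \<le> ?E y - ?E x" "?E y - ?E x \<le> eh s y" using eh_convex[OF s, of x] by (auto simp: y_def)
  have c2: "eh s z \<le> ?E x - ?E z" "?E x - ?E z \<le> eh s x" using eh_convex[OF s, of z] unfolding zx by auto
  let ?m = "eh s x" and ?D = "eh s y - eh s z"
  let ?dv = "\<lambda>w g. \<bar>?L w g - ?E w\<bar>"
  have pt: "avg \<Omega> (pot x g) (\<lambda>\<omega>. \<bar>h s g \<omega> - ?m\<bar>) \<le> ln 2 + ?D + (?dv y g + 2 * ?dv x g + ?dv z g)" for g
  proof -
    let ?a = "avg \<Omega> (pot x g)"
    define u v where "u = ?L y g - ?L x g - ?m" and "v = ?L z g - ?L x g + ?m"
    have "?a (\<lambda>\<omega>. (pot x g \<omega> + \<bar>h s g \<omega> - ?m\<bar>) - pot x g \<omega>) \<le> lse \<Omega> (\<lambda>\<omega>. pot x g \<omega> + \<bar>h s g \<omega> - ?m\<bar>) - ?L x g"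
      by (rule lse_convex[OF fin ne])
    then have "exp (?a (\<lambda>\<omega>. \<bar>h s g \<omega> - ?m\<bar>)) \<le> exp (lse \<Omega> (\<lambda>\<omega>. pot x g \<omega> + \<bar>h s g \<omega> - ?m\<bar>) - ?L x g)" by simp
    also have "\<dots> = ?a (\<lambda>\<omega>. exp \<bar>h s g \<omega> - ?m\<bar>)" by (simp add: exp_lse_diff[OF fin ne])
    also have "\<dots> \<le> ?a (\<lambda>\<omega>. exp (- ?m) * exp (h s g \<omega>) + exp ?m * exp (- h s g \<omega>))"
    proof (rule avg_mono)
      fix \<omega>
      show "exp \<bar>h s g \<omega> - ?m\<bar> \<le> exp (- ?m) * exp (h s g \<omega>) + exp ?m * exp (- h s g \<omega>)"
        by (cases "h s g \<omega> \<ge> ?m") (auto simp: algebra_simps simp flip: exp_add)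
    qed
    also have "\<dots> = exp (- ?m) * ?a (\<lambda>\<omega>. exp (h s g \<omega>)) + exp ?m * ?a (\<lambda>\<omega>. exp (- h s g \<omega>))"
      by (simp add: avg_add avg_cmult)
    also have "?a (\<lambda>\<omega>. exp (h s g \<omega>)) = exp (?L y g - ?L x g)"
      unfolding exp_lse_diff[OF fin ne] py by simp
    also have "?a (\<lambda>\<omega>. exp (- h s g \<omega>)) = exp (?L z g - ?L x g)"
      unfolding exp_lse_diff[OF fin ne] pz by simp
    also have "exp (- ?m) * exp (?L y g - ?L x g) + exp ?m * exp (?L z g - ?L x g) = exp u + exp v"
      by (simp add: u_def v_def algebra_simps flip: exp_add)
    also have "\<dots> \<le> exp (max u v) + exp (max u v)" by (intro add_mono) auto
    also have "\<dots> = exp (ln 2 + max u v)" by (simp add: exp_add)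
    finally have 1: "?a (\<lambda>\<omega>. \<bar>h s g \<omega> - ?m\<bar>) \<le> ln 2 + max u v" by simp
    have "u \<le> ?D + ?dv y g + ?dv x g" "v \<le> ?D + ?dv z g + ?dv x g"
      unfolding u_def v_def using c1 c2 by linarith+
    then have "max u v \<le> ?D + (?dv y g + 2 * ?dv x g + ?dv z g)"
      using abs_ge_zero[of "?L x g - ?E x"] abs_ge_zero[of "?L y g - ?E y"] abs_ge_zero[of "?L z g - ?E z"]
      by (intro max.boundedI; linarith)
    then show ?thesis using 1 by linarith
  qed
  have idv: "integrable disorder (?dv w)" for w using il by auto
  have "dev s x \<le> (\<integral>g. ln 2 + ?D + (?dv y g + 2 * ?dv x g + ?dv z g) \<partial>disorder)"
    unfolding dev_def
  proof (rule integral_mono[OF _ _ pt])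
    show "integrable disorder (\<lambda>g. avg \<Omega> (pot x g) (\<lambda>\<omega>. \<bar>h s g \<omega> - ?m\<bar>))"
      by (rule integrable_avg_h[where s = s and k = "\<bar>?m\<bar>"]) auto
    show "integrable disorder (\<lambda>g. ln 2 + ?D + (?dv y g + 2 * ?dv x g + ?dv z g))"
      using idv[of x] idv[of y] idv[of z] by auto
  qed
  also have "\<dots> = ln 2 + ?D + ((\<integral>g. ?dv y g \<partial>disorder) + 2 * (\<integral>g. ?dv x g \<partial>disorder) + (\<integral>g. ?dv z g \<partial>disorder))"
    using idv[of x] idv[of y] idv[of z] by (simp add: disorder.prob_space[simplified])
  also have "\<dots> \<le> ln 2 + ?D + (6 * sqrt V + 2 * (6 * sqrt V) + 6 * sqrt V)"
    by (intro add_mono mult_left_mono order_refl subgaussian_abs_deviation sub V) auto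
  finally show ?thesis by (simp add: V_def y_def z_def)
qed

end

text \<open>A continuous stand-in for the indicator of \<open>y > - e\<close>: 0 up to
  \<open>- e\<close>, and 1 from \<open>- e + d\<close> on. The identities are available for
  polynomials, and uniform approximation extends them to continuous test functions only.\<close>

definition ramp :: "real \<Rightarrow> real \<Rightarrow> real \<Rightarrow> real" where
  "ramp e d y = max 0 (min 1 ((y + e) / d))"

lemma ramp_01: "0 \<le> ramp e d y" "ramp e d y \<le> 1"
  by (auto simp: ramp_def)

lemma ramp_low: "d > 0 \<Longrightarrow> y \<le> - e \<Longrightarrow> ramp e d y = 0"
  using divide_nonpos_pos[of "y + e" d] by (simp add: ramp_def)

lemma ramp_high: "d > 0 \<Longrightarrow> y \<ge> - (e - d) \<Longrightarrow> ramp e d y = 1"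
  by (simp add: ramp_def max_def min_def le_divide_eq)

lemma continuous_ramp: "d > 0 \<Longrightarrow> continuous_on A (ramp e d)"
  unfolding ramp_def[abs_def] by (intro continuous_intros) auto

lemma sum_Suc_split: "(\<Sum>s\<le>S. f s) = f 0 + (\<Sum>s=1..S. f s)" for f :: "nat \<Rightarrow> real"
proof -
  have "{..S} = insert 0 {1..S}" by auto
  then show ?thesis by simp
qed

section \<open>Replicas with pairwise negative overlaps\<close>

context perturbed
begin

definition sep :: "nat \<Rightarrow> real \<Rightarrow> (nat \<Rightarrow> 'o) \<Rightarrow> bool" where
  "sep n e \<tau> \<longleftrightarrow> (\<forall>l<n. \<forall>l'<l. R (\<tau> l) (\<tau> l') \<le> - e)"

definition gge :: "(nat \<Rightarrow> nat) \<Rightarrow> real" where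
  "gge x = (\<Sum>s=1..S. dev s x / (\<eta>\<^sup>2 * real (x s) * real M))"

text \<open>One side of the Ghirlanda-Guerra identity for the test function \<open>\<psi>\<close>.
  The sum includes \<open>l' = l\<close>, which contributes \<open>\<psi> 1\<close>.\<close>

definition GG :: "(nat \<Rightarrow> nat) \<Rightarrow> nat \<Rightarrow> ((nat \<Rightarrow> 'o) \<Rightarrow> real) \<Rightarrow> nat \<Rightarrow> (real \<Rightarrow> real) \<Rightarrow> real" where
  "GG x n f l \<psi> = (\<integral>g. rep \<Omega> (pot x g) n (\<lambda>\<tau>. f \<tau> * ((\<Sum>l'<n. \<psi> (R (\<tau> l) (\<tau> l'))) -
       real n * avg \<Omega> (pot x g) (\<lambda>\<omega>. \<psi> (R (\<tau> l) \<omega>)))) \<partial>disorder)"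

lemma dev_nonneg: "0 \<le> dev s x"
  unfolding dev_def by (intro Bochner_Integration.integral_nonneg avg_nonneg) auto

lemma GG_inner_bound:
  assumes l: "l < n" and f: "\<And>\<tau>. \<bar>f \<tau>\<bar> \<le> 1" and B: "\<And>y. \<bar>y\<bar> \<le> 1 \<Longrightarrow> \<bar>\<psi> y\<bar> \<le> B"
    and t: "\<tau> \<in> PiE {..<n} (\<lambda>_. \<Omega>)"
  shows "\<bar>f \<tau> * ((\<Sum>l'<n. \<psi> (R (\<tau> l) (\<tau> l'))) - real n * avg \<Omega> (pot x g) (\<lambda>\<omega>. \<psi> (R (\<tau> l) \<omega>)))\<bar> \<le> 2 * real n * B"
proof -
  have mem: "\<tau> l' \<in> \<Omega>" if "l' < n" for l' using t that by (auto simp: PiE_def Pi_def)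
  have "\<bar>\<Sum>l'<n. \<psi> (R (\<tau> l) (\<tau> l'))\<bar> \<le> (\<Sum>l'<n. B)"
    using mem l by (intro order_trans[OF sum_abs] sum_mono B R_le_1) auto
  moreover have "\<bar>avg \<Omega> (pot x g) (\<lambda>\<omega>. \<psi> (R (\<tau> l) \<omega>))\<bar> \<le> B"
    using mem l by (intro avg_abs_le fin ne B R_le_1) auto
  then have "\<bar>real n * avg \<Omega> (pot x g) (\<lambda>\<omega>. \<psi> (R (\<tau> l) \<omega>))\<bar> \<le> real n * B"
    by (simp add: abs_mult mult_left_mono)
  ultimately have d: "\<bar>(\<Sum>l'<n. \<psi> (R (\<tau> l) (\<tau> l'))) - real n * avg \<Omega> (pot x g) (\<lambda>\<omega>. \<psi> (R (\<tau> l) \<omega>))\<bar> \<le> 2 * real n * B"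
    using abs_triangle_ineq4[of "\<Sum>l'<n. \<psi> (R (\<tau> l) (\<tau> l'))" "real n * avg \<Omega> (pot x g) (\<lambda>\<omega>. \<psi> (R (\<tau> l) \<omega>))"] by simp
  have "\<bar>f \<tau>\<bar> * \<bar>(\<Sum>l'<n. \<psi> (R (\<tau> l) (\<tau> l'))) - real n * avg \<Omega> (pot x g) (\<lambda>\<omega>. \<psi> (R (\<tau> l) \<omega>))\<bar> \<le> 1 * (2 * real n * B)"
    by (intro mult_mono f d) auto
  then show ?thesis by (simp only: abs_mult mult_1)
qed

lemma GG_integrable:
  assumes l: "l < n" and f: "\<And>\<tau>. \<bar>f \<tau>\<bar> \<le> 1" and B: "\<And>y. \<bar>y\<bar> \<le> 1 \<Longrightarrow> \<bar>\<psi> y\<bar> \<le> B"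
  shows "integrable disorder (\<lambda>g. rep \<Omega> (pot x g) n (\<lambda>\<tau>. f \<tau> * ((\<Sum>l'<n. \<psi> (R (\<tau> l) (\<tau> l'))) -
       real n * avg \<Omega> (pot x g) (\<lambda>\<omega>. \<psi> (R (\<tau> l) \<omega>)))))"
proof (rule integrable_rep_bounded[where B = "2 * real n * B"])
  note [measurable] = measurable_avg[of "pot x", OF measurable_pot]
  show "(\<lambda>g. f \<tau> * ((\<Sum>l'<n. \<psi> (R (\<tau> l) (\<tau> l'))) - real n * avg \<Omega> (pot x g) (\<lambda>\<omega>. \<psi> (R (\<tau> l) \<omega>)))) \<in> borel_measurable disorder" for \<tau>
    by measurable
  show "\<bar>f \<tau> * ((\<Sum>l'<n. \<psi> (R (\<tau> l) (\<tau> l'))) - real n * avg \<Omega> (pot x g) (\<lambda>\<omega>. \<psi> (R (\<tau> l) \<omega>)))\<bar> \<le> 2 * real n * B"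
    if "\<tau> \<in> PiE {..<n} (\<lambda>_. \<Omega>)" for g \<tau>
    by (rule GG_inner_bound[OF l f B that])
qed (use fin ne in auto)

lemma ghirlanda_guerra_poly:
  assumes l: "l < n" and f: "\<And>\<tau>. \<bar>f \<tau>\<bar> \<le> 1" and x: "\<And>s. s \<in> {1..S} \<Longrightarrow> x s \<ge> 1"
    and k: "\<And>s. \<bar>k s\<bar> \<le> K"
  defines "\<psi> \<equiv> \<lambda>y. \<Sum>s\<le>S. k s * y ^ s"
  shows "\<bar>GG x n f l \<psi> - (\<integral>g. rep \<Omega> (pot x g) n f \<partial>disorder) * (\<psi> 1 - pe \<psi> x)\<bar> \<le> K * gge x"
proof -
  let ?e = "\<integral>g. rep \<Omega> (pot x g) n f \<partial>disorder" and ?T = "\<lambda>s. GG x n f l (\<lambda>y. y ^ s)"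
  have iT: "integrable disorder (\<lambda>g. rep \<Omega> (pot x g) n (\<lambda>\<tau>. f \<tau> * ((\<Sum>l'<n. R (\<tau> l) (\<tau> l') ^ s) -
       real n * avg \<Omega> (pot x g) (\<lambda>\<omega>. R (\<tau> l) \<omega> ^ s))))" for s
    by (rule GG_integrable[OF l f, where B = 1 and \<psi> = "\<lambda>y. y ^ s"]) (rule power_abs_le_1)
  have "(\<Sum>l'<n. \<psi> (R (\<tau> l) (\<tau> l'))) - real n * avg \<Omega> (pot x g) (\<lambda>\<omega>. \<psi> (R (\<tau> l) \<omega>)) =
    (\<Sum>s\<le>S. k s * ((\<Sum>l'<n. R (\<tau> l) (\<tau> l') ^ s) - real n * avg \<Omega> (pot x g) (\<lambda>\<omega>. R (\<tau> l) \<omega> ^ s)))" for \<tau> g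
  proof -
    have "(\<Sum>l'<n. \<psi> (R (\<tau> l) (\<tau> l'))) = (\<Sum>s\<le>S. k s * (\<Sum>l'<n. R (\<tau> l) (\<tau> l') ^ s))"
      unfolding \<psi>_def sum_distrib_left by (rule sum.swap)
    moreover have "avg \<Omega> (pot x g) (\<lambda>\<omega>. \<psi> (R (\<tau> l) \<omega>)) = (\<Sum>s\<le>S. k s * avg \<Omega> (pot x g) (\<lambda>\<omega>. R (\<tau> l) \<omega> ^ s))"
      unfolding \<psi>_def avg_sum avg_cmult ..
    ultimately show ?thesis by (simp add: right_diff_distrib sum_subtractf sum_distrib_left mult_ac)
  qed
  then have r: "rep \<Omega> (pot x g) n (\<lambda>\<tau>. f \<tau> * ((\<Sum>l'<n. \<psi> (R (\<tau> l) (\<tau> l'))) - real n * avg \<Omega> (pot x g) (\<lambda>\<omega>. \<psi> (R (\<tau> l) \<omega>)))) =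
    (\<Sum>s\<le>S. k s * rep \<Omega> (pot x g) n (\<lambda>\<tau>. f \<tau> * ((\<Sum>l'<n. R (\<tau> l) (\<tau> l') ^ s) - real n * avg \<Omega> (pot x g) (\<lambda>\<omega>. R (\<tau> l) \<omega> ^ s))))" for g
    unfolding rep_cmult[symmetric] rep_sum[symmetric]
    by (intro arg_cong[where f = "rep _ _ _"] ext) (simp add: sum_distrib_left mult_ac)
  have G: "GG x n f l \<psi> = (\<Sum>s\<le>S. k s * ?T s)"
    unfolding GG_def r using iT by (simp add: Bochner_Integration.integral_sum)
  have ip: "integrable disorder (\<lambda>g. avg \<Omega> (pot x g) (\<lambda>\<omega>. avg \<Omega> (pot x g) (\<lambda>\<omega>'. R \<omega> \<omega>' ^ s)))" for s
    by (rule pe_bound(1)[where B = 1 and f = "\<lambda>y. y ^ s"]) (rule power_abs_le_1)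
  have P: "pe \<psi> x = (\<Sum>s\<le>S. k s * pe (\<lambda>y. y ^ s) x)"
    unfolding pe_def \<psi>_def avg_sum avg_cmult using ip by (simp add: Bochner_Integration.integral_sum)
  \<comment> \<open>There is no perturbation of order 0, but for constant test functions the
    identity is exact.\<close>
  have T0: "?T 0 = 0"
    unfolding GG_def by (simp add: avg_const fin ne rep_const)
  have P0: "pe (\<lambda>y. y ^ 0) x = 1"
    unfolding pe_def by (simp add: avg_const fin ne disorder.prob_space[simplified])
  have ed: "GG x n f l \<psi> - ?e * (\<psi> 1 - pe \<psi> x) = (\<Sum>s\<le>S. k s * (?T s - ?e * (1 - pe (\<lambda>y. y ^ s) x)))"
  proof -
    have "\<psi> 1 = (\<Sum>s\<le>S. k s)" by (simp add: \<psi>_def)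
    then show ?thesis unfolding G P by (simp add: sum_subtractf sum.distrib sum_distrib_left sum_distrib_right algebra_simps)
  qed
  have "\<bar>\<Sum>s=1..S. k s * (?T s - ?e * (1 - pe (\<lambda>y. y ^ s) x))\<bar> \<le> (\<Sum>s=1..S. K * (dev s x / (\<eta>\<^sup>2 * real (x s) * real M)))"
  proof (intro order_trans[OF sum_abs] sum_mono)
    fix s assume s: "s \<in> {1..S}"
    have "\<bar>?T s - ?e * (1 - pe (\<lambda>y. y ^ s) x)\<bar> \<le> dev s x / (\<eta>\<^sup>2 * real (x s) * real M)"
      unfolding GG_def by (rule ghirlanda_guerra[where f = f and s = s and x = x, OF s l x[OF s] f])
    then show "\<bar>k s * (?T s - ?e * (1 - pe (\<lambda>y. y ^ s) x))\<bar> \<le> K * (dev s x / (\<eta>\<^sup>2 * real (x s) * real M))"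
      unfolding abs_mult using k by (intro mult_mono) (auto intro: order_trans[OF abs_ge_zero k])
  qed
  then show ?thesis unfolding ed sum_Suc_split T0 P0 by (simp add: gge_def sum_distrib_left)
qed

text \<open>Replacing \<open>ch\<close> by the polynomial changes \<open>GG\<close> by at most
  \<open>2 * n * \<delta>\<close> and the product term by at most \<open>2 * \<delta>\<close>; as
  \<open>n \<ge> 1\<close>, both fit into \<open>4 * n * \<delta>\<close>.\<close>

lemma ghirlanda_guerra_approx:
  assumes l: "l < n" and f: "\<And>\<tau>. \<bar>f \<tau>\<bar> \<le> 1" and x: "\<And>s. s \<in> {1..S} \<Longrightarrow> x s \<ge> 1"
    and k: "\<And>s. \<bar>k s\<bar> \<le> K" and B: "\<And>y. \<bar>y\<bar> \<le> 1 \<Longrightarrow> \<bar>ch y\<bar> \<le> 1"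
    and \<delta>: "\<And>y. \<bar>y\<bar> \<le> 1 \<Longrightarrow> \<bar>ch y - (\<Sum>s\<le>S. k s * y ^ s)\<bar> \<le> \<delta>"
  shows "\<bar>GG x n f l ch - (\<integral>g. rep \<Omega> (pot x g) n f \<partial>disorder) * (ch 1 - pe ch x)\<bar> \<le> K * gge x + 4 * real n * \<delta>"
proof -
  define \<psi> where "\<psi> y = (\<Sum>s\<le>S. k s * y ^ s)" for y :: real
  let ?e = "\<integral>g. rep \<Omega> (pot x g) n f \<partial>disorder"
  have d0: "\<delta> \<ge> 0" using \<delta>[of 0] by (auto intro: order_trans[OF abs_ge_zero])
  have d: "\<bar>ch y - \<psi> y\<bar> \<le> \<delta>" if "\<bar>y\<bar> \<le> 1" for y using \<delta>[OF that] by (simp add: \<psi>_def)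
  have B': "\<bar>\<psi> y\<bar> \<le> 1 + \<delta>" if "\<bar>y\<bar> \<le> 1" for y using d[OF that] B[OF that] by linarith
  have ec: "\<bar>?e\<bar> \<le> 1"
  proof -
    have i: "integrable disorder (\<lambda>g. rep \<Omega> (pot x g) n f)"
      by (rule integrable_rep_bounded[where B = 1]) (use fin ne f in auto)
    have "\<bar>?e\<bar> \<le> (\<integral>g. \<bar>rep \<Omega> (pot x g) n f\<bar> \<partial>disorder)" by (rule integral_abs_bound)
    also have "\<dots> \<le> (\<integral>g. 1 \<partial>disorder)"
      using i by (intro integral_mono) (auto intro!: rep_abs_le fin ne f)
    finally show ?thesis by (simp add: disorder.prob_space[simplified])
  qed
  have G: "\<bar>GG x n f l ch - GG x n f l \<psi>\<bar> \<le> 2 * real n * \<delta>"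
  proof -
    have i1: "integrable disorder (\<lambda>g. rep \<Omega> (pot x g) n (\<lambda>\<tau>. f \<tau> * ((\<Sum>l'<n. \<phi> (R (\<tau> l) (\<tau> l'))) -
       real n * avg \<Omega> (pot x g) (\<lambda>\<omega>. \<phi> (R (\<tau> l) \<omega>)))))" if "\<phi> \<in> {ch, \<psi>, \<lambda>y. ch y - \<psi> y}" for \<phi>
    proof -
      have "\<phi> = ch \<or> \<phi> = \<psi> \<or> \<phi> = (\<lambda>y. ch y - \<psi> y)" using that by auto
      then show ?thesis
      proof (elim disjE)
        assume "\<phi> = ch"
        then show ?thesis using GG_integrable[OF l f, where \<psi> = ch and B = 1] B by simp
      next
        assume "\<phi> = \<psi>"
        then show ?thesis using GG_integrable[OF l f, where \<psi> = \<psi> and B = "1 + \<delta>"] B' by simp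
      next
        assume e: "\<phi> = (\<lambda>y. ch y - \<psi> y)"
        show ?thesis unfolding e by (rule GG_integrable[OF l f, where B = \<delta>]) (rule d)
      qed
    qed
    have Ge: "GG x n f l ch - GG x n f l \<psi> = GG x n f l (\<lambda>y. ch y - \<psi> y)"
      unfolding GG_def
    proof (subst Bochner_Integration.integral_diff[symmetric])
      show "(\<integral>g. rep \<Omega> (pot x g) n (\<lambda>\<tau>. f \<tau> * ((\<Sum>l'<n. ch (R (\<tau> l) (\<tau> l'))) - real n * avg \<Omega> (pot x g) (\<lambda>\<omega>. ch (R (\<tau> l) \<omega>)))) -
          rep \<Omega> (pot x g) n (\<lambda>\<tau>. f \<tau> * ((\<Sum>l'<n. \<psi> (R (\<tau> l) (\<tau> l'))) - real n * avg \<Omega> (pot x g) (\<lambda>\<omega>. \<psi> (R (\<tau> l) \<omega>)))) \<partial>disorder) =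
        (\<integral>g. rep \<Omega> (pot x g) n (\<lambda>\<tau>. f \<tau> * ((\<Sum>l'<n. ch (R (\<tau> l) (\<tau> l')) - \<psi> (R (\<tau> l) (\<tau> l'))) -
          real n * avg \<Omega> (pot x g) (\<lambda>\<omega>. ch (R (\<tau> l) \<omega>) - \<psi> (R (\<tau> l) \<omega>)))) \<partial>disorder)"
        unfolding rep_diff[symmetric] avg_diff
        by (intro Bochner_Integration.integral_cong refl arg_cong[where f = "rep _ _ _"] ext)
           (simp add: sum_subtractf algebra_simps)
    qed (use i1 in auto)
    have "\<bar>GG x n f l ch - GG x n f l \<psi>\<bar> \<le> (\<integral>g. \<bar>rep \<Omega> (pot x g) n (\<lambda>\<tau>. f \<tau> * ((\<Sum>l'<n. ch (R (\<tau> l) (\<tau> l')) - \<psi> (R (\<tau> l) (\<tau> l'))) -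
          real n * avg \<Omega> (pot x g) (\<lambda>\<omega>. ch (R (\<tau> l) \<omega>) - \<psi> (R (\<tau> l) \<omega>))))\<bar> \<partial>disorder)"
      unfolding Ge unfolding GG_def by (rule integral_abs_bound)
    also have "\<dots> \<le> (\<integral>g. 2 * real n * \<delta> \<partial>disorder)"
      using i1[of "\<lambda>y. ch y - \<psi> y"] d
      by (intro integral_mono) (auto intro!: rep_abs_le fin ne GG_inner_bound[OF l f, where \<psi> = "\<lambda>y. ch y - \<psi> y"])
    finally show ?thesis by (simp add: disorder.prob_space[simplified])
  qed
  have P: "\<bar>pe ch x - pe \<psi> x\<bar> \<le> \<delta>"
  proof -
    have "pe ch x - pe \<psi> x = pe (\<lambda>y. ch y - \<psi> y) x"
      unfolding pe_def avg_diff using pe_bound(1)[of ch 1] pe_bound(1)[of \<psi> "1 + \<delta>"] B B' by simp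
    then show ?thesis using pe_bound(2)[of "\<lambda>y. ch y - \<psi> y" \<delta>] d by simp
  qed
  have "\<bar>GG x n f l \<psi> - ?e * (\<psi> 1 - pe \<psi> x)\<bar> \<le> K * gge x"
    unfolding \<psi>_def by (rule ghirlanda_guerra_poly[OF l f x k])
  moreover have "\<bar>?e * (\<psi> 1 - pe \<psi> x) - ?e * (ch 1 - pe ch x)\<bar> \<le> 2 * \<delta>"
  proof -
    have "\<bar>(\<psi> 1 - pe \<psi> x) - (ch 1 - pe ch x)\<bar> \<le> 2 * \<delta>" using P d[of 1] by simp
    then have "\<bar>?e\<bar> * \<bar>(\<psi> 1 - pe \<psi> x) - (ch 1 - pe ch x)\<bar> \<le> 1 * (2 * \<delta>)" using ec by (intro mult_mono) auto
    then show ?thesis by (simp only: abs_mult[symmetric] right_diff_distrib mult_1)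
  qed
  moreover have "2 * real n * \<delta> + 2 * \<delta> \<le> 4 * real n * \<delta>"
  proof -
    have "1 * \<delta> \<le> real n * \<delta>" using l d0 by (intro mult_right_mono) auto
    then show ?thesis by (simp add: mult_ac)
  qed
  ultimately show ?thesis using G by linarith
qed

text \<open>Given \<open>n\<close> separated replicas, the ramp vanishes at their mutual overlaps
  and equals 1 at \<open>l' = l\<close>. The identity then says that, on average, the ramp at the
  overlap of replica \<open>l\<close> with a fresh one is about \<open>pe ch / n\<close>. The union
  bound over \<open>l\<close> costs \<open>pe ch \<le> 1 - q\<close>, with \<open>q\<close> the
  probability of an overlap at most \<open>- e0\<close>, so the fresh replica joins with probability
  about \<open>q\<close> or more. The width \<open>d\<close> of the ramp is lost in the
  threshold.\<close>

lemma sep_step: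
  assumes n: "n \<ge> 1" and x: "\<And>s. s \<in> {1..S} \<Longrightarrow> x s \<ge> 1"
    and k: "\<And>s. \<bar>k s\<bar> \<le> K" and d: "0 < d" "d < e" and e: "e \<le> e0"
    and \<delta>: "\<And>y. \<bar>y\<bar> \<le> 1 \<Longrightarrow> \<bar>ramp e d y - (\<Sum>s\<le>S. k s * y ^ s)\<bar> \<le> \<delta>"
  shows "(\<integral>g. rep \<Omega> (pot x g) n (\<lambda>\<tau>. of_bool (sep n e \<tau>)) \<partial>disorder) * pe (\<lambda>y. of_bool (y \<le> - e0)) x
      - (K * gge x + 4 * real n * \<delta>)
     \<le> (\<integral>g. rep \<Omega> (pot x g) (Suc n) (\<lambda>\<tau>. of_bool (sep (Suc n) (e - d) \<tau>)) \<partial>disorder)"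
proof -
  let ?f = "\<lambda>\<tau>. of_bool (sep n e \<tau>) :: real" and ?ch = "ramp e d"
  let ?A = "\<lambda>g. avg \<Omega> (pot x g)" and ?r = "\<lambda>g. rep \<Omega> (pot x g) n"
  let ?err = "K * gge x + 4 * real n * \<delta>"
  have f: "\<bar>?f \<tau>\<bar> \<le> 1" for \<tau> by simp
  have B: "\<bar>?ch y\<bar> \<le> 1" for y using ramp_01[of e d y] by simp
  note m [measurable] = measurable_avg[of "pot x", OF measurable_pot]
  define E where "E = (\<integral>g. ?r g ?f \<partial>disorder)"
  have iE: "integrable disorder (\<lambda>g. ?r g ?f)"
    by (rule integrable_rep_bounded[where B = 1]) (use fin ne in auto)
  have E0: "0 \<le> E" unfolding E_def
    by (intro Bochner_Integration.integral_nonneg) (use rep_mono[of n \<Omega> "\<lambda>_. 0" ?f] rep_const[OF fin ne] in auto)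
  have av01: "0 \<le> ?A g (\<lambda>\<omega>. ?ch (R (\<tau> l) \<omega>))" "?A g (\<lambda>\<omega>. ?ch (R (\<tau> l) \<omega>)) \<le> 1" for g \<tau> l
  proof -
    have "?A g (\<lambda>\<omega>. ?ch (R (\<tau> l) \<omega>)) \<le> ?A g (\<lambda>_. 1)" by (rule avg_mono) (rule ramp_01)
    then show "?A g (\<lambda>\<omega>. ?ch (R (\<tau> l) \<omega>)) \<le> 1" by (simp add: avg_const fin ne)
  qed (intro avg_nonneg ramp_01)
  define T where "T l = (\<integral>g. ?r g (\<lambda>\<tau>. ?f \<tau> * ?A g (\<lambda>\<omega>. ?ch (R (\<tau> l) \<omega>))) \<partial>disorder)" for l
  have iT: "integrable disorder (\<lambda>g. ?r g (\<lambda>\<tau>. ?f \<tau> * ?A g (\<lambda>\<omega>. ?ch (R (\<tau> l) \<omega>))))" for l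
  proof (rule integrable_rep_bounded[where B = 1])
    show "\<bar>?f \<tau> * ?A g (\<lambda>\<omega>. ?ch (R (\<tau> l) \<omega>))\<bar> \<le> 1" for g \<tau> using av01[of g \<tau> l] by (auto simp: abs_mult)
  qed (use fin ne in auto)
  have pe1: "pe ?ch x \<le> 1 - pe (\<lambda>y. of_bool (y \<le> - e0)) x"
  proof -
    have i: "integrable disorder (\<lambda>g. ?A g (\<lambda>\<omega>. ?A g (\<lambda>\<omega>'. of_bool (R \<omega> \<omega>' \<le> - e0))))"
      by (rule pe_bound(1)[where B = 1 and f = "\<lambda>y. of_bool (y \<le> - e0)"]) simp
    have "pe ?ch x \<le> (\<integral>g. 1 - ?A g (\<lambda>\<omega>. ?A g (\<lambda>\<omega>'. of_bool (R \<omega> \<omega>' \<le> - e0))) \<partial>disorder)"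
      unfolding pe_def
    proof (rule integral_mono)
      show "integrable disorder (\<lambda>g. ?A g (\<lambda>\<omega>. ?A g (\<lambda>\<omega>'. ?ch (R \<omega> \<omega>'))))"
        by (rule pe_bound(1)[where B = 1]) (rule B)
      show "integrable disorder (\<lambda>g. 1 - ?A g (\<lambda>\<omega>. ?A g (\<lambda>\<omega>'. of_bool (R \<omega> \<omega>' \<le> - e0))))" using i by simp
      fix g
      have "?A g (\<lambda>\<omega>. ?A g (\<lambda>\<omega>'. ?ch (R \<omega> \<omega>'))) \<le> ?A g (\<lambda>\<omega>. ?A g (\<lambda>\<omega>'. 1 - of_bool (R \<omega> \<omega>' \<le> - e0)))"
      proof (intro avg_mono)
        fix \<omega> \<omega>'
        show "?ch (R \<omega> \<omega>') \<le> 1 - of_bool (R \<omega> \<omega>' \<le> - e0)"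
          using ramp_low[OF d(1), of "R \<omega> \<omega>'" e] ramp_01(2)[of e d] e by auto
      qed
      then show "?A g (\<lambda>\<omega>. ?A g (\<lambda>\<omega>'. ?ch (R \<omega> \<omega>'))) \<le> 1 - ?A g (\<lambda>\<omega>. ?A g (\<lambda>\<omega>'. of_bool (R \<omega> \<omega>' \<le> - e0)))"
        by (simp only: avg_diff avg_const[OF fin ne])
    qed
    then show ?thesis using i by (simp add: pe_def disorder.prob_space[simplified])
  qed
  have T: "real n * T l \<le> E * (1 - pe (\<lambda>y. of_bool (y \<le> - e0)) x) + ?err" if l: "l < n" for l
  proof -
    have c1: "?ch 1 = 1" by (rule ramp_high) (use d in auto)
    have "GG x n ?f l ?ch = E - real n * T l"
    proof -
      have "?r g (\<lambda>\<tau>. ?f \<tau> * ((\<Sum>l'<n. ?ch (R (\<tau> l) (\<tau> l'))) - real n * ?A g (\<lambda>\<omega>. ?ch (R (\<tau> l) \<omega>)))) =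
         ?r g ?f - real n * ?r g (\<lambda>\<tau>. ?f \<tau> * ?A g (\<lambda>\<omega>. ?ch (R (\<tau> l) \<omega>)))" for g
        unfolding rep_cmult[symmetric] rep_diff[symmetric]
      proof (rule rep_cong)
        fix \<tau> assume t: "\<tau> \<in> PiE {..<n} (\<lambda>_. \<Omega>)"
        have "?f \<tau> * (\<Sum>l'<n. ?ch (R (\<tau> l) (\<tau> l'))) = ?f \<tau>"
        proof (cases "sep n e \<tau>")
          case True
          have "?ch (R (\<tau> l) (\<tau> l')) = (if l' = l then 1 else 0)" if l': "l' < n" for l'
          proof (cases "l' = l")
            case True
            then show ?thesis using c1 t l by (auto simp: R_self PiE_def Pi_def)
          next
            case False
            have "R (\<tau> l) (\<tau> l') \<le> - e"
            proof (cases "l' < l")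
              case True then show ?thesis using \<open>sep n e \<tau>\<close> l by (auto simp: sep_def)
            next
              case False
              then have "R (\<tau> l') (\<tau> l) \<le> - e" using \<open>sep n e \<tau>\<close> l' \<open>l' \<noteq> l\<close> by (auto simp: sep_def)
              then show ?thesis by (simp add: R_def overlap_commute)
            qed
            then show ?thesis using False ramp_low[OF d(1)] by simp
          qed
          then have "(\<Sum>l'<n. ?ch (R (\<tau> l) (\<tau> l'))) = (\<Sum>l'<n. if l' = l then 1 else 0)" by (intro sum.cong) auto
          then show ?thesis using l by (simp add: sum.delta)
        qed simp
        then show "?f \<tau> * ((\<Sum>l'<n. ?ch (R (\<tau> l) (\<tau> l'))) - real n * ?A g (\<lambda>\<omega>. ?ch (R (\<tau> l) \<omega>))) =
          ?f \<tau> - real n * (?f \<tau> * ?A g (\<lambda>\<omega>. ?ch (R (\<tau> l) \<omega>)))"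
          by (simp only: right_diff_distrib mult.left_commute)
      qed
      then show ?thesis unfolding GG_def E_def T_def using iE iT by simp
    qed
    moreover have "\<bar>GG x n ?f l ?ch - E * (?ch 1 - pe ?ch x)\<bar> \<le> ?err"
      unfolding E_def by (rule ghirlanda_guerra_approx[OF l f x k B \<delta>])
    moreover have "E * pe ?ch x \<le> E * (1 - pe (\<lambda>y. of_bool (y \<le> - e0)) x)"
      by (rule mult_left_mono[OF pe1 E0])
    ultimately show ?thesis unfolding c1 right_diff_distrib mult_1_right by linarith
  qed
  have "real n * (\<Sum>l<n. T l) \<le> (\<Sum>l<n. E * (1 - pe (\<lambda>y. of_bool (y \<le> - e0)) x) + ?err)"
    unfolding sum_distrib_left by (rule sum_mono) (use T in auto)
  then have "real n * (\<Sum>l<n. T l) \<le> real n * (E * (1 - pe (\<lambda>y. of_bool (y \<le> - e0)) x) + ?err)" by simp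
  \<comment> \<open>Each \<open>T l\<close> is bounded by one \<open>n\<close>-th of the right side,
    so the sum over the \<open>n\<close> replicas brings in no factor \<open>n\<close>.\<close>
  then have sT: "(\<Sum>l<n. T l) \<le> E * (1 - pe (\<lambda>y. of_bool (y \<le> - e0)) x) + ?err" using n by simp
  have "(\<integral>g. ?r g ?f - (\<Sum>l<n. ?r g (\<lambda>\<tau>. ?f \<tau> * ?A g (\<lambda>\<omega>. ?ch (R (\<tau> l) \<omega>)))) \<partial>disorder) \<le>
     (\<integral>g. rep \<Omega> (pot x g) (Suc n) (\<lambda>\<tau>. of_bool (sep (Suc n) (e - d) \<tau>)) \<partial>disorder)"
  proof (rule integral_mono)
    show "integrable disorder (\<lambda>g. rep \<Omega> (pot x g) (Suc n) (\<lambda>\<tau>. of_bool (sep (Suc n) (e - d) \<tau>)))"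
      by (rule integrable_rep_bounded[where B = 1]) (use fin ne in auto)
    fix g
    have "?r g ?f - (\<Sum>l<n. ?r g (\<lambda>\<tau>. ?f \<tau> * ?A g (\<lambda>\<omega>. ?ch (R (\<tau> l) \<omega>)))) =
       ?r g (\<lambda>\<tau>. ?A g (\<lambda>\<omega>. ?f \<tau> - (\<Sum>l<n. ?f \<tau> * ?ch (R (\<tau> l) \<omega>))))"
      by (simp only: avg_diff avg_const[OF fin ne] avg_sum avg_cmult rep_diff rep_sum)
    also have "\<dots> \<le> ?r g (\<lambda>\<tau>. ?A g (\<lambda>\<omega>. of_bool (sep (Suc n) (e - d) (\<tau>(n := \<omega>)))))"
    proof (intro rep_mono avg_mono)
      fix \<tau> \<omega>
      show "?f \<tau> - (\<Sum>l<n. ?f \<tau> * ?ch (R (\<tau> l) \<omega>)) \<le> of_bool (sep (Suc n) (e - d) (\<tau>(n := \<omega>)))"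
      proof (cases "sep n e \<tau> \<and> (\<forall>l<n. R (\<tau> l) \<omega> < - (e - d))")
        case True
        then have "sep (Suc n) (e - d) (\<tau>(n := \<omega>))"
          using d unfolding sep_def
          by (auto simp: less_Suc_eq R_def overlap_commute intro: less_imp_le) (smt (verit))+
        moreover have "0 \<le> (\<Sum>l<n. ?f \<tau> * ?ch (R (\<tau> l) \<omega>))" by (intro sum_nonneg mult_nonneg_nonneg ramp_01) auto
        ultimately show ?thesis using True by (simp del: sum_mult_of_bool_eq sum_of_bool_mult_eq)
      next
        case False
        show ?thesis
        proof (cases "sep n e \<tau>")
          case True
          then obtain l where l: "l < n" "R (\<tau> l) \<omega> \<ge> - (e - d)" using False by (auto simp: not_less)
          have "?ch (R (\<tau> l) \<omega>) = 1" by (rule ramp_high[OF d(1) l(2)])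
          moreover have "?f \<tau> * ?ch (R (\<tau> l) \<omega>) \<le> (\<Sum>l<n. ?f \<tau> * ?ch (R (\<tau> l) \<omega>))"
            by (rule member_le_sum[where f = "\<lambda>l. ?f \<tau> * ?ch (R (\<tau> l) \<omega>)"]) (use l in \<open>auto intro!: ramp_01\<close>)
          ultimately show ?thesis using True by (simp add: of_bool_def)
        qed simp
      qed
    qed
    also have "\<dots> = rep \<Omega> (pot x g) (Suc n) (\<lambda>\<tau>. of_bool (sep (Suc n) (e - d) \<tau>))" by (rule rep_Suc[symmetric])
    finally show "?r g ?f - (\<Sum>l<n. ?r g (\<lambda>\<tau>. ?f \<tau> * ?A g (\<lambda>\<omega>. ?ch (R (\<tau> l) \<omega>)))) \<le> \<dots>" .
  qed (use iE iT in auto)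
  moreover have "(\<integral>g. ?r g ?f - (\<Sum>l<n. ?r g (\<lambda>\<tau>. ?f \<tau> * ?A g (\<lambda>\<omega>. ?ch (R (\<tau> l) \<omega>)))) \<partial>disorder) = E - (\<Sum>l<n. T l)"
    using iE iT by (simp add: E_def T_def Bochner_Integration.integral_sum)
  moreover have "E * (1 - pe (\<lambda>y. of_bool (y \<le> - e0)) x) = E - E * pe (\<lambda>y. of_bool (y \<le> - e0)) x"
    by (simp add: right_diff_distrib)
  ultimately show ?thesis using sT unfolding E_def[symmetric] by linarith
qed

text \<open>The sum of the \<open>n\<close> configurations has nonnegative squared norm, whereas
  separation would make that norm at most \<open>M * n * (1 - e * (n - 1)) < 0\<close>.\<close>

lemma sep_impossible:
  assumes t: "\<tau> \<in> PiE {..<n} (\<lambda>_. \<Omega>)" and e: "e * (real n - 1) > 1" and n: "n \<ge> 1"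
  shows "\<not> sep n e \<tau>"
proof
  assume s: "sep n e \<tau>"
  have "0 \<le> (\<Sum>i<M. (\<Sum>l<n. sg (\<tau> l) i)\<^sup>2)" by (intro sum_nonneg) auto
  also have "\<dots> = (\<Sum>i<M. \<Sum>l<n. \<Sum>l'<n. sg (\<tau> l) i * sg (\<tau> l') i)"
    by (simp add: power2_eq_square sum_product)
  also have "\<dots> = (\<Sum>l<n. \<Sum>l'<n. \<Sum>i<M. sg (\<tau> l) i * sg (\<tau> l') i)"
    by (subst sum.swap) (intro sum.cong refl sum.swap)
  also have "\<dots> = real M * (\<Sum>l<n. \<Sum>l'<n. R (\<tau> l) (\<tau> l'))"
    using M by (simp add: R_def overlap_def flip: sum_divide_distrib)
  finally have nn: "0 \<le> (\<Sum>l<n. \<Sum>l'<n. R (\<tau> l) (\<tau> l'))" using M by (simp add: zero_le_mult_iff)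
  have "(\<Sum>l<n. \<Sum>l'<n. R (\<tau> l) (\<tau> l')) \<le> (\<Sum>l<n. \<Sum>l'<n. (if l' = l then 1 + e else 0) - e)"
  proof (intro sum_mono)
    fix l l' assume l: "l \<in> {..<n}" "l' \<in> {..<n}"
    consider "l' = l" | "l' < l" | "l < l'" by linarith
    then show "R (\<tau> l) (\<tau> l') \<le> (if l' = l then 1 + e else 0) - e"
    proof cases
      case 1 then show ?thesis using t l by (auto simp: R_self PiE_def Pi_def)
    next
      case 2 then show ?thesis using s l by (auto simp: sep_def)
    next
      case 3
      then have "R (\<tau> l') (\<tau> l) \<le> - e" using s l by (auto simp: sep_def)
      then show ?thesis using 3 by (simp add: R_def overlap_commute)
    qed
  qed
  also have "\<dots> = real n * (1 - e * (real n - 1))" by (simp add: sum_subtractf sum.delta algebra_simps)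
  also have "\<dots> < 0" using n e by (simp add: mult_less_0_iff)
  finally show False using nn by simp
qed

text \<open>Start with one replica, which is vacuously separated, and add replicas by
  \<open>sep_step\<close>. Each addition lowers the threshold by \<open>e0 / (2 * n0)\<close>, so it
  is still \<open>e0 / 2\<close> at \<open>n0\<close> replicas, where separation is impossible.
  Hence \<open>q ^ (n0 - 1)\<close> is at most the accumulated error.\<close>

lemma negative_overlap_bound:
  assumes n0: "n0 \<ge> 1" and e0: "e0 > 0" and big: "e0 / 2 * (real n0 - 1) > 1"
    and x: "\<And>s. s \<in> {1..S} \<Longrightarrow> x s \<ge> 1" and \<delta>0: "\<delta> \<ge> 0"
    and approx: "\<And>n. n < n0 \<Longrightarrow> \<exists>k. (\<forall>s. \<bar>k s\<bar> \<le> K) \<and>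
      (\<forall>y. \<bar>y\<bar> \<le> 1 \<longrightarrow> \<bar>ramp (e0 * (1 - real n / (2 * real n0))) (e0 / (2 * real n0)) y - (\<Sum>s\<le>S. k s * y ^ s)\<bar> \<le> \<delta>)"
  shows "pe (\<lambda>y. of_bool (y \<le> - e0)) x ^ (n0 - 1) \<le> real n0 * (K * gge x + 4 * real n0 * \<delta>)"
proof -
  let ?q = "pe (\<lambda>y. of_bool (y \<le> - e0)) x" and ?err = "K * gge x + 4 * real n0 * \<delta>"
  let ?e = "\<lambda>n. e0 * (1 - real n / (2 * real n0))" and ?d = "e0 / (2 * real n0)"
  let ?E = "\<lambda>n. \<integral>g. rep \<Omega> (pot x g) n (\<lambda>\<tau>. of_bool (sep n (?e n) \<tau>)) \<partial>disorder"
  have q: "0 \<le> ?q" "?q \<le> 1"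
  proof -
    show "0 \<le> ?q" unfolding pe_def by (intro Bochner_Integration.integral_nonneg avg_nonneg) auto
    have "\<bar>?q\<bar> \<le> 1" by (rule pe_bound(2)) simp
    then show "?q \<le> 1" by simp
  qed
  have K0: "K \<ge> 0" using approx[of 0] n0 by (auto intro: order_trans[OF abs_ge_zero])
  have err0: "0 \<le> ?err"
  proof -
    have "0 \<le> gge x" unfolding gge_def by (intro sum_nonneg divide_nonneg_nonneg dev_nonneg) auto
    then show ?thesis using K0 \<delta>0 by simp
  qed
  have main: "?q ^ (n - 1) - real n * ?err \<le> ?E n" if "1 \<le> n" "n \<le> n0" for n
    using that
  proof (induction n rule: nat_induct_at_least)
    case base
    have "sep 1 e \<tau>" for e \<tau> by (simp add: sep_def)
    then show ?case using err0 by (simp add: rep_const fin ne disorder.prob_space[simplified])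
  next
    case (Suc n)
    then have nn: "n < n0" by simp
    obtain k where k: "\<And>s. \<bar>k s\<bar> \<le> K" and a: "\<And>y. \<bar>y\<bar> \<le> 1 \<Longrightarrow> \<bar>ramp (?e n) ?d y - (\<Sum>s\<le>S. k s * y ^ s)\<bar> \<le> \<delta>"
      using approx[OF nn] by blast
    have d: "0 < ?d" using e0 n0 by simp
    have "?e n - ?d = ?e (Suc n)" by (simp add: algebra_simps add_divide_distrib)
    moreover have "real (Suc n) / (2 * real n0) < 1" using nn by simp
    then have "0 < ?e (Suc n)" using e0 by simp
    ultimately have de: "?d < ?e n" "?e n - ?d = ?e (Suc n)" by linarith+
    have ee: "?e n \<le> e0" using e0 by (simp add: mult_le_cancel_left1)
    have "?E n * ?q - (K * gge x + 4 * real n * \<delta>) \<le> ?E (Suc n)"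
      unfolding de(2)[symmetric] by (rule sep_step[OF Suc.hyps x k d de(1) ee a])
    moreover have "4 * real n * \<delta> \<le> 4 * real n0 * \<delta>" using nn \<delta>0 by (intro mult_right_mono) auto
    moreover have "(?q ^ (n - 1) - real n * ?err) * ?q \<le> ?E n * ?q"
      using Suc.IH nn q by (intro mult_right_mono) auto
    moreover have "(?q ^ (n - 1) - real n * ?err) * ?q \<ge> ?q ^ n - real n * ?err"
    proof -
      have "real n * ?err * ?q \<le> real n * ?err * 1" using q err0 by (intro mult_left_mono mult_nonneg_nonneg) auto
      moreover have "?q ^ (n - 1) * ?q = ?q ^ n" using Suc.hyps by (cases n) auto
      ultimately show ?thesis by (simp add: left_diff_distrib)
    qed
    moreover have "real (Suc n) * ?err = real n * ?err + ?err" by (simp add: algebra_simps)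
    ultimately show ?case by simp
  qed
  have "?E n0 = 0"
  proof -
    have "?e n0 = e0 / 2" using n0 by simp
    then have "rep \<Omega> (pot x g) n0 (\<lambda>\<tau>. of_bool (sep n0 (?e n0) \<tau>)) = rep \<Omega> (pot x g) n0 (\<lambda>_. 0)" for g
      using sep_impossible[OF _ _ n0] big by (intro rep_cong) auto
    then show ?thesis by (simp add: rep_const fin ne)
  qed
  then show ?thesis using main[OF n0 order_refl] by simp
qed

end

text \<open>Weierstrass approximation. Only finitely many ramps occur, so one degree
  \<open>S\<close> and one coefficient bound \<open>K\<close> serve all of them; \<open>S\<close>
  becomes the number of perturbing interactions.\<close>

lemma ramp_poly_approx:
  fixes e d :: "nat \<Rightarrow> real"
  assumes d: "\<And>n. d n > 0" and \<delta>: "\<delta> > 0"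
  shows "\<exists>S K. \<forall>n<nn. \<exists>k. (\<forall>s. \<bar>k s\<bar> \<le> K) \<and>
      (\<forall>y. \<bar>y\<bar> \<le> 1 \<longrightarrow> \<bar>ramp (e n) (d n) y - (\<Sum>s\<le>S. k s * y ^ s)\<bar> \<le> \<delta>)"
proof -
  have "\<exists>a m. \<forall>y. \<bar>y\<bar> \<le> 1 \<longrightarrow> \<bar>ramp (e n) (d n) y - (\<Sum>s\<le>m. a s * y ^ s)\<bar> \<le> \<delta>" for n
  proof -
    obtain f where f: "real_polynomial_function f" "\<And>y. y \<in> {-1..1} \<Longrightarrow> \<bar>ramp (e n) (d n) y - f y\<bar> < \<delta>"
      using Stone_Weierstrass_real_polynomial_function[of "{-1..1}" "ramp (e n) (d n)" \<delta>]
        continuous_ramp[OF d] \<delta> by (metis compact_Icc)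
    obtain a m where am: "f = (\<lambda>x. \<Sum>i\<le>m. a i * x ^ i)"
      using real_polynomial_function_imp_sum[OF f(1)] by blast
    have "\<bar>ramp (e n) (d n) y - (\<Sum>s\<le>m. a s * y ^ s)\<bar> \<le> \<delta>" if "\<bar>y\<bar> \<le> 1" for y
    proof -
      have "y \<in> {-1..1}" using that by auto
      from less_imp_le[OF f(2)[OF this]] show ?thesis unfolding am .
    qed
    then show ?thesis by blast
  qed
  then obtain a m where am: "\<And>n y. \<bar>y\<bar> \<le> 1 \<Longrightarrow> \<bar>ramp (e n) (d n) y - (\<Sum>s\<le>m n. a n s * y ^ s)\<bar> \<le> \<delta>"
    by metis
  define S where "S = (\<Sum>n<nn. m n)"
  define K where "K = (\<Sum>n<nn. \<Sum>s\<le>m n. \<bar>a n s\<bar>)"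
  have "\<exists>k. (\<forall>s. \<bar>k s\<bar> \<le> K) \<and> (\<forall>y. \<bar>y\<bar> \<le> 1 \<longrightarrow> \<bar>ramp (e n) (d n) y - (\<Sum>s\<le>S. k s * y ^ s)\<bar> \<le> \<delta>)"
    if n: "n < nn" for n
  proof (intro exI[of _ "\<lambda>s. if s \<le> m n then a n s else 0"] conjI allI impI)
    have K: "(\<Sum>s\<le>m n. \<bar>a n s\<bar>) \<le> K"
      unfolding K_def by (rule member_le_sum[where f = "\<lambda>n. \<Sum>s\<le>m n. \<bar>a n s\<bar>"]) (use n in \<open>auto intro: sum_nonneg\<close>)
    fix s
    show "\<bar>if s \<le> m n then a n s else 0\<bar> \<le> K"
    proof (cases "s \<le> m n")
      case True
      then have "\<bar>a n s\<bar> \<le> (\<Sum>s\<le>m n. \<bar>a n s\<bar>)" by (intro member_le_sum) auto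
      then show ?thesis using K True by simp
    next
      case False
      have "0 \<le> (\<Sum>s\<le>m n. \<bar>a n s\<bar>)" by (intro sum_nonneg) auto
      then have "0 \<le> K" using K by linarith
      then show ?thesis using False by simp
    qed
  next
    fix y :: real assume y: "\<bar>y\<bar> \<le> 1"
    have mS: "m n \<le> S" unfolding S_def by (rule member_le_sum) (use n in auto)
    have "(\<Sum>s\<le>S. (if s \<le> m n then a n s else 0) * y ^ s) = (\<Sum>s\<le>m n. a n s * y ^ s)"
      using mS by (intro sum.mono_neutral_cong_right) auto
    then show "\<bar>ramp (e n) (d n) y - (\<Sum>s\<le>S. (if s \<le> m n then a n s else 0) * y ^ s)\<bar> \<le> \<delta>"
      using am[OF y, of n] by simp
  qed
  then show ?thesis by blast
qed

text \<open>Swapping the value at \<open>a\<close> with an additional element of \<open>B\<close> is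
  an involution of the functions paired with \<open>B\<close>. It allows one coordinate to be
  averaged while the others stay fixed.\<close>

lemma sum_PiE_resample:
  fixes f :: "('a \<Rightarrow> 'b) \<Rightarrow> real"
  assumes a: "a \<in> A"
  shows "(\<Sum>x\<in>PiE A (\<lambda>_. B). \<Sum>y\<in>B. f (x(a := y))) = real (card B) * (\<Sum>x\<in>PiE A (\<lambda>_. B). f x)"
proof -
  let ?P = "PiE A (\<lambda>_. B)"
  have bij: "bij_betw (\<lambda>(x, y). (x(a := y), x a)) (?P \<times> B) (?P \<times> B)"
    by (rule bij_betw_byWitness[where f' = "\<lambda>(x, y). (x(a := y), x a)"])
       (use a in \<open>auto simp: PiE_def Pi_def extensional_def\<close>)
  have "(\<Sum>x\<in>?P. \<Sum>y\<in>B. f (x(a := y))) = (\<Sum>z\<in>?P \<times> B. (\<lambda>(x, y). f x) ((\<lambda>(x, y). (x(a := y), x a)) z))"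
    by (simp add: sum.cartesian_product split_beta')
  also have "\<dots> = (\<Sum>z\<in>?P \<times> B. (\<lambda>(x, y). f x) z)"
    by (rule sum.reindex_bij_betw[OF bij])
  also have "\<dots> = (\<Sum>x\<in>?P. \<Sum>y\<in>B. f x)" by (rule sum.cartesian_product[symmetric])
  finally show ?thesis by (simp add: sum_distrib_left)
qed

section \<open>Averaging over a grid of perturbation strengths\<close>

context perturbed
begin

text \<open>In \<open>dev_bound\<close> the convexity term is a difference of \<open>eh\<close> over
  two units of strength, so it telescopes along \<open>J0\<close> consecutive strengths. As
  \<open>eh\<close> is of order \<open>J0 * \<eta>\<^sup>2 * M\<close>, the same as the
  denominators, the whole grid contributes the constant 10. The average per strength is
  \<open>10 / J0\<close>, which is small without any smallness of \<open>\<eta>\<close>.\<close>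

lemma sum_dev_grid:
  assumes s: "s \<in> {1..S}" and J: "J0 \<ge> 1" and x: "\<And>s. s \<in> {1..S} \<Longrightarrow> x s \<le> 2 * J0"
  shows "(\<Sum>y\<in>{J0+1..<2*J0+1}. dev s (x(s := y)) / (\<eta>\<^sup>2 * real y * real M)) \<le>
     (ln 2 + 24 * sqrt (real S * ((real (2 * J0 + 1))\<^sup>2 * \<eta>\<^sup>2 * real M))) / (\<eta>\<^sup>2 * real M) + 10"
proof -
  let ?c = "\<lambda>y. eh s (x(s := y))" and ?G = "{J0+1..<2*J0+1}"
  let ?k = "ln 2 + 24 * sqrt (real S * ((real (2 * J0 + 1))\<^sup>2 * \<eta>\<^sup>2 * real M))"
  have p: "\<eta>\<^sup>2 * real M > 0" using \<eta> M by simp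
  have "dev s (x(s := y)) / (\<eta>\<^sup>2 * real y * real M) \<le> (?k + ((?c (Suc y) - ?c y) + (?c y - ?c (y - 1)))) / (\<eta>\<^sup>2 * real M * real J0)"
    if y: "y \<in> ?G" for y
  proof -
    have "dev s (x(s := y)) / (\<eta>\<^sup>2 * real y * real M) \<le> dev s (x(s := y)) / (\<eta>\<^sup>2 * real M * real J0)"
    proof (rule divide_left_mono)
      have "\<eta>\<^sup>2 * real M * real J0 \<le> \<eta>\<^sup>2 * real M * real y" using p y by (intro mult_left_mono) auto
      then show "\<eta>\<^sup>2 * real M * real J0 \<le> \<eta>\<^sup>2 * real y * real M" by (simp add: mult_ac)
      show "0 < \<eta>\<^sup>2 * real y * real M * (\<eta>\<^sup>2 * real M * real J0)" using \<eta> M J y by simp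
    qed (rule dev_nonneg)
    also have "\<dots> \<le> (?k + ((?c (Suc y) - ?c y) + (?c y - ?c (y - 1)))) / (\<eta>\<^sup>2 * real M * real J0)"
    proof (rule divide_right_mono)
    have "dev s (x(s := y)) \<le> ln 2 + (eh s ((x(s := y))(s := (x(s := y)) s + 1)) - eh s ((x(s := y))(s := (x(s := y)) s - 1))) +
       24 * sqrt (real S * ((real (2 * J0 + 1))\<^sup>2 * \<eta>\<^sup>2 * real M))"
    proof (rule dev_bound[OF s])
      show "1 \<le> (x(s := y)) s" using y by simp
      show "(x(s := y)) s' + 1 \<le> 2 * J0 + 1" if "s' \<in> {1..S}" for s'
        using x[OF that] y by auto
    qed
    also have "\<dots> = ?k + ((?c (Suc y) - ?c y) + (?c y - ?c (y - 1)))" by simp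
    finally show "dev s (x(s := y)) \<le> ?k + ((?c (Suc y) - ?c y) + (?c y - ?c (y - 1)))" .
    qed (use p in simp)
    finally show ?thesis .
  qed
  then have "(\<Sum>y\<in>?G. dev s (x(s := y)) / (\<eta>\<^sup>2 * real y * real M)) \<le>
      (\<Sum>y\<in>?G. (?k + ((?c (Suc y) - ?c y) + (?c y - ?c (y - 1)))) / (\<eta>\<^sup>2 * real M * real J0))"
    by (rule sum_mono)
  also have "\<dots> = (real J0 * ?k + ((\<Sum>y\<in>?G. ?c (Suc y) - ?c y) + (\<Sum>y\<in>?G. ?c (Suc y - 1) - ?c (y - 1)))) / (\<eta>\<^sup>2 * real M * real J0)"
    by (simp only: sum_divide_distrib[symmetric] sum.distrib diff_Suc_1) (simp add: sum_subtractf distrib_left)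
  also have "(\<Sum>y\<in>?G. ?c (Suc y) - ?c y) = ?c (2 * J0 + 1) - ?c (J0 + 1)"
    by (rule sum_Suc_diff') simp
  also have "(\<Sum>y\<in>?G. ?c (Suc y - 1) - ?c (y - 1)) = ?c (2 * J0) - ?c J0"
    using sum_Suc_diff'[of "J0 + 1" "2 * J0 + 1" "\<lambda>y. ?c (y - 1)"] by simp
  also have "(real J0 * ?k + (?c (2 * J0 + 1) - ?c (J0 + 1) + (?c (2 * J0) - ?c J0))) / (\<eta>\<^sup>2 * real M * real J0) \<le>
      (real J0 * ?k + 10 * real J0 * (\<eta>\<^sup>2 * real M)) / (\<eta>\<^sup>2 * real M * real J0)"
  proof (intro divide_right_mono add_left_mono)
    have "?c (2 * J0 + 1) \<le> 2 * \<eta>\<^sup>2 * real ((x(s := 2 * J0 + 1)) s) * real M" by (rule eh_bounds(2)[OF s])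
    then have 1: "?c (2 * J0 + 1) \<le> 2 * (2 * real J0 + 1) * (\<eta>\<^sup>2 * real M)" by (simp add: algebra_simps)
    have "?c (2 * J0) \<le> 2 * \<eta>\<^sup>2 * real ((x(s := 2 * J0)) s) * real M" by (rule eh_bounds(2)[OF s])
    then have 2: "?c (2 * J0) \<le> 2 * (2 * real J0) * (\<eta>\<^sup>2 * real M)" by (simp add: mult_ac)
    have 3: "0 \<le> ?c (J0 + 1)" "0 \<le> ?c J0" by (rule eh_bounds(1)[OF s])+
    \<comment> \<open>This is \<open>8 * J0 + 2 \<le> 10 * J0\<close>, the origin of the constant
      10.\<close>
    have "(2 * (2 * real J0 + 1) + 2 * (2 * real J0)) * (\<eta>\<^sup>2 * real M) \<le> (10 * real J0) * (\<eta>\<^sup>2 * real M)"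
      using J p by (intro mult_right_mono) auto
    then show "?c (2 * J0 + 1) - ?c (J0 + 1) + (?c (2 * J0) - ?c J0) \<le> 10 * real J0 * (\<eta>\<^sup>2 * real M)"
      using 1 2 3 by (simp only: distrib_right)
  qed (use p in auto)
  also have "\<dots> = ?k / (\<eta>\<^sup>2 * real M) + 10"
  proof -
    have "(j * k + 10 * j * q) / (q * j) = k / q + 10" if "q > 0" "j > 0" for j k q :: real
      using that by (simp add: field_simps)
    then show ?thesis using p J by simp
  qed
  finally show ?thesis .
qed

text \<open>For each \<open>s\<close> only the strength \<open>x s\<close> runs along the grid while
  the others are fixed; \<open>dev_bound\<close> tolerates arbitrary values of those within the
  grid.\<close>

lemma sum_gge_grid:
  assumes J: "J0 \<ge> 1"
  defines "X \<equiv> PiE {1..S} (\<lambda>_. {J0+1..<2*J0+1})"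
  shows "real J0 * (\<Sum>x\<in>X. gge x) \<le> real (card X) * (real S * ((ln 2 + 24 * sqrt (real S * ((real (2 * J0 + 1))\<^sup>2 * \<eta>\<^sup>2 * real M))) / (\<eta>\<^sup>2 * real M) + 10))"
proof -
  let ?b = "(ln 2 + 24 * sqrt (real S * ((real (2 * J0 + 1))\<^sup>2 * \<eta>\<^sup>2 * real M))) / (\<eta>\<^sup>2 * real M) + 10"
  let ?f = "\<lambda>s x. dev s x / (\<eta>\<^sup>2 * real (x s) * real M)"
  have one: "real J0 * (\<Sum>x\<in>X. ?f s x) \<le> real (card X) * ?b" if s: "s \<in> {1..S}" for s
  proof -
    have "real J0 * (\<Sum>x\<in>X. ?f s x) = real (card {J0+1..<2*J0+1}) * (\<Sum>x\<in>X. ?f s x)" by simp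
    also have "\<dots> = (\<Sum>x\<in>X. \<Sum>y\<in>{J0+1..<2*J0+1}. ?f s (x(s := y)))"
      unfolding X_def by (rule sum_PiE_resample[OF s, symmetric])
    also have "\<dots> \<le> (\<Sum>x\<in>X. ?b)"
    proof (rule sum_mono)
      fix x assume x: "x \<in> X"
      have "x s' \<le> 2 * J0" if "s' \<in> {1..S}" for s'
        using x that unfolding X_def by (fastforce simp: PiE_def Pi_def)
      from sum_dev_grid[OF s J this] show "(\<Sum>y\<in>{J0+1..<2*J0+1}. ?f s (x(s := y))) \<le> ?b" by simp
    qed
    finally show ?thesis by simp
  qed
  have "real J0 * (\<Sum>x\<in>X. gge x) = (\<Sum>s=1..S. real J0 * (\<Sum>x\<in>X. ?f s x))"
    unfolding gge_def by (subst sum.swap) (simp add: sum_distrib_left)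
  also have "\<dots> \<le> (\<Sum>s=1..S. real (card X) * ?b)" by (rule sum_mono) (rule one)
  finally show ?thesis by (simp add: mult_ac)
qed

end

text \<open>Talagrand's positivity principle, uniformly in the reference weight.\<close>
theorem positivity:
  assumes "\<epsilon> > 0" "\<rho> > 0"
  shows "\<exists>S J0. J0 \<ge> 1 \<and> (\<forall>\<eta>>0. \<exists>M0. \<forall>M\<ge>M0. \<forall>(\<Omega> :: 'o set) c sg. perturbed \<Omega> sg M \<eta> \<longrightarrow>
     (\<Sum>x\<in>PiE {1..S} (\<lambda>_. {J0+1..<2*J0+1}). perturbed.pe \<Omega> c sg M S \<eta> (\<lambda>y. of_bool (y \<le> - \<epsilon>)) x)
       \<le> \<rho> * real (card (PiE {1..S} (\<lambda>_. {J0+1..<2*J0+1}))))"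
proof -
  \<comment> \<open>Four contributions of size \<open>\<rho>1\<close>: the case of small
    \<open>q\<close>, the approximation of the ramps, the terms that vanish as \<open>M\<close>
    grows, and the grid constant 10 divided by \<open>J0\<close>.\<close>
  define \<rho>1 where "\<rho>1 = \<rho> / 4"
  have \<rho>1: "\<rho>1 > 0" using assms by (simp add: \<rho>1_def)
  define n0 where "n0 = nat \<lceil>2 / \<epsilon>\<rceil> + 2"
  have n0: "n0 \<ge> 1" by (simp add: n0_def)
  have big: "\<epsilon> / 2 * (real n0 - 1) > 1"
  proof -
    have "real n0 - 1 = real (nat \<lceil>2 / \<epsilon>\<rceil>) + 1" by (simp add: n0_def)
    moreover have "2 / \<epsilon> \<le> real (nat \<lceil>2 / \<epsilon>\<rceil>)" by (rule real_nat_ceiling_ge)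
    ultimately have "real n0 - 1 > 2 / \<epsilon>" by linarith
    then have "\<epsilon> / 2 * (2 / \<epsilon>) < \<epsilon> / 2 * (real n0 - 1)" using assms by (intro mult_strict_left_mono) auto
    then show ?thesis using assms by simp
  qed
  \<comment> \<open>If \<open>q > \<rho>1\<close>, then \<open>negative_overlap_bound\<close>
    divided by \<open>\<rho>1 ^ (n0 - 1)\<close> becomes \<open>1 \<le> C * error\<close>. As
    \<open>q \<le> 1\<close>, this is a bound on \<open>q\<close> that is linear in
    \<open>gge\<close> and can be averaged over the grid.\<close>
  define C where "C = real n0 / \<rho>1 ^ (n0 - 1)"
  have C: "C > 0" using \<rho>1 n0 by (simp add: C_def)
  define \<delta> where "\<delta> = \<rho>1 / (C * (4 * real n0))"
  have \<delta>: "\<delta> > 0" using \<rho>1 C n0 by (simp add: \<delta>_def)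
  have C\<delta>: "C * (4 * real n0 * \<delta>) = \<rho>1" using C n0 by (simp add: \<delta>_def)
  have "\<epsilon> / (2 * real n0) > 0" using assms n0 by simp
  from ramp_poly_approx[where d = "\<lambda>_. \<epsilon> / (2 * real n0)" and e = "\<lambda>n. \<epsilon> * (1 - real n / (2 * real n0))" and nn = n0, OF this \<delta>]
  obtain S K where app: "\<And>n. n < n0 \<Longrightarrow> \<exists>k. (\<forall>s. \<bar>k s\<bar> \<le> K) \<and>
      (\<forall>y. \<bar>y\<bar> \<le> 1 \<longrightarrow> \<bar>ramp (\<epsilon> * (1 - real n / (2 * real n0))) (\<epsilon> / (2 * real n0)) y - (\<Sum>s\<le>S. k s * y ^ s)\<bar> \<le> \<delta>)"
    by blast
  have K0: "K \<ge> 0" using app[of 0] n0 by (auto intro: order_trans[OF abs_ge_zero])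
  \<comment> \<open>\<open>J0\<close> is fixed before \<open>\<eta>\<close> and \<open>M\<close>, so
    \<open>\<eta>\<close> can later be taken small compared with \<open>1 / J0\<close>.\<close>
  define J0 where "J0 = nat \<lceil>C * K * real S * 10 / \<rho>1\<rceil> + 1"
  have J0: "J0 \<ge> 1" by (simp add: J0_def)
  have J0': "C * K * real S * 10 / real J0 \<le> \<rho>1"
  proof -
    have "C * K * real S * 10 / \<rho>1 \<le> real (nat \<lceil>C * K * real S * 10 / \<rho>1\<rceil>)" by (rule real_nat_ceiling_ge)
    then have "C * K * real S * 10 / \<rho>1 \<le> real J0" by (simp add: J0_def)
    then show ?thesis using \<rho>1 J0 by (simp add: field_simps)
  qed
  let ?X = "PiE {1..S} (\<lambda>_. {J0+1..<2*J0+1})"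
  have "\<exists>M0. \<forall>M\<ge>M0. \<forall>(\<Omega> :: 'o set) c sg. perturbed \<Omega> sg M \<eta> \<longrightarrow>
     (\<Sum>x\<in>?X. perturbed.pe \<Omega> c sg M S \<eta> (\<lambda>y. of_bool (y \<le> - \<epsilon>)) x) \<le> \<rho> * real (card ?X)" if \<eta>: "\<eta> > 0" for \<eta>
  proof -
    define A where "A = sqrt (real S * ((real (2 * J0 + 1))\<^sup>2 * \<eta>\<^sup>2))"
    have "(\<lambda>M. C * K * real S / real J0 * (ln 2 / \<eta>\<^sup>2 * (1 / real M) + 24 * A / \<eta>\<^sup>2 * (1 / sqrt (real M)))) \<longlonglongrightarrow>
        C * K * real S / real J0 * (ln 2 / \<eta>\<^sup>2 * 0 + 24 * A / \<eta>\<^sup>2 * 0)"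
    proof (intro tendsto_intros lim_const_over_n)
      have "filterlim (\<lambda>M. sqrt (real M)) at_top sequentially"
        by (rule filterlim_compose[OF sqrt_at_top filterlim_real_sequentially])
      then show "(\<lambda>M. 1 / sqrt (real M)) \<longlonglongrightarrow> 0"
        by (intro tendsto_divide_0[OF tendsto_const] filterlim_at_top_imp_at_infinity)
    qed
    then have "(\<lambda>M. C * K * real S / real J0 * (ln 2 / \<eta>\<^sup>2 * (1 / real M) + 24 * A / \<eta>\<^sup>2 * (1 / sqrt (real M)))) \<longlonglongrightarrow> 0" by simp
    from order_tendstoD(2)[OF this \<rho>1] obtain M1 where M1: "\<And>M. M \<ge> M1 \<Longrightarrow>
        C * K * real S / real J0 * (ln 2 / \<eta>\<^sup>2 * (1 / real M) + 24 * A / \<eta>\<^sup>2 * (1 / sqrt (real M))) < \<rho>1"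
      unfolding eventually_sequentially by blast
    show ?thesis
    proof (intro exI[of _ M1] allI impI)
      fix M and \<Omega> :: "'o set" and c sg assume MM: "M1 \<le> M" and pert: "perturbed \<Omega> sg M \<eta>"
      interpret perturbed \<Omega> c sg M S \<eta> by (rule pert)
      let ?q = "pe (\<lambda>y. of_bool (y \<le> - \<epsilon>))"
      have q: "?q x \<le> 2 * \<rho>1 + C * K * gge x" if x: "x \<in> ?X" for x
      proof (cases "?q x \<le> \<rho>1")
        case True
        have "0 \<le> gge x" unfolding gge_def by (intro sum_nonneg divide_nonneg_nonneg dev_nonneg) auto
        then have "0 \<le> C * K * gge x" using C K0 by simp
        then show ?thesis using True \<rho>1 by linarith
      next
        case False
        have x1: "1 \<le> x s" if "s \<in> {1..S}" for s using x that by (fastforce simp: PiE_def Pi_def)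
        have "\<rho>1 ^ (n0 - 1) \<le> ?q x ^ (n0 - 1)" using False \<rho>1 by (intro power_mono) auto
        also have "\<dots> \<le> real n0 * (K * gge x + 4 * real n0 * \<delta>)"
          by (rule negative_overlap_bound[OF n0 assms(1) big x1 less_imp_le[OF \<delta>] app])
        finally have "1 \<le> C * (K * gge x + 4 * real n0 * \<delta>)" using \<rho>1 by (simp add: C_def field_simps)
        moreover have "\<bar>?q x\<bar> \<le> 1" by (rule pe_bound(2)) simp
        moreover have "C * (K * gge x + 4 * real n0 * \<delta>) = C * K * gge x + \<rho>1" unfolding distrib_left C\<delta> by simp
        ultimately show ?thesis using \<rho>1 by linarith
      qed
      have sq: "sqrt (real S * ((real (2 * J0 + 1))\<^sup>2 * \<eta>\<^sup>2 * real M)) = A * sqrt (real M)"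
        by (simp add: A_def mult.assoc flip: real_sqrt_mult)
      let ?b = "(ln 2 + 24 * (A * sqrt (real M))) / (\<eta>\<^sup>2 * real M) + 10"
      have g: "(\<Sum>x\<in>?X. gge x) \<le> real (card ?X) * (real S * ?b) / real J0"
        using sum_gge_grid[OF J0] J0 unfolding sq by (simp add: pos_le_divide_eq mult.commute)
      have "(\<Sum>x\<in>?X. ?q x) \<le> (\<Sum>x\<in>?X. 2 * \<rho>1 + C * K * gge x)" by (rule sum_mono) (rule q)
      also have "\<dots> = 2 * \<rho>1 * real (card ?X) + C * K * (\<Sum>x\<in>?X. gge x)"
        by (simp add: sum.distrib sum_distrib_left)
      also have "\<dots> \<le> 2 * \<rho>1 * real (card ?X) + C * K * (real (card ?X) * (real S * ?b) / real J0)"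
        using C K0 by (intro add_left_mono mult_left_mono g) auto
      also have "\<dots> = real (card ?X) * (2 * \<rho>1 + (C * K * real S / real J0 * (ln 2 / \<eta>\<^sup>2 * (1 / real M) + 24 * A / \<eta>\<^sup>2 * (1 / sqrt (real M))) +
          C * K * real S * 10 / real J0))"
      proof -
        have "sqrt (real M) / real M = 1 / sqrt (real M)" using M by (simp add: real_div_sqrt field_simps)
        then have "?b = ln 2 / \<eta>\<^sup>2 * (1 / real M) + 24 * A / \<eta>\<^sup>2 * (1 / sqrt (real M)) + 10"
        proof -
          assume q: "sqrt (real M) / real M = 1 / sqrt (real M)"
          have "?b = ln 2 / \<eta>\<^sup>2 * (1 / real M) + 24 * A / \<eta>\<^sup>2 * (sqrt (real M) / real M) + 10"
            by (simp add: add_divide_distrib)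
          then show ?thesis unfolding q .
        qed
        then show ?thesis by (simp only:) (simp add: algebra_simps add_divide_distrib)
      qed
      also have "\<dots> \<le> real (card ?X) * (2 * \<rho>1 + (\<rho>1 + \<rho>1))"
        using M1[OF MM] J0' by (intro mult_left_mono add_left_mono add_mono) auto
      finally show "(\<Sum>x\<in>?X. ?q x) \<le> \<rho> * real (card ?X)" by (simp add: \<rho>1_def mult.commute)
    qed
  qed
  then show ?thesis using J0 by blast
qed

section \<open>Existence of the limiting free energy\<close>

lemma convex_on_power_nonneg: "convex_on {0::real..} (\<lambda>x. x ^ p)"
proof (cases "even p")
  case True
  then show ?thesis using convex_on_subset[OF convex_power_even[of p]] by blast
next
  case False
  then show ?thesis by (rule convex_power_odd)
qed

text \<open>Jensen's inequality; the missing weight \<open>1 - k * \<alpha>\<close> is put on the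
  value 0, whose \<open>p\<close>-th power vanishes.\<close>

lemma power_weighted_mean_le:
  fixes y :: "nat \<Rightarrow> real"
  assumes y: "\<And>j. j < k \<Longrightarrow> 0 \<le> y j" and a: "0 \<le> \<alpha>" "real k * \<alpha> \<le> 1" and p: "p \<ge> 1"
  shows "(\<Sum>j<k. \<alpha> * y j) ^ p \<le> (\<Sum>j<k. \<alpha> * y j ^ p)"
proof -
  define w where "w j = (if j < k then \<alpha> else 1 - real k * \<alpha>)" for j
  define z where "z j = (if j < k then y j else 0)" for j
  have s1: "(\<Sum>j\<in>{..<k}. w j) = real k * \<alpha>" by (simp add: w_def)
  have "(\<Sum>j\<in>{..<Suc k}. w j *\<^sub>R z j) ^ p \<le> (\<Sum>j\<in>{..<Suc k}. w j * z j ^ p)"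
    by (rule convex_on_sum[OF _ _ convex_on_power_nonneg])
       (use y a s1 in \<open>auto simp: w_def z_def\<close>)
  moreover have "(\<Sum>j\<in>{..<Suc k}. w j *\<^sub>R z j) = (\<Sum>j<k. \<alpha> * y j)" by (simp add: w_def z_def)
  moreover have "(\<Sum>j\<in>{..<Suc k}. w j * z j ^ p) = (\<Sum>j<k. \<alpha> * y j ^ p)" using p by (simp add: w_def z_def)
  ultimately show ?thesis by simp
qed

text \<open>For nonnegative \<open>q j\<close> this is convexity of the power. The negative parts
  and the weight \<open>t\<close> are treated as errors: the power has Lipschitz constant
  \<open>p\<close> on [-1, 1], and negative parts beyond \<open>\<epsilon>\<close> are counted by
  the indicator. In \<open>p + 1\<close>, the 1 comes from replacing the powers of the positive
  parts by \<open>q j ^ p\<close>.\<close>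

lemma power_mean_almost_nonneg:
  fixes q :: "nat \<Rightarrow> real" and \<alpha> t \<epsilon> :: real
  assumes q: "\<And>j. j < k \<Longrightarrow> \<bar>q j\<bar> \<le> 1" and a: "0 \<le> \<alpha>" "0 \<le> t" "real k * \<alpha> + t = 1" and p: "p \<ge> 1" and e: "\<epsilon> \<ge> 0"
  shows "((\<Sum>j<k. \<alpha> * q j) + t) ^ p \<le> (\<Sum>j<k. \<alpha> * q j ^ p) +
     (real p + 1) * (\<epsilon> + (\<Sum>j<k. \<alpha> * of_bool (q j \<le> - \<epsilon>))) + real p * t"
proof -
  define b where "b = (\<Sum>j<k. \<alpha> * max 0 (q j))"
  define m where "m = (\<Sum>j<k. \<alpha> * max 0 (- q j))"
  have ka: "real k * \<alpha> \<le> 1" "0 \<le> real k * \<alpha>" using a by auto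
  have b01: "0 \<le> b" "b \<le> 1"
  proof -
    show "0 \<le> b" unfolding b_def using a by (intro sum_nonneg) auto
    have "b \<le> (\<Sum>j<k. \<alpha> * 1)" unfolding b_def using a q by (intro sum_mono mult_left_mono) (auto simp: abs_le_iff)
    then show "b \<le> 1" using ka by simp
  qed
  have m0: "0 \<le> m" unfolding m_def using a by (intro sum_nonneg) auto
  have R: "(\<Sum>j<k. \<alpha> * q j) = b - m"
    unfolding b_def m_def sum_subtractf[symmetric] by (intro sum.cong refl) (auto simp: max_def algebra_simps)
  have R1: "\<bar>(\<Sum>j<k. \<alpha> * q j) + t\<bar> \<le> 1"
  proof -
    have "\<bar>\<Sum>j<k. \<alpha> * q j\<bar> \<le> (\<Sum>j<k. \<alpha> * 1)"
      using a q by (intro order_trans[OF sum_abs] sum_mono) (auto simp: abs_mult intro: mult_left_le)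
    then show ?thesis using a by (simp add: abs_le_iff)
  qed
  have "((\<Sum>j<k. \<alpha> * q j) + t) ^ p - b ^ p \<le> real p * \<bar>(\<Sum>j<k. \<alpha> * q j) + t - b\<bar>"
    using norm_power_diff[of "(\<Sum>j<k. \<alpha> * q j) + t" b p] R1 b01 by simp
  also have "\<dots> \<le> real p * (m + t)" unfolding R using m0 a by (intro mult_left_mono) auto
  finally have 1: "((\<Sum>j<k. \<alpha> * q j) + t) ^ p \<le> b ^ p + real p * (m + t)" by simp
  have "b ^ p \<le> (\<Sum>j<k. \<alpha> * max 0 (q j) ^ p)"
    unfolding b_def by (rule power_weighted_mean_le) (use a ka p in auto)
  also have "\<dots> \<le> (\<Sum>j<k. \<alpha> * (q j ^ p + max 0 (- q j)))"
  proof (intro sum_mono mult_left_mono a)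
    fix j assume j: "j \<in> {..<k}"
    show "max 0 (q j) ^ p \<le> q j ^ p + max 0 (- q j)"
    proof (cases "q j \<ge> 0")
      case False
      have "\<bar>q j ^ p\<bar> \<le> \<bar>q j\<bar> ^ 1"
        unfolding power_abs using q j p by (intro power_decreasing) auto
      then show ?thesis using False p by (auto simp: max_def abs_le_iff power_0_left)
    qed (simp add: max_def)
  qed
  also have "\<dots> = (\<Sum>j<k. \<alpha> * q j ^ p) + m" by (simp add: m_def distrib_left sum.distrib)
  finally have 2: "b ^ p \<le> (\<Sum>j<k. \<alpha> * q j ^ p) + m" .
  have 3: "m \<le> \<epsilon> + (\<Sum>j<k. \<alpha> * of_bool (q j \<le> - \<epsilon>))"
  proof -
    have "m \<le> (\<Sum>j<k. \<alpha> * (\<epsilon> + of_bool (q j \<le> - \<epsilon>)))"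
      unfolding m_def
    proof (intro sum_mono mult_left_mono a)
      fix j assume "j \<in> {..<k}"
      then have "\<bar>q j\<bar> \<le> 1" using q by simp
      then show "max 0 (- q j) \<le> \<epsilon> + of_bool (q j \<le> - \<epsilon>)" using e by (auto simp: max_def)
    qed
    also have "\<dots> = real k * \<alpha> * \<epsilon> + (\<Sum>j<k. \<alpha> * of_bool (q j \<le> - \<epsilon>))"
      by (simp only: distrib_left sum.distrib) simp
    also have "real k * \<alpha> * \<epsilon> \<le> 1 * \<epsilon>" using ka e by (intro mult_right_mono)
    finally show ?thesis by simp
  qed
  have "(real p + 1) * m \<le> (real p + 1) * (\<epsilon> + (\<Sum>j<k. \<alpha> * of_bool (q j \<le> - \<epsilon>)))"
    by (intro mult_left_mono 3) auto
  then show ?thesis using 1 2 by (simp add: algebra_simps)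
qed

section \<open>Interpolation between one system and independent blocks\<close>

locale blocks =
  fixes p M kk r S :: nat and \<eta> :: real
  assumes p: "p \<ge> 1" and M: "M \<ge> 1" and kk: "kk \<ge> 1" and \<eta>: "\<eta> > 0"
begin

definition N :: nat where "N = kk * M + r"

definition \<Omega> :: "(nat \<Rightarrow> nat \<Rightarrow> real) set" where "\<Omega> = PiE {..<kk} (\<lambda>_. Sigma M)"

text \<open>The \<open>r\<close> spins left over by the division into blocks are frozen at 1, which
  makes every system size of the form \<open>kk * M + r\<close> accessible.\<close>

definition emb :: "(nat \<Rightarrow> nat \<Rightarrow> real) \<Rightarrow> nat \<Rightarrow> real" where
  "emb \<omega> = (\<lambda>i\<in>{..<N}. if i < kk * M then \<omega> (i div M) (i mod M) else 1)"

text \<open>The first list entry tags the family of couplings: \<open>0\<close> for the global \<open>p\<close>-spin Hamiltonian,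
  \<open>1\<close> for the block Hamiltonians and \<open>2\<close> for the perturbations; for the last two the second
  entry is the block.\<close>
definition J0 :: "nat list set" where "J0 = (\<lambda>xs. 0 # xs) ` idx p N"
definition J1 :: "nat list set" where "J1 = (\<lambda>(j, xs). 1 # j # xs) ` ({..<kk} \<times> idx p M)"
definition J2 :: "nat list set" where "J2 = (\<lambda>(j, xs). 2 # j # xs) ` ({..<kk} \<times> (\<Union>s\<in>{1..S}. idx s M))"
definition J :: "nat list set" where "J = J0 \<union> J1 \<union> J2"

definition ca :: "real \<Rightarrow> real \<Rightarrow> (nat \<Rightarrow> nat \<Rightarrow> real) \<Rightarrow> nat list \<Rightarrow> (nat \<Rightarrow> nat \<Rightarrow> real) \<Rightarrow> real" where
  "ca A B x i \<omega> = (if hd i = 0 then A * hc p N (tl i) (emb \<omega>)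
     else if hd i = 1 then B * hc p M (tl (tl i)) (\<omega> (hd (tl i)))
     else \<eta> * x (hd (tl i)) (length (tl (tl i))) * hc (length (tl (tl i))) M (tl (tl i)) (\<omega> (hd (tl i))))"

definition EN :: "real \<Rightarrow> real \<Rightarrow> (nat \<Rightarrow> nat \<Rightarrow> real) \<Rightarrow> (nat list \<Rightarrow> real) \<Rightarrow> (nat \<Rightarrow> nat \<Rightarrow> real) \<Rightarrow> real" where
  "EN A B x g = en J (ca A B x) (\<lambda>_. 0) g"

definition PHI :: "real \<Rightarrow> real \<Rightarrow> (nat \<Rightarrow> nat \<Rightarrow> real) \<Rightarrow> real" where
  "PHI A B x = (\<integral>g. lse \<Omega> (EN A B x g) \<partial>disorder)"

definition Rg :: "(nat \<Rightarrow> nat \<Rightarrow> real) \<Rightarrow> (nat \<Rightarrow> nat \<Rightarrow> real) \<Rightarrow> real" where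
  "Rg \<omega> \<omega>' = overlap N (emb \<omega>) (emb \<omega>')"

definition Rb :: "nat \<Rightarrow> (nat \<Rightarrow> nat \<Rightarrow> real) \<Rightarrow> (nat \<Rightarrow> nat \<Rightarrow> real) \<Rightarrow> real" where
  "Rb j \<omega> \<omega>' = overlap M (\<omega> j) (\<omega>' j)"

definition pav :: "real \<Rightarrow> real \<Rightarrow> (nat \<Rightarrow> nat \<Rightarrow> real) \<Rightarrow> ((nat \<Rightarrow> nat \<Rightarrow> real) \<Rightarrow> (nat \<Rightarrow> nat \<Rightarrow> real) \<Rightarrow> real) \<Rightarrow> real" where
  "pav A B x f = (\<integral>g. avg \<Omega> (EN A B x g) (\<lambda>\<omega>. avg \<Omega> (EN A B x g) (\<lambda>\<omega>'. f \<omega> \<omega>')) \<partial>disorder)"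

lemma N1: "N \<ge> 1" "kk * M \<le> N" using M kk by (auto simp: N_def Suc_le_eq)

lemma finite_\<Omega> [simp]: "finite \<Omega>" unfolding \<Omega>_def by (intro finite_PiE) auto

lemma \<Omega>_ne [simp]: "\<Omega> \<noteq> {}" unfolding \<Omega>_def by (simp add: PiE_eq_empty_iff)

lemma \<Omega>_block: "\<omega> \<in> \<Omega> \<Longrightarrow> j < kk \<Longrightarrow> \<omega> j \<in> Sigma M" unfolding \<Omega>_def by (auto simp: PiE_def Pi_def)

lemma emb_Sigma: assumes "\<omega> \<in> \<Omega>" shows "emb \<omega> \<in> Sigma N"
  unfolding Sigma_def
proof (rule PiE_I)
  fix i assume i: "i \<in> {..<N}"
  show "emb \<omega> i \<in> {- 1, 1}"
  proof (cases "i < kk * M")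
    case True
    then have "i div M < kk" "i mod M < M" using M by (auto simp: less_mult_imp_div_less)
    then have "\<omega> (i div M) (i mod M) \<in> {-1, 1}"
      using \<Omega>_block[OF assms, of "i div M"] unfolding Sigma_def by (auto simp: PiE_def Pi_def)
    then show ?thesis using True i by (simp add: emb_def)
  qed (use i in \<open>simp add: emb_def\<close>)
qed (simp add: emb_def)

lemma emb_inj: "inj_on emb \<Omega>"
proof (rule inj_onI)
  fix \<omega> \<omega>' assume w: "\<omega> \<in> \<Omega>" "\<omega>' \<in> \<Omega>" and e: "emb \<omega> = emb \<omega>'"
  have "\<omega> j i = \<omega>' j i" if j: "j < kk" and i: "i < M" for j i
  proof -
    have l: "j * M + i < kk * M"
    proof -
      have "j * M + i < (j + 1) * M" using i by simp
      also have "\<dots> \<le> kk * M" using j by (intro mult_le_mono1) auto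
      finally show ?thesis .
    qed
    then have "j * M + i < N" using N1 by linarith
    then show ?thesis using fun_cong[OF e, of "j * M + i"] l i by (simp add: emb_def)
  qed
  moreover have "\<omega> j \<in> Sigma M" "\<omega>' j \<in> Sigma M" if "j < kk" for j using w that \<Omega>_block by auto
  ultimately have "\<omega> j = \<omega>' j" if "j < kk" for j
    using that unfolding Sigma_def by (intro PiE_ext[of "\<omega> j" "{..<M}" "\<lambda>_. {-1,1}" "\<omega>' j"]) auto
  then show "\<omega> = \<omega>'" using w unfolding \<Omega>_def by (intro PiE_ext[of \<omega> "{..<kk}" "\<lambda>_. Sigma M" \<omega>']) auto
qed

lemma sum_blocks: "(\<Sum>i<kk * M. f (i div M) (i mod M)) = (\<Sum>j<kk. \<Sum>i<M. f j i)" for f :: "nat \<Rightarrow> nat \<Rightarrow> real"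
proof -
  have "(\<Sum>i<kk * M. f (i div M) (i mod M)) = (\<Sum>j<kk. \<Sum>i\<in>{j * M..<j * M + M}. f (i div M) (i mod M))"
    by (rule sum.nat_group[symmetric])
  also have "\<dots> = (\<Sum>j<kk. \<Sum>i<M. f j i)"
  proof (rule sum.cong[OF refl])
    fix j
    have "(\<Sum>i\<in>{j * M..<j * M + M}. f (i div M) (i mod M)) = (\<Sum>i\<in>{0..<M}. f ((i + j * M) div M) ((i + j * M) mod M))"
      using sum.shift_bounds_nat_ivl[of "\<lambda>i. f (i div M) (i mod M)" 0 "j * M" M] by (simp add: add.commute)
    also have "\<dots> = (\<Sum>i<M. f j i)" by (rule sum.cong) auto
    finally show "(\<Sum>i\<in>{j * M..<j * M + M}. f (i div M) (i mod M)) = (\<Sum>i<M. f j i)" .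
  qed
  finally show ?thesis .
qed

lemma Rg_eq: "Rg \<omega> \<omega>' = (\<Sum>j<kk. real M / real N * Rb j \<omega> \<omega>') + real r / real N"
proof -
  have spl: "{..<N} = {..<kk * M} \<union> {kk * M..<N}" using N1 by auto
  have "(\<Sum>i<N. emb \<omega> i * emb \<omega>' i) = (\<Sum>i<kk * M. \<omega> (i div M) (i mod M) * \<omega>' (i div M) (i mod M)) + (\<Sum>i\<in>{kk * M..<N}. 1)"
    unfolding spl
    by (subst sum.union_disjoint) (use N1 in \<open>auto simp: emb_def intro!: sum.cong arg_cong2[where f = "(+)"]\<close>)
  also have "\<dots> = (\<Sum>j<kk. \<Sum>i<M. \<omega> j i * \<omega>' j i) + real r"
    by (subst sum_blocks) (simp add: N_def)
  finally have e: "(\<Sum>i<N. emb \<omega> i * emb \<omega>' i) = (\<Sum>j<kk. \<Sum>i<M. \<omega> j i * \<omega>' j i) + real r" .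
  have q: "real M / real N * (y / real M) = y / real N" for y using M by simp
  show ?thesis
    unfolding Rg_def Rb_def overlap_def e q add_divide_distrib by (subst sum_divide_distrib) (rule refl)
qed

lemma sum_J0: "(\<Sum>i\<in>J0. f i) = (\<Sum>xs\<in>idx p N. f (0 # xs))" for f :: "nat list \<Rightarrow> real"
  unfolding J0_def by (subst sum.reindex) (auto simp: inj_on_def)

lemma sum_J1: "(\<Sum>i\<in>J1. f i) = (\<Sum>j<kk. \<Sum>xs\<in>idx p M. f (1 # j # xs))" for f :: "nat list \<Rightarrow> real"
  unfolding J1_def by (subst sum.reindex) (auto simp: inj_on_def sum.cartesian_product split_beta')

lemma sum_J2: "(\<Sum>i\<in>J2. f i) = (\<Sum>j<kk. \<Sum>s=1..S. \<Sum>xs\<in>idx s M. f (2 # j # xs))" for f :: "nat list \<Rightarrow> real"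
proof -
  have "(\<Sum>i\<in>J2. f i) = (\<Sum>j<kk. \<Sum>xs\<in>(\<Union>s\<in>{1..S}. idx s M). f (2 # j # xs))"
    unfolding J2_def by (subst sum.reindex) (auto simp: inj_on_def sum.cartesian_product split_beta')
  also have "\<dots> = (\<Sum>j<kk. \<Sum>s=1..S. \<Sum>xs\<in>idx s M. f (2 # j # xs))"
    by (intro sum.cong refl sum.UNION_disjoint) (auto simp: idx_def simp del: finite_idx intro: finite_idx[unfolded idx_def])
  finally show ?thesis .
qed

lemma finite_J [simp]: "finite J" "finite J0" "finite J1" "finite J2"
  by (auto simp: J_def J0_def J1_def J2_def)

lemma sum_J: "(\<Sum>i\<in>J. f i) = (\<Sum>i\<in>J0. f i) + (\<Sum>i\<in>J1. f i) + (\<Sum>i\<in>J2. f i)" for f :: "nat list \<Rightarrow> real"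
proof -
  have "J0 \<inter> J1 = {}" "(J0 \<union> J1) \<inter> J2 = {}" by (auto simp: J0_def J1_def J2_def)
  then show ?thesis unfolding J_def by (simp add: sum.union_disjoint)
qed

lemma EN_eq: "EN A B x g \<omega> = A * H p N (\<lambda>xs. g (0 # xs)) (emb \<omega>) + (\<Sum>j<kk. B * H p M (\<lambda>xs. g (1 # j # xs)) (\<omega> j)) +
   (\<Sum>j<kk. \<Sum>s=1..S. \<eta> * x j s * H s M (\<lambda>xs. g (2 # j # xs)) (\<omega> j))"
proof -
  have "(\<Sum>xs\<in>idx s M. \<eta> * x j (length xs) * hc (length xs) M xs (\<omega> j) * g (2 # j # xs)) =
     \<eta> * x j s * H s M (\<lambda>xs. g (2 # j # xs)) (\<omega> j)" for j s
    unfolding H_hc sum_distrib_left by (intro sum.cong refl) (auto simp: idx_def)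
  then show ?thesis
    unfolding EN_def en_def sum_J sum_J0 sum_J1 sum_J2
    by (simp add: ca_def H_hc[of p] sum_distrib_left mult.assoc)
qed

definition cov :: "real \<Rightarrow> real \<Rightarrow> (nat \<Rightarrow> nat \<Rightarrow> real) \<Rightarrow> (nat \<Rightarrow> nat \<Rightarrow> real) \<Rightarrow> (nat \<Rightarrow> nat \<Rightarrow> real) \<Rightarrow> real" where
  "cov A B x \<omega> \<omega>' = A * (real N * Rg \<omega> \<omega>' ^ p) + B * (\<Sum>j<kk. real M * Rb j \<omega> \<omega>' ^ p) +
     (\<Sum>j<kk. \<Sum>s=1..S. \<eta>\<^sup>2 * x j s * (real M * Rb j \<omega> \<omega>' ^ s))"

lemma ca_cov: "(\<Sum>i\<in>J. ca A' B' x' i \<omega> * ca A B x i \<omega>') = cov (A' * A) (B' * B) (\<lambda>j s. x' j s * x j s) \<omega> \<omega>'"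
proof -
  have 0: "(\<Sum>xs\<in>idx p N. ca A' B' x' (0 # xs) \<omega> * ca A B x (0 # xs) \<omega>') = A' * A * (real N * Rg \<omega> \<omega>' ^ p)"
    unfolding Rg_def hc_cov[OF N1(1) p, symmetric] sum_distrib_left by (intro sum.cong refl) (simp add: ca_def)
  have 1: "(\<Sum>xs\<in>idx p M. ca A' B' x' (1 # j # xs) \<omega> * ca A B x (1 # j # xs) \<omega>') = B' * B * (real M * Rb j \<omega> \<omega>' ^ p)" for j
    unfolding Rb_def hc_cov[OF M p, symmetric] sum_distrib_left by (intro sum.cong refl) (simp add: ca_def)
  have 2: "(\<Sum>xs\<in>idx s M. ca A' B' x' (2 # j # xs) \<omega> * ca A B x (2 # j # xs) \<omega>') =
     \<eta>\<^sup>2 * (x' j s * x j s) * (real M * Rb j \<omega> \<omega>' ^ s)" if "s \<in> {1..S}" for j s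
  proof -
    have "s \<ge> 1" using that by simp
    then show ?thesis
      unfolding Rb_def hc_cov[OF M \<open>s \<ge> 1\<close>, symmetric] sum_distrib_left
      by (intro sum.cong refl) (auto simp: ca_def idx_def power2_eq_square)
  qed
  show ?thesis
    unfolding sum_J sum_J0 sum_J1 sum_J2 0 1 cov_def using 2 by (simp add: sum_distrib_left)
qed

lemma measurable_EN [measurable]: "(\<lambda>g. EN A B x g \<omega>) \<in> borel_measurable disorder"
  unfolding EN_def by measurable

lemma integrable_PHI: "integrable disorder (\<lambda>g. lse \<Omega> (EN A B x g))"
  unfolding EN_def by (rule integrable_lse_en) auto

lemma integrable_pav:
  "integrable disorder (\<lambda>g. avg \<Omega> (EN A B x g) (\<lambda>\<omega>. avg \<Omega> (EN A B x g) (\<lambda>\<omega>'. f \<omega> \<omega>')))"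
proof (rule integrable_avg_bounded[where B = "\<Sum>\<omega>\<in>\<Omega>. \<Sum>\<omega>'\<in>\<Omega>. \<bar>f \<omega> \<omega>'\<bar>"])
  fix g \<omega> assume w: "\<omega> \<in> \<Omega>"
  have "\<bar>avg \<Omega> (EN A B x g) (\<lambda>\<omega>'. f \<omega> \<omega>')\<bar> \<le> (\<Sum>\<omega>'\<in>\<Omega>. \<bar>f \<omega> \<omega>'\<bar>)"
    by (intro avg_abs_le) (auto intro: member_le_sum)
  also have "\<dots> \<le> (\<Sum>\<omega>\<in>\<Omega>. \<Sum>\<omega>'\<in>\<Omega>. \<bar>f \<omega> \<omega>'\<bar>)"
    by (rule member_le_sum[where f = "\<lambda>\<omega>. \<Sum>\<omega>'\<in>\<Omega>. \<bar>f \<omega> \<omega>'\<bar>"]) (use w in \<open>auto intro: sum_nonneg\<close>)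
  finally show "\<bar>avg \<Omega> (EN A B x g) (\<lambda>\<omega>'. f \<omega> \<omega>')\<bar> \<le> \<dots>" .
qed (auto intro!: measurable_avg)

lemma pav_mono:
  assumes "\<And>\<omega> \<omega>'. \<omega> \<in> \<Omega> \<Longrightarrow> \<omega>' \<in> \<Omega> \<Longrightarrow> f \<omega> \<omega>' \<le> h \<omega> \<omega>'"
  shows "pav A B x f \<le> pav A B x h"
  unfolding pav_def by (intro integral_mono integrable_pav avg_mono assms)

lemma pav_const: "pav A B x (\<lambda>_ _. k) = k"
  unfolding pav_def by (simp add: avg_const disorder.prob_space[simplified])

lemma pav_add: "pav A B x (\<lambda>\<omega> \<omega>'. f \<omega> \<omega>' + h \<omega> \<omega>') = pav A B x f + pav A B x h"
  unfolding pav_def avg_add using integrable_pav by simp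

lemma pav_cmult: "pav A B x (\<lambda>\<omega> \<omega>'. k * f \<omega> \<omega>') = k * pav A B x f"
  unfolding pav_def avg_cmult by simp

lemma pav_sum: "pav A B x (\<lambda>\<omega> \<omega>'. \<Sum>i\<in>I. f i \<omega> \<omega>') = (\<Sum>i\<in>I. pav A B x (f i))"
  unfolding pav_def avg_sum using integrable_pav by (simp add: Bochner_Integration.integral_sum)

lemma Rb_abs: "\<omega> \<in> \<Omega> \<Longrightarrow> \<omega>' \<in> \<Omega> \<Longrightarrow> j < kk \<Longrightarrow> \<bar>Rb j \<omega> \<omega>'\<bar> \<le> 1"
  unfolding Rb_def by (intro overlap_abs_le_1 \<Omega>_block)

lemma R_self: "\<omega> \<in> \<Omega> \<Longrightarrow> Rg \<omega> \<omega> = 1" "\<omega> \<in> \<Omega> \<Longrightarrow> j < kk \<Longrightarrow> Rb j \<omega> \<omega> = 1"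
  unfolding Rg_def Rb_def using overlap_self N1 M emb_Sigma \<Omega>_block by auto

lemma EN_diff: "EN A' B' x' g \<omega> - EN A B x g \<omega> = (\<Sum>i\<in>J. ca (A' - A) (B' - B) (\<lambda>j s. x' j s - x j s) i \<omega> * g i)"
  unfolding EN_def en_def by (simp add: sum_subtractf[symmetric] left_diff_distrib[symmetric])
     (auto intro!: sum.cong simp: ca_def algebra_simps)

text \<open>The value of \<open>cov A B x\<close> on the diagonal, the same for all configurations
  because self-overlaps are 1.\<close>

definition dg :: "real \<Rightarrow> real \<Rightarrow> (nat \<Rightarrow> nat \<Rightarrow> real) \<Rightarrow> real" where
  "dg A B x = A * real N + B * (real kk * real M) + (\<Sum>j<kk. \<Sum>s=1..S. \<eta>\<^sup>2 * x j s * real M)"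

lemma expectation_linear:
  "(\<integral>g. avg \<Omega> (EN A B x g) (\<lambda>\<omega>. \<Sum>i\<in>J. ca A' B' x' i \<omega> * g i) \<partial>disorder) =
    dg (A' * A) (B' * B) (\<lambda>j s. x' j s * x j s) - pav A B x (cov (A' * A) (B' * B) (\<lambda>j s. x' j s * x j s))"
proof -
  have "avg \<Omega> (EN A B x g) (\<lambda>\<omega>. cov a b y \<omega> \<omega>) = dg a b y" for g a b y
  proof -
    have "avg \<Omega> (EN A B x g) (\<lambda>\<omega>. cov a b y \<omega> \<omega>) = avg \<Omega> (EN A B x g) (\<lambda>\<omega>. dg a b y)"
      by (rule avg_cong) (simp add: cov_def dg_def R_self)
    then show ?thesis by (simp add: avg_const)
  qed
  then have d: "(\<integral>g. avg \<Omega> (EN A B x g) (\<lambda>\<omega>. cov a b y \<omega> \<omega>) \<partial>disorder) = dg a b y" for a b y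
    by (simp add: disorder.prob_space[simplified])
  show ?thesis
    unfolding EN_def gibbs_ibp[OF finite_\<Omega> \<Omega>_ne finite_J(1) order_refl] ca_cov
    unfolding EN_def[symmetric] d pav_def ..
qed

lemma integrable_avg_linear:
  "integrable disorder (\<lambda>g. avg \<Omega> (EN A B x g) (\<lambda>\<omega>. \<Sum>i\<in>J. ca A' B' x' i \<omega> * g i))"
  unfolding avg_def
proof (rule Bochner_Integration.integrable_sum)
  fix \<omega> assume w: "\<omega> \<in> \<Omega>"
  note [measurable] = measurable_sm[of "EN A B x" \<Omega> \<omega>, OF measurable_EN]
  have ih: "integrable disorder (\<lambda>g. \<Sum>i\<in>J. ca A' B' x' i \<omega> * g i)" using integrable_coordinate by auto
  show "integrable disorder (\<lambda>g. sm \<Omega> (EN A B x g) \<omega> * (\<Sum>i\<in>J. ca A' B' x' i \<omega> * g i))"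
  proof (rule Bochner_Integration.integrable_bound[OF ih])
    have "\<bar>sm \<Omega> (EN A B x g) \<omega> * y\<bar> \<le> 1 * \<bar>y\<bar>" for g y
      unfolding abs_mult using sm_nonneg[of \<Omega> "EN A B x g" \<omega>] sm_le_1[OF _ w, of "EN A B x g"]
      by (intro mult_right_mono) auto
    then show "AE g in disorder. norm (sm \<Omega> (EN A B x g) \<omega> * (\<Sum>i\<in>J. ca A' B' x' i \<omega> * g i)) \<le> norm (\<Sum>i\<in>J. ca A' B' x' i \<omega> * g i)" by simp
  qed measurable
qed

text \<open>Convexity in all parameters at once, with the gradient at \<open>A\<close>,
  \<open>B\<close>, \<open>x\<close> computed by integration by parts. Moving along the
  interpolation and removing the perturbation are both instances.\<close>

lemma PHI_convex:
  "PHI A B x + (dg ((A' - A) * A) ((B' - B) * B) (\<lambda>j s. (x' j s - x j s) * x j s) -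
     pav A B x (cov ((A' - A) * A) ((B' - B) * B) (\<lambda>j s. (x' j s - x j s) * x j s))) \<le> PHI A' B' x'"
proof -
  let ?l = "\<lambda>g. avg \<Omega> (EN A B x g) (\<lambda>\<omega>. \<Sum>i\<in>J. ca (A' - A) (B' - B) (\<lambda>j s. x' j s - x j s) i \<omega> * g i)"
  have "?l g \<le> lse \<Omega> (EN A' B' x' g) - lse \<Omega> (EN A B x g)" for g
    unfolding EN_diff[symmetric] by (rule lse_convex) auto
  then have "(\<integral>g. ?l g \<partial>disorder) \<le> (\<integral>g. lse \<Omega> (EN A' B' x' g) - lse \<Omega> (EN A B x g) \<partial>disorder)"
    by (intro integral_mono integrable_avg_linear Bochner_Integration.integrable_diff integrable_PHI)
  also have "\<dots> = PHI A' B' x' - PHI A B x"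
    unfolding PHI_def by (rule Bochner_Integration.integral_diff[OF integrable_PHI integrable_PHI])
  finally show ?thesis unfolding expectation_linear by simp
qed

text \<open>The gradient with respect to the strengths carries the strengths themselves as a factor,
  so it vanishes at 0; by convexity the perturbation can only raise the free energy.\<close>

lemma PHI_remove_helper_lower: "PHI A B (\<lambda>_ _. 0) \<le> PHI A B x"
proof -
  have "cov 0 0 (\<lambda>_ _. 0) = (\<lambda>_ _. 0)" by (auto simp: cov_def fun_eq_iff)
  then show ?thesis using PHI_convex[of A B "\<lambda>_ _. 0" A B x] by (simp add: dg_def pav_const)
qed

text \<open>The tangent at \<open>x\<close> towards strength 0; the factor 2 accounts for the
  diagonal and the two-replica part of the covariance, each bounded by the maximal variance of the
  perturbation.\<close>

lemma PHI_remove_helper_upper: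
  assumes x: "\<And>j s. j < kk \<Longrightarrow> s \<in> {1..S} \<Longrightarrow> \<bar>x j s\<bar> \<le> D"
  shows "PHI A B x \<le> PHI A B (\<lambda>_ _. 0) + 2 * (real S * (\<eta>\<^sup>2 * D\<^sup>2)) * real N"
proof -
  let ?k = "real kk * (real S * (\<eta>\<^sup>2 * D\<^sup>2 * real M))"
  have x2: "x j s * x j s \<le> D\<^sup>2" if "j < kk" "s \<in> {1..S}" for j s
    using x[OF that] by (metis abs_ge_zero abs_mult_self_eq power2_eq_square power_mono mult_mono)
  have d: "(\<Sum>j<kk. \<Sum>s=1..S. \<eta>\<^sup>2 * (x j s * x j s) * real M) \<le> ?k"
  proof -
    have "(\<Sum>j<kk. \<Sum>s=1..S. \<eta>\<^sup>2 * (x j s * x j s) * real M) \<le> (\<Sum>j<kk. \<Sum>s=1..S. \<eta>\<^sup>2 * D\<^sup>2 * real M)"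
      using x2 by (intro sum_mono mult_right_mono mult_left_mono) auto
    then show ?thesis by simp
  qed
  have "pav A B x (\<lambda>_ _. - ?k) \<le> pav A B x (cov 0 0 (\<lambda>j s. x j s * x j s))"
  proof (rule pav_mono)
    fix \<omega> \<omega>' assume w: "\<omega> \<in> \<Omega>" "\<omega>' \<in> \<Omega>"
    have "(\<Sum>j<kk. \<Sum>s=1..S. - (\<eta>\<^sup>2 * (x j s * x j s) * real M)) \<le> (\<Sum>j<kk. \<Sum>s=1..S. \<eta>\<^sup>2 * (x j s * x j s) * (real M * Rb j \<omega> \<omega>' ^ s))"
    proof (intro sum_mono)
      fix j s assume "j \<in> {..<kk}"
      then have "\<bar>Rb j \<omega> \<omega>' ^ s\<bar> \<le> 1" using Rb_abs[OF w] by (simp add: power_abs power_le_one)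
      then have "real M * (-1) \<le> real M * Rb j \<omega> \<omega>' ^ s" by (intro mult_left_mono) auto
      then have "\<eta>\<^sup>2 * (x j s * x j s) * (real M * (-1)) \<le> \<eta>\<^sup>2 * (x j s * x j s) * (real M * Rb j \<omega> \<omega>' ^ s)"
        by (rule mult_left_mono) auto
      then show "- (\<eta>\<^sup>2 * (x j s * x j s) * real M) \<le> \<eta>\<^sup>2 * (x j s * x j s) * (real M * Rb j \<omega> \<omega>' ^ s)" by simp
    qed
    then show "- ?k \<le> cov 0 0 (\<lambda>j s. x j s * x j s) \<omega> \<omega>'" using d by (simp add: cov_def sum_negf)
  qed
  then have pk: "- ?k \<le> pav A B x (cov 0 0 (\<lambda>j s. x j s * x j s))" by (simp only: pav_const)
  have "PHI A B x + (dg 0 0 (\<lambda>j s. - (x j s * x j s)) - pav A B x (cov 0 0 (\<lambda>j s. - (x j s * x j s)))) \<le> PHI A B (\<lambda>_ _. 0)"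
    using PHI_convex[of A B x A B "\<lambda>_ _. 0"] by simp
  moreover have "cov 0 0 (\<lambda>j s. - (x j s * x j s)) = (\<lambda>\<omega> \<omega>'. (-1) * cov 0 0 (\<lambda>j s. x j s * x j s) \<omega> \<omega>')"
    by (auto simp: cov_def fun_eq_iff sum_negf)
  then have "pav A B x (cov 0 0 (\<lambda>j s. - (x j s * x j s))) = - pav A B x (cov 0 0 (\<lambda>j s. x j s * x j s))"
    by (simp only: pav_cmult)
  moreover have "dg 0 0 (\<lambda>j s. - (x j s * x j s)) \<ge> - ?k" using d by (simp add: dg_def sum_negf)
  moreover have "?k \<le> (real S * (\<eta>\<^sup>2 * D\<^sup>2)) * real N"
  proof -
    have "real kk * real M \<le> real N" using N1(2) by (metis of_nat_le_iff of_nat_mult)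
    then have "(real S * (\<eta>\<^sup>2 * D\<^sup>2)) * (real kk * real M) \<le> (real S * (\<eta>\<^sup>2 * D\<^sup>2)) * real N" by (intro mult_left_mono) auto
    then show ?thesis by (simp add: mult_ac)
  qed
  ultimately show ?thesis using pk by linarith
qed

end

lemma integral_reindex:
  fixes \<Psi> :: "(nat list \<Rightarrow> real) \<Rightarrow> real"
  assumes f: "inj f" and m: "\<Psi> \<in> borel_measurable disorder"
  shows "(\<integral>g. \<Psi> (\<lambda>i. g (f i)) \<partial>disorder) = (\<integral>g. \<Psi> g \<partial>disorder)"
    and "integrable disorder (\<lambda>g. \<Psi> (\<lambda>i. g (f i))) \<longleftrightarrow> integrable disorder \<Psi>"
proof -
  have "(\<integral>g. \<Psi> g \<partial>(distr disorder disorder (\<lambda>g i. g (f i)))) = (\<integral>g. \<Psi> (\<lambda>i. g (f i)) \<partial>disorder)"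
    by (rule integral_distr[OF measurable_reindex m])
  then show "(\<integral>g. \<Psi> (\<lambda>i. g (f i)) \<partial>disorder) = (\<integral>g. \<Psi> g \<partial>disorder)" by (simp add: distr_reindex[OF f])
  have "integrable (distr disorder disorder (\<lambda>g i. g (f i))) \<Psi> \<longleftrightarrow> integrable disorder (\<lambda>g. \<Psi> (\<lambda>i. g (f i)))"
    by (rule integrable_distr_eq[OF measurable_reindex m])
  then show "integrable disorder (\<lambda>g. \<Psi> (\<lambda>i. g (f i))) \<longleftrightarrow> integrable disorder \<Psi>" by (simp add: distr_reindex[OF f])
qed

lemma nn_integral_reindex:
  assumes f: "inj f" and m: "\<Psi> \<in> borel_measurable disorder"
  shows "(\<integral>\<^sup>+g. \<Psi> (\<lambda>i. g (f i)) \<partial>disorder) = (\<integral>\<^sup>+g. \<Psi> g \<partial>disorder)"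
proof -
  have "(\<integral>\<^sup>+g. \<Psi> g \<partial>(distr disorder disorder (\<lambda>g i. g (f i)))) = (\<integral>\<^sup>+g. \<Psi> (\<lambda>i. g (f i)) \<partial>disorder)"
    by (rule nn_integral_distr[OF measurable_reindex]) (use m in simp)
  then show ?thesis by (simp add: distr_reindex[OF f])
qed

lemma measurable_nn_integral_merge:
  assumes "f \<in> borel_measurable disorder"
  shows "(\<lambda>g. \<integral>\<^sup>+g'. f (\<lambda>i. if i \<in> K then g' i else g i) \<partial>disorder) \<in> borel_measurable disorder"
proof -
  have "(\<lambda>(g, g'). f (\<lambda>i. if i \<in> K then g' i else g i)) \<in> borel_measurable (disorder \<Otimes>\<^sub>M disorder)"
    using measurable_compose[OF measurable_pair_swap' measurable_compose[OF measurable_merge[of K] assms]]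
    by (simp add: split_beta' cong: if_cong)
  then show ?thesis by (rule disorder.borel_measurable_nn_integral)
qed

text \<open>Free of the normalisation in \<open>EL\<close>; the two differ by a multiple of
  \<open>N\<close> (see \<open>EL_eq\<close>), and this version is nonnegative.\<close>

definition aN :: "nat \<Rightarrow> real \<Rightarrow> nat \<Rightarrow> real" where
  "aN p k N = (\<integral>g. lse (Sigma N) (\<lambda>\<sigma>. k * H p N g \<sigma>) \<partial>disorder)"

lemma measurable_lse_H [measurable]: "(\<lambda>g. lse A (\<lambda>\<sigma>. k * H p N g \<sigma>)) \<in> borel_measurable disorder"
  by (rule measurable_lse) measurable

lemma integrable_lse_H:
  assumes "N \<ge> 1" "p \<ge> 1"
  shows "integrable disorder (\<lambda>g. lse (Sigma N) (\<lambda>\<sigma>. k * H p N g \<sigma>))"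
  using subgaussian_lse_H[OF assms order_refl, of k "\<lambda>_. 0"] by (simp add: subgaussian_def)

context blocks
begin

text \<open>Freezing the leftover spins restricts the sum over configurations, hence an inequality,
  in the direction that superadditivity asks for.\<close>

lemma PHI_global: "PHI A 0 (\<lambda>_ _. 0) \<le> aN p A N"
proof -
  have inj: "inj ((#) (0::nat))" by (simp add: inj_def)
  have "lse \<Omega> (EN A 0 (\<lambda>_ _. 0) g) \<le> lse (Sigma N) (\<lambda>\<sigma>. A * H p N (\<lambda>xs. g (0 # xs)) \<sigma>)" for g
  proof -
    have "lse \<Omega> (EN A 0 (\<lambda>_ _. 0) g) = lse (emb ` \<Omega>) (\<lambda>\<sigma>. A * H p N (\<lambda>xs. g (0 # xs)) \<sigma>)"
      unfolding lse_def sum.reindex[OF emb_inj] by (simp add: EN_eq o_def)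
    also have "\<dots> \<le> lse (Sigma N) (\<lambda>\<sigma>. A * H p N (\<lambda>xs. g (0 # xs)) \<sigma>)"
      by (rule lse_mono_set) (auto simp: emb_Sigma)
    finally show ?thesis .
  qed
  then have "PHI A 0 (\<lambda>_ _. 0) \<le> (\<integral>g. lse (Sigma N) (\<lambda>\<sigma>. A * H p N (\<lambda>xs. g (0 # xs)) \<sigma>) \<partial>disorder)"
    unfolding PHI_def
    by (intro integral_mono integrable_PHI)
       (use integral_reindex(2)[OF inj measurable_lse_H] integrable_lse_H[OF N1(1) p] in auto)
  also have "\<dots> = aN p A N" unfolding aN_def by (rule integral_reindex(1)[OF inj measurable_lse_H])
  finally show ?thesis .
qed

lemma PHI_local: "PHI 0 B (\<lambda>_ _. 0) = real kk * aN p B M"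
proof -
  have inj: "inj (\<lambda>xs. 1 # j # xs)" for j :: nat by (simp add: inj_def)
  let ?L = "\<lambda>j g. lse (Sigma M) (\<lambda>\<sigma>. B * H p M (\<lambda>xs. g (1 # j # xs)) \<sigma>)"
  have "lse \<Omega> (EN 0 B (\<lambda>_ _. 0) g) = (\<Sum>j<kk. ?L j g)" for g
  proof -
    have "(\<Sum>\<omega>\<in>\<Omega>. exp (EN 0 B (\<lambda>_ _. 0) g \<omega>)) = (\<Sum>\<omega>\<in>\<Omega>. \<Prod>j<kk. exp (B * H p M (\<lambda>xs. g (1 # j # xs)) (\<omega> j)))"
      by (simp add: EN_eq exp_sum)
    also have "\<dots> = (\<Prod>j<kk. \<Sum>\<sigma>\<in>Sigma M. exp (B * H p M (\<lambda>xs. g (1 # j # xs)) \<sigma>))"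
      unfolding \<Omega>_def by (subst prod_sum_PiE) auto
    finally have e: "(\<Sum>\<omega>\<in>\<Omega>. exp (EN 0 B (\<lambda>_ _. 0) g \<omega>)) =
      (\<Prod>j<kk. \<Sum>\<sigma>\<in>Sigma M. exp (B * H p M (\<lambda>xs. g (1 # j # xs)) \<sigma>))" .
    have "(\<Sum>\<sigma>\<in>Sigma M. exp (B * H p M (\<lambda>xs. g (1 # j # xs)) \<sigma>)) \<noteq> 0" for j
      using sum_exp_pos[OF finite_Sigma Sigma_nonempty, of "\<lambda>\<sigma>. B * H p M (\<lambda>xs. g (1 # j # xs)) \<sigma>" M] by linarith
    then show ?thesis unfolding lse_def e by (intro ln_prod) auto
  qed
  moreover have "integrable disorder (?L j)" for j
    using integral_reindex(2)[OF inj measurable_lse_H] integrable_lse_H[OF M p] by auto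
  ultimately have "PHI 0 B (\<lambda>_ _. 0) = (\<Sum>j<kk. \<integral>g. ?L j g \<partial>disorder)"
    unfolding PHI_def by (simp add: Bochner_Integration.integral_sum)
  also have "\<dots> = (\<Sum>j<kk. aN p B M)"
    unfolding aN_def by (intro sum.cong refl) (rule integral_reindex(1)[OF inj measurable_lse_H])
  finally show ?thesis by simp
qed

lemma H_cong: "(\<And>xs. xs \<in> idx s M \<Longrightarrow> g xs = g' xs) \<Longrightarrow> H s M g \<sigma> = H s M g' \<sigma>"
  by (simp add: H_def)

lemma perturbed_block: "j < kk \<Longrightarrow> perturbed \<Omega> (\<lambda>\<omega>. \<omega> j) M \<eta>"
  by unfold_locales (use \<Omega>_block M \<eta> in auto)

text \<open>Conditionally on all other couplings, the perturbation of block \<open>j\<close> acts on a deterministic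
  reference weight.\<close>
lemma block_positivity:
  fixes x :: "nat \<Rightarrow> nat \<Rightarrow> real" and X :: "(nat \<Rightarrow> nat) set"
  assumes j: "j < kk" and X: "finite X" and f: "\<And>y. 0 \<le> f y" "\<And>y. f y \<le> 1"
    and pos: "\<And>c. (\<Sum>y\<in>X. perturbed.pe \<Omega> c (\<lambda>\<omega>. \<omega> j) M S \<eta> f y) \<le> b"
  shows "(\<Sum>y\<in>X. pav A B (x(j := (\<lambda>s. real (y s)))) (\<lambda>\<omega> \<omega>'. f (Rb j \<omega> \<omega>'))) \<le> b"
proof -
  let ?x = "\<lambda>y. x(j := (\<lambda>s. real (y s)))"
  let ?F = "\<lambda>y g. avg \<Omega> (EN A B (?x y) g) (\<lambda>\<omega>. avg \<Omega> (EN A B (?x y) g) (\<lambda>\<omega>'. f (Rb j \<omega> \<omega>')))"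
  \<comment> \<open>Only the couplings of the perturbation of block \<open>j\<close> are resampled:
    tag 2, then \<open>j\<close>.\<close>
  let ?m = "\<lambda>g' g i. if i \<in> (\<lambda>xs. 2 # j # xs) ` (\<Union>s\<in>{1..S}. idx s M) then g' i else (g i :: real)"
  let ?c = "\<lambda>g. EN A B (x(j := (\<lambda>_. 0))) g"
  have inj: "inj (\<lambda>xs. 2 # j # xs)" by (simp add: inj_def)
  have F0: "0 \<le> ?F y g" for y g by (intro avg_nonneg f)
  have pe0: "0 \<le> perturbed.pe \<Omega> c (\<lambda>\<omega>. \<omega> j) M S \<eta> f y" for c y
    unfolding perturbed.pe_def[OF perturbed_block[OF j]] by (intro Bochner_Integration.integral_nonneg avg_nonneg f)
  have b0: "0 \<le> b" using pos[of "\<lambda>_. 0"] pe0 by (meson order_trans sum_nonneg)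
  have mF: "?F y \<in> borel_measurable disorder" for y
    by (intro measurable_avg measurable_EN) auto
  \<comment> \<open>For fixed \<open>g\<close> the energy splits into \<open>?c g\<close>, in which
    block \<open>j\<close> is unperturbed, and a perturbation by fresh couplings; this is the
    Hamiltonian of the locale \<open>perturbed\<close>.\<close>
  have EN: "EN A B (?x y) (?m g' g) \<omega> = perturbed.pot (?c g) (\<lambda>\<omega>. \<omega> j) M S \<eta> y (\<lambda>xs. g' (2 # j # xs)) \<omega>" for y g g' \<omega>
  proof -
    interpret P: perturbed \<Omega> "?c g" "\<lambda>\<omega>. \<omega> j" M S \<eta> by (rule perturbed_block[OF j])
    have H1: "H p N (\<lambda>xs. ?m g' g (0 # xs)) (emb \<omega>) = H p N (\<lambda>xs. g (0 # xs)) (emb \<omega>)"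
      "H p M (\<lambda>xs. ?m g' g (1 # i # xs)) (\<omega> i) = H p M (\<lambda>xs. g (1 # i # xs)) (\<omega> i)" for i
      by (auto intro!: arg_cong2[where f = "H _ _"] arg_cong[where f = "\<lambda>f. H _ _ f _"] ext)
    have H2: "H s M (\<lambda>xs. ?m g' g (2 # i # xs)) (\<omega> i) =
       (if i = j then H s M (\<lambda>xs. g' (2 # j # xs)) (\<omega> j) else H s M (\<lambda>xs. g (2 # i # xs)) (\<omega> i))" if "s \<in> {1..S}" for s i
    proof (cases "i = j")
      case True
      have mem: "2 # j # xs \<in> (\<lambda>xs. 2 # j # xs) ` (\<Union>s\<in>{1..S}. idx s M)" if "xs \<in> idx s M" for xs
        using that \<open>s \<in> {1..S}\<close> by (intro imageI UN_I[of s])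
      have "H s M (\<lambda>xs. ?m g' g (2 # j # xs)) (\<omega> j) = H s M (\<lambda>xs. g' (2 # j # xs)) (\<omega> j)"
        by (rule H_cong) (simp only: mem if_True)
      then show ?thesis unfolding True by (simp only: if_True simp_thms)
    next
      case False
      then show ?thesis by (auto intro!: H_cong)
    qed
    have "EN A B (?x y) (?m g' g) \<omega> = A * H p N (\<lambda>xs. g (0 # xs)) (emb \<omega>) + (\<Sum>i<kk. B * H p M (\<lambda>xs. g (1 # i # xs)) (\<omega> i)) +
      (\<Sum>i<kk. \<Sum>s=1..S. \<eta> * ?x y i s * H s M (\<lambda>xs. ?m g' g (2 # i # xs)) (\<omega> i))"
      unfolding EN_eq H1 ..
    also have "(\<Sum>i<kk. \<Sum>s=1..S. \<eta> * ?x y i s * H s M (\<lambda>xs. ?m g' g (2 # i # xs)) (\<omega> i)) =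
      (\<Sum>i<kk. (\<Sum>s=1..S. \<eta> * (x(j := (\<lambda>_. 0))) i s * H s M (\<lambda>xs. g (2 # i # xs)) (\<omega> i)) +
         (if i = j then \<Sum>s=1..S. real (y s) * (\<eta> * H s M (\<lambda>xs. g' (2 # j # xs)) (\<omega> j)) else 0))"
    proof (rule sum.cong[OF refl])
      fix i
      show "(\<Sum>s=1..S. \<eta> * ?x y i s * H s M (\<lambda>xs. ?m g' g (2 # i # xs)) (\<omega> i)) =
        (\<Sum>s=1..S. \<eta> * (x(j := (\<lambda>_. 0))) i s * H s M (\<lambda>xs. g (2 # i # xs)) (\<omega> i)) +
         (if i = j then \<Sum>s=1..S. real (y s) * (\<eta> * H s M (\<lambda>xs. g' (2 # j # xs)) (\<omega> j)) else 0)"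
        using H2 by (cases "i = j") (auto intro!: sum.cong simp: mult_ac)
    qed
    also have "\<dots> = (\<Sum>i<kk. \<Sum>s=1..S. \<eta> * (x(j := (\<lambda>_. 0))) i s * H s M (\<lambda>xs. g (2 # i # xs)) (\<omega> i)) +
        (\<Sum>s=1..S. real (y s) * (\<eta> * H s M (\<lambda>xs. g' (2 # j # xs)) (\<omega> j)))"
      using j by (simp add: sum.distrib sum.delta)
    finally show ?thesis unfolding P.pot_eq P.h_def by (simp add: EN_eq)
  qed
  have inner: "(\<integral>\<^sup>+g'. ennreal (?F y (?m g' g)) \<partial>disorder) = ennreal (perturbed.pe \<Omega> (?c g) (\<lambda>\<omega>. \<omega> j) M S \<eta> f y)" for y g
  proof -
    interpret P: perturbed \<Omega> "?c g" "\<lambda>\<omega>. \<omega> j" M S \<eta> by (rule perturbed_block[OF j])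
    let ?G = "\<lambda>g. avg \<Omega> (P.pot y g) (\<lambda>\<omega>. avg \<Omega> (P.pot y g) (\<lambda>\<omega>'. f (P.R \<omega> \<omega>')))"
    have mG: "?G \<in> borel_measurable disorder"
      by (intro measurable_avg P.measurable_pot) auto
    have "(\<integral>\<^sup>+g'. ennreal (?F y (?m g' g)) \<partial>disorder) = (\<integral>\<^sup>+g'. ennreal (?G (\<lambda>xs. g' (2 # j # xs))) \<partial>disorder)"
    proof (rule nn_integral_cong)
      fix g'
      have "EN A B (?x y) (?m g' g) = P.pot y (\<lambda>xs. g' (2 # j # xs))" by (rule ext) (rule EN)
      then show "ennreal (?F y (?m g' g)) = ennreal (?G (\<lambda>xs. g' (2 # j # xs)))"
        by (simp only: P.R_def Rb_def)
    qed
    also have "\<dots> = (\<integral>\<^sup>+g'. ennreal (?G g') \<partial>disorder)"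
      by (rule nn_integral_reindex[OF inj, where \<Psi> = "\<lambda>g. ennreal (?G g)"]) (use mG in measurable)
    also have "\<dots> = ennreal (P.pe f y)"
      unfolding P.pe_def
      by (rule nn_integral_eq_integral[OF P.pe_bound(1)[where B = 1]]) (use f in \<open>auto intro!: avg_nonneg simp: abs_of_nonneg\<close>)
    finally show ?thesis .
  qed
  have "ennreal (\<Sum>y\<in>X. pav A B (?x y) (\<lambda>\<omega> \<omega>'. f (Rb j \<omega> \<omega>'))) = (\<Sum>y\<in>X. \<integral>\<^sup>+g. ennreal (?F y g) \<partial>disorder)"
  proof -
    have "ennreal (pav A B (?x y) (\<lambda>\<omega> \<omega>'. f (Rb j \<omega> \<omega>'))) = (\<integral>\<^sup>+g. ennreal (?F y g) \<partial>disorder)" for y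
      unfolding pav_def by (rule nn_integral_eq_integral[symmetric, OF integrable_pav]) (use F0 in auto)
    moreover have "0 \<le> pav A B (?x y) (\<lambda>\<omega> \<omega>'. f (Rb j \<omega> \<omega>'))" for y
      unfolding pav_def by (intro Bochner_Integration.integral_nonneg F0)
    ultimately show ?thesis by (simp add: sum_ennreal[symmetric])
  qed
  also have "\<dots> = (\<Sum>y\<in>X. \<integral>\<^sup>+g. \<integral>\<^sup>+g'. ennreal (?F y (?m g' g)) \<partial>disorder \<partial>disorder)"
    using mF by (intro sum.cong refl nn_integral_merge) (auto intro!: measurable_compose[OF _ measurable_ennreal])
  also have "\<dots> = (\<integral>\<^sup>+g. (\<Sum>y\<in>X. \<integral>\<^sup>+g'. ennreal (?F y (?m g' g)) \<partial>disorder) \<partial>disorder)"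
    using mF by (intro nn_integral_sum[symmetric] measurable_nn_integral_merge[of "\<lambda>g. ennreal (?F _ g)"])
       (auto intro!: measurable_compose[OF _ measurable_ennreal])
  also have "\<dots> \<le> (\<integral>\<^sup>+g. ennreal b \<partial>disorder)"
  proof (rule nn_integral_mono)
    fix g
    have "(\<Sum>y\<in>X. \<integral>\<^sup>+g'. ennreal (?F y (?m g' g)) \<partial>disorder) = ennreal (\<Sum>y\<in>X. perturbed.pe \<Omega> (?c g) (\<lambda>\<omega>. \<omega> j) M S \<eta> f y)"
      unfolding inner using pe0 by (simp add: sum_ennreal)
    also have "\<dots> \<le> ennreal b" by (intro ennreal_leI pos)
    finally show "(\<Sum>y\<in>X. \<integral>\<^sup>+g'. ennreal (?F y (?m g' g)) \<partial>disorder) \<le> ennreal b" .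
  qed
  also have "\<dots> = ennreal b" by (simp add: disorder.emeasure_space_1[simplified])
  finally show ?thesis using b0 by simp
qed

text \<open>On the quarter circle the squares of the two amplitudes sum to a constant, and the
  amplitudes are smooth up to both ends, unlike square roots. To first order the weights
  \<open>u\<close> of the global and \<open>v\<close> of the block covariance cancel, so
  \<open>u * (Y0 - Y1)\<close> decides, and \<open>power_mean_almost_nonneg\<close> bounds the
  global overlap term by that of the blocks.\<close>

lemma PHI_step:
  assumes th: "0 \<le> \<theta>" "\<theta> \<le> \<theta>'" "\<theta>' \<le> pi / 2" and e: "\<epsilon> \<ge> 0"
  shows "PHI (k * sin \<theta>) (k * cos \<theta>) x -
     k\<^sup>2 * ((\<theta>' - \<theta>) * (real N * ((real p + 1) * (\<epsilon> + (\<Sum>j<kk. real M / real N * pav (k * sin \<theta>) (k * cos \<theta>) x (\<lambda>\<omega> \<omega>'. of_bool (Rb j \<omega> \<omega>' \<le> - \<epsilon>))))) + real p * real r)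
        + (\<theta>' - \<theta>)\<^sup>2 * real N) \<le> PHI (k * sin \<theta>') (k * cos \<theta>') x"
proof -
  define A B where "A = k * sin \<theta>" and "B = k * cos \<theta>"
  define u v where "u = (sin \<theta>' - sin \<theta>) * sin \<theta>" and "v = (cos \<theta>' - cos \<theta>) * cos \<theta>"
  let ?P = "pav A B x"
  define Y0 where "Y0 = real N - real N * ?P (\<lambda>\<omega> \<omega>'. Rg \<omega> \<omega>' ^ p)"
  define Y1 where "Y1 = real kk * real M - (\<Sum>j<kk. real M * ?P (\<lambda>\<omega> \<omega>'. Rb j \<omega> \<omega>' ^ p))"
  define W where "W = real N * ((real p + 1) * (\<epsilon> + (\<Sum>j<kk. real M / real N * ?P (\<lambda>\<omega> \<omega>'. of_bool (Rb j \<omega> \<omega>' \<le> - \<epsilon>))))) + real p * real r"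
  have N0: "real N > 0" using N1 by simp
  have W0: "W \<ge> 0"
  proof -
    have "0 \<le> ?P (\<lambda>\<omega> \<omega>'. of_bool (Rb j \<omega> \<omega>' \<le> - \<epsilon>))" for j
      unfolding pav_def by (intro Bochner_Integration.integral_nonneg avg_nonneg) auto
    then show ?thesis unfolding W_def using e by (intro add_nonneg_nonneg mult_nonneg_nonneg sum_nonneg) auto
  qed
  have AB: "(k * sin \<theta>' - A) * A = k\<^sup>2 * u" "(k * cos \<theta>' - B) * B = k\<^sup>2 * v"
    by (simp_all add: A_def B_def u_def v_def power2_eq_square algebra_simps)
  have covs: "cov a b (\<lambda>_ _. 0) = (\<lambda>\<omega> \<omega>'. (a * real N) * Rg \<omega> \<omega>' ^ p + (\<Sum>j<kk. (b * real M) * Rb j \<omega> \<omega>' ^ p))" for a b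
    by (auto simp: cov_def fun_eq_iff sum_distrib_left mult_ac)
  have "PHI A B x + (dg (k\<^sup>2 * u) (k\<^sup>2 * v) (\<lambda>_ _. 0) - ?P (cov (k\<^sup>2 * u) (k\<^sup>2 * v) (\<lambda>_ _. 0))) \<le> PHI (k * sin \<theta>') (k * cos \<theta>') x"
    using PHI_convex[of A B x "k * sin \<theta>'" "k * cos \<theta>'" x] unfolding AB by simp
  moreover have "dg (k\<^sup>2 * u) (k\<^sup>2 * v) (\<lambda>_ _. 0) - ?P (cov (k\<^sup>2 * u) (k\<^sup>2 * v) (\<lambda>_ _. 0)) = k\<^sup>2 * (u * Y0 + v * Y1)"
    unfolding covs pav_add pav_sum pav_cmult dg_def Y0_def Y1_def
    by (simp add: algebra_simps sum_distrib_left)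
  \<comment> \<open>Written as \<open>u * (Y0 - Y1) + (u + v) * Y1\<close>, where
    \<open>u + v = cos (\<theta>' - \<theta>) - 1\<close> is of second order.\<close>
  moreover have "u * Y0 + v * Y1 \<ge> - ((\<theta>' - \<theta>) * W + (\<theta>' - \<theta>)\<^sup>2 * real N)"
  proof -
    have Pb: "\<bar>?P (\<lambda>\<omega> \<omega>'. Rb j \<omega> \<omega>' ^ p)\<bar> \<le> 1" if "j < kk" for j
    proof -
      have "\<bar>Rb j \<omega> \<omega>' ^ p\<bar> \<le> 1" if "\<omega> \<in> \<Omega>" "\<omega>' \<in> \<Omega>" for \<omega> \<omega>'
        using Rb_abs[OF that \<open>j < kk\<close>] by (simp add: power_abs power_le_one)
      then have "?P (\<lambda>\<omega> \<omega>'. Rb j \<omega> \<omega>' ^ p) \<le> ?P (\<lambda>_ _. 1)" "?P (\<lambda>_ _. -1) \<le> ?P (\<lambda>\<omega> \<omega>'. Rb j \<omega> \<omega>' ^ p)"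
        by (auto intro!: pav_mono simp: abs_le_iff minus_le_iff)
      then show ?thesis by (simp add: pav_const)
    qed
    have kM: "real kk * real M \<le> real N" using N1(2) by (metis of_nat_le_iff of_nat_mult)
    have Y1b: "0 \<le> Y1" "Y1 \<le> 2 * real N"
    proof -
      have "(\<Sum>j<kk. real M * ?P (\<lambda>\<omega> \<omega>'. Rb j \<omega> \<omega>' ^ p)) \<le> (\<Sum>j<kk. real M * 1)"
        using Pb by (intro sum_mono mult_left_mono) (auto simp: abs_le_iff)
      moreover have "(\<Sum>j<kk. real M * (-1)) \<le> (\<Sum>j<kk. real M * ?P (\<lambda>\<omega> \<omega>'. Rb j \<omega> \<omega>' ^ p))"
        using Pb by (intro sum_mono mult_left_mono) (auto simp: abs_le_iff minus_le_iff)
      ultimately show "0 \<le> Y1" "Y1 \<le> 2 * real N" unfolding Y1_def using kM by auto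
    qed
    have Y: "Y0 - Y1 \<ge> - W"
    proof -
      let ?a = "real M / real N" and ?t = "real r / real N"
      have at: "real kk * ?a + ?t = 1" using N0 by (simp add: add_divide_distrib[symmetric] N_def)
      have "?P (\<lambda>\<omega> \<omega>'. Rg \<omega> \<omega>' ^ p) \<le> ?P (\<lambda>\<omega> \<omega>'. (\<Sum>j<kk. ?a * Rb j \<omega> \<omega>' ^ p) +
         ((real p + 1) * (\<epsilon> + (\<Sum>j<kk. ?a * of_bool (Rb j \<omega> \<omega>' \<le> - \<epsilon>))) + real p * ?t))"
      proof (rule pav_mono)
        fix \<omega> \<omega>' assume w: "\<omega> \<in> \<Omega>" "\<omega>' \<in> \<Omega>"
        show "Rg \<omega> \<omega>' ^ p \<le> (\<Sum>j<kk. ?a * Rb j \<omega> \<omega>' ^ p) +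
          ((real p + 1) * (\<epsilon> + (\<Sum>j<kk. ?a * of_bool (Rb j \<omega> \<omega>' \<le> - \<epsilon>))) + real p * ?t)"
          unfolding Rg_eq add.assoc[symmetric]
          by (rule power_mean_almost_nonneg) (use Rb_abs[OF w] at p e in auto)
      qed
      also have "\<dots> = (\<Sum>j<kk. ?a * ?P (\<lambda>\<omega> \<omega>'. Rb j \<omega> \<omega>' ^ p)) +
         ((real p + 1) * (\<epsilon> + (\<Sum>j<kk. ?a * ?P (\<lambda>\<omega> \<omega>'. of_bool (Rb j \<omega> \<omega>' \<le> - \<epsilon>)))) + real p * ?t)"
        by (simp only: pav_add pav_cmult pav_sum pav_const)
      finally have "real N * ?P (\<lambda>\<omega> \<omega>'. Rg \<omega> \<omega>' ^ p) \<le> real N * ((\<Sum>j<kk. ?a * ?P (\<lambda>\<omega> \<omega>'. Rb j \<omega> \<omega>' ^ p)) +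
         ((real p + 1) * (\<epsilon> + (\<Sum>j<kk. ?a * ?P (\<lambda>\<omega> \<omega>'. of_bool (Rb j \<omega> \<omega>' \<le> - \<epsilon>)))) + real p * ?t))"
        using N0 by (intro mult_left_mono) auto
      also have "\<dots> = (\<Sum>j<kk. real M * ?P (\<lambda>\<omega> \<omega>'. Rb j \<omega> \<omega>' ^ p)) + W"
        unfolding W_def using N0 by (simp add: distrib_left sum_distrib_left)
      finally show ?thesis unfolding Y0_def Y1_def using kM by linarith
    qed
    have sc: "0 \<le> sin \<theta>" "sin \<theta> \<le> 1" "sin \<theta> \<le> sin \<theta>'"
      using th by (auto intro!: sin_ge_zero sin_monotone_2pi_le)
    have ds: "sin \<theta>' - sin \<theta> \<le> \<theta>' - \<theta>"
    proof (cases "\<theta> = \<theta>'")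
      case False
      then obtain z where z: "sin \<theta>' - sin \<theta> = (\<theta>' - \<theta>) * cos z"
        using MVT2[of \<theta> \<theta>' sin cos] th by (auto intro: DERIV_sin)
      then show ?thesis using mult_left_mono[OF cos_le_one[of z], of "\<theta>' - \<theta>"] th by simp
    qed simp
    have u: "0 \<le> u" "u \<le> \<theta>' - \<theta>"
    proof -
      show "0 \<le> u" unfolding u_def using sc by simp
      have "u \<le> (\<theta>' - \<theta>) * 1" unfolding u_def using sc ds th by (intro mult_mono) auto
      then show "u \<le> \<theta>' - \<theta>" by simp
    qed
    have uv: "u + v \<ge> - (\<theta>' - \<theta>)\<^sup>2 / 2"
    proof -
      have "u + v = cos (\<theta>' - \<theta>) - ((sin \<theta>)\<^sup>2 + (cos \<theta>)\<^sup>2)"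
        unfolding u_def v_def cos_diff by (simp add: power2_eq_square algebra_simps)
      also have "\<dots> = - 2 * (sin ((\<theta>' - \<theta>) / 2))\<^sup>2"
      proof -
        have "cos (2 * ((\<theta>' - \<theta>) / 2)) = 1 - 2 * (sin ((\<theta>' - \<theta>) / 2))\<^sup>2" by (rule cos_double_sin)
        moreover have "2 * ((\<theta>' - \<theta>) / 2) = \<theta>' - \<theta>" by simp
        ultimately show ?thesis by (simp only: sin_cos_squared_add)
      qed
      also have "\<dots> \<ge> - 2 * ((\<theta>' - \<theta>) / 2)\<^sup>2"
      proof -
        have "\<bar>sin ((\<theta>' - \<theta>) / 2)\<bar> \<le> \<bar>(\<theta>' - \<theta>) / 2\<bar>" by (rule abs_sin_x_le_abs_x)
        then have "(sin ((\<theta>' - \<theta>) / 2))\<^sup>2 \<le> ((\<theta>' - \<theta>) / 2)\<^sup>2" by (simp only: abs_le_square_iff)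
        then show ?thesis by simp
      qed
      finally show ?thesis by (simp add: power_divide)
    qed
    have "u * (Y0 - Y1) \<ge> - ((\<theta>' - \<theta>) * W)"
    proof -
      have "u * (- W) \<le> u * (Y0 - Y1)" using Y u by (intro mult_left_mono) auto
      moreover have "u * W \<le> (\<theta>' - \<theta>) * W" using u W0 by (intro mult_right_mono) auto
      ultimately show ?thesis by simp
    qed
    moreover have "(u + v) * Y1 \<ge> - ((\<theta>' - \<theta>)\<^sup>2 * real N)"
    proof -
      have "- (\<theta>' - \<theta>)\<^sup>2 / 2 * Y1 \<le> (u + v) * Y1" using uv Y1b by (intro mult_right_mono) auto
      moreover have "(\<theta>' - \<theta>)\<^sup>2 / 2 * Y1 \<le> (\<theta>' - \<theta>)\<^sup>2 / 2 * (2 * real N)" using Y1b by (intro mult_left_mono) auto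
      ultimately show ?thesis by simp
    qed
    moreover have "u * Y0 + v * Y1 = u * (Y0 - Y1) + (u + v) * Y1" by (simp add: algebra_simps)
    ultimately show ?thesis by linarith
  qed
  then have "k\<^sup>2 * (- ((\<theta>' - \<theta>) * W + (\<theta>' - \<theta>)\<^sup>2 * real N)) \<le> k\<^sup>2 * (u * Y0 + v * Y1)"
    by (intro mult_left_mono) auto
  ultimately show ?thesis unfolding W_def[symmetric] A_def[symmetric] B_def[symmetric] by linarith
qed

text \<open>Interpolate along \<open>(sin \<theta>, cos \<theta>)\<close> with the perturbation of every block kept fixed, averaging over
  the strengths of the perturbations.\<close>
lemma superadditive_blocks:
  fixes X :: "(nat \<Rightarrow> nat) set"
  assumes X: "finite X" "X \<noteq> {}" and D: "\<And>y s. y \<in> X \<Longrightarrow> s \<in> {1..S} \<Longrightarrow> real (y s) \<le> D" and e: "\<epsilon> \<ge> 0"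
    and pos: "\<And>c j. j < kk \<Longrightarrow> (\<Sum>y\<in>X. perturbed.pe \<Omega> c (\<lambda>\<omega>. \<omega> j) M S \<eta> (\<lambda>y. of_bool (y \<le> - \<epsilon>)) y) \<le> \<rho> * real (card X)"
    and \<rho>: "\<rho> \<ge> 0"
  shows "real kk * aN p k M - 2 * k\<^sup>2 * (real N * ((real p + 1) * (\<epsilon> + \<rho>)) + real p * real r) -
     2 * (real S * (\<eta>\<^sup>2 * D\<^sup>2)) * real N \<le> aN p k N"
proof -
  \<comment> \<open>Every block has its own strengths from \<open>X\<close>, chosen independently of
    the other blocks.\<close>
  define XX where "XX = PiE {..<kk} (\<lambda>_. X)"
  have XX: "finite XX" "XX \<noteq> {}" unfolding XX_def using X by (auto intro!: finite_PiE simp: PiE_eq_empty_iff)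
  have cX: "real (card XX) > 0" "real (card X) > 0" using XX X by (auto simp: card_gt_0_iff)
  let ?xr = "\<lambda>x j s. real (x j s :: nat)"
  let ?q = "\<lambda>\<theta> x j. pav (k * sin \<theta>) (k * cos \<theta>) (?xr x) (\<lambda>\<omega> \<omega>'. of_bool (Rb j \<omega> \<omega>' \<le> - \<epsilon>))"
  \<comment> \<open>The strengths of block \<open>j\<close> are averaged with those of all other
    blocks fixed; the latter belong to the reference weight.\<close>
  have q: "(\<Sum>x\<in>XX. ?q \<theta> x j) \<le> \<rho> * real (card XX)" if j: "j < kk" for \<theta> j
  proof -
    have "real (card X) * (\<Sum>x\<in>XX. ?q \<theta> x j) = (\<Sum>x\<in>XX. \<Sum>y\<in>X. ?q \<theta> (x(j := y)) j)"
      unfolding XX_def by (rule sum_PiE_resample[symmetric]) (use j in simp)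
    also have "\<dots> \<le> (\<Sum>x\<in>XX. \<rho> * real (card X))"
    proof (rule sum_mono)
      fix x :: "nat \<Rightarrow> nat \<Rightarrow> nat"
      have "?xr (x(j := y)) = (?xr x)(j := (\<lambda>s. real (y s)))" for y by (auto simp: fun_eq_iff)
      then show "(\<Sum>y\<in>X. ?q \<theta> (x(j := y)) j) \<le> \<rho> * real (card X)"
        using block_positivity[OF j X(1), of "\<lambda>y. of_bool (y \<le> - \<epsilon>)"] pos[OF j] by simp
    qed
    finally have "real (card X) * (\<Sum>x\<in>XX. ?q \<theta> x j) \<le> real (card X) * (\<rho> * real (card XX))" by (simp add: mult_ac)
    then show ?thesis using cX by simp
  qed
  define \<Psi> where "\<Psi> \<theta> = (\<Sum>x\<in>XX. PHI (k * sin \<theta>) (k * cos \<theta>) (?xr x))" for \<theta>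
  define W where "W = real N * ((real p + 1) * (\<epsilon> + \<rho>)) + real p * real r"
  have W0: "W \<ge> 0" unfolding W_def using e \<rho> by simp
  have N0: "real N > 0" using N1 by simp
  have kM: "real kk * real M \<le> real N" using N1(2) by (metis of_nat_le_iff of_nat_mult)
  \<comment> \<open>At angle 0 only the block Hamiltonians are left besides the perturbation, at
    \<open>pi / 2\<close> only the global one. The length \<open>pi / 2 \<le> 2\<close> of the path
    gives the factor 2 in \<open>2 * k\<^sup>2\<close>.\<close>
  have "- \<Psi> (pi / 2) - (- \<Psi> 0) \<le> (real (card XX) * k\<^sup>2 * W) * (pi / 2 - 0)"
  proof (rule increment_bound_telescope[where C = "real (card XX) * k\<^sup>2 * real N"])
    fix a b :: real assume ab: "0 \<le> a" "a \<le> b" "b \<le> pi / 2"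
    let ?w = "\<lambda>x. real N * ((real p + 1) * (\<epsilon> + (\<Sum>j<kk. real M / real N * ?q a x j))) + real p * real r"
    have "(\<Sum>x\<in>XX. PHI (k * sin a) (k * cos a) (?xr x) - k\<^sup>2 * ((b - a) * ?w x + (b - a)\<^sup>2 * real N)) \<le> \<Psi> b"
      unfolding \<Psi>_def by (intro sum_mono PHI_step ab e)
    moreover have "(\<Sum>x\<in>XX. PHI (k * sin a) (k * cos a) (?xr x) - k\<^sup>2 * ((b - a) * ?w x + (b - a)\<^sup>2 * real N)) =
      \<Psi> a - k\<^sup>2 * ((b - a) * (\<Sum>x\<in>XX. ?w x) + real (card XX) * ((b - a)\<^sup>2 * real N))"
      by (simp add: \<Psi>_def sum_subtractf sum_distrib_left[symmetric] sum.distrib)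
    moreover have "(\<Sum>x\<in>XX. ?w x) \<le> real (card XX) * W"
    proof -
      have "(\<Sum>x\<in>XX. \<Sum>j<kk. real M / real N * ?q a x j) = (\<Sum>j<kk. real M / real N * (\<Sum>x\<in>XX. ?q a x j))"
        by (subst sum.swap) (simp add: sum_distrib_left)
      also have "\<dots> \<le> (\<Sum>j<kk. real M / real N * (\<rho> * real (card XX)))"
        using q by (intro sum_mono mult_left_mono) auto
      also have "\<dots> = (real kk * real M / real N) * (\<rho> * real (card XX))" by simp
      also have "\<dots> \<le> 1 * (\<rho> * real (card XX))" using kM N0 \<rho> by (intro mult_right_mono) auto
      finally have s: "(\<Sum>x\<in>XX. \<Sum>j<kk. real M / real N * ?q a x j) \<le> real (card XX) * \<rho>" by (simp add: mult.commute)
      have "(\<Sum>x\<in>XX. ?w x) = real N * ((real p + 1) * (real (card XX) * \<epsilon> + (\<Sum>x\<in>XX. \<Sum>j<kk. real M / real N * ?q a x j))) + real (card XX) * (real p * real r)"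
        by (simp only: sum.distrib sum_distrib_left[symmetric] sum_constant mult.left_commute[of "real p"])
      also have "\<dots> \<le> real N * ((real p + 1) * (real (card XX) * \<epsilon> + real (card XX) * \<rho>)) + real (card XX) * (real p * real r)"
        by (intro add_right_mono mult_left_mono add_left_mono s) auto
      also have "\<dots> = real (card XX) * W" by (simp add: W_def algebra_simps)
      finally show ?thesis .
    qed
    then have "k\<^sup>2 * ((b - a) * (\<Sum>x\<in>XX. ?w x)) \<le> k\<^sup>2 * ((b - a) * (real (card XX) * W))"
      using ab by (intro mult_left_mono) auto
    ultimately show "- \<Psi> b - - \<Psi> a \<le> (real (card XX) * k\<^sup>2 * W) * (b - a) + real (card XX) * k\<^sup>2 * real N * (b - a)\<^sup>2"
      by (simp add: algebra_simps)
  qed simp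
  moreover have "(real (card XX) * k\<^sup>2 * W) * (pi / 2) \<le> (real (card XX) * k\<^sup>2 * W) * 2"
    using W0 pi_less_4 by (intro mult_left_mono) auto
  moreover have "\<Psi> (pi / 2) \<le> real (card XX) * (aN p k N + 2 * (real S * (\<eta>\<^sup>2 * D\<^sup>2)) * real N)"
  proof -
    have "\<Psi> (pi / 2) = (\<Sum>x\<in>XX. PHI k 0 (?xr x))" by (simp add: \<Psi>_def)
    also have "\<dots> \<le> (\<Sum>x\<in>XX. aN p k N + 2 * (real S * (\<eta>\<^sup>2 * D\<^sup>2)) * real N)"
    proof (rule sum_mono)
      fix x assume x: "x \<in> XX"
      have "PHI k 0 (?xr x) \<le> PHI k 0 (\<lambda>_ _. 0) + 2 * (real S * (\<eta>\<^sup>2 * D\<^sup>2)) * real N"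
        by (rule PHI_remove_helper_upper) (use D x in \<open>auto simp: XX_def PiE_def Pi_def\<close>)
      then show "PHI k 0 (?xr x) \<le> aN p k N + 2 * (real S * (\<eta>\<^sup>2 * D\<^sup>2)) * real N" using PHI_global[of k] by linarith
    qed
    finally show ?thesis by simp
  qed
  moreover have "real (card XX) * (real kk * aN p k M) \<le> \<Psi> 0"
  proof -
    have "(\<Sum>x\<in>XX. real kk * aN p k M) \<le> (\<Sum>x\<in>XX. PHI 0 k (?xr x))"
      unfolding PHI_local[symmetric] by (intro sum_mono PHI_remove_helper_lower)
    then show ?thesis by (simp add: \<Psi>_def)
  qed
  ultimately have "real (card XX) * (real kk * aN p k M) \<le> real (card XX) * (aN p k N + 2 * (real S * (\<eta>\<^sup>2 * D\<^sup>2)) * real N + 2 * k\<^sup>2 * W)"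
    by (simp add: algebra_simps)
  then have "real kk * aN p k M \<le> aN p k N + 2 * (real S * (\<eta>\<^sup>2 * D\<^sup>2)) * real N + 2 * k\<^sup>2 * W"
    using cX by (simp only: mult_le_cancel_left_pos)
  then show ?thesis unfolding W_def by linarith
qed

end

text \<open>The order of choices is the point: \<open>\<epsilon>\<close> from
  \<open>\<delta>\<close>, then \<open>S\<close> and \<open>J0\<close> from
  \<open>positivity\<close>, then \<open>\<eta>\<close> so small that strengths up to
  \<open>2 * J0\<close> cost at most \<open>\<delta> / 2\<close> per spin, and \<open>M\<close>
  last. It works because \<open>S\<close> and \<open>J0\<close> do not depend on
  \<open>\<eta>\<close>.\<close>

theorem almost_superadditive:
  assumes p: "p \<ge> 1" and \<delta>: "\<delta> > 0"
  shows "\<exists>M0\<ge>1. \<forall>M\<ge>M0. \<forall>kk\<ge>1. \<forall>r.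
    real kk * aN p k M - \<delta> * real (kk * M + r) - 2 * k\<^sup>2 * (real p * real r) \<le> aN p k (kk * M + r)"
proof -
  define \<epsilon> where "\<epsilon> = \<delta> / (8 * (k\<^sup>2 + 1) * (real p + 1))"
  have den: "8 * (k\<^sup>2 + 1) * (real p + 1) > 0"
    by (intro mult_pos_pos) (auto simp: add_nonneg_pos)
  have \<epsilon>: "\<epsilon> > 0" unfolding \<epsilon>_def using \<delta> den by simp
  have \<epsilon>k: "2 * k\<^sup>2 * ((real p + 1) * (\<epsilon> + \<epsilon>)) \<le> \<delta> / 2"
  proof -
    have "2 * k\<^sup>2 * ((real p + 1) * (\<epsilon> + \<epsilon>)) \<le> 2 * (k\<^sup>2 + 1) * ((real p + 1) * (\<epsilon> + \<epsilon>))"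
      using \<epsilon> by (intro mult_right_mono) auto
    also have "\<dots> = 8 * (k\<^sup>2 + 1) * (real p + 1) * \<epsilon> / 2" by simp
    also have "8 * (k\<^sup>2 + 1) * (real p + 1) * \<epsilon> = \<delta>"
      unfolding \<epsilon>_def times_divide_eq_right by (rule nonzero_mult_div_cancel_left) (use den in linarith)
    finally show ?thesis .
  qed
  obtain S J0 where J0: "J0 \<ge> (1::nat)" and pos: "\<And>\<eta>. \<eta> > 0 \<Longrightarrow> \<exists>M0. \<forall>M\<ge>M0. \<forall>(\<Omega> :: (nat \<Rightarrow> nat \<Rightarrow> real) set) c sg. perturbed \<Omega> sg M \<eta> \<longrightarrow>
     (\<Sum>x\<in>PiE {1..S} (\<lambda>_. {J0+1..<2*J0+1}). perturbed.pe \<Omega> c sg M S \<eta> (\<lambda>y. of_bool (y \<le> - \<epsilon>)) x)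
       \<le> \<epsilon> * real (card (PiE {1..S} (\<lambda>_. {J0+1..<2*J0+1})))"
    using positivity[OF \<epsilon> \<epsilon>, where 'o = "nat \<Rightarrow> nat \<Rightarrow> real"] by blast
  define \<eta> where "\<eta> = sqrt (\<delta> / (16 * (real S + 1) * (real J0)\<^sup>2))"
  have den2: "16 * (real S + 1) * (real J0)\<^sup>2 > 0" using J0 by (intro mult_pos_pos) auto
  have \<eta>: "\<eta> > 0" unfolding \<eta>_def using \<delta> den2 by simp
  have \<eta>2: "2 * (real S * (\<eta>\<^sup>2 * (real (2 * J0))\<^sup>2)) \<le> \<delta> / 2"
  proof -
    have e1: "\<eta>\<^sup>2 = \<delta> / (16 * (real S + 1) * (real J0)\<^sup>2)"
      unfolding \<eta>_def using \<delta> den2 by (intro real_sqrt_pow2) auto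
    have e2: "(real (2 * J0))\<^sup>2 = 4 * (real J0)\<^sup>2" by (simp add: power_mult_distrib)
    have e3: "2 * (x * (\<delta> / (16 * s * j) * (4 * j))) = \<delta> / 2 * (x / s)" if "s > 0" "j > 0" for x s j :: real
      using that by (simp add: field_simps)
    have "2 * (real S * (\<eta>\<^sup>2 * (real (2 * J0))\<^sup>2)) = \<delta> / 2 * (real S / (real S + 1))"
      unfolding e1 e2 by (rule e3) (use J0 in auto)
    also have "\<dots> \<le> \<delta> / 2 * 1" using \<delta> by (intro mult_left_mono) auto
    finally show ?thesis by simp
  qed
  obtain M1 where M1: "\<And>M (\<Omega> :: (nat \<Rightarrow> nat \<Rightarrow> real) set) c sg. M \<ge> M1 \<Longrightarrow> perturbed \<Omega> sg M \<eta> \<Longrightarrow>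
     (\<Sum>x\<in>PiE {1..S} (\<lambda>_. {J0+1..<2*J0+1}). perturbed.pe \<Omega> c sg M S \<eta> (\<lambda>y. of_bool (y \<le> - \<epsilon>)) x)
       \<le> \<epsilon> * real (card (PiE {1..S} (\<lambda>_. {J0+1..<2*J0+1})))"
    using pos[OF \<eta>] by blast
  show ?thesis
  proof (intro exI[of _ "max 1 M1"] conjI allI impI)
    fix M kk r :: nat assume M: "max 1 M1 \<le> M" and kk: "1 \<le> kk"
    interpret B: blocks p M kk r S \<eta> by unfold_locales (use p M kk \<eta> in auto)
    have N: "B.N = kk * M + r" by (rule B.N_def)
    let ?X = "PiE {1..S} (\<lambda>_. {J0+1..<2*J0+1})"
    have "real kk * aN p k M - 2 * k\<^sup>2 * (real B.N * ((real p + 1) * (\<epsilon> + \<epsilon>)) + real p * real r) -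
       2 * (real S * (\<eta>\<^sup>2 * (real (2 * J0))\<^sup>2)) * real B.N \<le> aN p k B.N"
    proof (rule B.superadditive_blocks[where X = ?X])
      show "finite ?X" by (intro finite_PiE) auto
      show "?X \<noteq> {}" using J0 by (simp add: PiE_eq_empty_iff)
      show "real (y s) \<le> real (2 * J0)" if "y \<in> ?X" "s \<in> {1..S}" for y s
        using that by (fastforce simp: PiE_def Pi_def)
      show "(\<Sum>y\<in>?X. perturbed.pe B.\<Omega> c (\<lambda>\<omega>. \<omega> j) M S \<eta> (\<lambda>y. of_bool (y \<le> - \<epsilon>)) y) \<le> \<epsilon> * real (card ?X)"
        if "j < kk" for c j
        by (rule M1) (use M B.perturbed_block[OF that] in auto)
    qed (use \<epsilon> in auto)
    moreover have "2 * k\<^sup>2 * ((real p + 1) * (\<epsilon> + \<epsilon>)) * real B.N \<le> \<delta> / 2 * real B.N"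
      by (intro mult_right_mono \<epsilon>k) auto
    moreover have "2 * (real S * (\<eta>\<^sup>2 * (real (2 * J0))\<^sup>2)) * real B.N \<le> \<delta> / 2 * real B.N"
      by (intro mult_right_mono \<eta>2) auto
    moreover have "2 * k\<^sup>2 * (real B.N * ((real p + 1) * (\<epsilon> + \<epsilon>)) + real p * real r) =
       2 * k\<^sup>2 * ((real p + 1) * (\<epsilon> + \<epsilon>)) * real B.N + 2 * k\<^sup>2 * (real p * real r)" by (simp add: algebra_simps)
    ultimately show "real kk * aN p k M - \<delta> * real (kk * M + r) - 2 * k\<^sup>2 * (real p * real r) \<le> aN p k (kk * M + r)"
      unfolding N[symmetric] by linarith
  qed simp
qed

text \<open>Fekete's argument with an error term.\<close>
lemma almost_superadditive_convergent:
  fixes a :: "nat \<Rightarrow> real"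
  assumes lo: "\<And>N. N \<ge> 1 \<Longrightarrow> 0 \<le> a N" and up: "\<And>N. N \<ge> 1 \<Longrightarrow> a N \<le> C * real N"
    and sup: "\<And>\<delta>. \<delta> > 0 \<Longrightarrow> \<exists>M0\<ge>1. \<forall>M\<ge>M0. \<forall>kk\<ge>1. \<forall>r. real kk * a M - \<delta> * real (kk * M + r) - D * real r \<le> a (kk * M + r)"
    and D: "D \<ge> 0"
  shows "convergent (\<lambda>N. a N / real N)"
proof -
  let ?\<alpha> = "\<lambda>N. a N / real N"
  have \<alpha>: "0 \<le> ?\<alpha> N" "?\<alpha> N \<le> C" if "N \<ge> 1" for N
    using lo[OF that] up[OF that] that by (auto simp: divide_le_eq)
  have C0: "C \<ge> 0" using \<alpha>[of 1] by simp
  \<comment> \<open>Divide \<open>N\<close> by \<open>M\<close> with remainder \<open>r\<close>; for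
    fixed \<open>M\<close> the remainder costs at most \<open>(C + D) * M\<close>, negligible
    against \<open>N\<close>.\<close>
  have key: "\<exists>M0\<ge>1. \<forall>M\<ge>M0. \<forall>\<^sub>F N in sequentially. ?\<alpha> M - 2 * \<delta> \<le> ?\<alpha> N" if \<delta>: "\<delta> > 0" for \<delta>
  proof -
    obtain M0 where M0: "M0 \<ge> 1" and s: "\<And>M kk r. M \<ge> M0 \<Longrightarrow> kk \<ge> 1 \<Longrightarrow> real kk * a M - \<delta> * real (kk * M + r) - D * real r \<le> a (kk * M + r)"
      using sup[OF \<delta>] by blast
    have "\<forall>\<^sub>F N in sequentially. ?\<alpha> M - 2 * \<delta> \<le> ?\<alpha> N" if M: "M \<ge> M0" for M
    proof -
      have M1: "M \<ge> 1" using M M0 by simp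
      have "(\<lambda>N. ((C + D) * real M) / real N) \<longlonglongrightarrow> 0" by (rule lim_const_over_n)
      from order_tendstoD(2)[OF this \<delta>] eventually_ge_at_top[of M]
      show ?thesis
      proof eventually_elim
        case (elim N)
        define kk r where "kk = N div M" and "r = N mod M"
        have N: "N = kk * M + r" by (simp add: kk_def r_def)
        have kk: "kk \<ge> 1" using elim(2) M1 by (simp add: kk_def Suc_le_eq div_greater_zero_iff)
        have r: "real r \<le> real M" using M1 by (simp add: r_def less_imp_le)
        have N0: "real N > 0" using elim(2) M1 by simp
        have "real kk * a M - \<delta> * real N - D * real r \<le> a N" using s[OF M kk, of r] unfolding N[symmetric] .
        moreover have "real kk * a M = (real N - real r) * ?\<alpha> M"
        proof -
          have "real N = real kk * real M + real r" using N by (metis of_nat_add of_nat_mult)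
          then show ?thesis using M1 by simp
        qed
        moreover have "real r * ?\<alpha> M \<le> real M * C" using \<alpha>[OF M1] r C0 by (intro mult_mono) auto
        moreover have "D * real r \<le> D * real M" using r D by (intro mult_left_mono)
        moreover have "(real N - real r) * ?\<alpha> M = real N * ?\<alpha> M - real r * ?\<alpha> M" by (rule left_diff_distrib)
        ultimately have "real N * ?\<alpha> M - real M * C - \<delta> * real N - D * real M \<le> a N"
          by linarith
        moreover have "real N * (((C + D) * real M) / real N) = (C + D) * real M" using N0 by simp
        then have "real N * (?\<alpha> M - ((C + D) * real M) / real N - \<delta>) = real N * ?\<alpha> M - (C * real M + D * real M) - real N * \<delta>"
          by (simp only: right_diff_distrib distrib_right)
        ultimately have "real N * (?\<alpha> M - ((C + D) * real M) / real N - \<delta>) \<le> a N"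
          by (simp only: mult.commute[of \<delta>] mult.commute[of "real M"])
        then have "?\<alpha> M - ((C + D) * real M) / real N - \<delta> \<le> ?\<alpha> N"
          using N0 by (simp only: pos_le_divide_eq mult.commute)
        then show ?case using elim(1) by linarith
      qed
    qed
    then show ?thesis using M0 by blast
  qed
  \<comment> \<open>\<open>Sup A\<close> is the lower limit of the quotients; by \<open>key\<close>,
    quotients of large index cannot exceed it by much.\<close>
  define A where "A = {y. \<forall>\<^sub>F N in sequentially. y \<le> ?\<alpha> N}"
  have A0: "0 \<in> A"
  proof -
    have "\<forall>\<^sub>F N in sequentially. 0 \<le> ?\<alpha> N"
      using eventually_ge_at_top[of "1::nat"] by (rule eventually_mono) (rule \<alpha>(1))
    then show ?thesis by (simp add: A_def)
  qed
  have AC: "y \<le> C" if "y \<in> A" for y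
  proof -
    have "\<forall>\<^sub>F N in sequentially. y \<le> ?\<alpha> N \<and> N \<ge> 1"
      using that eventually_ge_at_top[of "1::nat"] unfolding A_def mem_Collect_eq by (rule eventually_conj)
    then obtain N where "y \<le> ?\<alpha> N" "N \<ge> 1" unfolding eventually_sequentially by blast
    then show ?thesis using \<alpha>(2)[of N] by linarith
  qed
  have bdd: "bdd_above A" using AC by (intro bdd_aboveI[of _ C])
  have "?\<alpha> \<longlonglongrightarrow> Sup A"
  proof (rule tendstoI)
    fix e :: real assume e: "e > 0"
    have e4: "e / 4 > 0" using e by simp
    obtain y where y: "y \<in> A" "Sup A - e < y"
      using less_cSupE[of "Sup A - e" A] A0 e by auto
    obtain M0 where M0: "\<And>M. M \<ge> M0 \<Longrightarrow> \<forall>\<^sub>F N in sequentially. ?\<alpha> M - 2 * (e / 4) \<le> ?\<alpha> N"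
      using key[OF e4] by blast
    have "\<forall>\<^sub>F N in sequentially. y \<le> ?\<alpha> N" using y(1) by (simp add: A_def)
    then show "\<forall>\<^sub>F N in sequentially. dist (?\<alpha> N) (Sup A) < e"
      using eventually_ge_at_top[of M0]
    proof eventually_elim
      case (elim N)
      have "?\<alpha> N - 2 * (e / 4) \<in> A" using M0[OF elim(2)] by (simp add: A_def)
      then have "?\<alpha> N - 2 * (e / 4) \<le> Sup A" by (rule cSup_upper[OF _ bdd])
      then show ?case using elim(1) y(2) e by (simp add: dist_real_def abs_less_iff)
    qed
  qed
  then show ?thesis by (rule convergentI)
qed

section \<open>Convergence of the expected free energy\<close>

lemma integral_coordinate: "(\<integral>g. g i \<partial>disorder) = 0"
  using disorder_ibp[of "\<lambda>_. 1" "\<lambda>_. 0" i 1] by simp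

lemma integral_H: "(\<integral>g. H p N g \<sigma> \<partial>disorder) = 0"
  unfolding H_hc using integrable_coordinate by (simp add: Bochner_Integration.integral_sum integral_coordinate)

lemma aN_nonneg:
  assumes "N \<ge> 1" "p \<ge> 1"
  shows "0 \<le> aN p k N"
proof -
  have "(\<integral>g. k * H p N g (ones N) \<partial>disorder) \<le> aN p k N"
    unfolding aN_def
    by (intro integral_mono integrable_lse_H assms lse_ge) (auto simp: integrable_H)
  then show ?thesis by (simp add: integral_H)
qed

lemma LW_eq: "LW p N \<beta> g = lse (Sigma N) (\<lambda>\<sigma>. \<beta> / sqrt 2 * H p N g \<sigma>) - (\<beta>\<^sup>2 / 4 + ln 2) * real N"
  unfolding LW_def Xe_def[abs_def] lse_add_const[OF finite_Sigma Sigma_nonempty]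
  by (simp add: algebra_simps)

lemma EL_eq:
  assumes "N \<ge> 1" "p \<ge> 1"
  shows "EL p N \<beta> = aN p (\<beta> / sqrt 2) N - (\<beta>\<^sup>2 / 4 + ln 2) * real N"
  unfolding EL_def LW_eq aN_def using integrable_lse_H[OF assms, of "\<beta> / sqrt 2"]
  by (simp add: disorder.prob_space[simplified])

lemma mgf_linear:
  assumes "finite J"
  shows "(\<integral>\<^sup>+g. ennreal (exp (\<Sum>i\<in>J. b i * g i)) \<partial>disorder) = ennreal (exp ((\<Sum>i\<in>J. (b i)\<^sup>2) / 2))"
proof -
  have "(\<integral>\<^sup>+g. ennreal (exp ((\<Sum>i\<in>J. b i * g i) - (\<Sum>i\<in>J. (b i)\<^sup>2) / 2)) * 1 \<partial>disorder) = 1"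
    by (subst cameron_martin[OF assms, symmetric]) (auto simp: disorder.emeasure_space_1[simplified])
  then have one: "(\<integral>\<^sup>+g. ennreal (exp ((\<Sum>i\<in>J. b i * g i) - (\<Sum>i\<in>J. (b i)\<^sup>2) / 2)) \<partial>disorder) = 1" by simp
  have "(\<integral>\<^sup>+g. ennreal (exp (\<Sum>i\<in>J. b i * g i)) \<partial>disorder) =
    (\<integral>\<^sup>+g. ennreal (exp ((\<Sum>i\<in>J. (b i)\<^sup>2) / 2)) * ennreal (exp ((\<Sum>i\<in>J. b i * g i) - (\<Sum>i\<in>J. (b i)\<^sup>2) / 2)) \<partial>disorder)"
    by (intro nn_integral_cong) (simp flip: ennreal_mult exp_add)
  also have "\<dots> = ennreal (exp ((\<Sum>i\<in>J. (b i)\<^sup>2) / 2))"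
    by (subst nn_integral_cmult) (auto simp: one)
  finally show ?thesis .
qed

lemma mgf_H_pair:
  assumes N: "N \<ge> 1" "p \<ge> 1" and s: "\<sigma> \<in> Sigma N" "\<tau> \<in> Sigma N"
  shows "(\<integral>\<^sup>+g. ennreal (exp (k * H p N g \<sigma> + k' * H p N g \<tau>)) \<partial>disorder) =
     ennreal (exp (real N * (k\<^sup>2 / 2 + k'\<^sup>2 / 2 + k * k' * overlap N \<sigma> \<tau> ^ p)))"
proof -
  let ?b = "\<lambda>i. k * hc p N i \<sigma> + k' * hc p N i \<tau>"
  have 1: "k * H p N g \<sigma> + k' * H p N g \<tau> = (\<Sum>i\<in>idx p N. ?b i * g i)" for g
    by (simp add: H_hc sum_distrib_left sum.distrib algebra_simps)
  have "(\<Sum>i\<in>idx p N. (?b i)\<^sup>2) = k\<^sup>2 * (\<Sum>i\<in>idx p N. hc p N i \<sigma> * hc p N i \<sigma>) + k'\<^sup>2 * (\<Sum>i\<in>idx p N. hc p N i \<tau> * hc p N i \<tau>) +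
     2 * k * k' * (\<Sum>i\<in>idx p N. hc p N i \<sigma> * hc p N i \<tau>)"
    unfolding sum_distrib_left sum.distrib[symmetric] by (intro sum.cong refl) (simp add: power2_eq_square algebra_simps)
  also have "\<dots> = 2 * (real N * (k\<^sup>2 / 2 + k'\<^sup>2 / 2 + k * k' * overlap N \<sigma> \<tau> ^ p))"
    unfolding hc_cov[OF N] overlap_self[OF N(1) s(1)] overlap_self[OF N(1) s(2)] by (simp add: algebra_simps)
  finally show ?thesis unfolding 1 by (subst mgf_linear) auto
qed

text \<open>The annealed bound: Jensen's inequality, as \<open>exp LW\<close> has expectation
  1.\<close>

lemma EL_nonpos:
  assumes N: "N \<ge> 1" "p \<ge> 1" and b: "0 \<le> \<beta>"
  shows "EL p N \<beta> \<le> 0"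
proof -
  have int: "integrable disorder (LW p N \<beta>)"
    using integrable_lse_Xe(1)[OF N order_refl Sigma_nonempty b] by (simp add: LW_def[abs_def])
  have i1: "integrable disorder (\<lambda>g. exp (LW p N \<beta> g))" and e1: "(\<integral>g. exp (LW p N \<beta> g) \<partial>disorder) = 1"
    using planted_integral_LW[OF N, of "\<lambda>_. 1" 1 \<beta>] by (auto simp: disorder.prob_space[simplified])
  have "ennreal (exp (EL p N \<beta>)) \<le> (\<integral>\<^sup>+g. ennreal (exp (LW p N \<beta> g)) \<partial>disorder)"
    unfolding EL_def by (rule disorder.nn_jensen_exp[OF int])
  also have "\<dots> = 1" using nn_integral_eq_integral[OF i1] e1 by simp
  finally show "EL p N \<beta> \<le> 0" by (simp flip: ennreal_1)
qed

lemma EL_convergent: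
  assumes p: "p \<ge> 1" and b: "0 \<le> \<beta>"
  shows "convergent (\<lambda>N. EL p N \<beta> / real N)"
proof -
  let ?k = "\<beta> / sqrt 2"
  have "convergent (\<lambda>N. aN p ?k N / real N)"
  proof (rule almost_superadditive_convergent[where C = "\<beta>\<^sup>2 / 4 + ln 2" and D = "2 * ?k\<^sup>2 * real p"])
    show "0 \<le> aN p ?k N" if "N \<ge> 1" for N by (rule aN_nonneg[OF that p])
    show "aN p ?k N \<le> (\<beta>\<^sup>2 / 4 + ln 2) * real N" if "N \<ge> 1" for N
      using EL_nonpos[OF that p b] EL_eq[OF that p, of \<beta>] by simp
    show "\<exists>M0\<ge>1. \<forall>M\<ge>M0. \<forall>kk\<ge>1. \<forall>r. real kk * aN p ?k M - \<delta> * real (kk * M + r) - 2 * ?k\<^sup>2 * real p * real r \<le> aN p ?k (kk * M + r)"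
      if "\<delta> > 0" for \<delta> using almost_superadditive[OF p that, of ?k] by (simp only: mult.assoc)
  qed simp
  then obtain L where L: "(\<lambda>N. aN p ?k N / real N) \<longlonglongrightarrow> L" by (auto simp: convergent_def)
  then have "(\<lambda>N. aN p ?k N / real N - (\<beta>\<^sup>2 / 4 + ln 2)) \<longlonglongrightarrow> L - (\<beta>\<^sup>2 / 4 + ln 2)" by (intro tendsto_intros)
  moreover have "\<forall>\<^sub>F N in sequentially. aN p ?k N / real N - (\<beta>\<^sup>2 / 4 + ln 2) = EL p N \<beta> / real N"
    using eventually_ge_at_top[of 1]
  proof eventually_elim
    case (elim N)
    then show ?case by (simp add: EL_eq[OF _ p] diff_divide_distrib)
  qed
  ultimately have "(\<lambda>N. EL p N \<beta> / real N) \<longlonglongrightarrow> L - (\<beta>\<^sup>2 / 4 + ln 2)" by (rule Lim_transform_eventually)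
  then show ?thesis by (rule convergentI)
qed

section \<open>The replica symmetric phase\<close>

lemma exp_sym_le: "exp x + exp (- x) \<le> 2 * exp (x\<^sup>2 / 2)" for x :: real
proof -
  have main: "exp x + exp (- x) \<le> 2 * exp (x\<^sup>2 / 2)" if x: "x \<ge> 0" for x :: real
  proof -
    \<comment> \<open>This is \<open>tanh y \<le> y\<close>; it makes the derivative of
      \<open>exp (- x\<^sup>2 / 2) * cosh x\<close> nonpositive.\<close>
    have t: "exp y - exp (- y) \<le> y * (exp y + exp (- y))" if y: "y \<ge> 0" for y :: real
    proof -
      have "0 * (exp 0 + exp (- 0)) - (exp 0 - exp (- 0)) \<le> y * (exp y + exp (- y)) - (exp y - exp (- y))"
      proof (rule DERIV_nonneg_imp_nondecreasing[OF y])
        fix z :: real assume z: "0 \<le> z" "z \<le> y"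
        have "((\<lambda>y. y * (exp y + exp (- y)) - (exp y - exp (- y))) has_real_derivative z * (exp z - exp (- z))) (at z)"
          by (auto intro!: derivative_eq_intros simp: algebra_simps)
        moreover have "0 \<le> z * (exp z - exp (- z))" using z by simp
        ultimately show "\<exists>d. ((\<lambda>y. y * (exp y + exp (- y)) - (exp y - exp (- y))) has_real_derivative d) (at z) \<and> 0 \<le> d" by blast
      qed
      then show ?thesis by simp
    qed
    have "exp (- x\<^sup>2 / 2) * (exp x + exp (- x)) \<le> exp (- 0\<^sup>2 / 2) * (exp 0 + exp (- 0))"
    proof (rule DERIV_nonpos_imp_nonincreasing[OF x])
      fix z :: real assume z: "0 \<le> z" "z \<le> x"
      have "((\<lambda>x. exp (- x\<^sup>2 / 2) * (exp x + exp (- x))) has_real_derivative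
          exp (- z\<^sup>2 / 2) * ((exp z - exp (- z)) - z * (exp z + exp (- z)))) (at z)"
        by (auto intro!: derivative_eq_intros simp: algebra_simps)
      moreover have "exp (- z\<^sup>2 / 2) * ((exp z - exp (- z)) - z * (exp z + exp (- z))) \<le> 0"
        using t[OF z(1)] by (intro mult_nonneg_nonpos) auto
      ultimately show "\<exists>d. ((\<lambda>x. exp (- x\<^sup>2 / 2) * (exp x + exp (- x))) has_real_derivative d) (at z) \<and> d \<le> 0" by blast
    qed
    then have "exp (x\<^sup>2 / 2) * (exp (- x\<^sup>2 / 2) * (exp x + exp (- x))) \<le> exp (x\<^sup>2 / 2) * 2"
      by (intro mult_left_mono) auto
    then show ?thesis by (simp add: mult.assoc[symmetric] flip: exp_add)
  qed
  show ?thesis using main[of x] main[of "- x"] by (cases "x \<ge> 0") (auto simp: add.commute)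
qed

lemma sum_exp_overlap:
  assumes s: "\<sigma> \<in> Sigma N"
  shows "(\<Sum>\<tau>\<in>Sigma N. exp (l * (\<Sum>i<N. \<sigma> i * \<tau> i))) \<le> 2 ^ N * exp (l\<^sup>2 / 2 * real N)"
proof -
  have "(\<Sum>\<tau>\<in>Sigma N. exp (l * (\<Sum>i<N. \<sigma> i * \<tau> i))) = (\<Sum>\<tau>\<in>PiE {..<N} (\<lambda>_. {-1, 1}). \<Prod>i<N. exp (l * (\<sigma> i * \<tau> i)))"
    by (simp add: Sigma_def sum_distrib_left exp_sum)
  also have "\<dots> = (\<Prod>i<N. \<Sum>t\<in>{-1, 1}. exp (l * (\<sigma> i * t)))"
    by (subst prod_sum_PiE) auto
  also have "\<dots> \<le> (\<Prod>i<N. 2 * exp (l\<^sup>2 / 2))"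
  proof (rule prod_mono)
    fix i assume i: "i \<in> {..<N}"
    have "(l * \<sigma> i)\<^sup>2 = l\<^sup>2 * (\<sigma> i * \<sigma> i)" by (simp add: power2_eq_square)
    then have "(l * \<sigma> i)\<^sup>2 = l\<^sup>2" using Sigma_square[OF s, of i] i by simp
    then show "0 \<le> (\<Sum>t\<in>{-1, 1}. exp (l * (\<sigma> i * t))) \<and> (\<Sum>t\<in>{-1, 1}. exp (l * (\<sigma> i * t))) \<le> 2 * exp (l\<^sup>2 / 2)"
      using exp_sym_le[of "l * \<sigma> i"] by (simp add: add.commute)
  qed
  also have "\<dots> = 2 ^ N * exp (l\<^sup>2 / 2 * real N)"
    by (simp add: power_mult_distrib exp_of_nat_mult[symmetric] mult.commute)
  finally show ?thesis .
qed

text \<open>Chernoff's bound with parameter \<open>v\<close> for a sum of \<open>N\<close> fair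
  signs, with one exponential for each sign of the overlap.\<close>

lemma overlap_hoeffding:
  assumes s: "\<sigma> \<in> Sigma N" and N: "N \<ge> 1" and v: "v \<ge> 0"
  shows "(\<Sum>\<tau>\<in>Sigma N. of_bool (v \<le> \<bar>overlap N \<sigma> \<tau>\<bar>)) \<le> 2 ^ N * (2 * exp (- (v\<^sup>2 / 2) * real N))"
proof -
  let ?T = "\<lambda>\<tau>. \<Sum>i<N. \<sigma> i * \<tau> i"
  have "(\<Sum>\<tau>\<in>Sigma N. of_bool (v \<le> \<bar>overlap N \<sigma> \<tau>\<bar>)) \<le>
     (\<Sum>\<tau>\<in>Sigma N. exp (- v\<^sup>2 * real N) * exp (v * ?T \<tau>) + exp (- v\<^sup>2 * real N) * exp (- v * ?T \<tau>))"
  proof (rule sum_mono)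
    fix \<tau>
    show "of_bool (v \<le> \<bar>overlap N \<sigma> \<tau>\<bar>) \<le> exp (- v\<^sup>2 * real N) * exp (v * ?T \<tau>) + exp (- v\<^sup>2 * real N) * exp (- v * ?T \<tau>)"
    proof (cases "v \<le> \<bar>overlap N \<sigma> \<tau>\<bar>")
      case True
      then have "v * real N \<le> \<bar>?T \<tau>\<bar>" using N by (simp add: overlap_def field_simps)
      then have a: "v * (v * real N) \<le> v * \<bar>?T \<tau>\<bar>" using v by (intro mult_left_mono)
      show ?thesis
      proof (cases "?T \<tau> \<ge> 0")
        case True
        then have "0 \<le> - v\<^sup>2 * real N + v * ?T \<tau>" using a by (simp add: power2_eq_square)
        then have "1 \<le> exp (- v\<^sup>2 * real N) * exp (v * ?T \<tau>)" by (simp only: exp_add[symmetric] one_le_exp_iff)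
        then show ?thesis by (auto intro: order_trans[of _ 1] add_increasing2)
      next
        case False
        then have "0 \<le> - v\<^sup>2 * real N + - v * ?T \<tau>" using a by (simp add: power2_eq_square)
        then have "1 \<le> exp (- v\<^sup>2 * real N) * exp (- v * ?T \<tau>)" by (simp only: exp_add[symmetric] one_le_exp_iff)
        then show ?thesis by (auto intro: order_trans[of _ 1] add_increasing)
      qed
    qed simp
  qed
  also have "\<dots> = exp (- v\<^sup>2 * real N) * ((\<Sum>\<tau>\<in>Sigma N. exp (v * ?T \<tau>)) + (\<Sum>\<tau>\<in>Sigma N. exp (- v * ?T \<tau>)))"
    by (simp add: sum.distrib sum_distrib_left distrib_left)
  also have "\<dots> \<le> exp (- v\<^sup>2 * real N) * (2 ^ N * exp (v\<^sup>2 / 2 * real N) + 2 ^ N * exp ((- v)\<^sup>2 / 2 * real N))"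
    by (intro mult_left_mono add_mono sum_exp_overlap s) auto
  also have "\<dots> = 2 ^ N * (2 * (exp (- v\<^sup>2 * real N) * exp (v\<^sup>2 / 2 * real N)))" by simp
  also have "exp (- v\<^sup>2 * real N) * exp (v\<^sup>2 / 2 * real N) = exp (- (v\<^sup>2 / 2) * real N)"
    by (simp flip: exp_add add: field_simps)
  finally show ?thesis .
qed

lemma mgf_Xe_pair:
  assumes N: "N \<ge> 1" "p \<ge> 1" and s: "\<sigma> \<in> Sigma N" "\<tau> \<in> Sigma N"
  shows "(\<integral>\<^sup>+g. ennreal (exp (Xe p N \<beta> g \<sigma> + Xe p N \<beta> g \<tau>)) \<partial>disorder) =
     ennreal (exp (\<beta>\<^sup>2 / 2 * real N * overlap N \<sigma> \<tau> ^ p) / 4 ^ N)"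
proof -
  let ?k = "\<beta> / sqrt 2"
  have k0: "?k\<^sup>2 = \<beta>\<^sup>2 / 2" "?k * ?k = \<beta>\<^sup>2 / 2" by (simp_all add: power_divide power2_eq_square)
  have "(\<integral>\<^sup>+g. ennreal (exp (Xe p N \<beta> g \<sigma> + Xe p N \<beta> g \<tau>)) \<partial>disorder) =
     (\<integral>\<^sup>+g. ennreal (exp (- (\<beta>\<^sup>2 / 2 * real N) - 2 * real N * ln 2)) * ennreal (exp (?k * H p N g \<sigma> + ?k * H p N g \<tau>)) \<partial>disorder)"
    by (intro nn_integral_cong) (simp add: Xe_def algebra_simps flip: ennreal_mult exp_add)
  also have "\<dots> = ennreal (exp (- (\<beta>\<^sup>2 / 2 * real N) - 2 * real N * ln 2)) * ennreal (exp (real N * (?k\<^sup>2 / 2 + ?k\<^sup>2 / 2 + ?k * ?k * overlap N \<sigma> \<tau> ^ p)))"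
    by (subst nn_integral_cmult, measurable) (subst mgf_H_pair[OF N s], rule refl)
  also have "\<dots> = ennreal (exp (\<beta>\<^sup>2 / 2 * real N * overlap N \<sigma> \<tau> ^ p - 2 * real N * ln 2))"
    unfolding k0 by (simp add: algebra_simps flip: ennreal_mult exp_add)
  also have "exp (\<beta>\<^sup>2 / 2 * real N * overlap N \<sigma> \<tau> ^ p - 2 * real N * ln 2) = exp (\<beta>\<^sup>2 / 2 * real N * overlap N \<sigma> \<tau> ^ p) / 4 ^ N"
  proof -
    have "exp (2 * real N * ln 2) = (4::real) ^ N"
    proof -
      have "exp (2 * real N * ln 2) = exp (real N * ln 4)" by (simp add: ln_realpow[of 2 2, simplified] algebra_simps)
      then show ?thesis by (simp add: exp_of_nat_mult)
    qed
    then show ?thesis by (simp add: exp_diff)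
  qed
  finally show ?thesis .
qed

text \<open>In expectation the weight of a pair depends on its overlap alone, so questions about
  pairs become counting problems.\<close>

lemma integral_pair_annealed:
  assumes N: "N \<ge> 1" "p \<ge> 1" and c: "\<And>\<sigma> \<tau>. 0 \<le> c \<sigma> \<tau>"
  shows "(\<integral>\<^sup>+g. ennreal (\<Sum>\<sigma>\<in>Sigma N. \<Sum>\<tau>\<in>Sigma N. exp (Xe p N \<beta> g \<sigma> + Xe p N \<beta> g \<tau>) * c \<sigma> \<tau>) \<partial>disorder) =
     ennreal (\<Sum>\<sigma>\<in>Sigma N. \<Sum>\<tau>\<in>Sigma N. exp (\<beta>\<^sup>2 / 2 * real N * overlap N \<sigma> \<tau> ^ p) / 4 ^ N * c \<sigma> \<tau>)"
proof -
  have "(\<integral>\<^sup>+g. ennreal (\<Sum>\<sigma>\<in>Sigma N. \<Sum>\<tau>\<in>Sigma N. exp (Xe p N \<beta> g \<sigma> + Xe p N \<beta> g \<tau>) * c \<sigma> \<tau>) \<partial>disorder) =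
     (\<integral>\<^sup>+g. (\<Sum>\<sigma>\<in>Sigma N. \<Sum>\<tau>\<in>Sigma N. ennreal (exp (Xe p N \<beta> g \<sigma> + Xe p N \<beta> g \<tau>)) * ennreal (c \<sigma> \<tau>)) \<partial>disorder)"
    using c by (intro nn_integral_cong) (simp add: sum_ennreal sum_nonneg flip: ennreal_mult)
  also have "\<dots> = (\<Sum>\<sigma>\<in>Sigma N. \<Sum>\<tau>\<in>Sigma N. (\<integral>\<^sup>+g. ennreal (exp (Xe p N \<beta> g \<sigma> + Xe p N \<beta> g \<tau>)) * ennreal (c \<sigma> \<tau>) \<partial>disorder))"
    by (simp add: nn_integral_sum)
  also have "\<dots> = (\<Sum>\<sigma>\<in>Sigma N. \<Sum>\<tau>\<in>Sigma N. ennreal (exp (\<beta>\<^sup>2 / 2 * real N * overlap N \<sigma> \<tau> ^ p) / 4 ^ N) * ennreal (c \<sigma> \<tau>))"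
    by (intro sum.cong refl) (simp add: nn_integral_multc mgf_Xe_pair[OF N])
  also have "\<dots> = ennreal (\<Sum>\<sigma>\<in>Sigma N. \<Sum>\<tau>\<in>Sigma N. exp (\<beta>\<^sup>2 / 2 * real N * overlap N \<sigma> \<tau> ^ p) / 4 ^ N * c \<sigma> \<tau>)"
    using c by (simp add: sum_ennreal sum_nonneg flip: ennreal_mult)
  finally show ?thesis .
qed

text \<open>The absolute overlap takes at most \<open>N + 1\<close> values, so a bound for each
  single value loses only a polynomial factor.\<close>

lemma overlap_grid:
  assumes "\<sigma> \<in> Sigma N" "\<tau> \<in> Sigma N" "N \<ge> 1"
  shows "\<exists>k\<in>{..N}. \<bar>overlap N \<sigma> \<tau>\<bar> = real k / real N"
proof -
  have "\<sigma> i * \<tau> i \<in> \<int>" if "i < N" for i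
  proof -
    have "x \<in> \<int>" if "x \<in> {-1, 1 :: real}" for x using that by auto
    moreover have "\<sigma> i \<in> {-1, 1}" "\<tau> i \<in> {-1, 1}" using assms that unfolding Sigma_def by (auto simp: PiE_def Pi_def)
    ultimately show ?thesis by (intro Ints_mult) blast+
  qed
  then have "(\<Sum>i<N. \<sigma> i * \<tau> i) \<in> \<int>" by (intro Ints_sum) auto
  then obtain z where z: "(\<Sum>i<N. \<sigma> i * \<tau> i) = of_int z" by (auto elim: Ints_cases)
  have "\<bar>overlap N \<sigma> \<tau>\<bar> = real (nat \<bar>z\<bar>) / real N" by (simp add: overlap_def z abs_divide)
  moreover have "real (nat \<bar>z\<bar>) \<le> real N"
  proof -
    have "real (nat \<bar>z\<bar>) / real N \<le> 1" using overlap_abs_le_1[OF assms(1,2)] calculation by simp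
    then show ?thesis using assms(3) by (simp add: divide_le_eq)
  qed
  then have "nat \<bar>z\<bar> \<in> {..N}" by simp
  ultimately show ?thesis by blast
qed

text \<open>As \<open>p \<ge> 2\<close>, a pair with overlap \<open>R\<close> has annealed weight at
  most \<open>exp (N * R\<^sup>2 / 2)\<close>, which the entropic bound
  \<open>exp (- N * R\<^sup>2 / 2)\<close> compensates exactly. Each of the \<open>N + 1\<close>
  values of \<open>\<bar>R\<bar>\<close> thus contributes at most 2.\<close>

lemma second_moment:
  assumes N: "N \<ge> 1" and p: "p \<ge> 2"
  shows "(\<Sum>\<sigma>\<in>Sigma N. \<Sum>\<tau>\<in>Sigma N. exp (1 / 2 * real N * overlap N \<sigma> \<tau> ^ p) / 4 ^ N) \<le> 2 * (real N + 1)"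
proof -
  have inner: "(\<Sum>\<tau>\<in>Sigma N. exp (1 / 2 * real N * overlap N \<sigma> \<tau> ^ p)) \<le> 2 ^ N * (2 * (real N + 1))" if s: "\<sigma> \<in> Sigma N" for \<sigma>
  proof -
    have "(\<Sum>\<tau>\<in>Sigma N. exp (1 / 2 * real N * overlap N \<sigma> \<tau> ^ p)) \<le>
      (\<Sum>\<tau>\<in>Sigma N. \<Sum>k\<le>N. exp ((real k / real N)\<^sup>2 / 2 * real N) * of_bool (real k / real N \<le> \<bar>overlap N \<sigma> \<tau>\<bar>))"
    proof (rule sum_mono)
      fix \<tau> assume t: "\<tau> \<in> Sigma N"
      obtain k where k: "k \<le> N" "\<bar>overlap N \<sigma> \<tau>\<bar> = real k / real N" using overlap_grid[OF s t N] by auto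
      have "overlap N \<sigma> \<tau> ^ p \<le> \<bar>overlap N \<sigma> \<tau>\<bar> ^ p" by (simp flip: power_abs)
      also have "\<dots> \<le> \<bar>overlap N \<sigma> \<tau>\<bar> ^ 2" using overlap_abs_le_1[OF s t] p by (intro power_decreasing) auto
      finally have "exp (1 / 2 * real N * overlap N \<sigma> \<tau> ^ p) \<le> exp ((real k / real N)\<^sup>2 / 2 * real N)"
        unfolding k(2) using mult_left_mono[of "overlap N \<sigma> \<tau> ^ p" "(real k / real N)\<^sup>2" "real N / 2"] by (simp add: mult_ac)
      also have "\<dots> = exp ((real k / real N)\<^sup>2 / 2 * real N) * of_bool (real k / real N \<le> \<bar>overlap N \<sigma> \<tau>\<bar>)"
        by (simp add: k)
      also have "\<dots> \<le> (\<Sum>k\<le>N. exp ((real k / real N)\<^sup>2 / 2 * real N) * of_bool (real k / real N \<le> \<bar>overlap N \<sigma> \<tau>\<bar>))"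
        by (rule member_le_sum[where f = "\<lambda>k. exp ((real k / real N)\<^sup>2 / 2 * real N) * of_bool (real k / real N \<le> \<bar>overlap N \<sigma> \<tau>\<bar>)"]) (use k in auto)
      finally show "exp (1 / 2 * real N * overlap N \<sigma> \<tau> ^ p) \<le> \<dots>" .
    qed
    also have "\<dots> = (\<Sum>k\<le>N. exp ((real k / real N)\<^sup>2 / 2 * real N) * (\<Sum>\<tau>\<in>Sigma N. of_bool (real k / real N \<le> \<bar>overlap N \<sigma> \<tau>\<bar>)))"
      unfolding sum_distrib_left by (rule sum.swap)
    also have "\<dots> \<le> (\<Sum>k\<le>N. exp ((real k / real N)\<^sup>2 / 2 * real N) * (2 ^ N * (2 * exp (- ((real k / real N)\<^sup>2 / 2) * real N))))"
      by (intro sum_mono mult_left_mono overlap_hoeffding[OF s N]) auto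
    also have "\<dots> = (\<Sum>k\<le>N. 2 ^ N * 2)"
    proof (rule sum.cong[OF refl])
      fix k
      have "exp ((real k / real N)\<^sup>2 / 2 * real N) * exp (- ((real k / real N)\<^sup>2 / 2) * real N) = 1" by (simp flip: exp_add)
      then show "exp ((real k / real N)\<^sup>2 / 2 * real N) * (2 ^ N * (2 * exp (- ((real k / real N)\<^sup>2 / 2) * real N))) = 2 ^ N * 2"
        by (simp only: mult.left_commute mult_1_right)
    qed
    finally show ?thesis by (simp add: algebra_simps)
  qed
  have "(\<Sum>\<sigma>\<in>Sigma N. \<Sum>\<tau>\<in>Sigma N. exp (1 / 2 * real N * overlap N \<sigma> \<tau> ^ p) / 4 ^ N) =
    (\<Sum>\<sigma>\<in>Sigma N. (\<Sum>\<tau>\<in>Sigma N. exp (1 / 2 * real N * overlap N \<sigma> \<tau> ^ p)) / 4 ^ N)"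
    by (simp add: sum_divide_distrib)
  also have "\<dots> \<le> (\<Sum>\<sigma>\<in>Sigma N. 2 ^ N * (2 * (real N + 1)) / 4 ^ N)"
    by (intro sum_mono divide_right_mono inner) auto
  also have "\<dots> = 2 ^ N * (2 ^ N * (2 * (real N + 1)) / 4 ^ N)" by (simp add: card_Sigma)
  also have "\<dots> = (2 ^ N * 2 ^ N / 4 ^ N) * (2 * (real N + 1))" by simp
  also have "(2 ^ N * 2 ^ N / 4 ^ N :: real) = 1" by (simp flip: power_mult_distrib)
  finally show ?thesis by simp
qed

text \<open>\<open>W = exp LW\<close> has mean 1 and a second moment polynomial in \<open>N\<close>,
  so the event \<open>W \<ge> 1 / 2\<close> has probability at least inverse polynomial. If
  \<open>EL\<close> were below \<open>- \<eta> * N\<close>, concentration would make that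
  probability exponentially small.\<close>

lemma EL_at_1:
  assumes p: "p \<ge> 2" and \<eta>: "\<eta> > 0"
  shows "\<forall>\<^sub>F N in sequentially. - \<eta> * real N \<le> EL p N 1"
proof -
  define c where "c = (\<eta> / 2)\<^sup>2 / 2"
  have c: "c > 0" using \<eta> by (simp add: c_def)
  have p1: "p \<ge> 1" using p by simp
  have "(\<lambda>N. ((8 * real N + 8) * exp (- c * real N))) \<longlonglongrightarrow> 0"
  proof -
    have "(\<lambda>N. 8 * (real N * exp (- c * real N)) + 8 * exp (- c * real N)) \<longlonglongrightarrow> 8 * 0 + 8 * 0"
    proof (intro tendsto_intros)
      have "((\<lambda>x::real. x ^ 1 / exp x) \<longlongrightarrow> 0) at_top" by (rule tendsto_power_div_exp_0)
      then have "((\<lambda>x::real. (c * x) / exp (c * x)) \<longlongrightarrow> 0) at_top"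
        using filterlim_compose[of "\<lambda>x::real. x ^ 1 / exp x" "nhds 0" at_top "\<lambda>x. c * x" at_top] c
        by (simp add: filterlim_tendsto_pos_mult_at_top[OF tendsto_const _ filterlim_ident])
      then have "((\<lambda>x::real. (c * x) / exp (c * x) / c) \<longlongrightarrow> 0 / c) at_top" by (intro tendsto_intros) (use c in auto)
      then have "((\<lambda>x::real. x * exp (- c * x)) \<longlongrightarrow> 0) at_top" using c by (simp add: exp_minus field_simps)
      then show "(\<lambda>N. real N * exp (- c * real N)) \<longlonglongrightarrow> 0"
        by (rule filterlim_compose[OF _ filterlim_real_sequentially])
      show "(\<lambda>N. exp (- c * real N)) \<longlonglongrightarrow> 0"
        by (rule filterlim_compose[OF exp_at_bot]) (use c in \<open>intro filterlim_tendsto_neg_mult_at_bot[OF tendsto_const] filterlim_real_sequentially, simp\<close>)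
    qed
    then show ?thesis by (simp add: algebra_simps)
  qed
  from order_tendstoD(2)[OF this, of 1]
  have ev: "\<forall>\<^sub>F N in sequentially. (8 * real N + 8) * exp (- c * real N) < 1" by simp
  obtain N1 where N1: "ln 2 \<le> \<eta> / 2 * real N1" using real_arch_simple[of "ln 2 / (\<eta> / 2)"] \<eta> by (auto simp: field_simps)
  show ?thesis
    using ev eventually_ge_at_top[of "max 1 N1"]
  proof eventually_elim
    case (elim N)
    have N: "N \<ge> 1" "N \<ge> N1" using elim(2) by auto
    show ?case
    proof (rule ccontr)
      assume "\<not> - \<eta> * real N \<le> EL p N 1"
      then have small: "EL p N 1 < - \<eta> * real N" by simp
      define P where "P = measure disorder {g. - ln 2 \<le> LW p N 1 g}"
      define C where "C = 2 * (real N + 1)"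
      have C: "C > 0" by (simp add: C_def)
      have "P \<le> measure disorder {g. (\<integral>g. LW p N 1 g \<partial>disorder) + \<eta> / 2 * real N \<le> LW p N 1 g}"
        unfolding P_def
      proof (rule measure_disorder_mono)
        have "\<eta> / 2 * real N1 \<le> \<eta> / 2 * real N" using N \<eta> by (intro mult_left_mono) auto
        then have "ln 2 \<le> \<eta> / 2 * real N" using N1 by linarith
        then show "{g. - ln 2 \<le> LW p N 1 g} \<subseteq> {g. (\<integral>g. LW p N 1 g \<partial>disorder) + \<eta> / 2 * real N \<le> LW p N 1 g}"
          using small by (auto simp: EL_def)
      qed measurable
      also have "\<dots> \<le> exp (- ((\<eta> / 2)\<^sup>2 / (2 * 1\<^sup>2)) * real N)"
        unfolding LW_def by (rule subgaussian_tails_linear(1)[OF subgaussian_Xe(1)]) (use N p1 \<eta> in auto)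
      finally have up: "P \<le> exp (- c * real N)" by (simp add: c_def)
      have i1: "integrable disorder (\<lambda>g. exp (LW p N 1 g))" and e1: "(\<integral>g. exp (LW p N 1 g) \<partial>disorder) = 1"
        using planted_integral_LW[OF N(1) p1, of "\<lambda>_. 1" 1 1] by (auto simp: disorder.prob_space[simplified])
      have sq: "exp (2 * LW p N 1 g) = (\<Sum>\<sigma>\<in>Sigma N. \<Sum>\<tau>\<in>Sigma N. exp (Xe p N 1 g \<sigma> + Xe p N 1 g \<tau>) * 1)" for g
        by (simp add: exp_double exp_LW power2_eq_square sum_product exp_add)
      have "(\<integral>\<^sup>+g. ennreal (exp (2 * LW p N 1 g)) \<partial>disorder) =
        ennreal (\<Sum>\<sigma>\<in>Sigma N. \<Sum>\<tau>\<in>Sigma N. exp (1\<^sup>2 / 2 * real N * overlap N \<sigma> \<tau> ^ p) / 4 ^ N * 1)"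
        unfolding sq by (rule integral_pair_annealed[OF N(1) p1]) simp
      also have "\<dots> \<le> ennreal C" unfolding C_def using second_moment[OF N(1) p] by (intro ennreal_leI) simp
      finally have nn: "(\<integral>\<^sup>+g. ennreal (exp (2 * LW p N 1 g)) \<partial>disorder) \<le> ennreal C" .
      have i2: "integrable disorder (\<lambda>g. exp (2 * LW p N 1 g))"
        by (rule integrableI_nonneg) (use nn in \<open>auto intro: le_less_trans\<close>)
      have e2: "(\<integral>g. exp (2 * LW p N 1 g) \<partial>disorder) \<le> C"
        using nn nn_integral_eq_integral[OF i2] C by simp
      \<comment> \<open>Paley-Zygmund through a pointwise inequality: where
        \<open>w \<ge> 1 / 2\<close>, use \<open>w \<le> w\<^sup>2 / (4 * C) + C\<close>; elsewhere
        \<open>w \<le> 1 / 2\<close>.\<close>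
      have "(\<integral>g. exp (LW p N 1 g) \<partial>disorder) \<le> (\<integral>g. 1 / 2 + exp (2 * LW p N 1 g) / (4 * C) + C * of_bool (- ln 2 \<le> LW p N 1 g) \<partial>disorder)"
      proof (rule integral_mono[OF i1])
        show "integrable disorder (\<lambda>g. 1 / 2 + exp (2 * LW p N 1 g) / (4 * C) + C * of_bool (- ln 2 \<le> LW p N 1 g))"
          using i2 integrable_of_bool[of "\<lambda>g. - ln 2 \<le> LW p N 1 g"] by auto
        fix g
        define w where "w = exp (LW p N 1 g)"
        have w2: "exp (2 * LW p N 1 g) = w\<^sup>2" by (simp add: w_def exp_double)
        show "exp (LW p N 1 g) \<le> 1 / 2 + exp (2 * LW p N 1 g) / (4 * C) + C * of_bool (- ln 2 \<le> LW p N 1 g)"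
        proof (cases "- ln 2 \<le> LW p N 1 g")
          case True
          have "0 \<le> (w - 2 * C)\<^sup>2 / (4 * C)" using C by simp
          also have "(w - 2 * C)\<^sup>2 / (4 * C) = w\<^sup>2 / (4 * C) - w + C" using C by (simp add: power2_eq_square field_simps)
          finally show ?thesis unfolding w2 using True by (simp add: w_def)
        next
          case False
          then have "w \<le> exp (- ln 2)" by (simp add: w_def)
          then have "w \<le> 1 / 2" by (simp add: exp_minus)
          moreover have "0 \<le> w\<^sup>2 / (4 * C)" using C by simp
          ultimately show ?thesis unfolding w2 using False by (simp add: w_def)
        qed
      qed
      also have "\<dots> = 1 / 2 + (\<integral>g. exp (2 * LW p N 1 g) \<partial>disorder) / (4 * C) + C * P"
        using i2 integrable_of_bool[of "\<lambda>g. - ln 2 \<le> LW p N 1 g"]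
        by (simp add: P_def integral_indicator_Collect disorder.prob_space[simplified])
      also have "\<dots> \<le> 1 / 2 + 1 / 4 + C * exp (- c * real N)"
      proof (intro add_mono mult_left_mono up order_refl)
        show "(\<integral>g. exp (2 * LW p N 1 g) \<partial>disorder) / (4 * C) \<le> 1 / 4"
          using e2 C by (simp add: field_simps)
      qed (use C in auto)
      finally have "1 / 4 \<le> C * exp (- c * real N)" unfolding e1 by simp
      moreover have "C * exp (- c * real N) = ((8 * real N + 8) * exp (- c * real N)) / 4" by (simp add: C_def algebra_simps)
      ultimately show False using elim(1) by linarith
    qed
  qed
qed

section \<open>The almost sure limit and membership in the phase\<close>

lemma FN_eq:
  assumes "N \<ge> 1"
  shows "FN p N g \<beta> = LW p N \<beta> g / real N + \<beta>\<^sup>2 / 4"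
proof -
  have "(\<Sum>\<sigma>\<in>Sigma N. 2 powr (- real N) * weight p N \<beta> g \<sigma>) = (\<Sum>\<sigma>\<in>Sigma N. exp (\<beta> / sqrt 2 * H p N g \<sigma> + (- real N * ln 2)))"
    unfolding weight_def exp_add by (intro sum.cong refl) (simp add: powr_def)
  then have "FN p N g \<beta> = lse (Sigma N) (\<lambda>\<sigma>. \<beta> / sqrt 2 * H p N g \<sigma> + (- real N * ln 2)) / real N"
    by (simp only: FN_def lse_def)
  also have "\<dots> = (lse (Sigma N) (\<lambda>\<sigma>. \<beta> / sqrt 2 * H p N g \<sigma>) - real N * ln 2) / real N"
    by (subst lse_add_const) auto
  also have "\<dots> = LW p N \<beta> g / real N + \<beta>\<^sup>2 / 4"
    unfolding LW_eq using assms by (simp add: field_simps)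
  finally show ?thesis .
qed

text \<open>The deviation probabilities are summable in \<open>N\<close>, so Borel-Cantelli applies
  on the common probability space of all \<open>N\<close>, for each of the countably many tolerances
  \<open>1 / Suc m\<close>.\<close>

lemma LW_AE_convergent:
  assumes p: "p \<ge> 1" and b: "\<beta> > 0"
  shows "AE g in disorder. (\<lambda>N. LW p N \<beta> g / real N - EL p N \<beta> / real N) \<longlonglongrightarrow> 0"
proof -
  have "AE g in disorder. \<forall>\<^sub>F N in sequentially. \<bar>LW p N \<beta> g / real N - EL p N \<beta> / real N\<bar> < 1 / real (Suc m)" for m
  proof -
    let ?x = "1 / real (Suc m)"
    define A where "A N = {g. N \<ge> 1 \<and> ?x * real N \<le> \<bar>LW p N \<beta> g - EL p N \<beta>\<bar>}" for N
    define c where "c = ?x\<^sup>2 / (2 * \<beta>\<^sup>2)"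
    have c: "c > 0" using b by (simp add: c_def)
    have mA: "A N \<in> sets disorder" for N unfolding A_def by measurable
    have le: "measure disorder (A N) \<le> 2 * exp (- c) ^ N" for N
    proof (cases "N \<ge> 1")
      case True
      have sub: "subgaussian (LW p N \<beta>) (\<beta>\<^sup>2 / 2 * real N)"
        using subgaussian_Xe(1)[OF True p order_refl Sigma_nonempty, of \<beta> \<beta>] b by (simp add: LW_def[abs_def])
      have "measure disorder (A N) \<le> measure disorder ({g. (\<integral>g. LW p N \<beta> g \<partial>disorder) + ?x * real N \<le> LW p N \<beta> g} \<union> {g. LW p N \<beta> g \<le> (\<integral>g. LW p N \<beta> g \<partial>disorder) - ?x * real N})"
      proof (rule measure_disorder_mono)
        show "A N \<subseteq> {g. (\<integral>g. LW p N \<beta> g \<partial>disorder) + ?x * real N \<le> LW p N \<beta> g} \<union> {g. LW p N \<beta> g \<le> (\<integral>g. LW p N \<beta> g \<partial>disorder) - ?x * real N}"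
        proof
          fix g assume "g \<in> A N"
          then have "?x * real N \<le> \<bar>LW p N \<beta> g - (\<integral>g. LW p N \<beta> g \<partial>disorder)\<bar>" by (simp only: A_def EL_def mem_Collect_eq)
          then show "g \<in> {g. (\<integral>g. LW p N \<beta> g \<partial>disorder) + ?x * real N \<le> LW p N \<beta> g} \<union> {g. LW p N \<beta> g \<le> (\<integral>g. LW p N \<beta> g \<partial>disorder) - ?x * real N}"
            unfolding Un_iff mem_Collect_eq by linarith
        qed
      qed measurable
      also have "\<dots> \<le> measure disorder {g. (\<integral>g. LW p N \<beta> g \<partial>disorder) + ?x * real N \<le> LW p N \<beta> g} + measure disorder {g. LW p N \<beta> g \<le> (\<integral>g. LW p N \<beta> g \<partial>disorder) - ?x * real N}"
        by (rule measure_Un_le) measurable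
      also have "\<dots> \<le> exp (- c * real N) + exp (- c * real N)"
        unfolding c_def by (intro add_mono subgaussian_tails_linear[OF sub True b]) auto
      also have "\<dots> = 2 * exp (- c) ^ N" by (simp add: exp_of_nat_mult[symmetric] mult.commute)
      finally show ?thesis .
    qed (simp add: A_def)
    have "summable (\<lambda>N. 2 * exp (- c) ^ N)" using c by (intro summable_mult summable_geometric) auto
    then have "summable (\<lambda>N. measure disorder (A N))"
    proof (rule summable_comparison_test'[where N = 0])
      show "norm (measure disorder (A N)) \<le> 2 * exp (- c) ^ N" for N
        unfolding real_norm_def abs_of_nonneg[OF measure_nonneg] by (rule le)
    qed
    then have "AE g in disorder. \<forall>\<^sub>F N in sequentially. g \<in> space disorder - A N"
      using mA by (intro borel_cantelli_AE1) (auto simp: disorder.emeasure_eq_measure)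
    then show ?thesis
    proof (rule AE_mp, intro AE_I2 impI)
      fix g assume "\<forall>\<^sub>F N in sequentially. g \<in> space disorder - A N"
      then show "\<forall>\<^sub>F N in sequentially. \<bar>LW p N \<beta> g / real N - EL p N \<beta> / real N\<bar> < ?x"
        using eventually_ge_at_top[of 1]
      proof eventually_elim
        case (elim N)
        then have "\<bar>LW p N \<beta> g - EL p N \<beta>\<bar> < ?x * real N" by (auto simp: A_def)
        then have "\<bar>LW p N \<beta> g - EL p N \<beta>\<bar> / real N < ?x" using elim(2) by (simp only: pos_divide_less_eq of_nat_0_less_iff)
        then show ?case by (simp add: diff_divide_distrib[symmetric] abs_divide)
      qed
    qed
  qed
  then have "AE g in disorder. \<forall>m. \<forall>\<^sub>F N in sequentially. \<bar>LW p N \<beta> g / real N - EL p N \<beta> / real N\<bar> < 1 / real (Suc m)"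
    unfolding AE_all_countable by blast
  then show ?thesis
  proof (rule AE_mp, intro AE_I2 impI)
    fix g assume ev: "\<forall>m. \<forall>\<^sub>F N in sequentially. \<bar>LW p N \<beta> g / real N - EL p N \<beta> / real N\<bar> < 1 / real (Suc m)"
    show "(\<lambda>N. LW p N \<beta> g / real N - EL p N \<beta> / real N) \<longlonglongrightarrow> 0"
    proof (rule tendstoI)
      fix e :: real assume "e > 0"
      then obtain m where m: "1 / real (Suc m) < e" using nat_approx_posE by blast
      show "\<forall>\<^sub>F N in sequentially. dist (LW p N \<beta> g / real N - EL p N \<beta> / real N) 0 < e"
        using ev[rule_format, of m] by (rule eventually_mono) (use m in auto)
    qed
  qed
qed

text \<open>Concentration transfers the limit of the expectations to almost every disorder, and two
  events of probability 1 meet, so the definite description in \<open>F\<close> is well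
  defined.\<close>

lemma F_eq:
  assumes p: "p \<ge> 1" and b: "\<beta> > 0" and L: "(\<lambda>N. EL p N \<beta> / real N) \<longlonglongrightarrow> L"
  shows "F p \<beta> = L + \<beta>\<^sup>2 / 4"
proof -
  have ae: "AE g in disorder. (\<lambda>N. FN p N g \<beta>) \<longlonglongrightarrow> L + \<beta>\<^sup>2 / 4"
    using LW_AE_convergent[OF p b]
  proof (rule AE_mp, intro AE_I2 impI)
    fix g assume "(\<lambda>N. LW p N \<beta> g / real N - EL p N \<beta> / real N) \<longlonglongrightarrow> 0"
    from tendsto_add[OF tendsto_add[OF this L] tendsto_const[of "\<beta>\<^sup>2 / 4"]]
    have "(\<lambda>N. LW p N \<beta> g / real N + \<beta>\<^sup>2 / 4) \<longlonglongrightarrow> L + \<beta>\<^sup>2 / 4" by simp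
    moreover have "\<forall>\<^sub>F N in sequentially. LW p N \<beta> g / real N + \<beta>\<^sup>2 / 4 = FN p N g \<beta>"
      using eventually_ge_at_top[of 1] by (rule eventually_mono) (simp add: FN_eq)
    ultimately show "(\<lambda>N. FN p N g \<beta>) \<longlonglongrightarrow> L + \<beta>\<^sup>2 / 4" by (rule Lim_transform_eventually)
  qed
  show ?thesis unfolding F_def
  proof (rule the_equality)
    show "AE g in disorder. (\<lambda>N. FN p N g \<beta>) \<longlonglongrightarrow> L + \<beta>\<^sup>2 / 4" by (rule ae)
    fix c assume c: "AE g in disorder. (\<lambda>N. FN p N g \<beta>) \<longlonglongrightarrow> c"
    from ae c have "AE g in disorder. c = L + \<beta>\<^sup>2 / 4"
      by eventually_elim (rule LIMSEQ_unique)
    then show "c = L + \<beta>\<^sup>2 / 4" by simp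
  qed
qed

text \<open>From left to right the existence of the limit is essential: otherwise the definite
  description in \<open>F\<close> need not denote a limit, and its value would say nothing about
  \<open>EL\<close>.\<close>

lemma replica_sym_iff:
  assumes p: "p \<ge> 1" and b: "\<beta> > 0"
  shows "\<beta> \<in> replica_sym p \<longleftrightarrow> (\<lambda>N. EL p N \<beta> / real N) \<longlonglongrightarrow> 0"
proof -
  obtain L where L: "(\<lambda>N. EL p N \<beta> / real N) \<longlonglongrightarrow> L"
    using EL_convergent[OF p, of \<beta>] b by (auto simp: convergent_def)
  show ?thesis
  proof
    assume "\<beta> \<in> replica_sym p"
    then have "L = 0" using F_eq[OF p b L] by (simp add: replica_sym_def)
    then show "(\<lambda>N. EL p N \<beta> / real N) \<longlonglongrightarrow> 0" using L by simp
  next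
    assume "(\<lambda>N. EL p N \<beta> / real N) \<longlonglongrightarrow> 0"
    from F_eq[OF p b this] b show "\<beta> \<in> replica_sym p" by (simp add: replica_sym_def)
  qed
qed

text \<open>The phase is nonempty, so any number below the supremum \<open>beta_c p\<close> lies
  below one of its points.\<close>

lemma one_in_replica_sym:
  assumes p: "p \<ge> 2"
  shows "1 \<in> replica_sym p"
proof -
  have p1: "p \<ge> 1" using p by simp
  have "(\<lambda>N. EL p N 1 / real N) \<longlonglongrightarrow> 0"
  proof (rule tendstoI)
    fix e :: real assume e: "e > 0"
    show "\<forall>\<^sub>F N in sequentially. dist (EL p N 1 / real N) 0 < e"
      using EL_at_1[OF p half_gt_zero[OF e]] eventually_ge_at_top[of 1]
    proof eventually_elim
      case (elim N)
      have "EL p N 1 \<le> 0" by (rule EL_nonpos) (use elim p1 in auto)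
      then have "\<bar>EL p N 1 / real N\<bar> = - EL p N 1 / real N" by (simp add: divide_nonpos_nonneg)
      also have "\<dots> \<le> e / 2"
      proof -
        have "- EL p N 1 \<le> e / 2 * real N" using elim(1) by simp
        then show ?thesis using elim(2) by (simp only: pos_divide_le_eq of_nat_0_less_iff)
      qed
      also have "\<dots> < e" using e by simp
      finally show ?case by simp
    qed
  qed
  then show ?thesis by (simp add: replica_sym_iff[OF p1])
qed

section \<open>The tail of the overlap\<close>

lemma overlap_tail_eq:
  "overlap_tail p N \<beta> \<epsilon> g = avg (Sigma N) (Xe p N \<beta> g) (\<lambda>\<sigma>. avg (Sigma N) (Xe p N \<beta> g) (\<lambda>\<tau>. of_bool (\<epsilon> \<le> \<bar>overlap N \<sigma> \<tau>\<bar>)))"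
proof -
  have g: "gibbs p N \<beta> g \<sigma> = sm (Sigma N) (Xe p N \<beta> g) \<sigma>" for \<sigma>
  proof -
    let ?c = "- (\<beta>\<^sup>2 / 4 * real N) - real N * ln 2"
    have "exp (Xe p N \<beta> g \<tau>) = weight p N \<beta> g \<tau> * exp ?c" for \<tau>
      by (simp add: Xe_def weight_def exp_add)
    then show ?thesis by (simp add: sm_def gibbs_def flip: sum_distrib_right)
  qed
  show ?thesis unfolding overlap_tail_def avg_def g sum_distrib_left by (simp add: of_bool_def mult_ac)
qed

text \<open>Where \<open>R ^ p \<le> 0\<close> the annealed weight of a pair is at most its value at
  \<beta> = 0, and Hoeffding's bound for independent configurations is left. For odd
  \<open>p\<close> this covers the negative overlaps, which positive thresholds on
  \<open>R ^ p\<close> do not see.\<close>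

lemma negative_overlap_annealed:
  assumes N: "N \<ge> 1" and p: "p \<ge> 1" and \<epsilon>: "\<epsilon> \<ge> 0"
  shows "(\<integral>g. avg (Sigma N) (Xe p N \<beta> g) (\<lambda>\<sigma>. avg (Sigma N) (Xe p N \<beta> g) (\<lambda>\<tau>. of_bool (\<epsilon> \<le> \<bar>overlap N \<sigma> \<tau>\<bar> \<and> overlap N \<sigma> \<tau> ^ p \<le> 0))) \<partial>disorder)
    \<le> measure disorder {g. LW p N \<beta> g \<le> - y} + exp (2 * y) * (2 * exp (- (\<epsilon>\<^sup>2 / 2) * real N))"
proof -
  let ?c = "\<lambda>\<sigma> \<tau>. of_bool (\<epsilon> \<le> \<bar>overlap N \<sigma> \<tau>\<bar> \<and> overlap N \<sigma> \<tau> ^ p \<le> 0) :: real"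
  let ?F = "\<lambda>g. avg (Sigma N) (Xe p N \<beta> g) (\<lambda>\<sigma>. avg (Sigma N) (Xe p N \<beta> g) (\<lambda>\<tau>. ?c \<sigma> \<tau>))"
  let ?Z = "\<lambda>g. \<Sum>\<sigma>\<in>Sigma N. \<Sum>\<tau>\<in>Sigma N. exp (Xe p N \<beta> g \<sigma> + Xe p N \<beta> g \<tau>) * ?c \<sigma> \<tau>"
  let ?S = "\<Sum>\<sigma>\<in>Sigma N. \<Sum>\<tau>\<in>Sigma N. exp (\<beta>\<^sup>2 / 2 * real N * overlap N \<sigma> \<tau> ^ p) / 4 ^ N * ?c \<sigma> \<tau>"
  have nn: "(\<integral>\<^sup>+g. ennreal (?Z g) \<partial>disorder) = ennreal ?S"
    by (rule integral_pair_annealed[OF N p]) simp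
  have Z0: "0 \<le> ?Z g" for g by (intro sum_nonneg) auto
  have S0: "0 \<le> ?S" by (intro sum_nonneg) auto
  have iZ: "integrable disorder ?Z" by (rule integrableI_nonneg) (use nn Z0 in auto)
  have eZ: "(\<integral>g. ?Z g \<partial>disorder) = ?S"
    using nn nn_integral_eq_integral[OF iZ] Z0 S0 by (simp add: integral_nonneg_AE)
  have S: "?S \<le> 2 * exp (- (\<epsilon>\<^sup>2 / 2) * real N)"
  proof -
    have "?S \<le> (\<Sum>\<sigma>\<in>Sigma N. \<Sum>\<tau>\<in>Sigma N. 1 / 4 ^ N * of_bool (\<epsilon> \<le> \<bar>overlap N \<sigma> \<tau>\<bar>))"
    proof (intro sum_mono)
      fix \<sigma> \<tau>
      show "exp (\<beta>\<^sup>2 / 2 * real N * overlap N \<sigma> \<tau> ^ p) / 4 ^ N * ?c \<sigma> \<tau> \<le> 1 / 4 ^ N * of_bool (\<epsilon> \<le> \<bar>overlap N \<sigma> \<tau>\<bar>)"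
      proof (cases "\<epsilon> \<le> \<bar>overlap N \<sigma> \<tau>\<bar> \<and> overlap N \<sigma> \<tau> ^ p \<le> 0")
        case True
        then have "\<beta>\<^sup>2 / 2 * real N * overlap N \<sigma> \<tau> ^ p \<le> 0" by (intro mult_nonneg_nonpos) auto
        then show ?thesis using True by (simp add: divide_right_mono)
      qed simp
    qed
    also have "\<dots> = (\<Sum>\<sigma>\<in>Sigma N. 1 / 4 ^ N * (\<Sum>\<tau>\<in>Sigma N. of_bool (\<epsilon> \<le> \<bar>overlap N \<sigma> \<tau>\<bar>)))"
      by (simp only: sum_distrib_left)
    also have "\<dots> \<le> (\<Sum>\<sigma>\<in>Sigma N. 1 / 4 ^ N * (2 ^ N * (2 * exp (- (\<epsilon>\<^sup>2 / 2) * real N))))"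
      by (intro sum_mono mult_left_mono overlap_hoeffding N \<epsilon>) auto
    also have "\<dots> = (2 ^ N * 2 ^ N / 4 ^ N) * (2 * exp (- (\<epsilon>\<^sup>2 / 2) * real N))" by (simp add: card_Sigma)
    also have "(2 ^ N * 2 ^ N / 4 ^ N :: real) = 1" by (simp flip: power_mult_distrib)
    finally show ?thesis by simp
  qed
  have c1: "avg (Sigma N) X f \<le> 1" if "\<And>\<sigma>. f \<sigma> \<le> 1" for f X
  proof -
    have "avg (Sigma N) X f \<le> avg (Sigma N) X (\<lambda>_. 1)" by (rule avg_mono) (rule that)
    then show ?thesis by (simp add: avg_const)
  qed
  have F1: "?F g \<le> 1" for g by (intro c1) auto
  have F0: "0 \<le> ?F g" for g by (intro avg_nonneg) auto
  have "?F g \<le> of_bool (LW p N \<beta> g \<le> - y) + exp (2 * y) * ?Z g" for g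
  proof (cases "LW p N \<beta> g \<le> - y")
    case True
    then show ?thesis using F1[of g] Z0[of g] by (simp add: add_increasing2)
  next
    case False
    have "?F g = exp (- 2 * LW p N \<beta> g) * ?Z g"
      unfolding avg_def sm_Xe sum_distrib_left
      by (intro sum.cong refl) (simp add: exp_add[symmetric] mult.assoc[symmetric])
    also have "\<dots> \<le> exp (2 * y) * ?Z g" using False Z0[of g] by (intro mult_right_mono) auto
    finally show ?thesis using False by simp
  qed
  moreover have "integrable disorder ?F"
    by (rule integrable_disorder_bounded[where B = 1]) (use F0 F1 in \<open>auto intro!: measurable_avg simp: abs_of_nonneg\<close>)
  ultimately have "(\<integral>g. ?F g \<partial>disorder) \<le> (\<integral>g. of_bool (LW p N \<beta> g \<le> - y) + exp (2 * y) * ?Z g \<partial>disorder)"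
    using iZ integrable_of_bool[of "\<lambda>g. LW p N \<beta> g \<le> - y"] by (intro integral_mono) auto
  also have "\<dots> = measure disorder {g. LW p N \<beta> g \<le> - y} + exp (2 * y) * ?S"
  proof -
    have m: "Measurable.pred disorder (\<lambda>g. LW p N \<beta> g \<le> - y)" by measurable
    show ?thesis
      unfolding Bochner_Integration.integral_add[OF integrable_of_bool[OF m] integrable_mult_right[OF iZ]]
        integral_mult_right_zero eZ integral_indicator_Collect[OF m] ..
  qed
  also have "\<dots> \<le> measure disorder {g. LW p N \<beta> g \<le> - y} + exp (2 * y) * (2 * exp (- (\<epsilon>\<^sup>2 / 2) * real N))"
    using S by (intro add_left_mono mult_left_mono) auto
  finally show ?thesis .
qed

theorem mainTheorem8:
  fixes p :: nat and a b \<epsilon> :: real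
  assumes "p \<ge> 2" and "0 < a" and "a < b" and "b < beta_c p" and "\<epsilon> > 0"
  shows "\<exists>K>0. \<forall>\<beta>\<in>{a..b}. \<forall>N::nat. N \<ge> 1 \<longrightarrow>
           (\<integral>g. overlap_tail p N \<beta> \<epsilon> g \<partial>disorder) \<le> K * exp (- real N / K)"
proof -
  have p1: "p \<ge> 1" using assms(1) by simp
  \<comment> \<open>A point of the phase strictly above \<open>b\<close>; the gap between them is
    what \<open>overlap_step\<close> uses for raising \<beta>.\<close>
  obtain b' where b': "b' \<in> replica_sym p" "b < b'"
    using assms(4) less_cSupE[of b "replica_sym p"] one_in_replica_sym[OF assms(1)] unfolding beta_c_def by blast
  then have b0: "b' > 0" by (simp add: replica_sym_def)
  have lim: "(\<lambda>N. EL p N b' / real N) \<longlonglongrightarrow> 0" using b'(1) replica_sym_iff[OF p1 b0] by simp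
  have EL: "\<forall>\<^sub>F N in sequentially. - \<eta> * real N \<le> EL p N b'" if "\<eta> > 0" for \<eta>
  proof -
    have "- \<eta> < 0" using that by simp
    from order_tendstoD(1)[OF lim this] eventually_ge_at_top[of 1]
    show ?thesis
    proof eventually_elim
      case (elim N)
      then show ?case by (simp add: pos_less_divide_eq)
    qed
  qed
  have ep: "\<epsilon> ^ p > 0" using assms by simp
  have ab: "0 < a" "a \<le> b" "b < b'" using assms b' by auto
  obtain \<gamma> where \<gamma>: "\<gamma> > 0" "\<forall>\<^sub>F N in sequentially. \<forall>\<beta>\<in>{a..b}. Q p N \<beta> (\<epsilon> ^ p) \<le> exp (- \<gamma> * real N)"
    using overlap_power_tail[OF p1 b0 EL ab ep] by blast
  \<comment> \<open>With this value \<open>exp (2 * \<eta> * N)\<close> uses up half of the entropic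
    rate \<open>\<epsilon>\<^sup>2 / 2\<close>.\<close>
  define \<eta> where "\<eta> = \<epsilon>\<^sup>2 / 8"
  have \<eta>: "\<eta> > 0" using assms by (simp add: \<eta>_def)
  have ev2: "\<forall>\<^sub>F N in sequentially. \<forall>\<beta>\<in>{0<..b'}.
      measure disorder {g. LW p N \<beta> g \<le> - \<eta> * real N} \<le> exp (- (\<eta>\<^sup>2 / (8 * b'\<^sup>2)) * real N)"
    by (rule LW_lower_tail[OF p1 b0 _ \<eta>]) (rule EL)
  define c where "c = min \<gamma> (min (\<eta>\<^sup>2 / (8 * b'\<^sup>2)) (\<epsilon>\<^sup>2 / 4))"
  have c: "c > 0" "c \<le> \<gamma>" "c \<le> \<eta>\<^sup>2 / (8 * b'\<^sup>2)" "c \<le> \<epsilon>\<^sup>2 / 4"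
    using \<gamma>(1) \<eta> b0 assms by (auto simp: c_def)
  have int: "integrable disorder (\<lambda>g. avg (Sigma N) (Xe p N \<beta> g) (\<lambda>\<sigma>. avg (Sigma N) (Xe p N \<beta> g) (\<lambda>\<tau>. of_bool (T \<sigma> \<tau>))))" for N \<beta> T
    by (rule integrable_avg_bounded[where B = 1]) (auto intro!: measurable_avg avg_abs_le)
  have le1: "(\<integral>g. overlap_tail p N \<beta> \<epsilon> g \<partial>disorder) \<le> 1" for N \<beta>
  proof -
    have "overlap_tail p N \<beta> \<epsilon> g \<le> 1" for g
    proof -
      have "overlap_tail p N \<beta> \<epsilon> g \<le> avg (Sigma N) (Xe p N \<beta> g) (\<lambda>\<sigma>. avg (Sigma N) (Xe p N \<beta> g) (\<lambda>\<tau>. 1))"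
        unfolding overlap_tail_eq by (intro avg_mono) auto
      then show ?thesis by (simp add: avg_const)
    qed
    then have "(\<integral>g. overlap_tail p N \<beta> \<epsilon> g \<partial>disorder) \<le> (\<integral>g. 1 \<partial>disorder)"
      unfolding overlap_tail_eq using int by (intro integral_mono) auto
    then show ?thesis by (simp add: disorder.prob_space[simplified])
  qed
  have "\<forall>\<^sub>F N in sequentially. \<forall>\<beta>\<in>{a..b}. (\<integral>g. overlap_tail p N \<beta> \<epsilon> g \<partial>disorder) \<le> 4 * exp (- c * real N)"
    using \<gamma>(2) ev2 eventually_ge_at_top[of 1]
  proof eventually_elim
    case (elim N)
    have mono: "exp (- x * real N) \<le> exp (- c * real N)" if "c \<le> x" for x
      using mult_right_mono[OF that, of "real N"] by simp
    show ?case
    proof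
      fix \<beta> assume \<beta>: "\<beta> \<in> {a..b}"
      let ?A = "\<lambda>g. avg (Sigma N) (Xe p N \<beta> g)"
      let ?n = "\<lambda>\<sigma> \<tau>. \<epsilon> \<le> \<bar>overlap N \<sigma> \<tau>\<bar> \<and> overlap N \<sigma> \<tau> ^ p \<le> 0"
      have "overlap_tail p N \<beta> \<epsilon> g \<le> pairfrac p N \<beta> (\<epsilon> ^ p) g + ?A g (\<lambda>\<sigma>. ?A g (\<lambda>\<tau>. of_bool (?n \<sigma> \<tau>)))" for g
        unfolding overlap_tail_eq pairfrac_def rho_def avg_add[symmetric]
      proof (intro avg_mono)
        fix \<sigma> \<tau>
        define q where "q = overlap N \<sigma> \<tau>"
        \<comment> \<open>A large overlap either has a large positive \<open>p\<close>-th power, the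
          case of the descent, or a nonpositive one, the annealed case.\<close>
        have "\<epsilon> ^ p \<le> q ^ p \<or> q ^ p \<le> 0" if "\<epsilon> \<le> \<bar>q\<bar>"
        proof (cases "q ^ p \<ge> 0")
          case True
          have "\<epsilon> ^ p \<le> \<bar>q\<bar> ^ p" using that assms(5) by (intro power_mono) auto
          also have "\<dots> = q ^ p" using True by (simp flip: power_abs)
          finally show ?thesis by simp
        qed auto
        then show "of_bool (\<epsilon> \<le> \<bar>overlap N \<sigma> \<tau>\<bar>) \<le> (of_bool (\<epsilon> ^ p \<le> overlap N \<sigma> \<tau> ^ p) + of_bool (?n \<sigma> \<tau>) :: real)"
          unfolding q_def by auto
      qed
      then have "(\<integral>g. overlap_tail p N \<beta> \<epsilon> g \<partial>disorder) \<le> (\<integral>g. pairfrac p N \<beta> (\<epsilon> ^ p) g + ?A g (\<lambda>\<sigma>. ?A g (\<lambda>\<tau>. of_bool (?n \<sigma> \<tau>))) \<partial>disorder)"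
        unfolding overlap_tail_eq by (intro integral_mono int Bochner_Integration.integrable_add integrable_pairfrac)
      also have "\<dots> = Q p N \<beta> (\<epsilon> ^ p) + (\<integral>g. ?A g (\<lambda>\<sigma>. ?A g (\<lambda>\<tau>. of_bool (?n \<sigma> \<tau>))) \<partial>disorder)"
        unfolding Q_def by (rule Bochner_Integration.integral_add[OF integrable_pairfrac int])
      also have "\<dots> \<le> exp (- \<gamma> * real N) + (measure disorder {g. LW p N \<beta> g \<le> - (\<eta> * real N)} +
         exp (2 * (\<eta> * real N)) * (2 * exp (- (\<epsilon>\<^sup>2 / 2) * real N)))"
        using elim \<beta> by (intro add_mono negative_overlap_annealed p1) (use assms in auto)
      also have "\<dots> \<le> exp (- c * real N) + (exp (- c * real N) + 2 * exp (- c * real N))"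
      proof (intro add_mono mono c)
        have "measure disorder {g. LW p N \<beta> g \<le> - (\<eta> * real N)} \<le> exp (- (\<eta>\<^sup>2 / (8 * b'\<^sup>2)) * real N)"
          using elim(2) \<beta> ab by simp
        also have "\<dots> \<le> exp (- c * real N)" by (rule mono) (rule c)
        finally show "measure disorder {g. LW p N \<beta> g \<le> - (\<eta> * real N)} \<le> exp (- c * real N)" .
        have "exp (2 * (\<eta> * real N)) * (2 * exp (- (\<epsilon>\<^sup>2 / 2) * real N)) = 2 * exp (- (\<epsilon>\<^sup>2 / 4) * real N)"
          by (simp add: \<eta>_def field_simps flip: exp_add)
        also have "\<dots> \<le> 2 * exp (- c * real N)" by (intro mult_left_mono mono c) auto
        finally show "exp (2 * (\<eta> * real N)) * (2 * exp (- (\<epsilon>\<^sup>2 / 2) * real N)) \<le> 2 * exp (- c * real N)" .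
      qed
      finally show "(\<integral>g. overlap_tail p N \<beta> \<epsilon> g \<partial>disorder) \<le> 4 * exp (- c * real N)" by simp
    qed
  qed
  then obtain N1 where N1: "\<And>N \<beta>. N \<ge> N1 \<Longrightarrow> \<beta> \<in> {a..b} \<Longrightarrow> (\<integral>g. overlap_tail p N \<beta> \<epsilon> g \<partial>disorder) \<le> 4 * exp (- c * real N)"
    unfolding eventually_sequentially by blast
  \<comment> \<open>For \<open>N \<ge> N1\<close> the prefactor 4 and the rate
    \<open>c \<ge> 1 / K\<close> suffice. For \<open>N < N1 \<le> K\<close> the factor
    \<open>exp (- N / K)\<close> is at least \<open>exp (- 1)\<close>, and
    \<open>K \<ge> 4 \<ge> exp 1\<close> makes the right side at least 1, which bounds any
    tail.\<close>
  define K where "K = max 4 (max (1 / c) (real N1))"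
  have K: "K \<ge> 4" "1 / c \<le> K" "real N1 \<le> K" by (auto simp: K_def)
  show ?thesis
  proof (intro exI[of _ K] conjI ballI allI impI)
    show "K > 0" using K by simp
    fix \<beta> N assume \<beta>: "\<beta> \<in> {a..b}" and N: "(1::nat) \<le> N"
    show "(\<integral>g. overlap_tail p N \<beta> \<epsilon> g \<partial>disorder) \<le> K * exp (- real N / K)"
    proof (cases "N \<ge> N1")
      case True
      have "1 / K \<le> c" using K c(1) by (simp add: field_simps)
      then have "1 / K * real N \<le> c * real N" by (intro mult_right_mono) auto
      then have "exp (- c * real N) \<le> exp (- real N / K)" by simp
      then have "4 * exp (- c * real N) \<le> K * exp (- real N / K)" using K(1) by (intro mult_mono) auto
      then show ?thesis using N1[OF True \<beta>] by linarith
    next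
      case False
      then have "real N / K \<le> 1" using K by (simp add: divide_le_eq)
      then have "exp (- 1) \<le> exp (- real N / K)" by simp
      then have "K * exp (- 1) \<le> K * exp (- real N / K)" using K(1) by (intro mult_left_mono) auto
      moreover have "1 \<le> K * exp (- 1)"
      proof -
        have "exp 1 \<le> K" using exp_le K(1) by linarith
        then show ?thesis by (simp add: exp_minus field_simps)
      qed
      ultimately show ?thesis using le1[of N \<beta>] by linarith
    qed
  qed
qed

end
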